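(* Let $k$ be a field of characteristic zero, $S$ a DG $k$-algebra, $V$ a complex of $k$-vector spaces of finite total dimension, and $S\to\underline{\mathrm{End}}\,V$ a morphism of DG algebras. For any $S\backslash A\in\mathrm{DGA}_S$, $B\in\mathrm{DGA}_k$ and $C\in\mathrm{CDGA}_k$, there are natural bijections (a) $\mathrm{Hom}_{\mathrm{DGA}_k}(\sqrt[V]{S\backslash A},\,B)\cong\mathrm{Hom}_{\mathrm{DGA}_S}(A,\,\underline{\mathrm{End}}\,V\otimes B)$, (b) $\mathrm{Hom}_{\mathrm{CDGA}_k}((S\backslash A)_V,\,C)\cong\mathrm{Hom}_{\mathrm{DGA}_S}(A,\,\underline{\mathrm{End}}\,V\otimes C)$.
   Context: All DG objects have differentials of degree $-1$, the Koszul sign rule is used, and $\otimes=\otimes_k$. $\mathrm{DGA}_k$ is the category of unital associative $\mathbb Z$-graded DG $k$-algebras and $\mathrm{CDGA}_k$ its full subcategory of graded-commutative DG algebras. $\mathrm{DGA}_S$ is the category whose objects are DG algebra maps $S\to A$ (written $S\backslash A$, or just $A$) and whose morphisms are DG algebra maps under $S$. $\underline{\mathrm{End}}\,V$ is the DG algebra of graded endomorphisms of $(V,d_V)$ with differential $df=d_Vf-(-1)^i f d_V$ for $f$ of degree $i$; it, and $\underline{\mathrm{End}}\,V\otimes B$ for any DG algebra $B$, are objects of $\mathrm{DGA}_S$ via the given map $S\to\underline{\mathrm{End}}\,V$. Let $\underline{\mathrm{End}}\,V*_S A$ be the coproduct in $\mathrm{DGA}_S$. Define $$\sqrt[V]{S\backslash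 A}:=(\underline{\mathrm{End}}\,V*_SA)^{\underline{\mathrm{End}}(V)},$$ the graded centralizer of the image of $\underline{\mathrm{End}}\,V$ in $\underline{\mathrm{End}}\,V*_SA$, and $$(S\backslash A)_V:=\sqrt[V]{S\backslash A}\,/\,\langle[\sqrt[V]{S\backslash A},\sqrt[V]{S\backslash A}]\rangle,$$ the quotient by the two-sided ideal generated by all graded commutators.
   Formalization: The complex V is assumed to be nonzero; for V = 0 the stated bijections fail, since with S = A = B = C = k the left-hand Hom sets out of the zero algebra are empty while the right-hand ones have one element. *)

theory Defs
  imports "HOL-Algebra.QuotRing" "HOL-Algebra.Module"
begin

section \<open>Linear algebra over a ring record\<close>

text \<open>\<open>koszul M n x\<close> is $(-1)^n x$.\<close>

definition koszul :: "('k, 'a, 'm) module_scheme \<Rightarrow> int \<Rightarrow> 'a \<Rightarrow> 'a" where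
  "koszul M n x = (if even n then x else \<ominus>\<^bsub>M\<^esub> x)"

definition is_linear ::
  "('k, 'r) ring_scheme \<Rightarrow> ('k, 'a) module \<Rightarrow> ('k, 'b) module \<Rightarrow> ('a \<Rightarrow> 'b) \<Rightarrow> bool" where
  "is_linear K M N f \<longleftrightarrow>
     f \<in> carrier M \<rightarrow> carrier N \<and>
     (\<forall>x\<in>carrier M. \<forall>y\<in>carrier M. f (x \<oplus>\<^bsub>M\<^esub> y) = f x \<oplus>\<^bsub>N\<^esub> f y) \<and>
     (\<forall>a\<in>carrier K. \<forall>x\<in>carrier M. f (a \<odot>\<^bsub>M\<^esub> x) = a \<odot>\<^bsub>N\<^esub> f x)"

text \<open>Maps are made extensional, so that sets of maps contain each map exactly once.\<close>

definition lin_hom ::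
  "('k, 'r) ring_scheme \<Rightarrow> ('k, 'a) module \<Rightarrow> ('k, 'b) module \<Rightarrow> ('a \<Rightarrow> 'b) set" where
  "lin_hom K M N = {f \<in> extensional (carrier M). is_linear K M N f}"

definition submod_gen ::
  "('k, 'r) ring_scheme \<Rightarrow> ('k, 'a) module \<Rightarrow> 'a set \<Rightarrow> 'a set" where
  "submod_gen K M X = \<Inter>{N. submodule N K M \<and> X \<subseteq> N}"

text \<open>The library record for modules extends the one for rings; in the modules built here its
  fields \<open>mult\<close> and \<open>one\<close> carry no information and are left unspecified.\<close>

definition quot_module :: "('k, 'a) module \<Rightarrow> 'a set \<Rightarrow> ('k, 'a set) module" where
  "quot_module M N =
     \<lparr>carrier = a_rcosets\<^bsub>M\<^esub> N, mult = undefined, one = undefined, zero = N,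
      add = (\<lambda>X Y. X <+>\<^bsub>M\<^esub> Y), smult = (\<lambda>a X. \<Union>x\<in>X. N +>\<^bsub>M\<^esub> (a \<odot>\<^bsub>M\<^esub> x))\<rparr>"

text \<open>\<open>quot_map M N F\<close> sends a coset of representative \<open>x\<close> to the class of \<open>F x\<close> in \<open>M/N\<close>
  (a single coset whenever \<open>F\<close> respects the two submodules).\<close>

definition quot_map :: "('k, 'b) module \<Rightarrow> 'b set \<Rightarrow> ('a \<Rightarrow> 'b) \<Rightarrow> 'a set \<Rightarrow> 'b set" where
  "quot_map M N F X = (\<Union>x\<in>X. N +>\<^bsub>M\<^esub> F x)"

definition quot_map2 ::
  "('k, 'b) module \<Rightarrow> 'b set \<Rightarrow> ('a \<Rightarrow> 'c \<Rightarrow> 'b) \<Rightarrow> 'a set \<Rightarrow> 'c set \<Rightarrow> 'b set" where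
  "quot_map2 M N F X Y = (\<Union>x\<in>X. \<Union>y\<in>Y. N +>\<^bsub>M\<^esub> F x y)"

text \<open>The free module on \<open>X\<close>, as finitely supported functions, and the linear extension of
  a map given on the basis.\<close>

definition free_module :: "('k, 'r) ring_scheme \<Rightarrow> 'x set \<Rightarrow> ('k, 'x \<Rightarrow> 'k) module" where
  "free_module K X =
     \<lparr>carrier = {c. (\<forall>x\<in>X. c x \<in> carrier K) \<and> (\<forall>x. x \<notin> X \<longrightarrow> c x = \<zero>\<^bsub>K\<^esub>) \<and>
                    finite {x. c x \<noteq> \<zero>\<^bsub>K\<^esub>}},
      mult = undefined, one = undefined,
      zero = (\<lambda>x. \<zero>\<^bsub>K\<^esub>), add = (\<lambda>c c' x. c x \<oplus>\<^bsub>K\<^esub> c' x),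
      smult = (\<lambda>a c x. a \<otimes>\<^bsub>K\<^esub> c x)\<rparr>"

definition single :: "('k, 'r) ring_scheme \<Rightarrow> 'x \<Rightarrow> 'x \<Rightarrow> 'k" where
  "single K x = (\<lambda>y. if y = x then \<one>\<^bsub>K\<^esub> else \<zero>\<^bsub>K\<^esub>)"

definition lin_ext ::
  "('k, 'r) ring_scheme \<Rightarrow> ('k, 'a) module \<Rightarrow> ('x \<Rightarrow> 'a) \<Rightarrow> ('x \<Rightarrow> 'k) \<Rightarrow> 'a" where
  "lin_ext K M f c = (\<Oplus>\<^bsub>M\<^esub>x\<in>{x. c x \<noteq> \<zero>\<^bsub>K\<^esub>}. c x \<odot>\<^bsub>M\<^esub> f x)"


section \<open>Complexes and DG algebras\<close>

text \<open>A graded module is the family of its homogeneous components. All operations of a DG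
  algebra act on homogeneous elements and take their degrees as arguments:
  \<open>gmult A m n x y\<close> is the product of \<open>x\<close> of degree \<open>m\<close> and \<open>y\<close> of degree \<open>n\<close>.\<close>

record ('k, 'a) complex_rec =
  cmp :: "int \<Rightarrow> ('k, 'a) module"
  diff :: "int \<Rightarrow> 'a \<Rightarrow> 'a"

record ('k, 'a) dga_rec = "('k, 'a) complex_rec" +
  gmult :: "int \<Rightarrow> int \<Rightarrow> 'a \<Rightarrow> 'a \<Rightarrow> 'a"
  gone :: 'a

abbreviation elts :: "('k, 'a, 'z) complex_rec_scheme \<Rightarrow> int \<Rightarrow> 'a set" where
  "elts V n \<equiv> carrier (cmp V n)"

locale chain_complex = field K for K :: "('k, 'r) ring_scheme" (structure) +
  fixes V :: "('k, 'a, 'z) complex_rec_scheme"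
  assumes module_cmp: "module K (cmp V n)"
    and diff_linear: "is_linear K (cmp V n) (cmp V (n - 1)) (diff V n)"
    and diff_diff: "x \<in> elts V n \<Longrightarrow> diff V (n - 1) (diff V n x) = \<zero>\<^bsub>cmp V (n - 2)\<^esub>"

locale dga = chain_complex K A
  for K :: "('k, 'r) ring_scheme" (structure) and A :: "('k, 'a, 'z) dga_rec_scheme" +
  assumes mult_linear_left:
      "y \<in> elts A n \<Longrightarrow> is_linear K (cmp A m) (cmp A (m + n)) (\<lambda>x. gmult A m n x y)"
    and mult_linear_right:
      "x \<in> elts A m \<Longrightarrow> is_linear K (cmp A n) (cmp A (m + n)) (gmult A m n x)"
    and mult_assoc:
      "\<lbrakk>x \<in> elts A m; y \<in> elts A n; z \<in> elts A p\<rbrakk> \<Longrightarrow>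
        gmult A (m + n) p (gmult A m n x y) z = gmult A m (n + p) x (gmult A n p y z)"
    and one_closed: "gone A \<in> elts A 0"
    and mult_one_left: "x \<in> elts A n \<Longrightarrow> gmult A 0 n (gone A) x = x"
    and mult_one_right: "x \<in> elts A n \<Longrightarrow> gmult A n 0 x (gone A) = x"
    and leibniz:
      "\<lbrakk>x \<in> elts A m; y \<in> elts A n\<rbrakk> \<Longrightarrow>
        diff A (m + n) (gmult A m n x y) =
          gmult A (m - 1) n (diff A m x) y \<oplus>\<^bsub>cmp A (m + n - 1)\<^esub>
          koszul (cmp A (m + n - 1)) m (gmult A m (n - 1) x (diff A n y))"

locale cdga = dga +
  assumes graded_commutative:
    "\<lbrakk>x \<in> elts A m; y \<in> elts A n\<rbrakk> \<Longrightarrow>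
      gmult A m n x y = koszul (cmp A (m + n)) (m * n) (gmult A n m y x)"

definition dga_hom ::
  "('k, 'r) ring_scheme \<Rightarrow> ('k, 'a) dga_rec \<Rightarrow> ('k, 'b) dga_rec \<Rightarrow> (int \<Rightarrow> 'a \<Rightarrow> 'b) set" where
  "dga_hom K A B =
     {f. (\<forall>n. f n \<in> lin_hom K (cmp A n) (cmp B n)) \<and>
         (\<forall>n. \<forall>x\<in>elts A n. f (n - 1) (diff A n x) = diff B n (f n x)) \<and>
         (\<forall>m n. \<forall>x\<in>elts A m. \<forall>y\<in>elts A n.
            f (m + n) (gmult A m n x y) = gmult B m n (f m x) (f n y)) \<and>
         f 0 (gone A) = gone B}"

definition dga_comp ::
  "('k, 'a) dga_rec \<Rightarrow> (int \<Rightarrow> 'b \<Rightarrow> 'c) \<Rightarrow> (int \<Rightarrow> 'a \<Rightarrow> 'b) \<Rightarrow> int \<Rightarrow> 'a \<Rightarrow> 'c" where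
  "dga_comp A g f = (\<lambda>n. compose (elts A n) (g n) (f n))"

definition dga_id :: "('k, 'a) dga_rec \<Rightarrow> int \<Rightarrow> 'a \<Rightarrow> 'a" where
  "dga_id A = (\<lambda>n. \<lambda>x\<in>elts A n. x)"

text \<open>An object of the category of DG algebras under \<open>S\<close> is a pair of a DG algebra \<open>A\<close> and a
  morphism \<open>\<alpha>\<close> from \<open>S\<close> to \<open>A\<close>.\<close>

definition dga_under ::
  "('k, 'r) ring_scheme \<Rightarrow> ('k, 's) dga_rec \<Rightarrow> ('k, 'a) dga_rec \<Rightarrow> (int \<Rightarrow> 's \<Rightarrow> 'a) \<Rightarrow> bool" where
  "dga_under K S A \<alpha> \<longleftrightarrow> dga K A \<and> \<alpha> \<in> dga_hom K S A"

definition dga_under_hom ::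
  "('k, 'r) ring_scheme \<Rightarrow> ('k, 's) dga_rec \<Rightarrow> ('k, 'a) dga_rec \<Rightarrow> (int \<Rightarrow> 's \<Rightarrow> 'a) \<Rightarrow>
   ('k, 'b) dga_rec \<Rightarrow> (int \<Rightarrow> 's \<Rightarrow> 'b) \<Rightarrow> (int \<Rightarrow> 'a \<Rightarrow> 'b) set" where
  "dga_under_hom K S A \<alpha> B \<beta> = {f \<in> dga_hom K A B. dga_comp S f \<alpha> = \<beta>}"


section \<open>Graded ideals, quotients and centralizers\<close>

definition graded_ideal ::
  "('k, 'r) ring_scheme \<Rightarrow> ('k, 'a) dga_rec \<Rightarrow> (int \<Rightarrow> 'a set) \<Rightarrow> bool" where
  "graded_ideal K A I \<longleftrightarrow>
     (\<forall>n. submodule (I n) K (cmp A n)) \<and>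
     (\<forall>m n. \<forall>x\<in>elts A m. \<forall>y\<in>I n. gmult A m n x y \<in> I (m + n) \<and> gmult A n m y x \<in> I (n + m))"

definition ideal_gen ::
  "('k, 'r) ring_scheme \<Rightarrow> ('k, 'a) dga_rec \<Rightarrow> (int \<Rightarrow> 'a set) \<Rightarrow> int \<Rightarrow> 'a set" where
  "ideal_gen K A X = (\<lambda>n. \<Inter>{I n |I. graded_ideal K A I \<and> (\<forall>m. X m \<subseteq> I m)})"

definition quot_dga :: "('k, 'a) dga_rec \<Rightarrow> (int \<Rightarrow> 'a set) \<Rightarrow> ('k, 'a set) dga_rec" where
  "quot_dga A I =
     \<lparr>cmp = (\<lambda>n. quot_module (cmp A n) (I n)),
      diff = (\<lambda>n. quot_map (cmp A (n - 1)) (I (n - 1)) (diff A n)),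
      gmult = (\<lambda>m n. quot_map2 (cmp A (m + n)) (I (m + n)) (gmult A m n)),
      gone = I 0 +>\<^bsub>cmp A 0\<^esub> gone A\<rparr>"

definition graded_centralizer ::
  "('k, 'e) dga_rec \<Rightarrow> (int \<Rightarrow> 'e \<Rightarrow> 'a) \<Rightarrow> ('k, 'a) dga_rec \<Rightarrow> ('k, 'a) dga_rec" where
  "graded_centralizer E \<iota> A =
     A\<lparr>cmp := (\<lambda>n. (cmp A n)
        \<lparr>carrier := {x \<in> elts A n. \<forall>m. \<forall>e\<in>elts E m.
           gmult A n m x (\<iota> m e) = koszul (cmp A (n + m)) (n * m) (gmult A m n (\<iota> m e) x)}\<rparr>)\<rparr>"

definition graded_commutators :: "('k, 'a) dga_rec \<Rightarrow> int \<Rightarrow> 'a set" where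
  "graded_commutators A n =
     {gmult A p q x y \<ominus>\<^bsub>cmp A n\<^esub> koszul (cmp A n) (p * q) (gmult A q p y x) |p q x y.
        p + q = n \<and> x \<in> elts A p \<and> y \<in> elts A q}"

definition comm_ideal :: "('k, 'r) ring_scheme \<Rightarrow> ('k, 'a) dga_rec \<Rightarrow> int \<Rightarrow> 'a set" where
  "comm_ideal K A = ideal_gen K A (graded_commutators A)"

definition abelianization ::
  "('k, 'r) ring_scheme \<Rightarrow> ('k, 'a) dga_rec \<Rightarrow> ('k, 'a set) dga_rec" where
  "abelianization K A = quot_dga A (comm_ideal K A)"

definition abelianization_map ::
  "('k, 'r) ring_scheme \<Rightarrow> ('k, 'a) dga_rec \<Rightarrow> ('k, 'b) dga_rec \<Rightarrow>
   (int \<Rightarrow> 'a \<Rightarrow> 'b) \<Rightarrow> int \<Rightarrow> 'a set \<Rightarrow> 'b set" where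
  "abelianization_map K A B f =
     (\<lambda>n. \<lambda>X\<in>elts (abelianization K A) n. quot_map (cmp B n) (comm_ideal K B n) (f n) X)"


section \<open>Graded endomorphisms\<close>

definition fin_total_dim ::
  "('k, 'r) ring_scheme \<Rightarrow> ('k, 'v) complex_rec \<Rightarrow> bool" where
  "fin_total_dim K V \<longleftrightarrow>
     (\<forall>n. \<exists>X. finite X \<and> X \<subseteq> elts V n \<and> submod_gen K (cmp V n) X = elts V n) \<and>
     finite {n. elts V n \<noteq> {\<zero>\<^bsub>cmp V n\<^esub>}}"

text \<open>An endomorphism of degree \<open>n\<close> is a family of linear maps from \<open>V p\<close> to \<open>V (p + n)\<close>.\<close>

definition End_module ::
  "('k, 'r) ring_scheme \<Rightarrow> ('k, 'v) complex_rec \<Rightarrow> int \<Rightarrow> ('k, int \<Rightarrow> 'v \<Rightarrow> 'v) module" where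
  "End_module K V n =
     \<lparr>carrier = {f. \<forall>p. f p \<in> lin_hom K (cmp V p) (cmp V (p + n))},
      mult = undefined, one = undefined,
      zero = (\<lambda>p. \<lambda>x\<in>elts V p. \<zero>\<^bsub>cmp V (p + n)\<^esub>),
      add = (\<lambda>f g p. \<lambda>x\<in>elts V p. f p x \<oplus>\<^bsub>cmp V (p + n)\<^esub> g p x),
      smult = (\<lambda>a f p. \<lambda>x\<in>elts V p. a \<odot>\<^bsub>cmp V (p + n)\<^esub> f p x)\<rparr>"

definition End_dga ::
  "('k, 'r) ring_scheme \<Rightarrow> ('k, 'v) complex_rec \<Rightarrow> ('k, int \<Rightarrow> 'v \<Rightarrow> 'v) dga_rec" where
  "End_dga K V =
     \<lparr>cmp = End_module K V,
      diff = (\<lambda>n f p. \<lambda>x\<in>elts V p.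
        diff V (p + n) (f p x) \<ominus>\<^bsub>cmp V (p + n - 1)\<^esub>
        koszul (cmp V (p + n - 1)) n (f (p - 1) (diff V p x))),
      gmult = (\<lambda>m n f g p. compose (elts V p) (f (p + n)) (g p)),
      gone = (\<lambda>p. \<lambda>x\<in>elts V p. x)\<rparr>"


section \<open>Tensor products of DG algebras\<close>

text \<open>A basis symbol \<open>(p, x, q, y)\<close> stands for $x \otimes y$ with \<open>x\<close> of degree \<open>p\<close> and \<open>y\<close> of
  degree \<open>q\<close>. The component of degree \<open>n\<close> of the tensor product is the free module on the
  symbols of total degree \<open>n\<close> modulo bilinearity, that is, the direct sum over \<open>p + q = n\<close> of
  the tensor products of the components. The operations are first defined on free modules.\<close>

type_synonym ('a, 'b) tsym = "int \<times> 'a \<times> int \<times> 'b"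

definition tsyms ::
  "('k, 'a) dga_rec \<Rightarrow> ('k, 'b) dga_rec \<Rightarrow> int \<Rightarrow> ('a, 'b) tsym set" where
  "tsyms A B n = {(p, x, q, y). p + q = n \<and> x \<in> elts A p \<and> y \<in> elts B q}"

definition free_tensor ::
  "('k, 'r) ring_scheme \<Rightarrow> ('k, 'a) dga_rec \<Rightarrow> ('k, 'b) dga_rec \<Rightarrow>
   ('k, ('a, 'b) tsym \<Rightarrow> 'k) dga_rec" where
  "free_tensor K A B = (let F = (\<lambda>n. free_module K (tsyms A B n)) in
     \<lparr>cmp = F,
      diff = (\<lambda>n. lin_ext K (F (n - 1)) (\<lambda>(p, x, q, y).
        single K (p - 1, diff A p x, q, y) \<oplus>\<^bsub>F (n - 1)\<^esub>
        koszul (F (n - 1)) p (single K (p, x, q - 1, diff B q y)))),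
      gmult = (\<lambda>m n c c'. lin_ext K (F (m + n)) (\<lambda>(p, x, q, y).
        lin_ext K (F (m + n)) (\<lambda>(p', x', q', y').
          koszul (F (m + n)) (q * p')
            (single K (p + p', gmult A p p' x x', q + q', gmult B q q' y y'))) c') c),
      gone = single K (0, gone A, 0, gone B)\<rparr>)"

definition bilinearity ::
  "('k, 'r) ring_scheme \<Rightarrow> ('k, 'a) dga_rec \<Rightarrow> ('k, 'b) dga_rec \<Rightarrow> int \<Rightarrow>
   (('a, 'b) tsym \<Rightarrow> 'k) set" where
  "bilinearity K A B n = (let F = free_module K (tsyms A B n) in
     {single K (p, x \<oplus>\<^bsub>cmp A p\<^esub> x', q, y) \<ominus>\<^bsub>F\<^esub>
        (single K (p, x, q, y) \<oplus>\<^bsub>F\<^esub> single K (p, x', q, y)) |p x x' q y.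
        p + q = n \<and> x \<in> elts A p \<and> x' \<in> elts A p \<and> y \<in> elts B q} \<union>
     {single K (p, x, q, y \<oplus>\<^bsub>cmp B q\<^esub> y') \<ominus>\<^bsub>F\<^esub>
        (single K (p, x, q, y) \<oplus>\<^bsub>F\<^esub> single K (p, x, q, y')) |p x q y y'.
        p + q = n \<and> x \<in> elts A p \<and> y \<in> elts B q \<and> y' \<in> elts B q} \<union>
     {single K (p, a \<odot>\<^bsub>cmp A p\<^esub> x, q, y) \<ominus>\<^bsub>F\<^esub> a \<odot>\<^bsub>F\<^esub> single K (p, x, q, y) |a p x q y.
        p + q = n \<and> a \<in> carrier K \<and> x \<in> elts A p \<and> y \<in> elts B q} \<union>
     {single K (p, x, q, a \<odot>\<^bsub>cmp B q\<^esub> y) \<ominus>\<^bsub>F\<^esub> a \<odot>\<^bsub>F\<^esub> single K (p, x, q, y) |a p x q y.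
        p + q = n \<and> a \<in> carrier K \<and> x \<in> elts A p \<and> y \<in> elts B q})"

definition tensor_rel ::
  "('k, 'r) ring_scheme \<Rightarrow> ('k, 'a) dga_rec \<Rightarrow> ('k, 'b) dga_rec \<Rightarrow> int \<Rightarrow>
   (('a, 'b) tsym \<Rightarrow> 'k) set" where
  "tensor_rel K A B n = submod_gen K (free_module K (tsyms A B n)) (bilinearity K A B n)"

definition tensor_dga ::
  "('k, 'r) ring_scheme \<Rightarrow> ('k, 'a) dga_rec \<Rightarrow> ('k, 'b) dga_rec \<Rightarrow>
   ('k, (('a, 'b) tsym \<Rightarrow> 'k) set) dga_rec" where
  "tensor_dga K A B = quot_dga (free_tensor K A B) (tensor_rel K A B)"

text \<open>\<open>tensor K A B p q x y\<close> is the element $x \otimes y$ of degree \<open>p + q\<close>.\<close>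

definition tensor ::
  "('k, 'r) ring_scheme \<Rightarrow> ('k, 'a) dga_rec \<Rightarrow> ('k, 'b) dga_rec \<Rightarrow> int \<Rightarrow> int \<Rightarrow> 'a \<Rightarrow> 'b \<Rightarrow>
   (('a, 'b) tsym \<Rightarrow> 'k) set" where
  "tensor K A B p q x y =
     tensor_rel K A B (p + q) +>\<^bsub>free_module K (tsyms A B (p + q))\<^esub> single K (p, x, q, y)"

definition tensor_map ::
  "('k, 'r) ring_scheme \<Rightarrow> ('k, 'a) dga_rec \<Rightarrow> ('k, 'b) dga_rec \<Rightarrow> ('k, 'c) dga_rec \<Rightarrow>
   ('k, 'd) dga_rec \<Rightarrow> (int \<Rightarrow> 'a \<Rightarrow> 'c) \<Rightarrow> (int \<Rightarrow> 'b \<Rightarrow> 'd) \<Rightarrow>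
   int \<Rightarrow> (('a, 'b) tsym \<Rightarrow> 'k) set \<Rightarrow> (('c, 'd) tsym \<Rightarrow> 'k) set" where
  "tensor_map K A B C D f g = (\<lambda>n. \<lambda>X\<in>elts (tensor_dga K A B) n.
     (let F = free_module K (tsyms C D n) in
      quot_map F (tensor_rel K C D n)
        (lin_ext K F (\<lambda>(p, x, q, y). single K (p, f p x, q, g q y))) X))"

text \<open>The structure map $s \mapsto \rho(s) \otimes 1$ of $E \otimes B$ as a DG algebra
  under \<open>S\<close>.\<close>

definition tensor_unit ::
  "('k, 'r) ring_scheme \<Rightarrow> ('k, 's) dga_rec \<Rightarrow> ('k, 'e) dga_rec \<Rightarrow> (int \<Rightarrow> 's \<Rightarrow> 'e) \<Rightarrow>
   ('k, 'b) dga_rec \<Rightarrow> int \<Rightarrow> 's \<Rightarrow> (('e, 'b) tsym \<Rightarrow> 'k) set" where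
  "tensor_unit K S E \<rho> B = (\<lambda>n. \<lambda>s\<in>elts S n. tensor K E B n 0 (\<rho> n s) (gone B))"


section \<open>Coproducts of DG algebras under a DG algebra\<close>

text \<open>The coproduct of $\rho: S \to E$ and $\alpha: S \to A$ is the free algebra on symbols for the
  homogeneous elements of \<open>E\<close> and \<open>A\<close>, modulo the two-sided ideal generated by the relations
  holding in \<open>E\<close>, those holding in \<open>A\<close>, and the identification of the two images of \<open>S\<close>.
  On the free algebra \<open>diff\<close> is only a derivation (the symbol of \<open>0\<close> is not zero there); it
  becomes a differential on the quotient.\<close>

type_synonym ('e, 'a) letter = "int \<times> ('e + 'a)"

definition letters :: "('k, 'e) dga_rec \<Rightarrow> ('k, 'a) dga_rec \<Rightarrow> ('e, 'a) letter set" where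
  "letters E A = {(n, Inl x) |n x. x \<in> elts E n} \<union> {(n, Inr y) |n y. y \<in> elts A n}"

definition word_deg :: "('e, 'a) letter list \<Rightarrow> int" where
  "word_deg w = sum_list (map fst w)"

definition words ::
  "('k, 'e) dga_rec \<Rightarrow> ('k, 'a) dga_rec \<Rightarrow> int \<Rightarrow> ('e, 'a) letter list set" where
  "words E A n = {w. set w \<subseteq> letters E A \<and> word_deg w = n}"

definition letter_diff ::
  "('k, 'e) dga_rec \<Rightarrow> ('k, 'a) dga_rec \<Rightarrow> ('e, 'a) letter \<Rightarrow> ('e, 'a) letter" where
  "letter_diff E A = (\<lambda>(n, z). (n - 1, map_sum (diff E n) (diff A n) z))"

definition free_algebra ::
  "('k, 'r) ring_scheme \<Rightarrow> ('k, 'e) dga_rec \<Rightarrow> ('k, 'a) dga_rec \<Rightarrow>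
   ('k, ('e, 'a) letter list \<Rightarrow> 'k) dga_rec" where
  "free_algebra K E A = (let F = (\<lambda>n. free_module K (words E A n)) in
     \<lparr>cmp = F,
      diff = (\<lambda>n. lin_ext K (F (n - 1)) (\<lambda>w. \<Oplus>\<^bsub>F (n - 1)\<^esub>i\<in>{..<length w}.
        koszul (F (n - 1)) (word_deg (take i w))
          (single K (w[i := letter_diff E A (w ! i)])))),
      gmult = (\<lambda>m n c c'. lin_ext K (F (m + n)) (\<lambda>u.
        lin_ext K (F (m + n)) (\<lambda>v. single K (u @ v)) c') c),
      gone = single K []\<rparr>)"

text \<open>The relations holding in \<open>A\<close>, for an embedding \<open>j\<close> of its elements into the letters.\<close>

definition alg_relations ::
  "('k, 'r) ring_scheme \<Rightarrow> ('k, 'a) dga_rec \<Rightarrow> ('a \<Rightarrow> 'l) \<Rightarrow>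
   ('k, (int \<times> 'l) list \<Rightarrow> 'k) module \<Rightarrow> int \<Rightarrow> ((int \<times> 'l) list \<Rightarrow> 'k) set" where
  "alg_relations K A j F n =
     {single K [(n, j (x \<oplus>\<^bsub>cmp A n\<^esub> y))] \<ominus>\<^bsub>F\<^esub> (single K [(n, j x)] \<oplus>\<^bsub>F\<^esub> single K [(n, j y)]) |x y.
        x \<in> elts A n \<and> y \<in> elts A n} \<union>
     {single K [(n, j (a \<odot>\<^bsub>cmp A n\<^esub> x))] \<ominus>\<^bsub>F\<^esub> a \<odot>\<^bsub>F\<^esub> single K [(n, j x)] |a x.
        a \<in> carrier K \<and> x \<in> elts A n} \<union>
     {single K [(n, j (gmult A p q x y))] \<ominus>\<^bsub>F\<^esub> single K [(p, j x), (q, j y)] |p q x y.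
        p + q = n \<and> x \<in> elts A p \<and> y \<in> elts A q} \<union>
     (if n = 0 then {single K [(0, j (gone A))] \<ominus>\<^bsub>F\<^esub> single K []} else {})"

definition coprod_relations ::
  "('k, 'r) ring_scheme \<Rightarrow> ('k, 's) dga_rec \<Rightarrow> ('k, 'e) dga_rec \<Rightarrow> (int \<Rightarrow> 's \<Rightarrow> 'e) \<Rightarrow>
   ('k, 'a) dga_rec \<Rightarrow> (int \<Rightarrow> 's \<Rightarrow> 'a) \<Rightarrow> int \<Rightarrow> (('e, 'a) letter list \<Rightarrow> 'k) set" where
  "coprod_relations K S E \<rho> A \<alpha> n = (let F = free_module K (words E A n) in
     alg_relations K E Inl F n \<union> alg_relations K A Inr F n \<union>
     {single K [(n, Inl (\<rho> n s))] \<ominus>\<^bsub>F\<^esub> single K [(n, Inr (\<alpha> n s))] |s. s \<in> elts S n})"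

definition coprod_ideal ::
  "('k, 'r) ring_scheme \<Rightarrow> ('k, 's) dga_rec \<Rightarrow> ('k, 'e) dga_rec \<Rightarrow> (int \<Rightarrow> 's \<Rightarrow> 'e) \<Rightarrow>
   ('k, 'a) dga_rec \<Rightarrow> (int \<Rightarrow> 's \<Rightarrow> 'a) \<Rightarrow> int \<Rightarrow> (('e, 'a) letter list \<Rightarrow> 'k) set" where
  "coprod_ideal K S E \<rho> A \<alpha> = ideal_gen K (free_algebra K E A) (coprod_relations K S E \<rho> A \<alpha>)"

definition coprod_dga ::
  "('k, 'r) ring_scheme \<Rightarrow> ('k, 's) dga_rec \<Rightarrow> ('k, 'e) dga_rec \<Rightarrow> (int \<Rightarrow> 's \<Rightarrow> 'e) \<Rightarrow>
   ('k, 'a) dga_rec \<Rightarrow> (int \<Rightarrow> 's \<Rightarrow> 'a) \<Rightarrow> ('k, (('e, 'a) letter list \<Rightarrow> 'k) set) dga_rec" where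
  "coprod_dga K S E \<rho> A \<alpha> = quot_dga (free_algebra K E A) (coprod_ideal K S E \<rho> A \<alpha>)"

definition coprod_inl ::
  "('k, 'r) ring_scheme \<Rightarrow> ('k, 's) dga_rec \<Rightarrow> ('k, 'e) dga_rec \<Rightarrow> (int \<Rightarrow> 's \<Rightarrow> 'e) \<Rightarrow>
   ('k, 'a) dga_rec \<Rightarrow> (int \<Rightarrow> 's \<Rightarrow> 'a) \<Rightarrow> int \<Rightarrow> 'e \<Rightarrow> (('e, 'a) letter list \<Rightarrow> 'k) set" where
  "coprod_inl K S E \<rho> A \<alpha> = (\<lambda>n. \<lambda>x\<in>elts E n.
     coprod_ideal K S E \<rho> A \<alpha> n +>\<^bsub>free_module K (words E A n)\<^esub> single K [(n, Inl x)])"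

definition coprod_inr ::
  "('k, 'r) ring_scheme \<Rightarrow> ('k, 's) dga_rec \<Rightarrow> ('k, 'e) dga_rec \<Rightarrow> (int \<Rightarrow> 's \<Rightarrow> 'e) \<Rightarrow>
   ('k, 'a) dga_rec \<Rightarrow> (int \<Rightarrow> 's \<Rightarrow> 'a) \<Rightarrow> int \<Rightarrow> 'a \<Rightarrow> (('e, 'a) letter list \<Rightarrow> 'k) set" where
  "coprod_inr K S E \<rho> A \<alpha> = (\<lambda>n. \<lambda>y\<in>elts A n.
     coprod_ideal K S E \<rho> A \<alpha> n +>\<^bsub>free_module K (words E A n)\<^esub> single K [(n, Inr y)])"

text \<open>The morphism of coproducts with the same first factor induced by a morphism
  \<open>f\<close> from \<open>A\<close> to \<open>B\<close> under \<open>S\<close>.\<close>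

definition coprod_map ::
  "('k, 'r) ring_scheme \<Rightarrow> ('k, 's) dga_rec \<Rightarrow> ('k, 'e) dga_rec \<Rightarrow> (int \<Rightarrow> 's \<Rightarrow> 'e) \<Rightarrow>
   ('k, 'a) dga_rec \<Rightarrow> (int \<Rightarrow> 's \<Rightarrow> 'a) \<Rightarrow> ('k, 'b) dga_rec \<Rightarrow> (int \<Rightarrow> 's \<Rightarrow> 'b) \<Rightarrow>
   (int \<Rightarrow> 'a \<Rightarrow> 'b) \<Rightarrow>
   int \<Rightarrow> (('e, 'a) letter list \<Rightarrow> 'k) set \<Rightarrow> (('e, 'b) letter list \<Rightarrow> 'k) set" where
  "coprod_map K S E \<rho> A \<alpha> B \<beta> f = (\<lambda>n. \<lambda>X\<in>elts (coprod_dga K S E \<rho> A \<alpha>) n.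
     (let F = free_module K (words E B n) in
      quot_map F (coprod_ideal K S E \<rho> B \<beta> n)
        (lin_ext K F (\<lambda>w. single K (map (\<lambda>(i, z). (i, map_sum id (f i) z)) w))) X))"


section \<open>The functors of the representation theory\<close>

text \<open>\<open>root_dga K S V \<rho> A \<alpha>\<close> is $\sqrt[V]{S\backslash A}$ and \<open>rep_dga K S V \<rho> A \<alpha>\<close> is
  $(S\backslash A)_V$, with \<open>\<rho>\<close> the given morphism from \<open>S\<close> to the endomorphisms of \<open>V\<close>.\<close>

definition root_dga ::
  "('k, 'r) ring_scheme \<Rightarrow> ('k, 's) dga_rec \<Rightarrow> ('k, 'v) complex_rec \<Rightarrow>
   (int \<Rightarrow> 's \<Rightarrow> (int \<Rightarrow> 'v \<Rightarrow> 'v)) \<Rightarrow> ('k, 'a) dga_rec \<Rightarrow> (int \<Rightarrow> 's \<Rightarrow> 'a) \<Rightarrow>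
   ('k, ((int \<Rightarrow> 'v \<Rightarrow> 'v, 'a) letter list \<Rightarrow> 'k) set) dga_rec" where
  "root_dga K S V \<rho> A \<alpha> =
     graded_centralizer (End_dga K V) (coprod_inl K S (End_dga K V) \<rho> A \<alpha>)
       (coprod_dga K S (End_dga K V) \<rho> A \<alpha>)"

definition root_map ::
  "('k, 'r) ring_scheme \<Rightarrow> ('k, 's) dga_rec \<Rightarrow> ('k, 'v) complex_rec \<Rightarrow>
   (int \<Rightarrow> 's \<Rightarrow> (int \<Rightarrow> 'v \<Rightarrow> 'v)) \<Rightarrow> ('k, 'a) dga_rec \<Rightarrow> (int \<Rightarrow> 's \<Rightarrow> 'a) \<Rightarrow>
   ('k, 'b) dga_rec \<Rightarrow> (int \<Rightarrow> 's \<Rightarrow> 'b) \<Rightarrow> (int \<Rightarrow> 'a \<Rightarrow> 'b) \<Rightarrow>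
   int \<Rightarrow> ((int \<Rightarrow> 'v \<Rightarrow> 'v, 'a) letter list \<Rightarrow> 'k) set \<Rightarrow>
   ((int \<Rightarrow> 'v \<Rightarrow> 'v, 'b) letter list \<Rightarrow> 'k) set" where
  "root_map K S V \<rho> A \<alpha> B \<beta> f =
     (\<lambda>n. restrict (coprod_map K S (End_dga K V) \<rho> A \<alpha> B \<beta> f n)
            (elts (root_dga K S V \<rho> A \<alpha>) n))"

definition rep_dga ::
  "('k, 'r) ring_scheme \<Rightarrow> ('k, 's) dga_rec \<Rightarrow> ('k, 'v) complex_rec \<Rightarrow>
   (int \<Rightarrow> 's \<Rightarrow> (int \<Rightarrow> 'v \<Rightarrow> 'v)) \<Rightarrow> ('k, 'a) dga_rec \<Rightarrow> (int \<Rightarrow> 's \<Rightarrow> 'a) \<Rightarrow>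
   ('k, ((int \<Rightarrow> 'v \<Rightarrow> 'v, 'a) letter list \<Rightarrow> 'k) set set) dga_rec" where
  "rep_dga K S V \<rho> A \<alpha> = abelianization K (root_dga K S V \<rho> A \<alpha>)"

definition rep_map ::
  "('k, 'r) ring_scheme \<Rightarrow> ('k, 's) dga_rec \<Rightarrow> ('k, 'v) complex_rec \<Rightarrow>
   (int \<Rightarrow> 's \<Rightarrow> (int \<Rightarrow> 'v \<Rightarrow> 'v)) \<Rightarrow> ('k, 'a) dga_rec \<Rightarrow> (int \<Rightarrow> 's \<Rightarrow> 'a) \<Rightarrow>
   ('k, 'b) dga_rec \<Rightarrow> (int \<Rightarrow> 's \<Rightarrow> 'b) \<Rightarrow> (int \<Rightarrow> 'a \<Rightarrow> 'b) \<Rightarrow>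
   int \<Rightarrow> ((int \<Rightarrow> 'v \<Rightarrow> 'v, 'a) letter list \<Rightarrow> 'k) set set \<Rightarrow>
   ((int \<Rightarrow> 'v \<Rightarrow> 'v, 'b) letter list \<Rightarrow> 'k) set set" where
  "rep_map K S V \<rho> A \<alpha> B \<beta> f =
     abelianization_map K (root_dga K S V \<rho> A \<alpha>) (root_dga K S V \<rho> B \<beta>)
       (root_map K S V \<rho> A \<alpha> B \<beta> f)"


section \<open>The constructions are well defined\<close>

text \<open>The rest of this theory shows that the objects constructed above are DG algebras, resp.
  graded-commutative ones, and that \<open>coprod_dga\<close> is the coproduct under \<open>S\<close>.\<close>


subsection \<open>Linear maps and quotient modules\<close>

lemma is_linearI:
  assumes "\<And>x. x \<in> carrier M \<Longrightarrow> f x \<in> carrier N"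
    "\<And>x y. x \<in> carrier M \<Longrightarrow> y \<in> carrier M \<Longrightarrow> f (x \<oplus>\<^bsub>M\<^esub> y) = f x \<oplus>\<^bsub>N\<^esub> f y"
    "\<And>a x. a \<in> carrier K \<Longrightarrow> x \<in> carrier M \<Longrightarrow> f (a \<odot>\<^bsub>M\<^esub> x) = a \<odot>\<^bsub>N\<^esub> f x"
  shows "is_linear K M N f"
  using assms by (auto simp: is_linear_def)

lemma is_linearD:
  assumes "is_linear K M N f"
  shows "x \<in> carrier M \<Longrightarrow> f x \<in> carrier N"
    "x \<in> carrier M \<Longrightarrow> y \<in> carrier M \<Longrightarrow> f (x \<oplus>\<^bsub>M\<^esub> y) = f x \<oplus>\<^bsub>N\<^esub> f y"
    "a \<in> carrier K \<Longrightarrow> x \<in> carrier M \<Longrightarrow> f (a \<odot>\<^bsub>M\<^esub> x) = a \<odot>\<^bsub>N\<^esub> f x"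
  using assms by (auto simp: is_linear_def)

lemma lin_group_hom:
  assumes "is_linear K M N f" "module K M" "module K N"
  shows "abelian_group_hom M N f"
proof -
  interpret M: module K M by fact
  interpret N: module K N by fact
  show ?thesis
    by (rule abelian_group_homI; unfold_locales) (auto simp: hom_def is_linearD[OF assms(1)])
qed

lemma lin_zero:
  assumes "is_linear K M N f" "module K M" "module K N"
  shows "f \<zero>\<^bsub>M\<^esub> = \<zero>\<^bsub>N\<^esub>"
  using abelian_group_hom.hom_zero[OF lin_group_hom[OF assms]] .

lemma lin_neg:
  assumes "is_linear K M N f" "module K M" "module K N" "x \<in> carrier M"
  shows "f (\<ominus>\<^bsub>M\<^esub> x) = \<ominus>\<^bsub>N\<^esub> f x"
  using abelian_group_hom.hom_a_inv[OF lin_group_hom[OF assms(1-3)] assms(4)] .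

lemma lin_minus:
  assumes "is_linear K M N f" "module K M" "module K N" "x \<in> carrier M" "y \<in> carrier M"
  shows "f (x \<ominus>\<^bsub>M\<^esub> y) = f x \<ominus>\<^bsub>N\<^esub> f y"
proof -
  interpret M: module K M by fact
  show ?thesis using assms by (simp add: a_minus_def is_linearD lin_neg)
qed

lemma lin_koszul:
  assumes "is_linear K M N f" "module K M" "module K N" "x \<in> carrier M"
  shows "f (koszul M n x) = koszul N n (f x)"
  using assms by (simp add: koszul_def lin_neg)

lemma lin_finsum:
  assumes "is_linear K M N f" "module K M" "module K N" "finite I" "g \<in> I \<rightarrow> carrier M"
  shows "f (finsum M g I) = finsum N (\<lambda>i. f (g i)) I"
  using assms(4,5)
proof (induction I)
  case empty
  interpret M: module K M by fact
  interpret N: module K N by fact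
  show ?case using lin_zero[OF assms(1-3)] by simp
next
  case (insert i I)
  interpret M: module K M by fact
  interpret N: module K N by fact
  have "finsum M g I \<in> carrier M" using insert by (intro M.finsum_closed) auto
  moreover have "g \<in> I \<rightarrow> carrier M" "g i \<in> carrier M" "(\<lambda>i. f (g i)) \<in> I \<rightarrow> carrier N" "f (g i) \<in> carrier N"
    using insert is_linearD(1)[OF assms(1)] by auto
  ultimately show ?case using insert by (simp add: is_linearD(2)[OF assms(1)])
qed

locale kmod = module K M for K :: "('k, 'r) ring_scheme" (structure) and M :: "('k, 'a) module"
begin

lemma koszul_closed [simp, intro]: "x \<in> carrier M \<Longrightarrow> koszul M n x \<in> carrier M"
  by (simp add: koszul_def)

lemma koszul_koszul: "x \<in> carrier M \<Longrightarrow> koszul M m (koszul M n x) = koszul M (m + n) x"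
  by (auto simp: koszul_def)

lemma koszul_add: "x \<in> carrier M \<Longrightarrow> y \<in> carrier M \<Longrightarrow> koszul M n (x \<oplus>\<^bsub>M\<^esub> y) = koszul M n x \<oplus>\<^bsub>M\<^esub> koszul M n y"
  by (auto simp: koszul_def M.minus_add)

lemma koszul_smult: "a \<in> carrier K \<Longrightarrow> x \<in> carrier M \<Longrightarrow> koszul M n (a \<odot>\<^bsub>M\<^esub> x) = a \<odot>\<^bsub>M\<^esub> koszul M n x"
  by (auto simp: koszul_def smult_r_minus)

lemma koszul_linear: "is_linear K M M (koszul M n)"
  by (rule is_linearI) (auto simp: koszul_add koszul_smult)

lemma koszul_0[simp]: "koszul M n \<zero>\<^bsub>M\<^esub> = \<zero>\<^bsub>M\<^esub>"
  by (auto simp: koszul_def)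

lemma submod_sub: "submodule N K M \<Longrightarrow> abelian_subgroup N M"
  by (intro abelian_subgroupI3 additive_subgroupI submodule.axioms(1) M.abelian_group_axioms)

lemma submod_zero: "submodule N K M \<Longrightarrow> \<zero>\<^bsub>M\<^esub> \<in> N"
  using additive_subgroup.zero_closed[OF abelian_subgroup.axioms(1)[OF submod_sub]] .

lemma submod_minus: "submodule N K M \<Longrightarrow> x \<in> N \<Longrightarrow> y \<in> N \<Longrightarrow> x \<ominus>\<^bsub>M\<^esub> y \<in> N"
  using submoduleE by (simp add: a_minus_def)

lemma submod_koszul: "submodule N K M \<Longrightarrow> x \<in> N \<Longrightarrow> koszul M n x \<in> N"
  using submoduleE(3) by (simp add: koszul_def)

lemma submod_subset: "submodule N K M \<Longrightarrow> x \<in> N \<Longrightarrow> x \<in> carrier M"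
  using submoduleE(1) by auto

lemma mem_rcos_iff:
  assumes "submodule N K M" "x \<in> carrier M" "y \<in> carrier M"
  shows "x \<in> N +>\<^bsub>M\<^esub> y \<longleftrightarrow> x \<ominus>\<^bsub>M\<^esub> y \<in> N"
proof
  assume "x \<in> N +>\<^bsub>M\<^esub> y"
  then obtain h where h: "h \<in> N" "x = h \<oplus>\<^bsub>M\<^esub> y" by (auto simp: a_r_coset_def')
  then have "x \<ominus>\<^bsub>M\<^esub> y = h" using assms submod_subset[OF assms(1)]
    by (simp add: a_minus_def M.a_assoc M.r_neg)
  then show "x \<ominus>\<^bsub>M\<^esub> y \<in> N" using h by simp
next
  assume "x \<ominus>\<^bsub>M\<^esub> y \<in> N"
  moreover have "x = (x \<ominus>\<^bsub>M\<^esub> y) \<oplus>\<^bsub>M\<^esub> y" using assms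
    by (simp add: a_minus_def M.a_assoc M.l_neg)
  ultimately show "x \<in> N +>\<^bsub>M\<^esub> y" by (auto simp: a_r_coset_def')
qed

lemma rcos_subset: "submodule N K M \<Longrightarrow> y \<in> carrier M \<Longrightarrow> x \<in> N +>\<^bsub>M\<^esub> y \<Longrightarrow> x \<in> carrier M"
  using submod_subset by (auto simp: a_r_coset_def')

lemma rcos_eq_iff:
  assumes "submodule N K M" "x \<in> carrier M" "y \<in> carrier M"
  shows "N +>\<^bsub>M\<^esub> x = N +>\<^bsub>M\<^esub> y \<longleftrightarrow> x \<ominus>\<^bsub>M\<^esub> y \<in> N"
proof
  assume "N +>\<^bsub>M\<^esub> x = N +>\<^bsub>M\<^esub> y"
  then show "x \<ominus>\<^bsub>M\<^esub> y \<in> N"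
    using mem_rcos_iff[OF assms] mem_rcos_iff[OF assms(1,2,2)] submod_zero[OF assms(1)] assms
    by (simp add: a_minus_def M.r_neg)
next
  assume a: "x \<ominus>\<^bsub>M\<^esub> y \<in> N"
  have "z \<ominus>\<^bsub>M\<^esub> x \<in> N \<longleftrightarrow> z \<ominus>\<^bsub>M\<^esub> y \<in> N" if z: "z \<in> carrier M" for z
  proof -
    have e: "z \<ominus>\<^bsub>M\<^esub> v = (z \<ominus>\<^bsub>M\<^esub> u) \<oplus>\<^bsub>M\<^esub> (u \<ominus>\<^bsub>M\<^esub> v)"
      if "u \<in> carrier M" "v \<in> carrier M" for u v
      using that z by (simp add: a_minus_def M.a_assoc M.r_neg1)
    have "y \<ominus>\<^bsub>M\<^esub> x = \<ominus>\<^bsub>M\<^esub> (x \<ominus>\<^bsub>M\<^esub> y)"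
      using assms by (simp add: a_minus_def M.minus_add M.a_comm)
    then have "y \<ominus>\<^bsub>M\<^esub> x \<in> N" using a submoduleE(3)[OF assms(1)] by simp
    then show ?thesis using a submoduleE(5)[OF assms(1)] e assms(2,3) by metis
  qed
  then show "N +>\<^bsub>M\<^esub> x = N +>\<^bsub>M\<^esub> y"
    using mem_rcos_iff[OF assms(1)] rcos_subset[OF assms(1)] assms(2,3) by blast
qed

lemma rcos_zero: "submodule N K M \<Longrightarrow> N +>\<^bsub>M\<^esub> \<zero>\<^bsub>M\<^esub> = N"
  using M.a_coset_add_zero submoduleE(1) by blast

lemma rcos_zero_iff:
  assumes "submodule N K M" "x \<in> carrier M"
  shows "N +>\<^bsub>M\<^esub> x = N \<longleftrightarrow> x \<in> N"
  using rcos_eq_iff[OF assms M.zero_closed] rcos_zero[OF assms(1)] assms(2)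
  by (simp add: a_minus_def M.minus_equality[of "\<zero>\<^bsub>M\<^esub>" "\<zero>\<^bsub>M\<^esub>"])

lemma rcos_self: "submodule N K M \<Longrightarrow> x \<in> carrier M \<Longrightarrow> x \<in> N +>\<^bsub>M\<^esub> x"
  by (simp add: mem_rcos_iff a_minus_def M.r_neg submod_zero)

lemma rcos_sum: "submodule N K M \<Longrightarrow> x \<in> carrier M \<Longrightarrow> y \<in> carrier M \<Longrightarrow>
   (N +>\<^bsub>M\<^esub> x) <+>\<^bsub>M\<^esub> (N +>\<^bsub>M\<^esub> y) = N +>\<^bsub>M\<^esub> (x \<oplus>\<^bsub>M\<^esub> y)"
  using abelian_subgroup.a_rcos_sum[OF submod_sub] .

end

lemma quot_map_rcos:
  assumes "module K M" "module K M'" "submodule N K M" "submodule N' K M'"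
    "is_linear K M M' F" "\<And>x. x \<in> N \<Longrightarrow> F x \<in> N'" "x \<in> carrier M"
  shows "quot_map M' N' F (N +>\<^bsub>M\<^esub> x) = N' +>\<^bsub>M'\<^esub> F x"
proof -
  interpret M: kmod K M using assms(1) by (simp add: kmod_def)
  interpret M': kmod K M' using assms(2) by (simp add: kmod_def)
  have "N' +>\<^bsub>M'\<^esub> F y = N' +>\<^bsub>M'\<^esub> F x" if y: "y \<in> N +>\<^bsub>M\<^esub> x" for y
  proof -
    have yc: "y \<in> carrier M" using M.rcos_subset assms(3,7) y by blast
    then have "F (y \<ominus>\<^bsub>M\<^esub> x) \<in> N'" using assms(6) M.mem_rcos_iff assms(3,7) y by blast
    then show ?thesis using yc assms by (simp add: M'.rcos_eq_iff is_linearD(1)[OF assms(5)] lin_minus)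
  qed
  moreover have "x \<in> N +>\<^bsub>M\<^esub> x" using M.rcos_self assms by blast
  ultimately show ?thesis unfolding quot_map_def by blast
qed

lemma quot_map2_rcos:
  assumes "module K M1" "module K M2" "module K M'" "submodule N1 K M1" "submodule N2 K M2" "submodule N' K M'"
    "\<And>y. y \<in> carrier M2 \<Longrightarrow> is_linear K M1 M' (\<lambda>x. F x y)" "\<And>x. x \<in> carrier M1 \<Longrightarrow> is_linear K M2 M' (F x)" 
    "\<And>x y. x \<in> N1 \<Longrightarrow> y \<in> carrier M2 \<Longrightarrow> F x y \<in> N'" 
    "\<And>x y. x \<in> carrier M1 \<Longrightarrow> y \<in> N2 \<Longrightarrow> F x y \<in> N'" "x \<in> carrier M1" "y \<in> carrier M2"
  shows "quot_map2 M' N' F (N1 +>\<^bsub>M1\<^esub> x) (N2 +>\<^bsub>M2\<^esub> y) = N' +>\<^bsub>M'\<^esub> F x y"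
proof -
  interpret M1: kmod K M1 using assms(1) by (simp add: kmod_def)
  interpret M2: kmod K M2 using assms(2) by (simp add: kmod_def)
  interpret M': kmod K M' using assms(3) by (simp add: kmod_def)
  have "quot_map2 M' N' F (N1 +>\<^bsub>M1\<^esub> x) (N2 +>\<^bsub>M2\<^esub> y) = (\<Union>x\<in>N1 +>\<^bsub>M1\<^esub> x. quot_map M' N' (F x) (N2 +>\<^bsub>M2\<^esub> y))"
    by (simp add: quot_map2_def quot_map_def)
  also have "\<dots> = (\<Union>x\<in>N1 +>\<^bsub>M1\<^esub> x. N' +>\<^bsub>M'\<^esub> F x y)"
    by (intro SUP_cong refl quot_map_rcos[where K=K] assms) (auto intro: M1.rcos_subset[OF assms(4)] assms)
  also have "\<dots> = quot_map M' N' (\<lambda>x. F x y) (N1 +>\<^bsub>M1\<^esub> x)"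
    by (simp add: quot_map_def)
  also have "\<dots> = N' +>\<^bsub>M'\<^esub> F x y"
    by (intro quot_map_rcos[where K=K] assms)
  finally show ?thesis .
qed

lemma quot_module_sel [simp]:
  "carrier (quot_module M N) = a_rcosets\<^bsub>M\<^esub> N"
  "\<zero>\<^bsub>quot_module M N\<^esub> = N"
  "X \<oplus>\<^bsub>quot_module M N\<^esub> Y = X <+>\<^bsub>M\<^esub> Y"
  by (simp_all add: quot_module_def)

lemma quot_carrierE:
  assumes "X \<in> a_rcosets\<^bsub>M\<^esub> N"
  obtains x where "x \<in> carrier M" "X = N +>\<^bsub>M\<^esub> x"
  using assms by (auto simp: A_RCOSETS_def')

context kmod begin

lemma rcos_in: "x \<in> carrier M \<Longrightarrow> N +>\<^bsub>M\<^esub> x \<in> a_rcosets\<^bsub>M\<^esub> N"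
  by (auto simp: A_RCOSETS_def')

lemma smult_linear: "a \<in> carrier K \<Longrightarrow> is_linear K M M ((\<odot>\<^bsub>M\<^esub>) a)"
  by (rule is_linearI) (auto simp: smult_r_distr smult_assoc1[symmetric] m_comm)

lemma quot_smult: 
  assumes "submodule N K M" "a \<in> carrier K" "x \<in> carrier M"
  shows "a \<odot>\<^bsub>quot_module M N\<^esub> (N +>\<^bsub>M\<^esub> x) = N +>\<^bsub>M\<^esub> (a \<odot>\<^bsub>M\<^esub> x)"
  using quot_map_rcos[OF module_axioms module_axioms assms(1,1) smult_linear[OF assms(2)] _ assms(3)]
    submoduleE(4)[OF assms(1,2)] by (simp add: quot_module_def quot_map_def)

lemma quot_is_module:
  assumes N: "submodule N K M"
  shows "module K (quot_module M N)"
proof -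
  let ?Q = "quot_module M N"
  have ag: "abelian_group ?Q"
  proof (rule abelian_groupI; (elim quot_carrierE | simp add: )?)
    show "N \<in> a_rcosets\<^bsub>M\<^esub> N" using rcos_in[OF M.zero_closed] rcos_zero[OF N] by metis
  next
    fix X Y assume "X \<in> a_rcosets\<^bsub>M\<^esub> N" "Y \<in> a_rcosets\<^bsub>M\<^esub> N"
    then obtain x y where "x \<in> carrier M" "X = N +>\<^bsub>M\<^esub> x" "y \<in> carrier M" "Y = N +>\<^bsub>M\<^esub> y"
      by (auto elim!: quot_carrierE)
    then show "X <+>\<^bsub>M\<^esub> Y \<in> a_rcosets\<^bsub>M\<^esub> N" "X <+>\<^bsub>M\<^esub> Y = Y <+>\<^bsub>M\<^esub> X"
      using M.a_comm[of x y] by (simp_all add: rcos_sum[OF N] rcos_in)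
  next
    fix X Y Z assume "X \<in> a_rcosets\<^bsub>M\<^esub> N" "Y \<in> a_rcosets\<^bsub>M\<^esub> N" "Z \<in> a_rcosets\<^bsub>M\<^esub> N"
    then show "X <+>\<^bsub>M\<^esub> Y <+>\<^bsub>M\<^esub> Z = X <+>\<^bsub>M\<^esub> (Y <+>\<^bsub>M\<^esub> Z)"
      by (auto elim!: quot_carrierE simp: rcos_sum[OF N] M.a_assoc)
  next
    fix X assume "X \<in> a_rcosets\<^bsub>M\<^esub> N"
    then obtain x where x: "x \<in> carrier M" "X = N +>\<^bsub>M\<^esub> x" by (rule quot_carrierE)
    show "N <+>\<^bsub>M\<^esub> X = X" using rcos_sum[OF N M.zero_closed x(1)] x rcos_zero[OF N] by simp
    show "\<exists>Y\<in>a_rcosets\<^bsub>M\<^esub> N. Y <+>\<^bsub>M\<^esub> X = N"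
      using rcos_sum[OF N M.a_inv_closed[OF x(1)] x(1)] x rcos_zero[OF N] rcos_in[OF M.a_inv_closed[OF x(1)]] 
      by (auto simp: M.l_neg)
  qed
  show ?thesis
    by (rule moduleI[OF R.cring_axioms ag]; simp?)
      (auto elim!: quot_carrierE simp: rcos_sum[OF N] quot_smult[OF N] smult_l_distr smult_r_distr smult_assoc1 rcos_in)
qed

lemma quot_neg:
  assumes N: "submodule N K M" and x: "x \<in> carrier M"
  shows "\<ominus>\<^bsub>quot_module M N\<^esub> (N +>\<^bsub>M\<^esub> x) = N +>\<^bsub>M\<^esub> (\<ominus>\<^bsub>M\<^esub> x)"
proof -
  have "is_linear K M (quot_module M N) (\<lambda>x. N +>\<^bsub>M\<^esub> x)"
    by (rule is_linearI) (auto simp: rcos_sum[OF N] quot_smult[OF N] rcos_in)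
  from lin_neg[OF this module_axioms quot_is_module[OF N] x] show ?thesis by simp
qed

lemma quot_koszul:
  assumes N: "submodule N K M" and x: "x \<in> carrier M"
  shows "koszul (quot_module M N) n (N +>\<^bsub>M\<^esub> x) = N +>\<^bsub>M\<^esub> (koszul M n x)"
  using quot_neg[OF assms] by (simp add: koszul_def)

end


subsection \<open>Free modules\<close>

lemma free_sel [simp]:
  "\<zero>\<^bsub>free_module K X\<^esub> = (\<lambda>x. \<zero>\<^bsub>K\<^esub>)"
  "c \<oplus>\<^bsub>free_module K X\<^esub> d = (\<lambda>x. c x \<oplus>\<^bsub>K\<^esub> d x)"
  "a \<odot>\<^bsub>free_module K X\<^esub> c = (\<lambda>x. a \<otimes>\<^bsub>K\<^esub> c x)"
  by (simp_all add: free_module_def)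

context field begin

lemma free_carrierI:
  "(\<And>x. x \<in> X \<Longrightarrow> c x \<in> carrier R) \<Longrightarrow> (\<And>x. x \<notin> X \<Longrightarrow> c x = \<zero>) \<Longrightarrow> finite {x. c x \<noteq> \<zero>} \<Longrightarrow> c \<in> carrier (free_module R X)"
  by (simp add: free_module_def)

lemma free_carrierD:
  assumes "c \<in> carrier (free_module R X)"
  shows "c x \<in> carrier R" "c x \<noteq> \<zero> \<Longrightarrow> x \<in> X" "finite {x. c x \<noteq> \<zero>}"
  using assms by (cases "x \<in> X"; auto simp: free_module_def)+

lemma free_add:
  assumes c: "c \<in> carrier (free_module R X)" and d: "d \<in> carrier (free_module R X)"
  shows "(\<lambda>x. c x \<oplus> d x) \<in> carrier (free_module R X)"
proof (rule free_carrierI)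
  show "finite {x. c x \<oplus> d x \<noteq> \<zero>}"
    by (rule finite_subset[of _ "{x. c x \<noteq> \<zero>} \<union> {x. d x \<noteq> \<zero>}"])
      (use free_carrierD(3)[OF c] free_carrierD(3)[OF d] in auto)
qed (use free_carrierD(1,2)[OF c] free_carrierD(1,2)[OF d] in \<open>auto\<close>, metis r_zero zero_closed)

lemma free_smult:
  assumes a: "a \<in> carrier R" and d: "d \<in> carrier (free_module R X)"
  shows "(\<lambda>x. a \<otimes> d x) \<in> carrier (free_module R X)"
proof (rule free_carrierI)
  show "finite {x. a \<otimes> d x \<noteq> \<zero>}"
    by (rule finite_subset[of _ "{x. d x \<noteq> \<zero>}"]) (use a free_carrierD(3)[OF d] in auto)
qed (use a free_carrierD(1,2)[OF d] in \<open>auto\<close>, metis r_null)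

lemma free_is_module: "module R (free_module R X)"
proof -
  have ag: "abelian_group (free_module R X)"
  proof (rule abelian_groupI; simp?)
    show "(\<lambda>x. \<zero>) \<in> carrier (free_module R X)" by (auto intro: free_carrierI)
  next
    fix c assume c: "c \<in> carrier (free_module R X)"
    have "(\<lambda>x. \<ominus> \<one> \<otimes> c x) \<in> carrier (free_module R X)" using c by (intro free_smult) auto
    moreover have "(\<lambda>x. (\<ominus> \<one> \<otimes> c x) \<oplus> c x) = (\<lambda>x. \<zero>)" using free_carrierD(1)[OF c] by (auto simp: l_minus l_neg)
    ultimately show "\<exists>y\<in>carrier (free_module R X). (\<lambda>x. y x \<oplus> c x) = (\<lambda>x. \<zero>)" by (intro bexI)
  qed (auto simp: free_carrierD(1) free_add a_ac)
  show ?thesis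
    by (rule moduleI[OF cring_axioms ag]) (auto simp: free_carrierD(1) free_smult l_distr r_distr m_assoc)
qed

lemma single_closed: "x \<in> X \<Longrightarrow> single R x \<in> carrier (free_module R X)"
  by (rule free_carrierI) (auto simp: single_def)

lemma single_supp: "{y. single R x y \<noteq> \<zero>} = {x}"
  by (auto simp: single_def)

lemma free_induct [consumes 1, case_names zero add smult]:
  assumes c: "c \<in> carrier (free_module R X)"
    and z: "P (\<lambda>x. \<zero>)"
    and a: "\<And>c d. c \<in> carrier (free_module R X) \<Longrightarrow> d \<in> carrier (free_module R X) \<Longrightarrow> P c \<Longrightarrow> P d \<Longrightarrow> P (\<lambda>x. c x \<oplus> d x)"
    and s: "\<And>k x. k \<in> carrier R \<Longrightarrow> x \<in> X \<Longrightarrow> P (\<lambda>y. k \<otimes> single R x y)"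
  shows "P c"
proof -
  have P: "\<And>c. c \<in> carrier (free_module R X) \<Longrightarrow> {x. c x \<noteq> \<zero>} \<subseteq> S \<Longrightarrow> P c" if "finite S" for S
    using that
  proof (induction S)
    case empty
    then have "c = (\<lambda>x. \<zero>)" by auto
    then show ?case using z by simp
  next
    case (insert x S)
    let ?d = "c(x := \<zero>)" and ?s = "\<lambda>y. c x \<otimes> single R x y"
    show ?case
    proof (cases "x \<in> X")
      case True
      have d: "?d \<in> carrier (free_module R X)"
      proof (rule free_carrierI)
        show "finite {y. ?d y \<noteq> \<zero>}"
          by (rule finite_subset[OF _ free_carrierD(3)[OF insert.prems(1)]]) auto
      qed (use free_carrierD(1,2)[OF insert.prems(1)] in auto)
      have sc: "?s \<in> carrier (free_module R X)"
        using True by (intro free_smult single_closed free_carrierD(1)[OF insert.prems(1)])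
      have "c = (\<lambda>y. ?d y \<oplus> ?s y)"
        using free_carrierD(1)[OF insert.prems(1)] by (auto simp: single_def)
      moreover have "P ?d" using insert.prems(2) by (intro insert.IH[OF d]) auto
      moreover have "P ?s" using True by (intro s free_carrierD(1)[OF insert.prems(1)])
      ultimately show ?thesis using a[OF d sc] by metis
    next
      case False
      then have "c x = \<zero>" using free_carrierD(2)[OF insert.prems(1)] by blast
      then show ?thesis using insert by (intro insert.IH) auto
    qed
  qed
  show ?thesis using P[OF free_carrierD(3)[OF c] c] by blast
qed

end

locale lin_extension = kmod K M + field K for K :: "('k, 'r) ring_scheme" (structure) and M :: "('k, 'a) module" +
  fixes X :: "'x set" and f :: "'x \<Rightarrow> 'a"
  assumes f: "\<And>x. x \<in> X \<Longrightarrow> f x \<in> carrier M"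
begin

lemma ext_mono:
  assumes c: "c \<in> carrier (free_module K X)" and S: "finite S" "{x. c x \<noteq> \<zero>} \<subseteq> S" "S \<subseteq> X"
  shows "lin_ext K M f c = (\<Oplus>\<^bsub>M\<^esub>x\<in>S. c x \<odot>\<^bsub>M\<^esub> f x)"
proof -
  have "(\<Oplus>\<^bsub>M\<^esub>x\<in>S. c x \<odot>\<^bsub>M\<^esub> f x) = (\<Oplus>\<^bsub>M\<^esub>x\<in>{x. c x \<noteq> \<zero>}. c x \<odot>\<^bsub>M\<^esub> f x)"
    using S f free_carrierD(1)[OF c] by (intro M.add.finprod_mono_neutral_cong_right) auto
  then show ?thesis by (simp add: lin_ext_def)
qed

lemma ext_closed: "c \<in> carrier (free_module K X) \<Longrightarrow> lin_ext K M f c \<in> carrier M"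
  unfolding lin_ext_def by (intro M.finsum_closed) (auto simp: free_carrierD(1,3) intro!: smult_closed f dest: free_carrierD(2))

lemma ext_linear: "is_linear K (free_module K X) M (lin_ext K M f)"
proof (rule is_linearI; (simp add: ext_closed)?)
  fix c d assume c: "c \<in> carrier (free_module K X)" and d: "d \<in> carrier (free_module K X)"
  let ?S = "{x. c x \<noteq> \<zero>} \<union> {x. d x \<noteq> \<zero>}"
  have S: "finite ?S" "?S \<subseteq> X" using c d by (auto simp: free_carrierD(1,3) dest: free_carrierD(2))
  have fS: "x \<in> ?S \<Longrightarrow> f x \<in> carrier M" for x using S f by blast
  have "lin_ext K M f (\<lambda>x. c x \<oplus> d x) = (\<Oplus>\<^bsub>M\<^esub>x\<in>?S. (c x \<oplus> d x) \<odot>\<^bsub>M\<^esub> f x)"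
    using S by (intro ext_mono free_add c d) auto
  also have "\<dots> = (\<Oplus>\<^bsub>M\<^esub>x\<in>?S. c x \<odot>\<^bsub>M\<^esub> f x \<oplus>\<^bsub>M\<^esub> d x \<odot>\<^bsub>M\<^esub> f x)"
    using fS c d by (intro M.add.finprod_cong') (auto simp: smult_l_distr free_carrierD(1))
  also have "\<dots> = (\<Oplus>\<^bsub>M\<^esub>x\<in>?S. c x \<odot>\<^bsub>M\<^esub> f x) \<oplus>\<^bsub>M\<^esub> (\<Oplus>\<^bsub>M\<^esub>x\<in>?S. d x \<odot>\<^bsub>M\<^esub> f x)"
    using fS c d by (intro M.finsum_addf) (auto simp: free_carrierD(1))
  also have "\<dots> = lin_ext K M f c \<oplus>\<^bsub>M\<^esub> lin_ext K M f d"
    using S ext_mono[OF c S(1) _ S(2)] ext_mono[OF d S(1) _ S(2)] by simp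
  finally show "lin_ext K M f (\<lambda>x. c x \<oplus> d x) = lin_ext K M f c \<oplus>\<^bsub>M\<^esub> lin_ext K M f d" .
next
  fix a c assume a: "a \<in> carrier K" and c: "c \<in> carrier (free_module K X)"
  let ?S = "{x. c x \<noteq> \<zero>}"
  have S: "finite ?S" "?S \<subseteq> X" using c by (auto simp: free_carrierD(1,3) dest: free_carrierD(2))
  have fS: "x \<in> ?S \<Longrightarrow> f x \<in> carrier M" for x using S f by blast
  have "lin_ext K M f (\<lambda>x. a \<otimes> c x) = (\<Oplus>\<^bsub>M\<^esub>x\<in>?S. (a \<otimes> c x) \<odot>\<^bsub>M\<^esub> f x)"
    using S a by (intro ext_mono free_smult c) auto
  also have "\<dots> = (\<Oplus>\<^bsub>M\<^esub>x\<in>?S. a \<odot>\<^bsub>M\<^esub> (c x \<odot>\<^bsub>M\<^esub> f x))"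
    using fS c a by (intro M.add.finprod_cong') (auto simp: smult_assoc1 free_carrierD(1))
  also have "\<dots> = a \<odot>\<^bsub>M\<^esub> lin_ext K M f c" unfolding lin_ext_def
    using fS c a S by (intro finsum_smult_ldistr[symmetric]) (auto simp: free_carrierD(1))
  finally show "lin_ext K M f (\<lambda>x. a \<otimes> c x) = a \<odot>\<^bsub>M\<^esub> lin_ext K M f c" .
qed

lemma ext_single: "x \<in> X \<Longrightarrow> lin_ext K M f (single K x) = f x"
  unfolding lin_ext_def single_supp using f by (simp add: single_def)

end

context field begin
lemma free_linear_eq:
  assumes "is_linear R (free_module R X) M f" "is_linear R (free_module R X) M g" "module R M"
    "\<And>x. x \<in> X \<Longrightarrow> f (single R x) = g (single R x)" "c \<in> carrier (free_module R X)"
  shows "f c = g c"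
  using assms(5)
proof (induction rule: free_induct)
  case zero
  then show ?case using lin_zero[OF assms(1) free_is_module assms(3)] lin_zero[OF assms(2) free_is_module assms(3)] by simp
next
  case (add c d)
  then show ?case using is_linearD(2)[OF assms(1)] is_linearD(2)[OF assms(2)] by simp
next
  case (smult k x)
  then show ?case using is_linearD(3)[OF assms(1), of k "single R x"] is_linearD(3)[OF assms(2), of k "single R x"]
    by (simp add: single_closed assms)
qed
end


subsection \<open>Quotients of graded algebras with a derivation\<close>

locale pre_dga = field K
  for K :: "('k, 'r) ring_scheme" (structure) and A :: "('k, 'a) dga_rec" +
  assumes mod: "\<And>n. module K (cmp A n)"
    and d_lin: "\<And>n. is_linear K (cmp A n) (cmp A (n - 1)) (diff A n)"
    and mult_l:
      "\<And>y n m. y \<in> elts A n \<Longrightarrow> is_linear K (cmp A m) (cmp A (m + n)) (\<lambda>x. gmult A m n x y)"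
    and mult_r:
      "\<And>x n m. x \<in> elts A m \<Longrightarrow> is_linear K (cmp A n) (cmp A (m + n)) (gmult A m n x)"
    and assoc:
      "\<And>x y z m n p. \<lbrakk>x \<in> elts A m; y \<in> elts A n; z \<in> elts A p\<rbrakk> \<Longrightarrow>
        gmult A (m + n) p (gmult A m n x y) z = gmult A m (n + p) x (gmult A n p y z)"
    and one_in: "gone A \<in> elts A 0"
    and one_l: "\<And>x n. x \<in> elts A n \<Longrightarrow> gmult A 0 n (gone A) x = x"
    and one_r: "\<And>x n. x \<in> elts A n \<Longrightarrow> gmult A n 0 x (gone A) = x"
    and leib:
      "\<And>x y m n. \<lbrakk>x \<in> elts A m; y \<in> elts A n\<rbrakk> \<Longrightarrow>
        diff A (m + n) (gmult A m n x y) =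
          gmult A (m - 1) n (diff A m x) y \<oplus>\<^bsub>cmp A (m + n - 1)\<^esub>
          koszul (cmp A (m + n - 1)) m (gmult A m (n - 1) x (diff A n y))"
begin

lemma kmod: "kmod K (cmp A n)" using mod by (simp add: kmod_def)

lemma mult_in: "x \<in> elts A m \<Longrightarrow> y \<in> elts A n \<Longrightarrow> gmult A m n x y \<in> elts A (m + n)"
  using is_linearD(1)[OF mult_r] by blast

lemma d_in: "x \<in> elts A n \<Longrightarrow> diff A n x \<in> elts A (n - 1)"
  using is_linearD(1)[OF d_lin] by blast

end

lemma dga_pre: "dga K A \<Longrightarrow> pre_dga K A"
  by (simp add: dga_def dga_axioms_def chain_complex_def chain_complex_axioms_def pre_dga_def pre_dga_axioms_def)

locale pre_quot = pre_dga +
  fixes I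
  assumes gi: "graded_ideal K A I"
    and dI: "\<And>n x. x \<in> I n \<Longrightarrow> diff A n x \<in> I (n - 1)"
    and ddI: "\<And>n x. x \<in> elts A n \<Longrightarrow> diff A (n - 1) (diff A n x) \<in> I (n - 2)"
begin

abbreviation "Q \<equiv> quot_dga A I"

lemma sub: "submodule (I n) K (cmp A n)" using gi by (simp add: graded_ideal_def)

lemma I_in: "x \<in> I n \<Longrightarrow> x \<in> elts A n" using kmod.submod_subset[OF kmod sub] .

lemma I_l: "x \<in> elts A m \<Longrightarrow> y \<in> I n \<Longrightarrow> gmult A m n x y \<in> I (m + n)"
  and I_r: "x \<in> elts A m \<Longrightarrow> y \<in> I n \<Longrightarrow> gmult A n m y x \<in> I (n + m)"
  using gi by (auto simp: graded_ideal_def)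

abbreviation cl where "cl n x \<equiv> I n +>\<^bsub>cmp A n\<^esub> x"

lemma cmpQ: "cmp Q n = quot_module (cmp A n) (I n)" by (simp add: quot_dga_def)

lemma eltsQ: "elts Q n = a_rcosets\<^bsub>cmp A n\<^esub> (I n)" by (simp add: cmpQ)

lemma cl_in: "x \<in> elts A n \<Longrightarrow> cl n x \<in> elts Q n"
  by (simp add: eltsQ kmod.rcos_in[OF kmod])

lemma elQE: assumes "X \<in> elts Q n" obtains x where "x \<in> elts A n" "X = cl n x"
  using assms by (auto simp: eltsQ elim: quot_carrierE)

lemma modQ: "module K (cmp Q n)"
  unfolding cmpQ by (rule kmod.quot_is_module[OF kmod sub])

lemma zeroQ: "\<zero>\<^bsub>cmp Q n\<^esub> = I n" by (simp add: cmpQ)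

lemma addQ: "x \<in> elts A n \<Longrightarrow> y \<in> elts A n \<Longrightarrow> cl n x \<oplus>\<^bsub>cmp Q n\<^esub> cl n y = cl n (x \<oplus>\<^bsub>cmp A n\<^esub> y)"
  by (simp add: cmpQ kmod.rcos_sum[OF kmod sub])

lemma smultQ: "a \<in> carrier K \<Longrightarrow> x \<in> elts A n \<Longrightarrow> a \<odot>\<^bsub>cmp Q n\<^esub> cl n x = cl n (a \<odot>\<^bsub>cmp A n\<^esub> x)"
  by (simp add: cmpQ kmod.quot_smult[OF kmod sub])

lemma koszulQ: "x \<in> elts A n \<Longrightarrow> koszul (cmp Q n) i (cl n x) = cl n (koszul (cmp A n) i x)"
  by (simp add: cmpQ kmod.quot_koszul[OF kmod sub])

lemma dQ: "x \<in> elts A n \<Longrightarrow> diff Q n (cl n x) = cl (n - 1) (diff A n x)"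
  using quot_map_rcos[OF mod mod sub sub d_lin dI] by (simp add: quot_dga_def)

lemma mQ: "x \<in> elts A m \<Longrightarrow> y \<in> elts A n \<Longrightarrow> gmult Q m n (cl m x) (cl n y) = cl (m + n) (gmult A m n x y)"
  using quot_map2_rcos[OF mod mod mod sub sub sub mult_l mult_r I_r I_l] by (simp add: quot_dga_def)

lemma oneQ: "gone Q = cl 0 (gone A)" by (simp add: quot_dga_def)

lemma cl_lin: "is_linear K (cmp A n) (cmp Q n) (cl n)"
  by (rule is_linearI) (auto simp: cl_in addQ smultQ)

lemma dgaQ: "dga K Q"
proof (intro dga.intro dga_axioms.intro chain_complex.intro chain_complex_axioms.intro field_axioms modQ)
  note [simp] = addQ smultQ koszulQ dQ mQ oneQ cl_in mult_in d_in
  have [simp]: "x \<in> elts A n \<Longrightarrow> y \<in> elts A n \<Longrightarrow> x \<oplus>\<^bsub>cmp A n\<^esub> y \<in> elts A n" for x y n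
    using abelian_monoid.a_closed mod[of n] by (metis abelian_group_def module_def)
  have [simp]: "x \<in> elts A n \<Longrightarrow> koszul (cmp A n) i x \<in> elts A n" for x n i
    by (simp add: kmod.koszul_closed[OF kmod])
  have [simp]: "a \<in> carrier K \<Longrightarrow> x \<in> elts A n \<Longrightarrow> a \<odot>\<^bsub>cmp A n\<^esub> x \<in> elts A n" for a x n
    using module.smult_closed[OF mod] by blast
  note lin = is_linearD[OF d_lin] is_linearD[OF mult_l] is_linearD[OF mult_r]
  show "is_linear K (cmp Q n) (cmp Q (n - 1)) (diff Q n)" for n
    by (rule is_linearI) (auto elim!: elQE simp: lin)
  show "diff Q (n - 1) (diff Q n X) = \<zero>\<^bsub>cmp Q (n - 2)\<^esub>" if "X \<in> elts Q n" for X n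
  proof -
    obtain x where x: "x \<in> elts A n" "X = cl n x" using \<open>X \<in> elts Q n\<close> by (elim elQE)
    have e: "n - 1 - 1 = n - 2" by simp
    have "diff Q (n - 1) (diff Q n X) = cl (n - 2) (diff A (n - 1) (diff A n x))"
      using x dQ[OF d_in[OF x(1)]] unfolding e by simp
    then show ?thesis using kmod.rcos_zero_iff[OF kmod sub, of "diff A (n - 1) (diff A n x)" "n - 2"]
       d_in[OF d_in[OF x(1)]] ddI[OF x(1)] unfolding e by (simp add: zeroQ)
  qed
  show "is_linear K (cmp Q m) (cmp Q (m + n)) (\<lambda>X. gmult Q m n X Y)" if "Y \<in> elts Q n" for Y n m
    using that by (intro is_linearI) (auto elim!: elQE simp: lin)
  show "is_linear K (cmp Q n) (cmp Q (m + n)) (gmult Q m n X)" if "X \<in> elts Q m" for X n m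
    using that by (intro is_linearI) (auto elim!: elQE simp: lin)
  show "gmult Q (m + n) p (gmult Q m n X Y) Z = gmult Q m (n + p) X (gmult Q n p Y Z)"
    if "X \<in> elts Q m" "Y \<in> elts Q n" "Z \<in> elts Q p" for X Y Z m n p
    using that by (elim elQE) (simp add: assoc mQ[of _ "m+n" _ p] mQ[of _ m _ "n+p"] add.assoc)
  show "gone Q \<in> elts Q 0" by (simp add: one_in)
  show "gmult Q 0 n (gone Q) X = X" if "X \<in> elts Q n" for X n
    using that mQ[OF one_in, of _ n] by (elim elQE) (simp add: one_l)
  show "gmult Q n 0 X (gone Q) = X" if "X \<in> elts Q n" for X n
    using that mQ[OF _ one_in, of _ n] by (elim elQE) (simp add: one_r)
  show "diff Q (m + n) (gmult Q m n X Y) = gmult Q (m - 1) n (diff Q m X) Y \<oplus>\<^bsub>cmp Q (m + n - 1)\<^esub>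
          koszul (cmp Q (m + n - 1)) m (gmult Q m (n - 1) X (diff Q n Y))"
    if XY: "X \<in> elts Q m" "Y \<in> elts Q n" for X Y m n
  proof -
    obtain x y where xy: "x \<in> elts A m" "X = cl m x" "y \<in> elts A n" "Y = cl n y"
      using XY by (elim elQE)
    have e: "m - 1 + n = m + n - 1" "m + (n - 1) = m + n - 1" by auto
    have "gmult A (m - 1) n (diff A m x) y \<in> elts A (m + n - 1)" "gmult A m (n - 1) x (diff A n y) \<in> elts A (m + n - 1)"
      using mult_in[OF d_in[OF xy(1)] xy(3)] mult_in[OF xy(1) d_in[OF xy(3)]] by (simp_all only: e)
    then show ?thesis using xy mQ[OF d_in[OF xy(1)] xy(3)] mQ[OF xy(1) d_in[OF xy(3)]]
      by (simp add: leib e)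
  qed
qed

end

context pre_dga begin

lemma Int_submodule:
  assumes "\<And>N. N \<in> F \<Longrightarrow> submodule N K (cmp A n)" "F \<noteq> {}"
  shows "submodule (\<Inter>F) K (cmp A n)"
proof -
  interpret kmod K "cmp A n" by (rule kmod)
  show ?thesis
  proof (rule submoduleI)
    show "\<Inter>F \<subseteq> elts A n" using assms submoduleE(1) by blast
    show "\<zero>\<^bsub>cmp A n\<^esub> \<in> \<Inter>F" using assms(1) submod_zero by blast
    show "\<ominus>\<^bsub>cmp A n\<^esub> a \<in> \<Inter>F" if "a \<in> \<Inter>F" for a using assms(1) submoduleE(3) that by (meson InterE InterI)
    show "a \<oplus>\<^bsub>cmp A n\<^esub> b \<in> \<Inter>F" if "a \<in> \<Inter>F" "b \<in> \<Inter>F" for a b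
      using assms(1) submoduleE(5) that by (meson InterE InterI)
    show "a \<odot>\<^bsub>cmp A n\<^esub> b \<in> \<Inter>F" if "a \<in> carrier K" "b \<in> \<Inter>F" for a b
      using assms(1) submoduleE(4) that by (meson InterE InterI)
  qed
qed

lemma full_ideal: "graded_ideal K A (elts A)"
  using module.carrier_is_submodule[OF mod] mult_in by (auto simp: graded_ideal_def)

lemma ideal_gen_ideal:
  assumes "\<And>n. X n \<subseteq> elts A n"
  shows "graded_ideal K A (ideal_gen K A X)"
proof -
  let ?F = "\<lambda>n. {I n |I. graded_ideal K A I \<and> (\<forall>m. X m \<subseteq> I m)}"
  have "submodule (\<Inter>(?F n)) K (cmp A n)" for n
  proof (rule Int_submodule)
    show "?F n \<noteq> {}" using full_ideal assms by blast
  qed (auto simp: graded_ideal_def)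
  moreover have "gmult A m n x y \<in> \<Inter>(?F (m + n)) \<and> gmult A n m y x \<in> \<Inter>(?F (n + m))"
    if "x \<in> elts A m" "y \<in> \<Inter>(?F n)" for m n x y
  proof -
    have "gmult A m n x y \<in> I (m + n) \<and> gmult A n m y x \<in> I (n + m)"
      if I: "graded_ideal K A I" "\<forall>m. X m \<subseteq> I m" for I
    proof -
      have "y \<in> I n" using I \<open>y \<in> \<Inter>(?F n)\<close> by blast
      then show ?thesis using I(1) \<open>x \<in> elts A m\<close> unfolding graded_ideal_def by blast
    qed
    then show ?thesis by blast
  qed
  ultimately show ?thesis unfolding graded_ideal_def ideal_gen_def by simp
qed

lemma ideal_gen_incl: "x \<in> X n \<Longrightarrow> x \<in> ideal_gen K A X n"
  by (auto simp: ideal_gen_def)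

lemma ideal_gen_least: "graded_ideal K A I \<Longrightarrow> (\<And>m. X m \<subseteq> I m) \<Longrightarrow> x \<in> ideal_gen K A X n \<Longrightarrow> x \<in> I n"
  by (auto simp: ideal_gen_def)

lemma ideal_gen_diff:
  assumes X: "\<And>n. X n \<subseteq> elts A n" and dX: "\<And>n x. x \<in> X n \<Longrightarrow> diff A n x \<in> ideal_gen K A X (n - 1)"
    and x: "x \<in> ideal_gen K A X n"
  shows "diff A n x \<in> ideal_gen K A X (n - 1)"
proof -
  let ?J = "ideal_gen K A X"
  have J: "graded_ideal K A ?J" by (rule ideal_gen_ideal[OF X])
  have sub: "submodule (?J n) K (cmp A n)" for n using J by (simp add: graded_ideal_def)
  have Jin: "x \<in> ?J n \<Longrightarrow> x \<in> elts A n" for x n using kmod.submod_subset[OF kmod sub] .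
  let ?I = "\<lambda>n. {x \<in> ?J n. diff A n x \<in> ?J (n - 1)}"
  have "graded_ideal K A ?I"
    unfolding graded_ideal_def
  proof (intro conjI allI ballI)
    fix n
    interpret kmod K "cmp A n" by (rule kmod)
    interpret B: kmod K "cmp A (n - 1)" by (rule kmod)
    note 0 = submoduleE[OF sub] B.submoduleE[OF sub] submod_zero[OF sub] B.submod_zero[OF sub] is_linearD[OF d_lin]
       Jin lin_zero[OF d_lin mod mod] lin_neg[OF d_lin mod mod] 
    show "submodule (?I n) K (cmp A n)"
    proof (rule submoduleI)
      show "?I n \<subseteq> elts A n" using Jin by blast
    qed (simp_all add: 0)
  next
    fix m n x y assume x: "x \<in> elts A m" and y: "y \<in> ?I n"
    have e: "m - 1 + n = m + n - 1" "m + (n - 1) = m + n - 1" "n - 1 + m = n + m - 1" "n + (m - 1) = n + m - 1" by auto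
    have JJ: "x \<in> elts A m \<Longrightarrow> y \<in> ?J n \<Longrightarrow> gmult A m n x y \<in> ?J (m + n) \<and> gmult A n m y x \<in> ?J (n + m)" for m n x y
      using J by (auto simp: graded_ideal_def)
    have yJ: "y \<in> ?J n" "diff A n y \<in> ?J (n - 1)" using y by auto
    note 1 = JJ[OF x yJ(1)] JJ[OF x yJ(2), unfolded e] JJ[OF d_in[OF x] yJ(1), unfolded e]
    have add: "u \<in> ?J k \<Longrightarrow> v \<in> ?J k \<Longrightarrow> u \<oplus>\<^bsub>cmp A k\<^esub> koszul (cmp A k) i v \<in> ?J k" for u v k i
      using module.submoduleE(5)[OF mod sub] kmod.submod_koszul[OF kmod sub] by blast
    show "gmult A m n x y \<in> ?I (m + n)" "gmult A n m y x \<in> ?I (n + m)"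
      using 1 add by (simp_all add: leib x Jin[OF yJ(1)])
  qed
  moreover have "X m \<subseteq> ?I m" for m using dX ideal_gen_incl by blast
  ultimately show ?thesis using ideal_gen_least[OF _ _ x, of ?I] by blast
qed

end


subsection \<open>The free algebra\<close>

lemma is_linear_comp: "is_linear K M N f \<Longrightarrow> is_linear K N L g \<Longrightarrow> is_linear K M L (\<lambda>x. g (f x))"
  by (rule is_linearI) (simp_all add: is_linearD[of K M N f] is_linearD[of K N L g])

context kmod begin

lemma is_linear_zero: "module K N \<Longrightarrow> is_linear K N M (\<lambda>_. \<zero>\<^bsub>M\<^esub>)"
  by (rule is_linearI) (auto simp: smult_r_null)

lemma is_linear_add: 
  assumes "is_linear K N M f" "is_linear K N M g" 
  shows "is_linear K N M (\<lambda>x. f x \<oplus>\<^bsub>M\<^esub> g x)"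
  by (rule is_linearI) (auto simp: is_linearD[OF assms(1)] is_linearD[OF assms(2)] smult_r_distr M.a_ac)

lemma is_linear_smult: 
  assumes "is_linear K N M f" "a \<in> carrier K"
  shows "is_linear K N M (\<lambda>x. a \<odot>\<^bsub>M\<^esub> f x)"
  using is_linear_comp[OF assms(1) smult_linear[OF assms(2)]] .

lemma is_linear_koszul: 
  assumes "is_linear K N M f"
  shows "is_linear K N M (\<lambda>x. koszul M i (f x))"
  using is_linear_comp[OF assms(1) koszul_linear] .

lemma lin_ext_cong: 
  assumes "field K" "c \<in> carrier (free_module K X)" "\<And>x. x \<in> X \<Longrightarrow> f x = g x" "\<And>x. x \<in> X \<Longrightarrow> g x \<in> carrier M"
  shows "lin_ext K M f c = lin_ext K M g c"
  unfolding lin_ext_def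
  using assms(3,4) field.free_carrierD[OF assms(1,2)] by (intro M.add.finprod_cong') auto

lemma lin_ext_param:
  assumes "field K" "module K N" "c \<in> carrier (free_module K X)"
    "\<And>x. x \<in> X \<Longrightarrow> is_linear K N M (f x)"
  shows "is_linear K N M (\<lambda>y. lin_ext K M (\<lambda>x. f x y) c)"
proof -
  interpret field K by fact
  have L: "lin_extension K M X (\<lambda>x. f x y)" if "y \<in> carrier N" for y
    using that is_linearD(1)[OF assms(4)] by unfold_locales auto
  interpret N: kmod K N using assms(2) by (simp add: kmod_def)
  note lin = lin_extension.ext_linear[OF L] 
  from assms(3) show ?thesis
  proof (induction rule: free_induct)
    case zero
    show ?case by (simp add: lin_ext_def is_linear_zero assms(2))
  next
    case (add c d)
    have "is_linear K N M (\<lambda>y. lin_ext K M (\<lambda>x. f x y) c \<oplus>\<^bsub>M\<^esub> lin_ext K M (\<lambda>x. f x y) d)"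
      by (rule is_linear_add) (fact add)+
    then show ?case using is_linearD(2)[OF lin add(1,2)] by (auto simp: is_linear_def Pi_def)
  next
    case (smult k x)
    have "is_linear K N M (\<lambda>y. k \<odot>\<^bsub>M\<^esub> f x y)"
      by (rule is_linear_smult) (fact smult assms(4)[OF smult(2)])+
    then show ?case using is_linearD(3)[OF lin smult(1) single_closed[OF smult(2)]] lin_extension.ext_single[OF L smult(2)]
      by (auto simp: is_linear_def Pi_def)
  qed
qed

end

locale free_alg = field K + E: pre_dga K E + A: pre_dga K A
  for K :: "('k, 'r) ring_scheme" (structure) and E :: "('k, 'e) dga_rec" and A :: "('k, 'a) dga_rec"
begin

abbreviation "F n \<equiv> free_module K (words E A n)"
abbreviation "FA \<equiv> free_algebra K E A"
abbreviation "ld \<equiv> letter_diff E A"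

lemma modF: "module K (F n)" by (rule free_is_module)
lemma kmodF: "kmod K (F n)" using modF by (simp add: kmod_def)

lemma sel [simp]: "cmp FA n = F n" "gone FA = single K []"
  by (simp_all add: free_algebra_def)

lemma word_deg_simps [simp]: "word_deg [] = 0" "word_deg (l # w) = fst l + word_deg w" "word_deg (u @ v) = word_deg u + word_deg v"
  by (simp_all add: word_deg_def)

lemma ld_in: "l \<in> letters E A \<Longrightarrow> ld l \<in> letters E A"
  using E.d_in A.d_in by (auto simp: letters_def letter_diff_def)
lemma fst_ld: "fst (ld l) = fst l - 1" by (simp add: letter_diff_def split: prod.splits)

lemma words_Nil: "[] \<in> words E A 0" by (simp add: words_def)
lemma words_app: "u \<in> words E A m \<Longrightarrow> v \<in> words E A n \<Longrightarrow> u @ v \<in> words E A (m + n)"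
  by (auto simp: words_def)
lemma words_sgl: "l \<in> letters E A \<Longrightarrow> n = fst l \<Longrightarrow> [l] \<in> words E A n"
  by (auto simp: words_def)

lemma deg_upd: "i < length w \<Longrightarrow> word_deg (w[i := ld (w ! i)]) = word_deg w - 1"
  using arg_cong[OF id_take_nth_drop[of i w], of word_deg] by (simp add: upd_conv_take_nth_drop fst_ld)

lemma words_upd: 
  assumes "w \<in> words E A n" "i < length w"
  shows "w[i := ld (w ! i)] \<in> words E A (n - 1)"
proof -
  have "w ! i \<in> letters E A" using assms by (auto simp: words_def)
  then have "set (w[i := ld (w ! i)]) \<subseteq> insert (ld (w ! i)) (set w)" "ld (w ! i) \<in> letters E A"
    using set_update_subset_insert[of w i] ld_in by auto
  then have "set (w[i := ld (w ! i)]) \<subseteq> letters E A" using assms by (auto simp: words_def)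
  then show ?thesis using assms deg_upd[of i w] by (simp add: words_def)
qed

definition dt where "dt n w i = koszul (F (n - 1)) (word_deg (take i w)) (single K (w[i := ld (w ! i)]))"
definition dw where "dw n w = (\<Oplus>\<^bsub>F (n - 1)\<^esub>i\<in>{..<length w}. dt n w i)"

lemma dt_in: "w \<in> words E A n \<Longrightarrow> i < length w \<Longrightarrow> dt n w i \<in> carrier (F (n - 1))"
  unfolding dt_def by (intro kmod.koszul_closed[OF kmodF] single_closed words_upd)

lemma agF: "abelian_group (F n)" using modF module.axioms(2) by blast
lemma amF: "abelian_monoid (F n)" using agF by (simp add: abelian_group_def)

lemma dw_in: "w \<in> words E A n \<Longrightarrow> dw n w \<in> carrier (F (n - 1))"
  unfolding dw_def by (intro abelian_monoid.finsum_closed amF) (auto intro: dt_in)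

lemma diff_FA: "diff FA n = lin_ext K (F (n - 1)) (dw n)"
  by (simp add: free_algebra_def dw_def[abs_def] dt_def[abs_def])

lemma ext_d: "lin_extension K (F (n - 1)) (words E A n) (dw n)"
  by (intro lin_extension.intro kmodF lin_extension_axioms.intro field_axioms dw_in)

lemma d_linF: "is_linear K (F n) (F (n - 1)) (diff FA n)"
  unfolding diff_FA by (rule lin_extension.ext_linear[OF ext_d])

lemma d_single: "w \<in> words E A n \<Longrightarrow> diff FA n (single K w) = dw n w"
  unfolding diff_FA by (rule lin_extension.ext_single[OF ext_d])

definition inner where "inner N c' u = lin_ext K (F N) (\<lambda>v. single K (u @ v)) c'"

lemma mult_FA: "gmult FA m n c c' = lin_ext K (F (m + n)) (inner (m + n) c') c"
  by (simp add: free_algebra_def inner_def[abs_def])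

lemma ext_inner: "u \<in> words E A m \<Longrightarrow> lin_extension K (F (m + n)) (words E A n) (\<lambda>v. single K (u @ v))"
  by (intro lin_extension.intro kmodF lin_extension_axioms.intro field_axioms single_closed words_app)

lemma inner_in: "u \<in> words E A m \<Longrightarrow> c' \<in> carrier (F n) \<Longrightarrow> inner (m + n) c' u \<in> carrier (F (m + n))"
  unfolding inner_def by (rule lin_extension.ext_closed[OF ext_inner])

lemma ext_outer: "c' \<in> carrier (F n) \<Longrightarrow> lin_extension K (F (m + n)) (words E A m) (inner (m + n) c')"
  by (intro lin_extension.intro kmodF lin_extension_axioms.intro field_axioms inner_in)

lemma mult_lF: "y \<in> carrier (F n) \<Longrightarrow> is_linear K (F m) (F (m + n)) (\<lambda>x. gmult FA m n x y)"
  unfolding mult_FA by (rule lin_extension.ext_linear[OF ext_outer])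

lemma mult_rF: "x \<in> carrier (F m) \<Longrightarrow> is_linear K (F n) (F (m + n)) (gmult FA m n x)"
proof -
  assume x: "x \<in> carrier (F m)"
  have "is_linear K (F n) (F (m + n)) (\<lambda>y. inner (m + n) y u)" if "u \<in> words E A m" for u
    unfolding inner_def by (rule lin_extension.ext_linear[OF ext_inner[OF that]])
  from kmod.lin_ext_param[OF kmodF field_axioms modF x, OF this]
  show ?thesis by (simp add: mult_FA[abs_def])
qed

lemma mult_single: "u \<in> words E A m \<Longrightarrow> v \<in> words E A n \<Longrightarrow> gmult FA m n (single K u) (single K v) = single K (u @ v)"
  unfolding mult_FA using lin_extension.ext_single[OF ext_outer[OF single_closed]] lin_extension.ext_single[OF ext_inner]
  by (simp add: inner_def)

lemma mult_inF: "x \<in> carrier (F m) \<Longrightarrow> y \<in> carrier (F n) \<Longrightarrow> gmult FA m n x y \<in> carrier (F (m + n))"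
  using is_linearD(1)[OF mult_rF] by blast
lemma d_inF: "x \<in> carrier (F n) \<Longrightarrow> diff FA n x \<in> carrier (F (n - 1))"
  using is_linearD(1)[OF d_linF] by blast

lemma bilin_eq:
  assumes "\<And>y. y \<in> carrier (F n) \<Longrightarrow> is_linear K (F m) M (\<lambda>x. f x y)" "\<And>x. x \<in> carrier (F m) \<Longrightarrow> is_linear K (F n) M (f x)"
     "\<And>y. y \<in> carrier (F n) \<Longrightarrow> is_linear K (F m) M (\<lambda>x. g x y)" "\<And>x. x \<in> carrier (F m) \<Longrightarrow> is_linear K (F n) M (g x)"
     "module K M" "\<And>u v. u \<in> words E A m \<Longrightarrow> v \<in> words E A n \<Longrightarrow> f (single K u) (single K v) = g (single K u) (single K v)"
     "x \<in> carrier (F m)" "y \<in> carrier (F n)"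
   shows "f x y = g x y"
proof -
  have 1: "f (single K u) y = g (single K u) y" if "u \<in> words E A m" for u
    by (rule free_linear_eq[OF assms(2,4,5)]) (use that assms single_closed in auto)
  show ?thesis
    by (rule free_linear_eq[OF assms(1,3,5)]) (use 1 assms in auto)
qed

lemma assocF: 
  assumes "x \<in> carrier (F m)" "y \<in> carrier (F n)" "z \<in> carrier (F p)"
  shows "gmult FA (m + n) p (gmult FA m n x y) z = gmult FA m (n + p) x (gmult FA n p y z)"
proof -
  have lin: "z \<in> carrier (F p) \<Longrightarrow> is_linear K (F (m+n)) (F (m + n + p)) (\<lambda>x. gmult FA (m+n) p x z)" 
    "x \<in> carrier (F m) \<Longrightarrow> is_linear K (F (n+p)) (F (m + n + p)) (gmult FA m (n+p) x)"
    "z \<in> carrier (F (n + p)) \<Longrightarrow> is_linear K (F m) (F (m + n + p)) (\<lambda>x. gmult FA m (n+p) x z)" for x z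
    using mult_lF mult_rF[of x m "n + p"] mult_lF[of z "n + p" m] mult_lF[of z p "m + n"] by (auto simp: add.assoc)
  have 1: "gmult FA (m + n) p (gmult FA m n x y) (single K w) = gmult FA m (n + p) x (gmult FA n p y (single K w))"
    if w: "w \<in> words E A p" and "x \<in> carrier (F m)" "y \<in> carrier (F n)" for x y w
  proof (rule bilin_eq[OF _ _ _ _ modF[of "m + n + p"] _ \<open>x \<in> _\<close> \<open>y \<in> _\<close>])
    note s = single_closed[OF w]
    show "is_linear K (F m) (F (m + n + p)) (\<lambda>x. gmult FA (m + n) p (gmult FA m n x y) (single K w))" if "y \<in> carrier (F n)" for y
      using is_linear_comp[OF mult_lF[OF that] lin(1)[OF s]] .
    show "is_linear K (F n) (F (m + n + p)) (\<lambda>y. gmult FA (m + n) p (gmult FA m n x y) (single K w))" if "x \<in> carrier (F m)" for x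
      using is_linear_comp[OF mult_rF[OF that] lin(1)[OF s]] .
    show "is_linear K (F m) (F (m + n + p)) (\<lambda>x. gmult FA m (n + p) x (gmult FA n p y (single K w)))" if "y \<in> carrier (F n)" for y
      using lin(3)[OF mult_inF[OF that s]] .
    show "is_linear K (F n) (F (m + n + p)) (\<lambda>y. gmult FA m (n + p) x (gmult FA n p y (single K w)))" if "x \<in> carrier (F m)" for x
      using is_linear_comp[OF mult_lF[OF s] lin(2)[OF that]] .
    show "gmult FA (m + n) p (gmult FA m n (single K u) (single K v)) (single K w) = gmult FA m (n + p) (single K u) (gmult FA n p (single K v) (single K w))"
      if "u \<in> words E A m" "v \<in> words E A n" for u v
      using that w words_app by (simp add: mult_single)
  qed
  show ?thesis
  proof (rule free_linear_eq[OF _ _ modF[of "m + n + p"] _ \<open>z \<in> _\<close>])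
    show "is_linear K (F p) (F (m + n + p)) (gmult FA (m + n) p (gmult FA m n x y))"
      using mult_rF[OF mult_inF[OF assms(1,2)]] .
    show "is_linear K (F p) (F (m + n + p)) (\<lambda>z. gmult FA m (n + p) x (gmult FA n p y z))"
      using is_linear_comp[OF mult_rF[OF assms(2)] lin(2)[OF assms(1)]] .
  qed (use 1 assms in auto)
qed

lemma lessThan_add: "{..<m + n} = {..<m} \<union> (\<lambda>i. m + i) ` {..<n::nat}"
proof -
  have "x \<in> (\<lambda>i. m + i) ` {..<n}" if "x < m + n" "\<not> x < m" for x
    using that by (intro image_eqI[of _ _ "x - m"]) auto
  then show ?thesis by auto
qed

lemma dw_app:
  assumes u: "u \<in> words E A m" and v: "v \<in> words E A n"
  shows "dw (m + n) (u @ v) = gmult FA (m - 1) n (dw m u) (single K v) \<oplus>\<^bsub>F (m + n - 1)\<^esub>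
          koszul (F (m + n - 1)) m (gmult FA m (n - 1) (single K u) (dw n v))"
proof -
  let ?F = "F (m + n - 1)"
  interpret F: kmod K ?F by (rule kmodF)
  have e: "m - 1 + n = m + n - 1" "m + (n - 1) = m + n - 1" by auto
  note uv = words_app[OF u v]
  have "dw (m + n) (u @ v) = (\<Oplus>\<^bsub>?F\<^esub>i\<in>{..<length u} \<union> (\<lambda>i. length u + i) ` {..<length v}. dt (m + n) (u @ v) i)"
    unfolding dw_def by (simp add: lessThan_add)
  also have "\<dots> = (\<Oplus>\<^bsub>?F\<^esub>i\<in>{..<length u}. dt (m + n) (u @ v) i) \<oplus>\<^bsub>?F\<^esub> (\<Oplus>\<^bsub>?F\<^esub>i\<in>(\<lambda>i. length u + i) ` {..<length v}. dt (m + n) (u @ v) i)"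
    by (rule F.M.finsum_Un_disjoint) (use dt_in[OF uv] in auto)
  also have "(\<Oplus>\<^bsub>?F\<^esub>i\<in>(\<lambda>i. length u + i) ` {..<length v}. dt (m + n) (u @ v) i) = (\<Oplus>\<^bsub>?F\<^esub>i\<in>{..<length v}. dt (m + n) (u @ v) (length u + i))"
    by (rule F.M.finsum_reindex) (use dt_in[OF uv] in \<open>auto simp: inj_on_def\<close>)
  also have "(\<Oplus>\<^bsub>?F\<^esub>i\<in>{..<length u}. dt (m + n) (u @ v) i) = gmult FA (m - 1) n (dw m u) (single K v)"
  proof -
    have "gmult FA (m - 1) n (dw m u) (single K v) = (\<Oplus>\<^bsub>?F\<^esub>i\<in>{..<length u}. gmult FA (m - 1) n (dt m u i) (single K v))"
      unfolding dw_def using lin_finsum[OF mult_lF[OF single_closed[OF v], of "m - 1"] modF modF, of "{..<length u}" "dt m u"] dt_in[OF u]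
      by (simp add: e)
    also have "\<dots> = (\<Oplus>\<^bsub>?F\<^esub>i\<in>{..<length u}. dt (m + n) (u @ v) i)"
    proof (rule F.M.finsum_cong')
      fix i assume "i \<in> {..<length u}"
      then have i: "i < length u" by simp
      show "gmult FA (m - 1) n (dt m u i) (single K v) = dt (m + n) (u @ v) i"
        unfolding dt_def lin_koszul[OF mult_lF[OF single_closed[OF v]] modF modF single_closed[OF words_upd[OF u i]]]
        using i by (simp add: mult_single[OF words_upd[OF u i] v] e list_update_append nth_append)
    qed (use dt_in[OF uv] in auto)
    finally show ?thesis ..
  qed
  also have "(\<Oplus>\<^bsub>?F\<^esub>i\<in>{..<length v}. dt (m + n) (u @ v) (length u + i)) = koszul ?F m (gmult FA m (n - 1) (single K u) (dw n v))"
  proof -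
    have g: "is_linear K (F (n - 1)) ?F (\<lambda>y. koszul ?F m (gmult FA m (n - 1) (single K u) y))"
      using F.is_linear_koszul[of "F (n - 1)"] mult_rF[OF single_closed[OF u], of "n - 1"] by (simp add: e)
    have "koszul ?F m (gmult FA m (n - 1) (single K u) (dw n v)) = (\<Oplus>\<^bsub>?F\<^esub>i\<in>{..<length v}. koszul ?F m (gmult FA m (n - 1) (single K u) (dt n v i)))"
      unfolding dw_def using lin_finsum[OF g modF modF, of "{..<length v}" "dt n v"] dt_in[OF v] by simp
    also have "\<dots> = (\<Oplus>\<^bsub>?F\<^esub>i\<in>{..<length v}. dt (m + n) (u @ v) (length u + i))"
    proof (rule F.M.finsum_cong')
      fix i assume "i \<in> {..<length v}"
      then have i: "i < length v" by simp
      have um: "word_deg u = m" using u by (simp add: words_def)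
      have c: "single K (u @ v[i := ld (v ! i)]) \<in> carrier ?F"
        using single_closed[OF words_app[OF u words_upd[OF v i]]] by (simp add: e)
      show "koszul ?F m (gmult FA m (n - 1) (single K u) (dt n v i)) = dt (m + n) (u @ v) (length u + i)"
        unfolding dt_def lin_koszul[OF mult_rF[OF single_closed[OF u]] modF modF single_closed[OF words_upd[OF v i]]]
        using i c um by (simp add: mult_single[OF u words_upd[OF v i]] e list_update_append nth_append F.koszul_koszul)
    qed (use dt_in[OF uv] in auto)
    finally show ?thesis ..
  qed
  finally show ?thesis .
qed

lemma leibF:
  assumes "x \<in> carrier (F m)" "y \<in> carrier (F n)"
  shows "diff FA (m + n) (gmult FA m n x y) =
          gmult FA (m - 1) n (diff FA m x) y \<oplus>\<^bsub>F (m + n - 1)\<^esub>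
          koszul (F (m + n - 1)) m (gmult FA m (n - 1) x (diff FA n y))"
proof -
  let ?F = "F (m + n - 1)"
  interpret F: kmod K ?F by (rule kmodF)
  have e: "m - 1 + n = m + n - 1" "m + (n - 1) = m + n - 1" by auto
  have l: "z \<in> carrier (F n) \<Longrightarrow> is_linear K (F (m - 1)) ?F (\<lambda>x. gmult FA (m - 1) n x z)"
     "x \<in> carrier (F (m - 1)) \<Longrightarrow> is_linear K (F n) ?F (\<lambda>z. gmult FA (m - 1) n x z)" 
     "z \<in> carrier (F (n - 1)) \<Longrightarrow> is_linear K (F m) ?F (\<lambda>x. gmult FA m (n - 1) x z)" 
     "x \<in> carrier (F m) \<Longrightarrow> is_linear K (F (n - 1)) ?F (\<lambda>z. gmult FA m (n - 1) x z)" for x z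
    using mult_lF[of z n "m - 1"] mult_lF[of z "n - 1" m] mult_rF[of x "m - 1" n] mult_rF[of x m "n - 1"] by (simp_all add: e)
  show ?thesis
  proof (rule bilin_eq[OF _ _ _ _ modF[of "m + n - 1"] _ assms])
    fix y assume y: "y \<in> carrier (F n)"
    show "is_linear K (F m) ?F (\<lambda>x. diff FA (m + n) (gmult FA m n x y))"
      using is_linear_comp[OF mult_lF[OF y] d_linF] .
    show "is_linear K (F m) ?F (\<lambda>x. gmult FA (m - 1) n (diff FA m x) y \<oplus>\<^bsub>?F\<^esub> koszul ?F m (gmult FA m (n - 1) x (diff FA n y)))"
      by (intro F.is_linear_add F.is_linear_koszul is_linear_comp[OF d_linF l(1)[OF y]] l(3)[OF d_inF[OF y]])
  next
    fix x assume x: "x \<in> carrier (F m)"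
    show "is_linear K (F n) ?F (\<lambda>y. diff FA (m + n) (gmult FA m n x y))"
      using is_linear_comp[OF mult_rF[OF x] d_linF] .
    show "is_linear K (F n) ?F (\<lambda>y. gmult FA (m - 1) n (diff FA m x) y \<oplus>\<^bsub>?F\<^esub> koszul ?F m (gmult FA m (n - 1) x (diff FA n y)))"
      by (intro F.is_linear_add F.is_linear_koszul is_linear_comp[OF d_linF l(4)[OF x]] l(2)[OF d_inF[OF x]])
  next
    fix u v assume uv: "u \<in> words E A m" "v \<in> words E A n"
    show "diff FA (m + n) (gmult FA m n (single K u) (single K v)) =
          gmult FA (m - 1) n (diff FA m (single K u)) (single K v) \<oplus>\<^bsub>?F\<^esub>
          koszul ?F m (gmult FA m (n - 1) (single K u) (diff FA n (single K v)))"
      using uv words_app[OF uv] by (simp add: mult_single d_single dw_app)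
  qed
qed

lemma pre_FA: "pre_dga K FA"
proof (intro pre_dga.intro pre_dga_axioms.intro field_axioms; (simp only: sel)?)
  note one = single_closed[OF words_Nil]
  show "single K [] \<in> carrier (F 0)" by (rule one)
  show "gmult FA 0 n (single K []) x = x" if "x \<in> carrier (F n)" for n x
  proof (rule free_linear_eq[OF _ _ modF[of n] _ that])
    show "is_linear K (F n) (F n) (gmult FA 0 n (single K []))" using mult_rF[OF one] by simp
    show "is_linear K (F n) (F n) (\<lambda>x. x)" by (rule is_linearI) auto
  qed (use mult_single[OF words_Nil] in simp)
  show "gmult FA n 0 x (single K []) = x" if "x \<in> carrier (F n)" for n x
  proof (rule free_linear_eq[OF _ _ modF[of n] _ that])
    show "is_linear K (F n) (F n) (\<lambda>x. gmult FA n 0 x (single K []))" using mult_lF[OF one, of n] by simp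
    show "is_linear K (F n) (F n) (\<lambda>x. x)" by (rule is_linearI) auto
  qed (use mult_single[OF _ words_Nil] in simp)
qed (fact modF d_linF mult_lF mult_rF assocF leibF)+

end


subsection \<open>Relations in the free algebra\<close>

locale fa_ideal = free_alg +
  fixes J
  assumes J: "graded_ideal K FA J"
begin

lemma subJ: "submodule (J n) K (F n)" using J by (simp add: graded_ideal_def)
abbreviation "Qm n \<equiv> quot_module (F n) (J n)"
abbreviation "cl n x \<equiv> J n +>\<^bsub>F n\<^esub> x"

lemma modQm: "module K (Qm n)" by (rule kmod.quot_is_module[OF kmodF subJ])
lemma kmodQm: "kmod K (Qm n)" using modQm by (simp add: kmod_def)

lemma cl_linear: "is_linear K (F n) (Qm n) (cl n)"
  by (rule is_linearI) (auto simp: kmod.rcos_sum[OF kmodF subJ, simplified] kmod.quot_smult[OF kmodF subJ, simplified] kmod.rcos_in[OF kmodF])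

lemma J_iff: "x \<in> carrier (F n) \<Longrightarrow> y \<in> carrier (F n) \<Longrightarrow> x \<ominus>\<^bsub>F n\<^esub> y \<in> J n \<longleftrightarrow> cl n x = cl n y"
  using kmod.rcos_eq_iff[OF kmodF subJ] by blast

lemma J_0: "x \<in> carrier (F n) \<Longrightarrow> x \<in> J n \<longleftrightarrow> cl n x = \<zero>\<^bsub>Qm n\<^esub>"
  using kmod.rcos_zero_iff[OF kmodF subJ] by simp

lemma J_mult: "x \<in> carrier (F m) \<Longrightarrow> y \<in> J n \<Longrightarrow> gmult FA m n x y \<in> J (m + n)"
  "x \<in> carrier (F m) \<Longrightarrow> y \<in> J n \<Longrightarrow> gmult FA n m y x \<in> J (n + m)"
  using J by (auto simp: graded_ideal_def)

end

locale emb = fa_ideal K E A J + B: dga K B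
  for K :: "('k, 'r) ring_scheme" (structure) and E :: "('k, 'e) dga_rec" and A :: "('k, 'a) dga_rec" and J
    and B :: "('k,'b) dga_rec" +
  fixes j :: "'b \<Rightarrow> 'e + 'a"
  assumes j_in: "x \<in> elts B n \<Longrightarrow> (n, j x) \<in> letters E A"
    and j_d: "letter_diff E A (n, j x) = (n - 1, j (diff B n x))"
    and rels: "alg_relations K B j (F n) n \<subseteq> J n"
begin

abbreviation "s n x \<equiv> single K [(n, j x)]"

lemma s_in: "x \<in> elts B n \<Longrightarrow> s n x \<in> carrier (F n)"
  by (intro single_closed words_sgl j_in) auto

lemma ss_in: "x \<in> elts B p \<Longrightarrow> y \<in> elts B q \<Longrightarrow> single K [(p, j x), (q, j y)] \<in> carrier (F (p + q))"
  by (intro single_closed) (auto simp: words_def j_in)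

lemma B_add: "x \<in> elts B n \<Longrightarrow> y \<in> elts B n \<Longrightarrow> x \<oplus>\<^bsub>cmp B n\<^esub> y \<in> elts B n"
  using B.module_cmp[of n] by (meson abelian_group.axioms(1) abelian_monoid.a_closed module.axioms(2))
lemma B_smult: "a \<in> carrier K \<Longrightarrow> x \<in> elts B n \<Longrightarrow> a \<odot>\<^bsub>cmp B n\<^esub> x \<in> elts B n"
  using B.module_cmp[of n] by (meson module.smult_closed)
lemma F_add: "x \<in> carrier (F n) \<Longrightarrow> y \<in> carrier (F n) \<Longrightarrow> x \<oplus>\<^bsub>F n\<^esub> y \<in> carrier (F n)"
  by (meson abelian_group.axioms(1) abelian_monoid.a_closed agF)
lemma F_smult: "a \<in> carrier K \<Longrightarrow> x \<in> carrier (F n) \<Longrightarrow> a \<odot>\<^bsub>F n\<^esub> x \<in> carrier (F n)"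
  by (meson module.smult_closed modF)
lemma B_mult: "x \<in> elts B m \<Longrightarrow> y \<in> elts B n \<Longrightarrow> gmult B m n x y \<in> elts B (m + n)"
  using is_linearD(1)[OF B.mult_linear_right] by blast
lemma B_d: "x \<in> elts B n \<Longrightarrow> diff B n x \<in> elts B (n - 1)"
  using is_linearD(1)[OF B.diff_linear] by blast

lemma cls_linear: "is_linear K (cmp B n) (Qm n) (\<lambda>x. cl n (s n x))"
proof (rule is_linearI)
  fix x y assume xy: "x \<in> elts B n" "y \<in> elts B n"
  have "s n (x \<oplus>\<^bsub>cmp B n\<^esub> y) \<ominus>\<^bsub>F n\<^esub> (s n x \<oplus>\<^bsub>F n\<^esub> s n y) \<in> J n"
    using rels[of n] xy by (auto simp: alg_relations_def simp del: free_sel)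
  then have "cl n (s n (x \<oplus>\<^bsub>cmp B n\<^esub> y)) = cl n (s n x \<oplus>\<^bsub>F n\<^esub> s n y)"
    using xy by (subst (asm) J_iff) (auto intro: s_in B_add F_add simp del: free_sel)
  then show "cl n (s n (x \<oplus>\<^bsub>cmp B n\<^esub> y)) = cl n (s n x) \<oplus>\<^bsub>Qm n\<^esub> cl n (s n y)"
    using is_linearD(2)[OF cl_linear s_in s_in] xy by metis
next
  fix a x assume ax: "a \<in> carrier K" "x \<in> elts B n"
  have "s n (a \<odot>\<^bsub>cmp B n\<^esub> x) \<ominus>\<^bsub>F n\<^esub> a \<odot>\<^bsub>F n\<^esub> s n x \<in> J n"
    using rels[of n] ax by (auto simp: alg_relations_def simp del: free_sel)
  then have "cl n (s n (a \<odot>\<^bsub>cmp B n\<^esub> x)) = cl n (a \<odot>\<^bsub>F n\<^esub> s n x)"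
    using ax by (subst (asm) J_iff) (auto intro: s_in B_smult F_smult simp del: free_sel)
  then show "cl n (s n (a \<odot>\<^bsub>cmp B n\<^esub> x)) = a \<odot>\<^bsub>Qm n\<^esub> cl n (s n x)"
    using is_linearD(3)[OF cl_linear _ s_in] ax by metis
qed (rule is_linearD(1)[OF cl_linear s_in])

lemma cls_mult: "x \<in> elts B p \<Longrightarrow> y \<in> elts B q \<Longrightarrow>
   cl (p + q) (s (p + q) (gmult B p q x y)) = cl (p + q) (single K [(p, j x), (q, j y)])"
proof -
  assume xy: "x \<in> elts B p" "y \<in> elts B q"
  have "s (p + q) (gmult B p q x y) \<ominus>\<^bsub>F (p + q)\<^esub> single K [(p, j x), (q, j y)] \<in> J (p + q)"
    by (rule subsetD[OF rels[of "p + q"]]) (use xy in \<open>unfold alg_relations_def, blast\<close>)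
  then show ?thesis using xy by (subst (asm) J_iff) (auto intro: s_in B_mult ss_in)
qed

lemma cls_one: "cl 0 (s 0 (gone B)) = cl 0 (single K [])"
proof -
  have "s 0 (gone B) \<ominus>\<^bsub>F 0\<^esub> single K [] \<in> J 0"
    using rels[of 0] by (auto simp: alg_relations_def simp del: free_sel)
  then show ?thesis by (subst (asm) J_iff) (auto intro: s_in B.one_closed single_closed words_Nil)
qed

lemma mult_s: "x \<in> elts B p \<Longrightarrow> y \<in> elts B q \<Longrightarrow> single K [(p, j x), (q, j y)] = gmult FA p q (s p x) (s q y)"
  by (subst mult_single) (auto intro: words_sgl j_in)

lemma d_s: "x \<in> elts B n \<Longrightarrow> diff FA n (s n x) = s (n - 1) (diff B n x)"
proof -
  assume x: "x \<in> elts B n"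
  interpret F: kmod K "F (n - 1)" by (rule kmodF)
  have "diff FA n (s n x) = dw n [(n, j x)]" using x by (intro d_single words_sgl j_in) auto
  also have "\<dots> = (\<Oplus>\<^bsub>F (n - 1)\<^esub>i\<in>{0::nat}. s (n - 1) (diff B n x))"
    unfolding dw_def using s_in[OF B_d[OF x]] by (intro F.M.finsum_cong') (auto simp: dt_def koszul_def j_d)
  also have "\<dots> = s (n - 1) (diff B n x)"
    using s_in[OF B_d[OF x]] by (subst F.M.finsum_insert) (auto simp del: free_sel)
  finally show ?thesis .
qed

lemma cl_mult_cong:
  assumes "x \<in> carrier (F m)" "x' \<in> carrier (F m)" "y \<in> carrier (F n)" "y' \<in> carrier (F n)"
     "cl m x = cl m x'" "cl n y = cl n y'"
   shows "cl (m + n) (gmult FA m n x y) = cl (m + n) (gmult FA m n x' y')"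
proof -
  have "gmult FA m n x y \<ominus>\<^bsub>F (m + n)\<^esub> gmult FA m n x' y \<in> J (m + n)"
    using J_mult(2)[OF assms(3), of "x \<ominus>\<^bsub>F m\<^esub> x'" m] J_iff[OF assms(1,2)] assms lin_minus[OF mult_lF[OF assms(3)] modF modF assms(1,2)] by simp
  moreover have "gmult FA m n x' y \<ominus>\<^bsub>F (m + n)\<^esub> gmult FA m n x' y' \<in> J (m + n)"
    using J_mult(1)[OF assms(2), of "y \<ominus>\<^bsub>F n\<^esub> y'" n] J_iff[OF assms(3,4)] assms lin_minus[OF mult_rF[OF assms(2)] modF modF assms(3,4)] by simp
  ultimately show ?thesis by (simp add: J_iff mult_inF assms)
qed

lemma d_rels: "r \<in> alg_relations K B j (F n) n \<Longrightarrow> diff FA n r \<in> J (n - 1)"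
proof -
  let ?Q = "Qm (n - 1)"
  interpret F: kmod K "F (n - 1)" by (rule kmodF)
  have dm: "diff FA n (u \<ominus>\<^bsub>F n\<^esub> v) \<in> J (n - 1) \<longleftrightarrow> cl (n - 1) (diff FA n u) = cl (n - 1) (diff FA n v)"
    if "u \<in> carrier (F n)" "v \<in> carrier (F n)" for u v
    using that by (simp add: lin_minus[OF d_linF modF modF] J_iff d_inF)
  assume "r \<in> alg_relations K B j (F n) n"
  then consider
     (1) x y where "x \<in> elts B n" "y \<in> elts B n" "r = s n (x \<oplus>\<^bsub>cmp B n\<^esub> y) \<ominus>\<^bsub>F n\<^esub> (s n x \<oplus>\<^bsub>F n\<^esub> s n y)"
   | (2) a x where "a \<in> carrier K" "x \<in> elts B n" "r = s n (a \<odot>\<^bsub>cmp B n\<^esub> x) \<ominus>\<^bsub>F n\<^esub> a \<odot>\<^bsub>F n\<^esub> s n x"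
   | (3) p q x y where "p + q = n" "x \<in> elts B p" "y \<in> elts B q" "r = s n (gmult B p q x y) \<ominus>\<^bsub>F n\<^esub> single K [(p, j x), (q, j y)]"
   | (4) "n = 0" "r = s n (gone B) \<ominus>\<^bsub>F n\<^esub> single K []"
    unfolding alg_relations_def by (auto split: if_splits)
  then show ?thesis
  proof cases
    case 1
    show ?thesis unfolding 1(3)
      apply (subst dm, intro s_in B_add 1, intro F_add s_in 1)
      apply (subst is_linearD(2)[OF d_linF], (intro s_in 1)+)
      apply (simp only: d_s 1 B_add is_linearD(2)[OF B.diff_linear])
      apply (simp only: is_linearD(2)[OF cl_linear] is_linearD(2)[OF cls_linear] s_in B_d 1)
      done
  next
    case 2
    show ?thesis unfolding 2(3)
      apply (subst dm, intro s_in B_smult 2, intro F_smult s_in 2)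
      apply (subst is_linearD(3)[OF d_linF], (intro s_in 2)+)
      apply (simp only: d_s 2 B_smult is_linearD(3)[OF B.diff_linear])
      apply (simp only: is_linearD(3)[OF cl_linear] is_linearD(3)[OF cls_linear] s_in B_d 2)
      done
  next
    case 3
    note x = 3(2) and y = 3(3)
    have e: "p - 1 + q = n - 1" "p + (q - 1) = n - 1" "p + q - 1 = n - 1" using 3(1) by auto
    let ?X = "gmult B (p - 1) q (diff B p x) y" and ?Y = "gmult B p (q - 1) x (diff B q y)"
    let ?X' = "gmult FA (p - 1) q (s (p - 1) (diff B p x)) (s q y)" and ?Y' = "gmult FA p (q - 1) (s p x) (s (q - 1) (diff B q y))"
    have XY: "?X \<in> elts B (n - 1)" "?Y \<in> elts B (n - 1)" using B_mult[OF B_d[OF x] y] B_mult[OF x B_d[OF y]] e by metis+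
    have XY': "?X' \<in> carrier (F (n - 1))" "?Y' \<in> carrier (F (n - 1))"
      using mult_inF[OF s_in[OF B_d[OF x]] s_in[OF y]] mult_inF[OF s_in[OF x] s_in[OF B_d[OF y]]] e by metis+
    have kB: "koszul (cmp B (n - 1)) p ?Y \<in> elts B (n - 1)"
      using kmod.koszul_closed XY B.module_cmp[of "n - 1"] by (metis kmod_def)
    have kF: "koszul (F (n - 1)) p ?Y' \<in> carrier (F (n - 1))" using XY' F.koszul_closed by blast
    have 1: "diff B n (gmult B p q x y) = ?X \<oplus>\<^bsub>cmp B (n - 1)\<^esub> koszul (cmp B (n - 1)) p ?Y"
      using B.leibniz[OF x y] 3(1) by simp
    have 2: "diff FA n (gmult FA p q (s p x) (s q y)) = ?X' \<oplus>\<^bsub>F (n - 1)\<^esub> koszul (F (n - 1)) p ?Y'"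
      using leibF[OF s_in[OF x] s_in[OF y]] 3(1) d_s x y by simp
    have 3: "cl (n - 1) (s (n - 1) ?X) = cl (n - 1) ?X'" "cl (n - 1) (s (n - 1) ?Y) = cl (n - 1) ?Y'"
      using cls_mult[OF B_d[OF x] y] cls_mult[OF x B_d[OF y]] mult_s[OF B_d[OF x] y] mult_s[OF x B_d[OF y]] e by metis+
    have gm: "gmult B p q x y \<in> elts B n" "gmult FA p q (s p x) (s q y) \<in> carrier (F n)"
      using B_mult[OF x y] mult_inF[OF s_in[OF x] s_in[OF y]] \<open>p + q = n\<close> by metis+
    have "cl (n - 1) (diff FA n (s n (gmult B p q x y))) = cl (n - 1) (s (n - 1) (?X \<oplus>\<^bsub>cmp B (n - 1)\<^esub> koszul (cmp B (n - 1)) p ?Y))"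
      using d_s[OF gm(1)] 1 by simp
    also have "\<dots> = cl (n - 1) (s (n - 1) ?X) \<oplus>\<^bsub>?Q\<^esub> koszul ?Q p (cl (n - 1) (s (n - 1) ?Y))"
      using is_linearD(2)[OF cls_linear XY(1) kB] lin_koszul[OF cls_linear B.module_cmp modQm XY(2), of p] by metis
    also have "\<dots> = cl (n - 1) (?X' \<oplus>\<^bsub>F (n - 1)\<^esub> koszul (F (n - 1)) p ?Y')"
      using is_linearD(2)[OF cl_linear XY'(1) kF] lin_koszul[OF cl_linear modF modQm XY'(2), of p] 3 by metis
    also have "\<dots> = cl (n - 1) (diff FA n (single K [(p, j x), (q, j y)]))" using 2 mult_s[OF x y] by simp
    finally show ?thesis unfolding \<open>r = _\<close>
      using dm[OF s_in[OF gm(1)], of "single K [(p, j x), (q, j y)]"] gm(2) mult_s[OF x y] by simp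
  next
    case 4
    have z: "diff B 0 (gone B) = \<zero>\<^bsub>cmp B (- 1)\<^esub>"
    proof -
      interpret M: module K "cmp B (-1)" by (rule B.module_cmp)
      have d1: "diff B 0 (gone B) \<in> elts B (-1)" using B_d[OF B.one_closed] by simp
      have "diff B 0 (gone B) = diff B 0 (gone B) \<oplus>\<^bsub>cmp B (- 1)\<^esub> diff B 0 (gone B)"
        using B.leibniz[OF B.one_closed B.one_closed] B.mult_one_left[OF B.one_closed] B.mult_one_left[OF d1] B.mult_one_right[OF d1]
        by (simp add: koszul_def)
      then show ?thesis using d1 by (metis M.add.r_cancel_one' )
    qed
    have z': "diff FA 0 (single K []) = \<zero>\<^bsub>F (- 1)\<^esub>"
    proof -
      interpret F1: kmod K "F (-1)" by (rule kmodF)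
      show ?thesis using d_single[OF words_Nil] by (simp add: dw_def del: free_sel)
    qed
    have "cl (- 1) (s (- 1) \<zero>\<^bsub>cmp B (- 1)\<^esub>) = \<zero>\<^bsub>Qm (- 1)\<^esub>"
      using lin_zero[OF cls_linear B.module_cmp modQm] .
    moreover have "cl (- 1) \<zero>\<^bsub>F (- 1)\<^esub> = \<zero>\<^bsub>Qm (- 1)\<^esub>"
      using lin_zero[OF cl_linear modF modQm] .
    ultimately have "cl (n - 1) (diff FA n (s n (gone B))) = cl (n - 1) (diff FA n (single K []))"
      using d_s[OF B.one_closed] z z' 4(1) by (simp del: free_sel quot_module_sel)
    then show ?thesis unfolding 4(2)
      using dm[of "s n (gone B)" "single K []"] 4(1) B.one_closed words_Nil by (simp add: s_in single_closed)
  qed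
qed

lemma dd_s: "x \<in> elts B n \<Longrightarrow> diff FA (n - 1) (diff FA n (s n x)) \<in> J (n - 2)"
proof -
  assume x: "x \<in> elts B n"
  have e: "n - 1 - 1 = n - 2" by simp
  have "diff FA (n - 1) (diff FA n (s n x)) = s (n - 2) (diff B (n - 1) (diff B n x))"
    using d_s[OF B_d[OF x]] d_s[OF x] by (simp add: e)
  also have "\<dots> = s (n - 2) \<zero>\<^bsub>cmp B (n - 2)\<^esub>" using B.diff_diff[OF x] by simp
  also have "\<dots> \<in> J (n - 2)"
  proof -
    interpret M: module K "cmp B (n - 2)" by (rule B.module_cmp)
    show ?thesis using lin_zero[OF cls_linear B.module_cmp modQm, of "n - 2"] J_0[OF s_in[OF M.M.zero_closed]] by simp
  qed
  finally show ?thesis .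
qed

end


subsection \<open>The coproduct and its universal property\<close>

lemma (in free_alg) dd_mult:
  assumes u: "u \<in> carrier (F m)" and v: "v \<in> carrier (F n)"
  shows "diff FA (m + n - 1) (diff FA (m + n) (gmult FA m n u v)) =
     gmult FA (m - 2) n (diff FA (m - 1) (diff FA m u)) v \<oplus>\<^bsub>F (m + n - 2)\<^esub> gmult FA m (n - 2) u (diff FA (n - 1) (diff FA n v))"
proof -
  let ?F = "F (m + n - 2)"
  interpret F1: kmod K "F (m + n - 1)" by (rule kmodF)
  interpret F: kmod K ?F by (rule kmodF)
  have e: "m - 1 + n = m + n - 1" "m + (n - 1) = m + n - 1" "m + n - 1 - 1 = m + n - 2" "m - 1 - 1 = m - 2" "n - 1 - 1 = n - 2"
     "m - 1 + (n - 1) = m + n - 2" "m - 2 + n = m + n - 2" "m + (n - 2) = m + n - 2" by auto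
  let ?X = "gmult FA (m - 1) n (diff FA m u) v" and ?Y = "gmult FA m (n - 1) u (diff FA n v)"
  let ?A = "gmult FA (m - 2) n (diff FA (m - 1) (diff FA m u)) v" and ?Z = "gmult FA (m - 1) (n - 1) (diff FA m u) (diff FA n v)"
  let ?W = "gmult FA m (n - 2) u (diff FA (n - 1) (diff FA n v))"
  note du = d_inF[OF u] and dv = d_inF[OF v]
  have in1: "?X \<in> carrier (F (m + n - 1))" "?Y \<in> carrier (F (m + n - 1))"
    using mult_inF[OF du v] mult_inF[OF u dv] by (simp_all only: e)
  have in2: "?A \<in> carrier ?F" "?Z \<in> carrier ?F" "?W \<in> carrier ?F"
    using mult_inF[OF d_inF[OF du] v] mult_inF[OF u d_inF[OF dv]] mult_inF[OF du dv] by (simp_all only: e)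
  have dX: "diff FA (m + n - 1) ?X = ?A \<oplus>\<^bsub>?F\<^esub> koszul ?F (m - 1) ?Z"
    using leibF[OF du v] by (simp only: e)
  have dY: "diff FA (m + n - 1) ?Y = ?Z \<oplus>\<^bsub>?F\<^esub> koszul ?F m ?W"
    using leibF[OF u dv] by (simp only: e)
  note l = d_linF[of "m + n - 1", unfolded e]
  have "diff FA (m + n - 1) (diff FA (m + n) (gmult FA m n u v)) = diff FA (m + n - 1) (?X \<oplus>\<^bsub>F (m + n - 1)\<^esub> koszul (F (m + n - 1)) m ?Y)"
    using leibF[OF u v] by simp
  also have "\<dots> = diff FA (m + n - 1) ?X \<oplus>\<^bsub>?F\<^esub> koszul ?F m (diff FA (m + n - 1) ?Y)"
    using is_linearD(2)[OF l in1(1) F1.koszul_closed[OF in1(2)]] lin_koszul[OF l modF modF in1(2)] by simp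
  also have "\<dots> = ?A \<oplus>\<^bsub>?F\<^esub> koszul ?F (m - 1) ?Z \<oplus>\<^bsub>?F\<^esub> (koszul ?F m ?Z \<oplus>\<^bsub>?F\<^esub> ?W)"
    unfolding dX dY using in2 by (simp add: F.koszul_add F.koszul_koszul del: free_sel) (simp add: koszul_def)
  also have "\<dots> = ?A \<oplus>\<^bsub>?F\<^esub> ((koszul ?F (m - 1) ?Z \<oplus>\<^bsub>?F\<^esub> koszul ?F m ?Z) \<oplus>\<^bsub>?F\<^esub> ?W)"
    using in2 by (simp add: F.M.a_assoc del: free_sel)
  also have "koszul ?F (m - 1) ?Z \<oplus>\<^bsub>?F\<^esub> koszul ?F m ?Z = \<zero>\<^bsub>?F\<^esub>"
    using in2 by (simp add: koszul_def F.M.l_neg F.M.r_neg del: free_sel)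
  finally show ?thesis using in2 by (simp del: free_sel)
qed

locale coprod_loc = field K + S: dga K S + E: dga K E + A: dga K A
  for K :: "('k, 'r) ring_scheme" (structure) and S :: "('k, 's) dga_rec" and E :: "('k, 'e) dga_rec"
  and A :: "('k, 'a) dga_rec" +
  fixes \<rho> \<alpha>
  assumes rho: "\<rho> \<in> dga_hom K S E" and alpha: "\<alpha> \<in> dga_hom K S A"
begin

sublocale free_alg K E A
  by (intro free_alg.intro dga_pre E.dga_axioms A.dga_axioms field_axioms)

abbreviation "Rl \<equiv> coprod_relations K S E \<rho> A \<alpha>"
abbreviation "JJ \<equiv> coprod_ideal K S E \<rho> A \<alpha>"
abbreviation "P \<equiv> coprod_dga K S E \<rho> A \<alpha>"

lemma hom_in: "f \<in> dga_hom K X Y \<Longrightarrow> x \<in> elts X n \<Longrightarrow> f n x \<in> elts Y n"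
  by (auto simp: dga_hom_def lin_hom_def is_linear_def)

lemma sl_in: "x \<in> elts E n \<Longrightarrow> single K [(n, Inl x)] \<in> carrier (F n)" 
  and sr_in: "y \<in> elts A n \<Longrightarrow> single K [(n, Inr y)] \<in> carrier (F n)"
  by (auto intro!: single_closed words_sgl simp: letters_def)

lemma alg_rel_in:
  assumes B: "dga K B" and j: "\<And>n x. x \<in> elts B n \<Longrightarrow> (n, j x) \<in> letters E A"
  shows "alg_relations K B j (F n) n \<subseteq> carrier (F n)"
proof -
  interpret B: dga K B by fact
  interpret F: kmod K "F n" by (rule kmodF)
  interpret M: module K "cmp B n" by (rule B.module_cmp)
  have 1: "x \<in> elts B n \<Longrightarrow> single K [(n, j x)] \<in> carrier (F n)" for x
    by (intro single_closed words_sgl j) auto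
  have 2: "p + q = n \<Longrightarrow> x \<in> elts B p \<Longrightarrow> y \<in> elts B q \<Longrightarrow> single K [(p, j x), (q, j y)] \<in> carrier (F n)" for p q x y
    by (intro single_closed) (auto simp: words_def j)
  have 3: "p + q = n \<Longrightarrow> x \<in> elts B p \<Longrightarrow> y \<in> elts B q \<Longrightarrow> gmult B p q x y \<in> elts B n" for p q x y
    using is_linearD(1)[OF B.mult_linear_right] by blast
  have 4: "n = 0 \<Longrightarrow> single K [] \<in> carrier (F n)" using single_closed[OF words_Nil] by simp
  show ?thesis unfolding alg_relations_def
  proof (intro Un_least subsetI)
    fix r assume "r \<in> {single K [(n, j (gmult B p q x y))] \<ominus>\<^bsub>F n\<^esub> single K [(p, j x), (q, j y)] |p q x y.
      p + q = n \<and> x \<in> elts B p \<and> y \<in> elts B q}"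
    then show "r \<in> carrier (F n)" using 1 2 3 F.M.minus_closed by blast
  next
    fix r assume "r \<in> (if n = 0 then {single K [(0, j (gone B))] \<ominus>\<^bsub>F n\<^esub> single K []} else {})"
    then show "r \<in> carrier (F n)" using F.M.minus_closed[OF 1[of "gone B"] 4] B.one_closed by (auto split: if_splits simp del: free_sel)
  qed (auto intro!: F.M.minus_closed F.M.a_closed 1 simp del: free_sel)
qed

lemma Rl_in: "Rl n \<subseteq> elts FA n"
proof -
  interpret F: kmod K "F n" by (rule kmodF)
  have "alg_relations K E Inl (F n) n \<subseteq> carrier (F n)" "alg_relations K A Inr (F n) n \<subseteq> carrier (F n)"
    by (rule alg_rel_in; (unfold_locales)?; simp add: letters_def)+
  then show ?thesis unfolding coprod_relations_def Let_def using hom_in[OF rho] hom_in[OF alpha] 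
    by (auto intro!: F.M.minus_closed sl_in sr_in)
qed

lemma JJ: "graded_ideal K FA JJ"
  unfolding coprod_ideal_def by (rule pre_dga.ideal_gen_ideal[OF pre_FA Rl_in])

sublocale fa_ideal K E A JJ by unfold_locales (rule JJ)

lemma Rl_JJ: "Rl n \<subseteq> JJ n"
  unfolding coprod_ideal_def using pre_dga.ideal_gen_incl[OF pre_FA] by blast

sublocale L: emb K E A JJ E Inl
  by unfold_locales (use Rl_JJ in \<open>auto simp: letters_def letter_diff_def coprod_relations_def Let_def\<close>)
sublocale R: emb K E A JJ A Inr
  by unfold_locales (use Rl_JJ in \<open>auto simp: letters_def letter_diff_def coprod_relations_def Let_def\<close>)

lemma dRl: "r \<in> Rl n \<Longrightarrow> diff FA n r \<in> JJ (n - 1)"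
proof -
  assume "r \<in> Rl n"
  then consider "r \<in> alg_relations K E Inl (F n) n" | "r \<in> alg_relations K A Inr (F n) n" |
     (3) s where "s \<in> elts S n" "r = single K [(n, Inl (\<rho> n s))] \<ominus>\<^bsub>F n\<^esub> single K [(n, Inr (\<alpha> n s))]"
    unfolding coprod_relations_def Let_def by blast
  then show ?thesis
  proof cases
    case 3
    have ds: "diff S n s \<in> elts S (n - 1)" using is_linearD(1)[OF S.diff_linear] 3(1) by blast
    have "diff FA n r = diff FA n (single K [(n, Inl (\<rho> n s))]) \<ominus>\<^bsub>F (n - 1)\<^esub> diff FA n (single K [(n, Inr (\<alpha> n s))])"
      unfolding 3(2) by (intro lin_minus[OF d_linF modF modF] sl_in sr_in hom_in[OF rho] hom_in[OF alpha] 3)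
    also have "\<dots> = single K [(n - 1, Inl (diff E n (\<rho> n s)))] \<ominus>\<^bsub>F (n - 1)\<^esub> single K [(n - 1, Inr (diff A n (\<alpha> n s)))]"
      using L.d_s[OF hom_in[OF rho 3(1)]] R.d_s[OF hom_in[OF alpha 3(1)]] by simp
    also have "\<dots> = single K [(n - 1, Inl (\<rho> (n - 1) (diff S n s)))] \<ominus>\<^bsub>F (n - 1)\<^esub> single K [(n - 1, Inr (\<alpha> (n - 1) (diff S n s)))]"
      using rho alpha 3(1) by (simp add: dga_hom_def)
    also have "\<dots> \<in> Rl (n - 1)" unfolding coprod_relations_def Let_def using ds by blast
    finally show ?thesis using Rl_JJ by blast
  qed (auto intro: L.d_rels R.d_rels)
qed

lemma dJJ: "x \<in> JJ n \<Longrightarrow> diff FA n x \<in> JJ (n - 1)"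
  using pre_dga.ideal_gen_diff[OF pre_FA Rl_in] dRl unfolding coprod_ideal_def by blast

lemma letterE: 
  assumes "l \<in> letters E A" 
  obtains n x where "l = (n, Inl x)" "x \<in> elts E n" | n y where "l = (n, Inr y)" "y \<in> elts A n"
  using assms by (auto simp: letters_def)

lemma dd_single: "w \<in> words E A n \<Longrightarrow> diff FA (n - 1) (diff FA n (single K w)) \<in> JJ (n - 2)"
proof (induction w arbitrary: n)
  case Nil
  then have [simp]: "n = 0" by (simp add: words_def)
  interpret F1: kmod K "F (-1)" by (rule kmodF)
  interpret F2: kmod K "F (-2)" by (rule kmodF)
  have "diff FA 0 (single K []) = \<zero>\<^bsub>F (- 1)\<^esub>"
    using d_single[OF words_Nil] by (simp add: dw_def del: free_sel)
  moreover have "diff FA (-1) \<zero>\<^bsub>F (- 1)\<^esub> = \<zero>\<^bsub>F (- 2)\<^esub>" using lin_zero[OF d_linF[of "-1"] modF modF] by (simp del: free_sel)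
  ultimately show ?case using F2.submod_zero[OF subJ] by (simp del: free_sel)
next
  case (Cons l w)
  let ?m = "fst l" and ?k = "word_deg w"
  have w: "w \<in> words E A ?k" and l: "l \<in> letters E A" and n: "n = ?m + ?k" using Cons.prems by (auto simp: words_def)
  have lw: "[l] \<in> words E A ?m" using l by (simp add: words_def)
  have dl: "diff FA (?m - 1) (diff FA ?m (single K [l])) \<in> JJ (?m - 2)"
    using l by (rule letterE) (simp_all add: L.dd_s R.dd_s)
  have dw: "diff FA (?k - 1) (diff FA ?k (single K w)) \<in> JJ (?k - 2)" by (rule Cons.IH[OF w])
  have e: "?m - 2 + ?k = n - 2" "?m + (?k - 2) = n - 2" using n by auto
  have "single K (l # w) = gmult FA ?m ?k (single K [l]) (single K w)" using mult_single[OF lw w] by simp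
  then show ?case
    using dd_mult[OF single_closed[OF lw] single_closed[OF w]] J_mult(2)[OF single_closed[OF w] dl] J_mult(1)[OF single_closed[OF lw] dw]
     module.submoduleE(5)[OF modF subJ] unfolding n[symmetric] e by metis
qed

lemma ddJJ: assumes "x \<in> elts FA n" shows "diff FA (n - 1) (diff FA n x) \<in> JJ (n - 2)"
proof -
  have e: "n - 1 - 1 = n - 2" by simp
  have l: "is_linear K (F n) (F (n - 2)) (\<lambda>x. diff FA (n - 1) (diff FA n x))"
    using is_linear_comp[OF d_linF d_linF[of "n - 1"]] unfolding e .
  have "cl (n - 2) (diff FA (n - 1) (diff FA n x)) = \<zero>\<^bsub>Qm (n - 2)\<^esub>"
  proof (rule free_linear_eq[OF is_linear_comp[OF l cl_linear] _ modQm])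
    show "is_linear K (F n) (Qm (n - 2)) (\<lambda>_. \<zero>\<^bsub>Qm (n - 2)\<^esub>)" by (rule kmod.is_linear_zero[OF kmodQm modF])
    show "x \<in> carrier (F n)" using assms by simp
    show "cl (n - 2) (diff FA (n - 1) (diff FA n (single K w))) = \<zero>\<^bsub>Qm (n - 2)\<^esub>" if "w \<in> words E A n" for w
      using dd_single[OF that] is_linearD(1)[OF l single_closed[OF that]] J_0 by blast
  qed
  then show ?thesis using J_0 is_linearD(1)[OF l] assms by simp
qed

sublocale PQ: pre_quot K FA JJ
  by (intro pre_quot.intro pre_FA pre_quot_axioms.intro JJ dJJ ddJJ)

lemma P_dga: "dga K P" unfolding coprod_dga_def by (rule PQ.dgaQ)

sublocale P: dga K P by (rule P_dga)

lemma P_cmp: "cmp P n = Qm n" unfolding coprod_dga_def PQ.cmpQ by simp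
lemma P_d: "x \<in> carrier (F n) \<Longrightarrow> diff P n (cl n x) = cl (n - 1) (diff FA n x)"
  unfolding coprod_dga_def using PQ.dQ by simp
lemma P_m: "x \<in> carrier (F m) \<Longrightarrow> y \<in> carrier (F n) \<Longrightarrow> gmult P m n (cl m x) (cl n y) = cl (m + n) (gmult FA m n x y)"
  unfolding coprod_dga_def using PQ.mQ by simp
lemma P_1: "gone P = cl 0 (single K [])"
  unfolding coprod_dga_def using PQ.oneQ by simp
lemma P_E: assumes "X \<in> elts P n" obtains c where "c \<in> carrier (F n)" "X = cl n c"
  using assms unfolding P_cmp by (auto elim: quot_carrierE)

lemma emb_hom:
  assumes "emb K E A JJ B j" 
  shows "(\<lambda>n. \<lambda>x\<in>elts B n. cl n (single K [(n, j x)])) \<in> dga_hom K B P"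
proof -
  interpret Z: emb K E A JJ B j by fact
  have 1: "is_linear K (cmp B n) (cmp P n) (\<lambda>x\<in>elts B n. cl n (single K [(n, j x)]))" for n
  proof -
    interpret M: module K "cmp B n" by (rule Z.B.module_cmp)
    show ?thesis using Z.cls_linear[of n] unfolding P_cmp is_linear_def by (auto simp del: quot_module_sel)
  qed
  show ?thesis unfolding dga_hom_def lin_hom_def
    using 1 Z.s_in Z.B_d Z.B_mult Z.B.one_closed
    by (auto simp: P_d Z.d_s P_m Z.cls_mult Z.mult_s P_1 Z.cls_one)
qed

lemma inl_hom: "coprod_inl K S E \<rho> A \<alpha> \<in> dga_hom K E P"
  unfolding coprod_inl_def by (rule emb_hom) unfold_locales
lemma inr_hom: "coprod_inr K S E \<rho> A \<alpha> \<in> dga_hom K A P"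
  unfolding coprod_inr_def by (rule emb_hom) unfold_locales

lemma square: "dga_comp S (coprod_inl K S E \<rho> A \<alpha>) \<rho> = dga_comp S (coprod_inr K S E \<rho> A \<alpha>) \<alpha>"
proof -
  have "cl n (single K [(n, Inl (\<rho> n s))]) = cl n (single K [(n, Inr (\<alpha> n s))])" if s: "s \<in> elts S n" for s n
  proof -
    have "single K [(n, Inl (\<rho> n s))] \<ominus>\<^bsub>F n\<^esub> single K [(n, Inr (\<alpha> n s))] \<in> JJ n"
      using Rl_JJ[of n] s unfolding coprod_relations_def Let_def by blast
    then show ?thesis using J_iff sl_in sr_in hom_in[OF rho s] hom_in[OF alpha s] by blast
  qed
  then show ?thesis
    by (auto simp: dga_comp_def compose_def coprod_inl_def coprod_inr_def fun_eq_iff hom_in[OF rho] hom_in[OF alpha])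
qed

end

locale coprod_univ = coprod_loc K S E A \<rho> \<alpha> + T: dga K T
  for K :: "('k, 'r) ring_scheme" (structure) and S :: "('k, 's) dga_rec" and E :: "('k, 'e) dga_rec"
  and A :: "('k, 'a) dga_rec" and \<rho> \<alpha> and T :: "('k, 't) dga_rec" +
  fixes f g
  assumes f: "f \<in> dga_hom K E T" and g: "g \<in> dga_hom K A T"
    and fg: "dga_comp S f \<rho> = dga_comp S g \<alpha>"
begin

lemma T_mult: "x \<in> elts T m \<Longrightarrow> y \<in> elts T n \<Longrightarrow> gmult T m n x y \<in> elts T (m + n)"
  using is_linearD(1)[OF T.mult_linear_right] by blast
lemma kmodT: "kmod K (cmp T n)" using T.module_cmp by (simp add: kmod_def)

fun lv :: "int \<times> ('e + 'a) \<Rightarrow> 't" where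
  "lv (n, Inl x) = f n x" | "lv (n, Inr y) = g n y"

fun ev :: "(int \<times> ('e + 'a)) list \<Rightarrow> 't" where
  "ev [] = gone T" | "ev (l # w) = gmult T (fst l) (word_deg w) (lv l) (ev w)"

lemma lv_in: "l \<in> letters E A \<Longrightarrow> lv l \<in> elts T (fst l)"
  by (erule letterE) (simp_all add: hom_in[OF f] hom_in[OF g])

lemma ev_in': "set w \<subseteq> letters E A \<Longrightarrow> ev w \<in> elts T (word_deg w)"
  by (induction w) (auto simp: T.one_closed intro!: T_mult lv_in)
lemma ev_in: "w \<in> words E A n \<Longrightarrow> ev w \<in> elts T n"
  using ev_in' by (auto simp: words_def)

lemma ev_app: "set u \<subseteq> letters E A \<Longrightarrow> set v \<subseteq> letters E A \<Longrightarrow> ev (u @ v) = gmult T (word_deg u) (word_deg v) (ev u) (ev v)"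
proof (induction u)
  case Nil then show ?case using T.mult_one_left[OF ev_in'] by simp
next
  case (Cons l u)
  then show ?case using T.mult_assoc[OF lv_in[of l] ev_in'[of u] ev_in'[of v]] by simp
qed

definition eval where "eval n c = lin_ext K (cmp T n) ev c"

lemma ext_ev: "lin_extension K (cmp T n) (words E A n) ev"
  by (intro lin_extension.intro kmodT lin_extension_axioms.intro field_axioms ev_in)
lemma eval_lin: "is_linear K (F n) (cmp T n) (eval n)"
  unfolding eval_def[abs_def] by (rule lin_extension.ext_linear[OF ext_ev])
lemma eval_single: "w \<in> words E A n \<Longrightarrow> eval n (single K w) = ev w"
  unfolding eval_def by (rule lin_extension.ext_single[OF ext_ev])
lemma eval_in: "c \<in> carrier (F n) \<Longrightarrow> eval n c \<in> elts T n"
  using is_linearD(1)[OF eval_lin] by blast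

lemma eval_mult: 
  assumes "x \<in> carrier (F m)" "y \<in> carrier (F n)"
  shows "eval (m + n) (gmult FA m n x y) = gmult T m n (eval m x) (eval n y)"
proof (rule bilin_eq[OF _ _ _ _ T.module_cmp _ assms])
  fix u v assume "u \<in> words E A m" "v \<in> words E A n"
  then show "eval (m + n) (gmult FA m n (single K u) (single K v)) = gmult T m n (eval m (single K u)) (eval n (single K v))"
    using ev_app[of u v] by (simp add: mult_single eval_single words_app) (simp add: words_def)
qed (fact is_linear_comp[OF mult_lF eval_lin] is_linear_comp[OF mult_rF eval_lin]
   is_linear_comp[OF eval_lin T.mult_linear_left[OF eval_in]] is_linear_comp[OF eval_lin T.mult_linear_right[OF eval_in]])+

lemma eval_dl: "l \<in> letters E A \<Longrightarrow> eval (fst l - 1) (diff FA (fst l) (single K [l])) = diff T (fst l) (lv l)"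
proof (erule letterE)
  fix n x assume l: "l = (n, Inl x)" and x: "x \<in> elts E n"
  have "eval (n - 1) (single K [(n - 1, Inl (diff E n x))]) = f (n - 1) (diff E n x)"
    using L.B_d[OF x] T.mult_one_right[OF hom_in[OF f L.B_d[OF x]]] by (subst eval_single) (auto simp: words_def letters_def)
  then show ?thesis using L.d_s[OF x] x f by (simp add: l dga_hom_def)
next
  fix n x assume l: "l = (n, Inr x)" and x: "x \<in> elts A n"
  have "eval (n - 1) (single K [(n - 1, Inr (diff A n x))]) = g (n - 1) (diff A n x)"
    using R.B_d[OF x] T.mult_one_right[OF hom_in[OF g R.B_d[OF x]]] by (subst eval_single) (auto simp: words_def letters_def)
  then show ?thesis using R.d_s[OF x] x g by (simp add: l dga_hom_def)
qed

lemma d_one: "diff T 0 (gone T) = \<zero>\<^bsub>cmp T (- 1)\<^esub>"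
proof -
  interpret M: module K "cmp T (-1)" by (rule T.module_cmp)
  have d1: "diff T 0 (gone T) \<in> elts T (-1)" using is_linearD(1)[OF T.diff_linear T.one_closed] by simp
  have "diff T 0 (gone T) = diff T 0 (gone T) \<oplus>\<^bsub>cmp T (- 1)\<^esub> diff T 0 (gone T)"
    by (rule T.leibniz[OF T.one_closed T.one_closed, simplified T.mult_one_left[OF T.one_closed],
      simplified, simplified T.mult_one_left[OF d1] T.mult_one_right[OF d1] koszul_def, simplified])
  then show ?thesis using d1 by (metis M.M.add.r_cancel_one')
qed

lemma eval_dw: "w \<in> words E A n \<Longrightarrow> eval (n - 1) (diff FA n (single K w)) = diff T n (ev w)"
proof (induction w arbitrary: n)
  case Nil
  then have [simp]: "n = 0" by (simp add: words_def)
  interpret F1: kmod K "F (-1)" by (rule kmodF)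
  have "diff FA 0 (single K []) = \<zero>\<^bsub>F (- 1)\<^esub>"
    using d_single[OF words_Nil] by (simp add: dw_def del: free_sel)
  then show ?case using lin_zero[OF eval_lin modF T.module_cmp, of "-1"] d_one by (simp del: free_sel)
next
  case (Cons l w)
  let ?m = "fst l" and ?k = "word_deg w"
  have w: "w \<in> words E A ?k" and l: "l \<in> letters E A" and n: "n = ?m + ?k" using Cons.prems by (auto simp: words_def)
  have lw: "[l] \<in> words E A ?m" using l by (simp add: words_def)
  note sl = single_closed[OF lw] and sw = single_closed[OF w]
  have e: "?m - 1 + ?k = n - 1" "?m + (?k - 1) = n - 1" using n by auto
  have evl: "ev [l] = lv l" using T.mult_one_right[OF lv_in[OF l]] by simp
  have s: "single K (l # w) = gmult FA ?m ?k (single K [l]) (single K w)" using mult_single[OF lw w] by simp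
  have X: "gmult FA (?m - 1) ?k (diff FA ?m (single K [l])) (single K w) \<in> carrier (F (n - 1))"
     "gmult FA ?m (?k - 1) (single K [l]) (diff FA ?k (single K w)) \<in> carrier (F (n - 1))"
    using mult_inF[OF d_inF[OF sl] sw] mult_inF[OF sl d_inF[OF sw]] by (simp_all only: e)
  have "eval (n - 1) (diff FA n (single K (l # w))) = 
     eval (n - 1) (gmult FA (?m - 1) ?k (diff FA ?m (single K [l])) (single K w)) \<oplus>\<^bsub>cmp T (n - 1)\<^esub>
     koszul (cmp T (n - 1)) ?m (eval (n - 1) (gmult FA ?m (?k - 1) (single K [l]) (diff FA ?k (single K w))))"
    using leibF[OF sl sw] is_linearD(2)[OF eval_lin X(1) kmod.koszul_closed[OF kmodF X(2)]] lin_koszul[OF eval_lin modF T.module_cmp X(2)]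
    unfolding s n by simp
  also have "\<dots> = gmult T (?m - 1) ?k (diff T ?m (lv l)) (ev w) \<oplus>\<^bsub>cmp T (n - 1)\<^esub>
     koszul (cmp T (n - 1)) ?m (gmult T ?m (?k - 1) (lv l) (diff T ?k (ev w)))"
    using eval_mult[OF d_inF[OF sl] sw] eval_mult[OF sl d_inF[OF sw]] Cons.IH[OF w] eval_dl[OF l] evl
    unfolding e by (simp add: eval_single lw w)
  also have "\<dots> = diff T n (ev (l # w))"
    using T.leibniz[OF lv_in[OF l] ev_in[OF w]] n by simp
  finally show ?case .
qed

lemma eval_d: "c \<in> carrier (F n) \<Longrightarrow> eval (n - 1) (diff FA n c) = diff T n (eval n c)"
  by (rule free_linear_eq[OF is_linear_comp[OF d_linF eval_lin] is_linear_comp[OF eval_lin T.diff_linear] T.module_cmp])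
   (simp_all add: eval_dw eval_single)

definition ker where "ker n = {c \<in> carrier (F n). eval n c = \<zero>\<^bsub>cmp T n\<^esub>}"

lemma ker_ideal: "graded_ideal K FA ker"
  unfolding graded_ideal_def
proof (intro conjI allI ballI)
  fix n
  interpret F: kmod K "F n" by (rule kmodF)
  interpret M: module K "cmp T n" by (rule T.module_cmp)
  have z: "\<ominus>\<^bsub>cmp T n\<^esub> \<zero>\<^bsub>cmp T n\<^esub> = \<zero>\<^bsub>cmp T n\<^esub>" by (rule M.M.minus_equality) simp_all
  show "submodule (ker n) K (cmp FA n)"
    unfolding sel ker_def using is_linearD[OF eval_lin] lin_zero[OF eval_lin modF T.module_cmp] lin_neg[OF eval_lin modF T.module_cmp] z
    by (intro F.submoduleI) (auto simp del: free_sel)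
next
  fix m n x y assume x: "x \<in> elts FA m" and y: "y \<in> ker n"
  have y': "y \<in> carrier (F n)" "eval n y = \<zero>\<^bsub>cmp T n\<^esub>" using y by (auto simp: ker_def)
  show "gmult FA m n x y \<in> ker (m + n)" "gmult FA n m y x \<in> ker (n + m)"
    using x y' mult_inF eval_mult[of x m y n] eval_mult[of y n x m]
     lin_zero[OF T.mult_linear_right[OF eval_in[of x m], of n] T.module_cmp T.module_cmp]
     lin_zero[OF T.mult_linear_left[OF eval_in[of x m], of n] T.module_cmp T.module_cmp]
    by (simp_all add: ker_def)
qed

lemma ker_iff: "x \<in> carrier (F n) \<Longrightarrow> y \<in> carrier (F n) \<Longrightarrow> eval n x = eval n y \<Longrightarrow> x \<ominus>\<^bsub>F n\<^esub> y \<in> ker n"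
proof -
  assume a: "x \<in> carrier (F n)" "y \<in> carrier (F n)" "eval n x = eval n y"
  interpret F: kmod K "F n" by (rule kmodF)
  interpret M: module K "cmp T n" by (rule T.module_cmp)
  show ?thesis using a lin_minus[OF eval_lin modF T.module_cmp a(1,2)] eval_in[OF a(2)]
    by (simp add: ker_def a_minus_def M.M.r_neg del: free_sel)
qed

lemma alg_ker:
  assumes "emb K E A JJ B j" "f' \<in> dga_hom K B T" "\<And>n x. lv (n, j x) = f' n x"
  shows "alg_relations K B j (F n) n \<subseteq> ker n"
proof -
  interpret Z: emb K E A JJ B j by fact
  interpret F: kmod K "F n" by (rule kmodF)
  have es: "eval n (single K [(n, j x)]) = f' n x" if "x \<in> elts B n" for x n
    using that T.mult_one_right[OF hom_in[OF assms(2) that]] by (subst eval_single) (auto simp: words_def Z.j_in assms(3))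
  have ess: "eval (p + q) (single K [(p, j x), (q, j y)]) = gmult T p q (f' p x) (f' q y)" if "x \<in> elts B p" "y \<in> elts B q" for x y p q
    using Z.mult_s[OF that] eval_mult[OF Z.s_in[OF that(1)] Z.s_in[OF that(2)]] es that by simp
  have lin: "is_linear K (cmp B n) (cmp T n) (f' n)" for n using assms(2) by (simp add: dga_hom_def lin_hom_def)
  have 1: "Z.s n (x \<oplus>\<^bsub>cmp B n\<^esub> y) \<ominus>\<^bsub>F n\<^esub> (Z.s n x \<oplus>\<^bsub>F n\<^esub> Z.s n y) \<in> ker n" if "x \<in> elts B n" "y \<in> elts B n" for x y
    by (rule ker_iff) (use that Z.B_add Z.s_in Z.F_add es is_linearD(2)[OF lin] is_linearD(2)[OF eval_lin] in \<open>simp_all del: free_sel\<close>)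
  have 2: "Z.s n (a \<odot>\<^bsub>cmp B n\<^esub> x) \<ominus>\<^bsub>F n\<^esub> a \<odot>\<^bsub>F n\<^esub> Z.s n x \<in> ker n" if "x \<in> elts B n" "a \<in> carrier K" for x a
    by (rule ker_iff) (use that Z.B_smult Z.s_in Z.F_smult es is_linearD(3)[OF lin] is_linearD(3)[OF eval_lin] in \<open>simp_all del: free_sel\<close>)
  have 3: "Z.s (p + q) (gmult B p q x y) \<ominus>\<^bsub>F (p + q)\<^esub> single K [(p, j x), (q, j y)] \<in> ker (p + q)" if "x \<in> elts B p" "y \<in> elts B q" for x y p q
    by (rule ker_iff) (use that Z.B_mult Z.s_in Z.ss_in es ess assms(2) in \<open>simp_all add: dga_hom_def\<close>)
  have 4: "Z.s 0 (gone B) \<ominus>\<^bsub>F 0\<^esub> single K [] \<in> ker 0"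
    by (rule ker_iff) (use Z.B.one_closed Z.s_in single_closed[OF words_Nil] es eval_single[OF words_Nil] assms(2) in \<open>simp_all add: dga_hom_def\<close>)
  show ?thesis unfolding alg_relations_def
  proof (intro Un_least subsetI)
    fix r assume "r \<in> {Z.s n (gmult B p q x y) \<ominus>\<^bsub>F n\<^esub> single K [(p, j x), (q, j y)] |p q x y.
      p + q = n \<and> x \<in> elts B p \<and> y \<in> elts B q}"
    then show "r \<in> ker n" using 3 by blast
  next
    fix r assume "r \<in> (if n = 0 then {Z.s 0 (gone B) \<ominus>\<^bsub>F n\<^esub> single K []} else {})"
    then show "r \<in> ker n" using 4 by (auto split: if_splits simp del: free_sel)
  qed (use 1 2 in blast)+
qed

lemma JJ_ker: "c \<in> JJ n \<Longrightarrow> eval n c = \<zero>\<^bsub>cmp T n\<^esub>"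
proof -
  have "Rl m \<subseteq> ker m" for m
  proof -
    have "alg_relations K E Inl (F m) m \<subseteq> ker m" by (rule alg_ker[OF _ f]) (unfold_locales, simp)
    moreover have "alg_relations K A Inr (F m) m \<subseteq> ker m" by (rule alg_ker[OF _ g]) (unfold_locales, simp)
    moreover have "single K [(m, Inl (\<rho> m s))] \<ominus>\<^bsub>F m\<^esub> single K [(m, Inr (\<alpha> m s))] \<in> ker m" if s: "s \<in> elts S m" for s
    proof (rule ker_iff)
      note h = hom_in[OF rho s] hom_in[OF alpha s]
      show "single K [(m, Inl (\<rho> m s))] \<in> carrier (F m)" "single K [(m, Inr (\<alpha> m s))] \<in> carrier (F m)"
        using h sl_in sr_in by auto
      have "f m (\<rho> m s) = g m (\<alpha> m s)" using fun_cong[OF fun_cong[OF fg, of m], of s] s by (simp add: dga_comp_def compose_def)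
      then show "eval m (single K [(m, Inl (\<rho> m s))]) = eval m (single K [(m, Inr (\<alpha> m s))])"
        using h eval_single[of "[(m, Inl (\<rho> m s))]" m] eval_single[of "[(m, Inr (\<alpha> m s))]" m]
          T.mult_one_right[OF hom_in[OF f h(1)]] T.mult_one_right[OF hom_in[OF g h(2)]] by (simp add: words_def letters_def)
    qed
    ultimately show ?thesis unfolding coprod_relations_def Let_def by blast
  qed
  note le = pre_dga.ideal_gen_least[OF pre_FA ker_ideal this]
  show "eval n c = \<zero>\<^bsub>cmp T n\<^esub>" if "c \<in> JJ n"
    using le[of c n] that unfolding coprod_ideal_def ker_def by simp
qed

definition h where "h n = (\<lambda>X\<in>elts P n. eval n (SOME c. c \<in> carrier (F n) \<and> X = cl n c))"

lemma h_cl: "c \<in> carrier (F n) \<Longrightarrow> h n (cl n c) = eval n c"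
proof -
  assume c: "c \<in> carrier (F n)"
  let ?d = "SOME d. d \<in> carrier (F n) \<and> cl n c = cl n d"
  interpret F: kmod K "F n" by (rule kmodF)
  interpret M: module K "cmp T n" by (rule T.module_cmp)
  have d: "?d \<in> carrier (F n) \<and> cl n c = cl n ?d" by (rule someI[of _ c]) (simp add: c)
  then have "c \<ominus>\<^bsub>F n\<^esub> ?d \<in> JJ n" using J_iff c by blast
  then have "eval n c \<ominus>\<^bsub>cmp T n\<^esub> eval n ?d = \<zero>\<^bsub>cmp T n\<^esub>"
    using JJ_ker[of "c \<ominus>\<^bsub>F n\<^esub> ?d" n] lin_minus[OF eval_lin modF T.module_cmp c, of ?d] d by argo
  moreover have "eval n c = (eval n c \<ominus>\<^bsub>cmp T n\<^esub> eval n ?d) \<oplus>\<^bsub>cmp T n\<^esub> eval n ?d"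
    using eval_in[OF c] eval_in[of ?d n] d by (simp add: a_minus_def M.M.a_assoc M.M.l_neg)
  ultimately have "eval n c = eval n ?d" using eval_in[of ?d n] d by simp
  moreover have "cl n c \<in> elts P n" unfolding P_cmp using c F.rcos_in by simp
  ultimately show ?thesis by (simp add: h_def)
qed

lemma h_hom: "h \<in> dga_hom K P T"
proof -
  have "is_linear K (cmp P n) (cmp T n) (h n)" for n
  proof (rule is_linearI)
    fix X Y a
    assume "X \<in> elts P n" "Y \<in> elts P n"
    then obtain c d where "c \<in> carrier (F n)" "X = cl n c" "d \<in> carrier (F n)" "Y = cl n d" by (elim P_E)
    then show "h n X \<in> elts T n" "h n (X \<oplus>\<^bsub>cmp P n\<^esub> Y) = h n X \<oplus>\<^bsub>cmp T n\<^esub> h n Y"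
      unfolding P_cmp using is_linearD(2)[OF eval_lin, of c n d] L.F_add[of c n d]
      by (simp_all add: h_cl eval_in del: free_sel quot_module_sel flip: is_linearD(2)[OF cl_linear])
  next
    fix a X assume "X \<in> elts P n" and a: "a \<in> carrier K"
    then obtain c where "c \<in> carrier (F n)" "X = cl n c" by (elim P_E)
    then show "h n (a \<odot>\<^bsub>cmp P n\<^esub> X) = a \<odot>\<^bsub>cmp T n\<^esub> h n X"
      unfolding P_cmp using a is_linearD(3)[OF eval_lin, of a c n] L.F_smult[of a c n]
      by (simp add: h_cl del: free_sel quot_module_sel flip: is_linearD(3)[OF cl_linear])
  qed
  moreover have "h n \<in> extensional (elts P n)" for n by (simp add: h_def)
  moreover have "h 0 (gone P) = gone T" using h_cl[OF single_closed[OF words_Nil]] eval_single[OF words_Nil] by (simp add: P_1)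
  moreover have "h (n - 1) (diff P n X) = diff T n (h n X)" if "X \<in> elts P n" for n X
    using that by (elim P_E) (simp add: P_d h_cl d_inF eval_d)
  moreover have "h (m + n) (gmult P m n X Y) = gmult T m n (h m X) (h n Y)" if "X \<in> elts P m" "Y \<in> elts P n" for X Y m n
    using that by (elim P_E) (simp add: P_m h_cl mult_inF eval_mult)
  ultimately show ?thesis by (simp add: dga_hom_def lin_hom_def)
qed

lemma h_inl: "dga_comp E h (coprod_inl K S E \<rho> A \<alpha>) = f"
proof (intro ext)
  fix n x
  show "dga_comp E h (coprod_inl K S E \<rho> A \<alpha>) n x = f n x"
  proof (cases "x \<in> elts E n")
    case True
    then show ?thesis using h_cl[OF sl_in[OF True]] eval_single[of "[(n, Inl x)]" n] T.mult_one_right[OF hom_in[OF f True]]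
      by (simp add: dga_comp_def compose_def coprod_inl_def words_def letters_def)
  next
    case False
    then show ?thesis using f by (simp add: dga_comp_def compose_def dga_hom_def lin_hom_def extensional_def)
  qed
qed

lemma h_inr: "dga_comp A h (coprod_inr K S E \<rho> A \<alpha>) = g"
proof (intro ext)
  fix n x
  show "dga_comp A h (coprod_inr K S E \<rho> A \<alpha>) n x = g n x"
  proof (cases "x \<in> elts A n")
    case True
    then show ?thesis using h_cl[OF sr_in[OF True]] eval_single[of "[(n, Inr x)]" n] T.mult_one_right[OF hom_in[OF g True]]
      by (simp add: dga_comp_def compose_def coprod_inr_def words_def letters_def)
  next
    case False
    then show ?thesis using g by (simp add: dga_comp_def compose_def dga_hom_def lin_hom_def extensional_def)
  qed
qed

lemma h_unique:
  assumes k: "k \<in> dga_hom K P T" "dga_comp E k (coprod_inl K S E \<rho> A \<alpha>) = f" "dga_comp A k (coprod_inr K S E \<rho> A \<alpha>) = g"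
  shows "k = h"
proof (intro ext)
  fix n X
  have klin: "is_linear K (Qm n) (cmp T n) (k n)" for n using k(1) by (simp add: dga_hom_def lin_hom_def P_cmp del: quot_module_sel)
  have kl: "k (fst l) (cl (fst l) (single K [l])) = lv l" if "l \<in> letters E A" for l
    using that
  proof (rule letterE)
    fix n x assume "l = (n, Inl x)" "x \<in> elts E n"
    then show ?thesis using fun_cong[OF fun_cong[OF k(2), of n], of x] by (simp add: dga_comp_def compose_def coprod_inl_def)
  next
    fix n x assume "l = (n, Inr x)" "x \<in> elts A n"
    then show ?thesis using fun_cong[OF fun_cong[OF k(3), of n], of x] by (simp add: dga_comp_def compose_def coprod_inr_def)
  qed
  have kw: "k n (cl n (single K w)) = ev w" if "w \<in> words E A n" for n w
    using that
  proof (induction w arbitrary: n)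
    case Nil
    then show ?case using k(1) P_1 by (simp add: dga_hom_def words_def)
  next
    case (Cons l w)
    let ?m = "fst l" and ?k = "word_deg w"
    have w: "w \<in> words E A ?k" and l: "l \<in> letters E A" and n: "n = ?m + ?k" using Cons.prems by (auto simp: words_def)
    have lw: "[l] \<in> words E A ?m" using l by (simp add: words_def)
    note sl = single_closed[OF lw] and sw = single_closed[OF w]
    have in_P: "cl ?m (single K [l]) \<in> elts P ?m" "cl ?k (single K w) \<in> elts P ?k"
      unfolding P_cmp using sl sw kmod.rcos_in[OF kmodF] by auto
    have "cl n (single K (l # w)) = gmult P ?m ?k (cl ?m (single K [l])) (cl ?k (single K w))"
      using P_m[OF sl sw] mult_single[OF lw w] n by simp
    moreover have "k (?m + ?k) (gmult P ?m ?k (cl ?m (single K [l])) (cl ?k (single K w))) =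
       gmult T ?m ?k (k ?m (cl ?m (single K [l]))) (k ?k (cl ?k (single K w)))"
      using k(1) in_P unfolding dga_hom_def by blast
    ultimately show ?case using kl[OF l] Cons.IH[OF w] n by simp
  qed
  show "k n X = h n X"
  proof (cases "X \<in> elts P n")
    case True
    then obtain c where c: "c \<in> carrier (F n)" "X = cl n c" by (elim P_E)
    have "k n (cl n c) = eval n c"
      by (rule free_linear_eq[OF is_linear_comp[OF cl_linear klin] eval_lin T.module_cmp _ c(1)]) (simp add: kw eval_single)
    then show ?thesis using c h_cl by simp
  next
    case False
    then show ?thesis using k(1) h_hom by (simp add: dga_hom_def lin_hom_def extensional_def)
  qed
qed

end

theorem coprod_universal:
  assumes "dga K S" "dga_under K S E \<rho>" "dga_under K S A \<alpha>" "dga K T" 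
    "f \<in> dga_hom K E T" "g \<in> dga_hom K A T" "dga_comp S f \<rho> = dga_comp S g \<alpha>"
  shows "\<exists>!h. h \<in> dga_hom K (coprod_dga K S E \<rho> A \<alpha>) T \<and>
    dga_comp E h (coprod_inl K S E \<rho> A \<alpha>) = f \<and> dga_comp A h (coprod_inr K S E \<rho> A \<alpha>) = g"
proof -
  have "field K" using assms(1) by (simp add: dga_def chain_complex_def)
  then interpret coprod_univ K S E A \<rho> \<alpha> T f g
    using assms unfolding dga_under_def
    by (intro coprod_univ.intro coprod_univ_axioms.intro coprod_loc.intro coprod_loc_axioms.intro) auto
  show ?thesis
  proof (rule ex1I)
    show "h \<in> dga_hom K P T \<and> dga_comp E h (coprod_inl K S E \<rho> A \<alpha>) = f \<and> dga_comp A h (coprod_inr K S E \<rho> A \<alpha>) = g"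
      using h_hom h_inl h_inr by simp
  qed (use h_unique in simp)
qed

theorem coprod_under:
  assumes "dga K S" "dga_under K S E \<rho>" "dga_under K S A \<alpha>"
  shows "dga K (coprod_dga K S E \<rho> A \<alpha>)"
    and "coprod_inl K S E \<rho> A \<alpha> \<in> dga_hom K E (coprod_dga K S E \<rho> A \<alpha>)"
    and "coprod_inr K S E \<rho> A \<alpha> \<in> dga_hom K A (coprod_dga K S E \<rho> A \<alpha>)"
    and "dga_comp S (coprod_inl K S E \<rho> A \<alpha>) \<rho> = dga_comp S (coprod_inr K S E \<rho> A \<alpha>) \<alpha>"
proof -
  have "field K" using assms(1) by (simp add: dga_def chain_complex_def)
  then interpret coprod_loc K S E A \<rho> \<alpha>
    using assms unfolding dga_under_def
    by (intro coprod_loc.intro coprod_loc_axioms.intro) auto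
  show "dga K P" "coprod_inl K S E \<rho> A \<alpha> \<in> dga_hom K E P" "coprod_inr K S E \<rho> A \<alpha> \<in> dga_hom K A P"
    "dga_comp S (coprod_inl K S E \<rho> A \<alpha>) \<rho> = dga_comp S (coprod_inr K S E \<rho> A \<alpha>) \<alpha>"
    by (rule P_dga inl_hom inr_hom square)+
qed


subsection \<open>Centralizers and abelianizations\<close>

context pre_dga begin

abbreviation "kz n i \<equiv> koszul (cmp A n) i"

lemma a_in: "x \<in> elts A n \<Longrightarrow> y \<in> elts A n \<Longrightarrow> x \<oplus>\<^bsub>cmp A n\<^esub> y \<in> elts A n"
  using mod[of n] by (meson abelian_group.axioms(1) abelian_monoid.a_closed module.axioms(2))
lemma s_in: "a \<in> carrier K \<Longrightarrow> x \<in> elts A n \<Longrightarrow> a \<odot>\<^bsub>cmp A n\<^esub> x \<in> elts A n"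
  using mod[of n] by (meson module.smult_closed)
lemma k_in: "x \<in> elts A n \<Longrightarrow> kz n i x \<in> elts A n"
  by (rule kmod.koszul_closed[OF kmod])
lemma z_in: "\<zero>\<^bsub>cmp A n\<^esub> \<in> elts A n"
  using mod[of n] by (meson abelian_group.axioms(1) abelian_monoid.zero_closed module.axioms(2))
lemma n_in: "x \<in> elts A n \<Longrightarrow> \<ominus>\<^bsub>cmp A n\<^esub> x \<in> elts A n"
  using k_in[of x n 1] by (simp add: koszul_def)

lemma m_k_l: "x \<in> elts A m \<Longrightarrow> y \<in> elts A n \<Longrightarrow> gmult A m n (kz m i x) y = kz (m + n) i (gmult A m n x y)"
  by (rule lin_koszul[OF mult_l mod mod])
lemma m_k_r: "x \<in> elts A m \<Longrightarrow> y \<in> elts A n \<Longrightarrow> gmult A m n x (kz n i y) = kz (m + n) i (gmult A m n x y)"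
  by (rule lin_koszul[OF mult_r mod mod])
lemma d_k: "x \<in> elts A n \<Longrightarrow> diff A n (kz n i x) = kz (n - 1) i (diff A n x)"
  by (rule lin_koszul[OF d_lin mod mod])

lemma koszul_cong: "even (i - j) \<Longrightarrow> koszul M i x = koszul M j x"
  by (auto simp: koszul_def)

end

lemma restrict_neg:
  assumes "module K M" "submodule H K M" "x \<in> H"
  shows "\<ominus>\<^bsub>M\<lparr>carrier := H\<rparr>\<^esub> x = \<ominus>\<^bsub>M\<^esub> x"
proof -
  interpret module K M by fact
  have "subgroup H (add_monoid M)" using assms(2) by (simp add: submodule_def)
  from group.m_inv_consistent[OF M.a_group this assms(3)] show ?thesis by (simp add: a_inv_def)
qed

lemma restrict_koszul:
  assumes "module K M" "submodule H K M" "x \<in> H"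
  shows "koszul (M\<lparr>carrier := H\<rparr>) i x = koszul M i x"
  using restrict_neg[OF assms] by (simp add: koszul_def)

locale centralizer = field K + E: dga K E + A: dga K A
  for K :: "('k, 'r) ring_scheme" (structure) and E :: "('k, 'e) dga_rec" and A :: "('k, 'a) dga_rec" +
  fixes \<iota> assumes io: "\<iota> \<in> dga_hom K E A"
begin

sublocale A: pre_dga K A by (rule dga_pre[OF A.dga_axioms])
sublocale E: pre_dga K E by (rule dga_pre[OF E.dga_axioms])

definition "C n = {x \<in> elts A n. \<forall>m. \<forall>e\<in>elts E m.
           gmult A n m x (\<iota> m e) = koszul (cmp A (n + m)) (n * m) (gmult A m n (\<iota> m e) x)}"

abbreviation "Z \<equiv> graded_centralizer E \<iota> A"

lemma selZ: "cmp Z n = (cmp A n)\<lparr>carrier := C n\<rparr>" "diff Z = diff A" "gmult Z = gmult A" "gone Z = gone A"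
  by (simp_all add: graded_centralizer_def C_def)

lemma io_in: "e \<in> elts E m \<Longrightarrow> \<iota> m e \<in> elts A m"
  using io by (auto simp: dga_hom_def lin_hom_def is_linear_def)
lemma io_d: "e \<in> elts E m \<Longrightarrow> \<iota> (m - 1) (diff E m e) = diff A m (\<iota> m e)"
  using io by (auto simp: dga_hom_def)

lemma C_in: "x \<in> C n \<Longrightarrow> x \<in> elts A n" by (simp add: C_def)
lemma C_c: "x \<in> C n \<Longrightarrow> e \<in> elts E m \<Longrightarrow> gmult A n m x (\<iota> m e) = A.kz (n + m) (n * m) (gmult A m n (\<iota> m e) x)" by (simp add: C_def)
lemma C_sub: "submodule (C n) K (cmp A n)"
proof -
  interpret M: kmod K "cmp A n" by (rule A.kmod)
  show ?thesis
  proof (rule M.submoduleI)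
    have l: "is_linear K (cmp A n) (cmp A (n + m)) (\<lambda>x. gmult A n m x (\<iota> m e))" if "e \<in> elts E m" for m e
      by (rule A.mult_l[OF io_in[OF that]])
    have kl: "is_linear K (cmp A n) (cmp A (n + m)) (\<lambda>x. A.kz (n + m) (n * m) (gmult A m n (\<iota> m e) x))" if "e \<in> elts E m" for m e
      using kmod.is_linear_koszul[OF A.kmod A.mult_r[OF io_in[OF that], of n], of "n * m"] by (simp only: add.commute)
    show "C n \<subseteq> elts A n" using C_in by blast
    show "\<zero>\<^bsub>cmp A n\<^esub> \<in> C n" unfolding C_def
    proof (intro CollectI conjI allI ballI)
      fix m e assume e: "e \<in> elts E m"
      show "gmult A n m \<zero>\<^bsub>cmp A n\<^esub> (\<iota> m e) = A.kz (n + m) (n * m) (gmult A m n (\<iota> m e) \<zero>\<^bsub>cmp A n\<^esub>)"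
        using lin_zero[OF l[OF e] A.mod A.mod] lin_zero[OF kl[OF e] A.mod A.mod] by simp
    qed simp
    show "\<ominus>\<^bsub>cmp A n\<^esub> a \<in> C n" if a: "a \<in> C n" for a
      unfolding C_def
    proof (intro CollectI conjI allI ballI)
      fix m e assume e: "e \<in> elts E m"
      show "gmult A n m (\<ominus>\<^bsub>cmp A n\<^esub> a) (\<iota> m e) = A.kz (n + m) (n * m) (gmult A m n (\<iota> m e) (\<ominus>\<^bsub>cmp A n\<^esub> a))"
        using lin_neg[OF l[OF e] A.mod A.mod C_in[OF a]] lin_neg[OF kl[OF e] A.mod A.mod C_in[OF a]] C_c[OF a e] by simp
    qed (use C_in[OF a] in simp)
    show "a \<oplus>\<^bsub>cmp A n\<^esub> b \<in> C n" if a: "a \<in> C n" and b: "b \<in> C n" for a b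
      unfolding C_def
    proof (intro CollectI conjI allI ballI)
      fix m e assume e: "e \<in> elts E m"
      show "gmult A n m (a \<oplus>\<^bsub>cmp A n\<^esub> b) (\<iota> m e) = A.kz (n + m) (n * m) (gmult A m n (\<iota> m e) (a \<oplus>\<^bsub>cmp A n\<^esub> b))"
        using is_linearD(2)[OF l[OF e] C_in[OF a] C_in[OF b]] is_linearD(2)[OF kl[OF e] C_in[OF a] C_in[OF b]] C_c[OF a e] C_c[OF b e] by simp
    qed (use C_in[OF a] C_in[OF b] in simp)
    show "a \<odot>\<^bsub>cmp A n\<^esub> b \<in> C n" if a: "a \<in> carrier K" and b: "b \<in> C n" for a b
      unfolding C_def
    proof (intro CollectI conjI allI ballI)
      fix m e assume e: "e \<in> elts E m"
      show "gmult A n m (a \<odot>\<^bsub>cmp A n\<^esub> b) (\<iota> m e) = A.kz (n + m) (n * m) (gmult A m n (\<iota> m e) (a \<odot>\<^bsub>cmp A n\<^esub> b))"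
        using is_linearD(3)[OF l[OF e] a C_in[OF b]] is_linearD(3)[OF kl[OF e] a C_in[OF b]] C_c[OF b e] by simp
    qed (use C_in[OF b] a in simp)
  qed
qed

lemma C_mod: "module K (cmp Z n)" unfolding selZ by (rule submodule.submodule_is_module[OF C_sub A.mod])

lemma C_mult: assumes x: "x \<in> C p" and y: "y \<in> C q" shows "gmult A p q x y \<in> C (p + q)"
proof -
  have "gmult A (p + q) m (gmult A p q x y) (\<iota> m e) = koszul (cmp A (p + q + m)) ((p + q) * m) (gmult A m (p + q) (\<iota> m e) (gmult A p q x y))"
    if e: "e \<in> elts E m" for m e
  proof -
    note i = io_in[OF e] C_in[OF x] C_in[OF y]
    let ?N = "p + q + m" and ?e = "\<iota> m e"
    have eq: "p + (q + m) = ?N" "p + m + q = ?N" "m + p + q = ?N" "m + (p + q) = ?N" "p + (m + q) = ?N" by auto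
    interpret N: kmod K "cmp A ?N" by (rule A.kmod)
    have ex: "gmult A m p ?e x \<in> elts A (p + m)" and ey: "gmult A m q ?e y \<in> elts A (q + m)"
      using A.mult_in[OF i(1,2)] A.mult_in[OF i(1,3)] by (simp_all only: add.commute)
    have in1: "gmult A m (p + q) ?e (gmult A p q x y) \<in> elts A ?N" 
      using A.mult_in[OF i(1) A.mult_in[OF i(2,3)]] by (simp only: eq)
    have "gmult A (p + q) m (gmult A p q x y) ?e = gmult A p (q + m) x (gmult A q m y ?e)"
      using A.assoc[OF i(2,3,1)] .
    also have "\<dots> = A.kz ?N (q * m) (gmult A p (q + m) x (gmult A m q ?e y))"
      using A.m_k_r[OF i(2) ey] C_c[OF y e] by (simp only: eq)
    also have "gmult A p (q + m) x (gmult A m q ?e y) = gmult A (p + m) q (gmult A p m x ?e) y"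
      using A.assoc[OF i(2,1,3)] by (simp only: add.commute[of q m])
    also have "\<dots> = A.kz ?N (p * m) (gmult A (p + m) q (gmult A m p ?e x) y)"
      using A.m_k_l[OF ex i(3)] C_c[OF x e] by (simp only: eq)
    also have "gmult A (p + m) q (gmult A m p ?e x) y = gmult A m (p + q) ?e (gmult A p q x y)"
      using A.assoc[OF i(1,2,3)] by (simp only: add.commute[of p m])
    finally show ?thesis unfolding N.koszul_koszul[OF in1] by (simp only: distrib_right add.commute[of "q * m" "p * m"])
  qed
  then show ?thesis using A.mult_in[OF C_in[OF x] C_in[OF y]] by (simp add: C_def)
qed

lemma C_one: "gone A \<in> C 0"
  using A.one_in A.one_l[OF io_in] A.one_r[OF io_in] by (auto simp: C_def koszul_def)

lemma C_d: assumes x: "x \<in> C n" shows "diff A n x \<in> C (n - 1)"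
proof -
  have "gmult A (n - 1) m (diff A n x) (\<iota> m e) = koszul (cmp A (n - 1 + m)) ((n - 1) * m) (gmult A m (n - 1) (\<iota> m e) (diff A n x))"
    if e: "e \<in> elts E m" for m e
  proof -
    note i = io_in[OF e] C_in[OF x]
    let ?N = "n + m - 1" and ?e = "\<iota> m e"
    have eq: "n - 1 + m = ?N" "m + n - 1 = ?N" "m - 1 + n = ?N" "m + (n - 1) = ?N" "n + (m - 1) = ?N" "m + n = n + m" by auto
    interpret N: kmod K "cmp A ?N" by (rule A.kmod)
    let ?u = "gmult A (n - 1) m (diff A n x) ?e" and ?v = "gmult A m (n - 1) ?e (diff A n x)"
    let ?w = "gmult A (m - 1) n (diff A m ?e) x"
    note de = E.d_in[OF e]
    have in1: "?u \<in> elts A ?N" "?v \<in> elts A ?N" "?w \<in> elts A ?N"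
      using A.mult_in[OF A.d_in[OF i(2)] i(1)] A.mult_in[OF i(1) A.d_in[OF i(2)]] A.mult_in[OF A.d_in[OF i(1)] i(2)]
      by (simp_all only: eq)
    have ex: "gmult A m n ?e x \<in> elts A (n + m)" using A.mult_in[OF i] by (simp only: eq)
    have 1: "diff A (n + m) (gmult A n m x ?e) = ?u \<oplus>\<^bsub>cmp A ?N\<^esub> A.kz ?N n (gmult A n (m - 1) x (diff A m ?e))"
      using A.leib[OF i(2,1)] .
    have 2: "gmult A n (m - 1) x (diff A m ?e) = A.kz ?N (n * (m - 1)) ?w"
      using C_c[OF x de] io_d[OF e] by (simp only: eq)
    have 3: "diff A (n + m) (gmult A m n ?e x) = ?w \<oplus>\<^bsub>cmp A ?N\<^esub> A.kz ?N m ?v"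
      using A.leib[OF i] by (simp only: eq)
    have 4: "diff A (n + m) (gmult A n m x ?e) = A.kz ?N (n * m) (diff A (n + m) (gmult A m n ?e x))"
      using A.d_k[OF ex, of "n * m"] C_c[OF x e] by simp
    have 5: "?u \<oplus>\<^bsub>cmp A ?N\<^esub> A.kz ?N (n * m) ?w = A.kz ?N (n * m) ?w \<oplus>\<^bsub>cmp A ?N\<^esub> A.kz ?N (n * m + m) ?v"
      using 1 2 3 4 in1 A.koszul_cong[of "n + n * (m - 1)" "n * m" "cmp A ?N" ?w]
      by (simp add: N.koszul_koszul N.koszul_add right_diff_distrib)
    have "?u = A.kz ?N (n * m + m) ?v"
      using 5 in1 by (metis N.M.a_comm N.M.add.right_cancel N.koszul_closed)
    also have "\<dots> = A.kz ?N ((n - 1) * m) ?v"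
      by (rule A.koszul_cong) (simp add: left_diff_distrib)
    finally show ?thesis by (simp only: eq)
  qed
  then show ?thesis using A.d_in[OF C_in[OF x]] by (simp add: C_def)
qed

lemma lin_Z:
  assumes "is_linear K (cmp A n) (cmp A m) f" "\<And>x. x \<in> C n \<Longrightarrow> f x \<in> C m"
  shows "is_linear K (cmp Z n) (cmp Z m) f"
  using assms C_in by (auto simp: is_linear_def selZ)

lemma dgaZ: "dga K Z"
proof (intro dga.intro dga_axioms.intro chain_complex.intro chain_complex_axioms.intro field_axioms C_mod)
  have e: "elts Z n = C n" for n by (simp add: selZ)
  show "is_linear K (cmp Z n) (cmp Z (n - 1)) (diff Z n)" for n
    unfolding selZ(2) by (rule lin_Z[OF A.d_lin C_d])
  show "is_linear K (cmp Z m) (cmp Z (m + n)) (\<lambda>x. gmult Z m n x y)" if "y \<in> elts Z n" for y n m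
    using that unfolding selZ(3) e by (intro lin_Z A.mult_l C_in C_mult)
  show "is_linear K (cmp Z n) (cmp Z (m + n)) (gmult Z m n x)" if "x \<in> elts Z m" for x n m
    using that unfolding selZ(3) e by (intro lin_Z A.mult_r C_in C_mult)
  show "diff Z (m + n) (gmult Z m n x y) = gmult Z (m - 1) n (diff Z m x) y \<oplus>\<^bsub>cmp Z (m + n - 1)\<^esub>
          koszul (cmp Z (m + n - 1)) m (gmult Z m (n - 1) x (diff Z n y))"
    if "x \<in> elts Z m" "y \<in> elts Z n" for x y m n
  proof -
    have "gmult A m (n - 1) x (diff A n y) \<in> C (m + n - 1)"
      using C_mult[OF _ C_d, of x m y n] that by (simp add: e add_diff_eq)
    from restrict_koszul[OF A.mod C_sub this] show ?thesis
      using that A.leib[OF C_in C_in, of x m y n] by (simp add: selZ e)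
  qed
qed (use C_in C_one A.diff_diff A.assoc A.one_l A.one_r in \<open>auto simp: selZ\<close>)

end

context pre_dga begin

lemma comm_in: "graded_commutators A n \<subseteq> elts A n"
proof -
  interpret M: kmod K "cmp A n" by (rule kmod)
  show ?thesis
  proof
    fix r assume "r \<in> graded_commutators A n"
    then obtain p q x y where r: "r = gmult A p q x y \<ominus>\<^bsub>cmp A n\<^esub> kz n (p * q) (gmult A q p y x)"
      and n: "p + q = n" "q + p = n" and x: "x \<in> elts A p" and y: "y \<in> elts A q" by (auto simp: graded_commutators_def)
    show "r \<in> elts A n" unfolding r
      using mult_in[OF x y] mult_in[OF y x] unfolding n by (intro M.M.minus_closed M.koszul_closed)
  qed
qed

lemma comm_gi: "graded_ideal K A (comm_ideal K A)"
  unfolding comm_ideal_def by (rule ideal_gen_ideal[OF comm_in])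

lemma comm_incl: "x \<in> elts A p \<Longrightarrow> y \<in> elts A q \<Longrightarrow> p + q = n \<Longrightarrow>
   gmult A p q x y \<ominus>\<^bsub>cmp A n\<^esub> kz n (p * q) (gmult A q p y x) \<in> comm_ideal K A n"
  unfolding comm_ideal_def by (rule ideal_gen_incl) (unfold graded_commutators_def, blast)

lemma comm_d: "r \<in> graded_commutators A n \<Longrightarrow> diff A n r \<in> comm_ideal K A (n - 1)"
proof -
  assume "r \<in> graded_commutators A n"
  then obtain p q x y where r: "r = gmult A p q x y \<ominus>\<^bsub>cmp A n\<^esub> kz n (p * q) (gmult A q p y x)"
    and n: "p + q = n" and x: "x \<in> elts A p" and y: "y \<in> elts A q" by (auto simp: graded_commutators_def)
  let ?N = "n - 1"
  interpret N: kmod K "cmp A ?N" by (rule kmod)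
  have eq: "p + q = n" "q + p = n" "p - 1 + q = ?N" "q + (p - 1) = ?N" "p + (q - 1) = ?N" "q - 1 + p = ?N" using n by auto
  let ?a = "gmult A (p - 1) q (diff A p x) y" and ?a' = "gmult A q (p - 1) y (diff A p x)"
  let ?b = "gmult A p (q - 1) x (diff A q y)" and ?b' = "gmult A (q - 1) p (diff A q y) x"
  note dx = d_in[OF x] and dy = d_in[OF y]
  have i: "?a \<in> elts A ?N" "?a' \<in> elts A ?N" "?b \<in> elts A ?N" "?b' \<in> elts A ?N" "gmult A p q x y \<in> elts A n" "gmult A q p y x \<in> elts A n"
    using mult_in[OF dx y] mult_in[OF y dx] mult_in[OF x dy] mult_in[OF dy x] mult_in[OF x y] mult_in[OF y x] by (simp_all only: eq)
  have 1: "diff A n (gmult A p q x y) = ?a \<oplus>\<^bsub>cmp A ?N\<^esub> kz ?N p ?b" using leib[OF x y] by (simp only: eq)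
  have 2: "diff A n (gmult A q p y x) = ?b' \<oplus>\<^bsub>cmp A ?N\<^esub> kz ?N q ?a'" using leib[OF y x] by (simp only: eq)
  have k: "kz ?N (p * q + q) ?a' = kz ?N ((p - 1) * q) ?a'" "kz ?N (p * q) ?b' = kz ?N (p + p * (q - 1)) ?b'"
    by (rule koszul_cong; simp add: left_diff_distrib right_diff_distrib)+
  have "diff A n r = (?a \<oplus>\<^bsub>cmp A ?N\<^esub> kz ?N p ?b) \<ominus>\<^bsub>cmp A ?N\<^esub> kz ?N (p * q) (?b' \<oplus>\<^bsub>cmp A ?N\<^esub> kz ?N q ?a')"
    unfolding r using lin_minus[OF d_lin mod mod i(5) k_in[OF i(6)]] d_k[OF i(6)] 1 2 by simp
  also have "\<dots> = (?a \<oplus>\<^bsub>cmp A ?N\<^esub> kz ?N p ?b) \<ominus>\<^bsub>cmp A ?N\<^esub> (kz ?N (p + p * (q - 1)) ?b' \<oplus>\<^bsub>cmp A ?N\<^esub> kz ?N ((p - 1) * q) ?a')"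
    using i k by (simp add: N.koszul_add N.koszul_koszul)
  also have "\<dots> = (?a \<ominus>\<^bsub>cmp A ?N\<^esub> kz ?N ((p - 1) * q) ?a') \<oplus>\<^bsub>cmp A ?N\<^esub> kz ?N p (?b \<ominus>\<^bsub>cmp A ?N\<^esub> kz ?N (p * (q - 1)) ?b')"
  proof -
    have [simp]: "kz ?N p (u \<ominus>\<^bsub>cmp A ?N\<^esub> v) = kz ?N p u \<ominus>\<^bsub>cmp A ?N\<^esub> kz ?N p v" if "u \<in> elts A ?N" "v \<in> elts A ?N" for u v
      using lin_minus[OF N.koszul_linear mod mod that] .
    show ?thesis using i by (simp add: N.koszul_koszul) (simp add: a_minus_def N.M.minus_add N.M.a_ac)
  qed
  also have "\<dots> \<in> comm_ideal K A ?N"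
    using N.submoduleE(5) N.submod_koszul comm_gi comm_incl[OF dx y eq(3)] comm_incl[OF x dy eq(5)] unfolding graded_ideal_def by meson
  finally show ?thesis .
qed

end

lemma abelianization_cdga:
  assumes "dga K A" shows "cdga K (abelianization K A)"
proof -
  interpret A0: dga K A by fact
  interpret pre_dga K A by (rule dga_pre[OF assms])
  interpret pre_quot K A "comm_ideal K A"
  proof (intro pre_quot.intro pre_dga_axioms pre_quot_axioms.intro comm_gi)
    show "diff A n x \<in> comm_ideal K A (n - 1)" if "x \<in> comm_ideal K A n" for n x
      using that ideal_gen_diff[OF comm_in comm_d[unfolded comm_ideal_def]] unfolding comm_ideal_def by blast
    show "diff A (n - 1) (diff A n x) \<in> comm_ideal K A (n - 2)" if "x \<in> elts A n" for n x
      using A0.diff_diff[OF that] kmod.submod_zero[OF kmod] comm_gi unfolding graded_ideal_def by metis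
  qed
  have "gmult Q m n X Y = koszul (cmp Q (m + n)) (m * n) (gmult Q n m Y X)"
    if XY: "X \<in> elts Q m" "Y \<in> elts Q n" for X Y m n
  proof -
    obtain x y where xy: "x \<in> elts A m" "X = cl m x" "y \<in> elts A n" "Y = cl n y" using XY by (elim elQE)
    have yx: "gmult A n m y x \<in> elts A (m + n)" using mult_in[OF xy(3,1)] by (simp only: add.commute)
    have "cl (m + n) (gmult A m n x y) = cl (m + n) (kz (m + n) (m * n) (gmult A n m y x))"
      using comm_incl[OF xy(1,3) refl] kmod.rcos_eq_iff[OF kmod sub mult_in[OF xy(1,3)] k_in[OF yx]] by blast
    then show ?thesis using xy mQ[OF xy(1,3)] mQ[OF xy(3,1)] koszulQ[OF yx] by (simp add: add.commute)
  qed
  then show ?thesis unfolding abelianization_def using dgaQ by (intro cdga.intro cdga_axioms.intro)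
qed


subsection \<open>Tensor products\<close>

locale tens = field K + A0: dga K A + B0: dga K B
  for K :: "('k, 'r) ring_scheme" (structure) and A :: "('k, 'a) dga_rec" and B :: "('k, 'b) dga_rec"
begin

sublocale A: pre_dga K A by (rule dga_pre[OF A0.dga_axioms])
sublocale B: pre_dga K B by (rule dga_pre[OF B0.dga_axioms])

abbreviation "G n \<equiv> free_module K (tsyms A B n)"
abbreviation "R n \<equiv> tensor_rel K A B n"
abbreviation "FT \<equiv> free_tensor K A B"
abbreviation "sg p x q y \<equiv> single K (p, x, q, y)"

lemma modG: "module K (G n)" by (rule free_is_module)
lemma kmodG: "kmod K (G n)" using modG by (simp add: kmod_def)

lemma sg_in: "x \<in> elts A p \<Longrightarrow> y \<in> elts B q \<Longrightarrow> p + q = n \<Longrightarrow> sg p x q y \<in> carrier (G n)"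
  by (rule single_closed) (simp add: tsyms_def)

lemma tsE: assumes "s \<in> tsyms A B n" 
  obtains p x q y where "s = (p, x, q, y)" "p + q = n" "x \<in> elts A p" "y \<in> elts B q"
  using assms by (auto simp: tsyms_def)

lemma G_a: "u \<in> carrier (G n) \<Longrightarrow> v \<in> carrier (G n) \<Longrightarrow> u \<oplus>\<^bsub>G n\<^esub> v \<in> carrier (G n)"
  using modG[of n] by (meson abelian_group.axioms(1) abelian_monoid.a_closed module.axioms(2))
lemma G_s: "a \<in> carrier K \<Longrightarrow> u \<in> carrier (G n) \<Longrightarrow> a \<odot>\<^bsub>G n\<^esub> u \<in> carrier (G n)"
  using modG[of n] by (meson module.smult_closed)
lemma G_k: "u \<in> carrier (G n) \<Longrightarrow> koszul (G n) i u \<in> carrier (G n)"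
  by (rule kmod.koszul_closed[OF kmodG])
lemma G_m: "u \<in> carrier (G n) \<Longrightarrow> v \<in> carrier (G n) \<Longrightarrow> u \<ominus>\<^bsub>G n\<^esub> v \<in> carrier (G n)"
  using modG[of n] by (meson abelian_group.minus_closed module.axioms(2))

lemma bil_in: "bilinearity K A B n \<subseteq> carrier (G n)"
  unfolding bilinearity_def Let_def
  by (auto intro!: G_m G_a G_s sg_in A.a_in B.a_in A.s_in B.s_in simp del: free_sel)

lemma R_sub: "submodule (R n) K (G n)"
proof -
  interpret G: kmod K "G n" by (rule kmodG)
  let ?F = "{N. submodule N K (G n) \<and> bilinearity K A B n \<subseteq> N}"
  have "carrier (G n) \<in> ?F" using G.carrier_is_submodule bil_in by blast
  moreover have s: "submodule N K (G n)" if "N \<in> ?F" for N using that by blast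
  ultimately show ?thesis unfolding tensor_rel_def submod_gen_def
  proof (intro G.submoduleI)
    show "\<Inter>?F \<subseteq> carrier (G n)" using \<open>carrier (G n) \<in> ?F\<close> by blast
    show "\<zero>\<^bsub>G n\<^esub> \<in> \<Inter>?F" using s G.submod_zero by blast
    show "\<ominus>\<^bsub>G n\<^esub> a \<in> \<Inter>?F" if "a \<in> \<Inter>?F" for a using s G.submoduleE(3) that by (meson InterE InterI)
    show "a \<oplus>\<^bsub>G n\<^esub> b \<in> \<Inter>?F" if "a \<in> \<Inter>?F" "b \<in> \<Inter>?F" for a b
      using s G.submoduleE(5) that by (meson InterE InterI)
    show "a \<odot>\<^bsub>G n\<^esub> b \<in> \<Inter>?F" if "a \<in> carrier K" "b \<in> \<Inter>?F" for a b
      using s G.submoduleE(4) that by (meson InterE InterI)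
  qed
qed

lemma bil_R: "r \<in> bilinearity K A B n \<Longrightarrow> r \<in> R n"
  by (auto simp: tensor_rel_def submod_gen_def)

lemma kill:
  assumes H: "is_linear K (G n) M H" and M: "module K M"
    and l: "\<And>p q y. p + q = n \<Longrightarrow> y \<in> elts B q \<Longrightarrow> is_linear K (cmp A p) M (\<lambda>x. H (sg p x q y))"
    and r: "\<And>p q x. p + q = n \<Longrightarrow> x \<in> elts A p \<Longrightarrow> is_linear K (cmp B q) M (\<lambda>y. H (sg p x q y))"
    and c: "c \<in> R n"
  shows "H c = \<zero>\<^bsub>M\<^esub>"
proof -
  interpret M: kmod K M using M by (simp add: kmod_def)
  interpret G: kmod K "G n" by (rule kmodG)
  let ?N = "{c \<in> carrier (G n). H c = \<zero>\<^bsub>M\<^esub>}"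
  have z: "\<ominus>\<^bsub>M\<^esub> \<zero>\<^bsub>M\<^esub> = \<zero>\<^bsub>M\<^esub>" by (rule M.M.minus_equality) simp_all
  have "submodule ?N K (G n)"
    using is_linearD[OF H] lin_zero[OF H modG M] lin_neg[OF H modG M] z
    by (intro G.submoduleI) (auto simp del: free_sel)
  moreover have "bilinearity K A B n \<subseteq> ?N"
  proof
    have eq: "u \<ominus>\<^bsub>G n\<^esub> v \<in> ?N" if "u \<in> carrier (G n)" "v \<in> carrier (G n)" "H u = H v" for u v
      using that lin_minus[OF H modG M that(1,2)] is_linearD(1)[OF H that(2)] by (simp add: a_minus_def M.M.r_neg del: free_sel)
    fix c assume "c \<in> bilinearity K A B n"
    then consider
       (1) p x x' q y where "c = sg p (x \<oplus>\<^bsub>cmp A p\<^esub> x') q y \<ominus>\<^bsub>G n\<^esub> (sg p x q y \<oplus>\<^bsub>G n\<^esub> sg p x' q y)" "p + q = n" "x \<in> elts A p" "x' \<in> elts A p" "y \<in> elts B q"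
     | (2) p x q y y' where "c = sg p x q (y \<oplus>\<^bsub>cmp B q\<^esub> y') \<ominus>\<^bsub>G n\<^esub> (sg p x q y \<oplus>\<^bsub>G n\<^esub> sg p x q y')" "p + q = n" "x \<in> elts A p" "y \<in> elts B q" "y' \<in> elts B q"
     | (3) a p x q y where "c = sg p (a \<odot>\<^bsub>cmp A p\<^esub> x) q y \<ominus>\<^bsub>G n\<^esub> a \<odot>\<^bsub>G n\<^esub> sg p x q y" "p + q = n" "a \<in> carrier K" "x \<in> elts A p" "y \<in> elts B q"
     | (4) a p x q y where "c = sg p x q (a \<odot>\<^bsub>cmp B q\<^esub> y) \<ominus>\<^bsub>G n\<^esub> a \<odot>\<^bsub>G n\<^esub> sg p x q y" "p + q = n" "a \<in> carrier K" "x \<in> elts A p" "y \<in> elts B q"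
      unfolding bilinearity_def Let_def by blast
    then show "c \<in> ?N"
    proof cases
      case 1
      show ?thesis unfolding 1(1)
      proof (rule eq)
        show "H (sg p (x \<oplus>\<^bsub>cmp A p\<^esub> x') q y) = H (sg p x q y \<oplus>\<^bsub>G n\<^esub> sg p x' q y)"
          using is_linearD(2)[OF l[OF 1(2,5)] 1(3,4)] is_linearD(2)[OF H sg_in[OF 1(3,5,2)] sg_in[OF 1(4,5,2)]] by simp
      qed (use 1 sg_in A.a_in G.M.a_closed in \<open>simp_all del: free_sel\<close>)
    next
      case 2
      show ?thesis unfolding 2(1)
      proof (rule eq)
        show "H (sg p x q (y \<oplus>\<^bsub>cmp B q\<^esub> y')) = H (sg p x q y \<oplus>\<^bsub>G n\<^esub> sg p x q y')"
          using is_linearD(2)[OF r[OF 2(2,3)] 2(4,5)] is_linearD(2)[OF H sg_in[OF 2(3,4,2)] sg_in[OF 2(3,5,2)]] by simp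
      qed (use 2 sg_in B.a_in G.M.a_closed in \<open>simp_all del: free_sel\<close>)
    next
      case 3
      show ?thesis unfolding 3(1)
      proof (rule eq)
        show "H (sg p (a \<odot>\<^bsub>cmp A p\<^esub> x) q y) = H (a \<odot>\<^bsub>G n\<^esub> sg p x q y)"
          using is_linearD(3)[OF l[OF 3(2,5)] 3(3,4)] is_linearD(3)[OF H 3(3) sg_in[OF 3(4,5,2)]] by simp
      qed (use 3 sg_in A.s_in G.smult_closed in \<open>simp_all del: free_sel\<close>)
    next
      case 4
      show ?thesis unfolding 4(1)
      proof (rule eq)
        show "H (sg p x q (a \<odot>\<^bsub>cmp B q\<^esub> y)) = H (a \<odot>\<^bsub>G n\<^esub> sg p x q y)"
          using is_linearD(3)[OF r[OF 4(2,4)] 4(3,5)] is_linearD(3)[OF H 4(3) sg_in[OF 4(4,5,2)]] by simp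
      qed (use 4 sg_in B.s_in G.smult_closed in \<open>simp_all del: free_sel\<close>)
    qed
  qed
  ultimately have "R n \<subseteq> ?N" unfolding tensor_rel_def submod_gen_def by blast
  then show ?thesis using c by blast
qed

abbreviation "Qm n \<equiv> quot_module (G n) (R n)"
abbreviation "cl n x \<equiv> R n +>\<^bsub>G n\<^esub> x"

lemma modQm: "module K (Qm n)" by (rule kmod.quot_is_module[OF kmodG R_sub])
lemma kmodQm: "kmod K (Qm n)" using modQm by (simp add: kmod_def)
lemma cl_linear: "is_linear K (G n) (Qm n) (cl n)"
  by (rule is_linearI) (auto simp: kmod.rcos_sum[OF kmodG R_sub, simplified] kmod.quot_smult[OF kmodG R_sub, simplified] kmod.rcos_in[OF kmodG])
lemma cl_in: "x \<in> carrier (G n) \<Longrightarrow> cl n x \<in> carrier (Qm n)"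
  by (rule is_linearD(1)[OF cl_linear])
lemma R_iff: "x \<in> carrier (G n) \<Longrightarrow> y \<in> carrier (G n) \<Longrightarrow> x \<ominus>\<^bsub>G n\<^esub> y \<in> R n \<longleftrightarrow> cl n x = cl n y"
  using kmod.rcos_eq_iff[OF kmodG R_sub] by blast
lemma R_0: "x \<in> carrier (G n) \<Longrightarrow> x \<in> R n \<longleftrightarrow> cl n x = \<zero>\<^bsub>Qm n\<^esub>"
  using kmod.rcos_zero_iff[OF kmodG R_sub] by simp
lemma R_in: "x \<in> R n \<Longrightarrow> x \<in> carrier (G n)" using kmod.submod_subset[OF kmodG R_sub] .
lemma Q_E: assumes "X \<in> carrier (Qm n)" obtains c where "c \<in> carrier (G n)" "X = cl n c"
  using assms by (auto elim: quot_carrierE)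

lemma cl_l: assumes n: "p + q = n" and y: "y \<in> elts B q" shows "is_linear K (cmp A p) (Qm n) (\<lambda>x. cl n (sg p x q y))"
proof (rule is_linearI)
  interpret G: kmod K "G n" by (rule kmodG)
  show "cl n (sg p x q y) \<in> carrier (Qm n)" if "x \<in> elts A p" for x by (rule cl_in[OF sg_in[OF that y n]])
  show "cl n (sg p (x \<oplus>\<^bsub>cmp A p\<^esub> x') q y) = cl n (sg p x q y) \<oplus>\<^bsub>Qm n\<^esub> cl n (sg p x' q y)" if x: "x \<in> elts A p" "x' \<in> elts A p" for x x'
  proof -
    note i = sg_in[OF x(1) y n] sg_in[OF x(2) y n] sg_in[OF A.a_in[OF x] y n]
    have "sg p (x \<oplus>\<^bsub>cmp A p\<^esub> x') q y \<ominus>\<^bsub>G n\<^esub> (sg p x q y \<oplus>\<^bsub>G n\<^esub> sg p x' q y) \<in> R n"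
      by (rule bil_R) (unfold bilinearity_def Let_def, use x y n in blast)
    then have "cl n (sg p (x \<oplus>\<^bsub>cmp A p\<^esub> x') q y) = cl n (sg p x q y \<oplus>\<^bsub>G n\<^esub> sg p x' q y)"
      using R_iff[OF i(3) G.M.a_closed[OF i(1,2)]] by blast
    then show ?thesis using is_linearD(2)[OF cl_linear i(1,2)] by (simp only:)
  qed
  show "cl n (sg p (a \<odot>\<^bsub>cmp A p\<^esub> x) q y) = a \<odot>\<^bsub>Qm n\<^esub> cl n (sg p x q y)" if x: "a \<in> carrier K" "x \<in> elts A p" for x a
  proof -
    note i = sg_in[OF x(2) y n] sg_in[OF A.s_in[OF x] y n]
    have "sg p (a \<odot>\<^bsub>cmp A p\<^esub> x) q y \<ominus>\<^bsub>G n\<^esub> a \<odot>\<^bsub>G n\<^esub> sg p x q y \<in> R n"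
      by (rule bil_R) (unfold bilinearity_def Let_def, use x y n in blast)
    then have "cl n (sg p (a \<odot>\<^bsub>cmp A p\<^esub> x) q y) = cl n (a \<odot>\<^bsub>G n\<^esub> sg p x q y)"
      using R_iff[OF i(2) G.smult_closed[OF x(1) i(1)]] by blast
    then show ?thesis using is_linearD(3)[OF cl_linear x(1) i(1)] by (simp only:)
  qed
qed

lemma cl_r: assumes n: "p + q = n" and x: "x \<in> elts A p" shows "is_linear K (cmp B q) (Qm n) (\<lambda>y. cl n (sg p x q y))"
proof (rule is_linearI)
  interpret G: kmod K "G n" by (rule kmodG)
  show "cl n (sg p x q y) \<in> carrier (Qm n)" if "y \<in> elts B q" for y by (rule cl_in[OF sg_in[OF x that n]])
  show "cl n (sg p x q (y \<oplus>\<^bsub>cmp B q\<^esub> y')) = cl n (sg p x q y) \<oplus>\<^bsub>Qm n\<^esub> cl n (sg p x q y')" if y: "y \<in> elts B q" "y' \<in> elts B q" for y y'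
  proof -
    note i = sg_in[OF x y(1) n] sg_in[OF x y(2) n] sg_in[OF x B.a_in[OF y] n]
    have "sg p x q (y \<oplus>\<^bsub>cmp B q\<^esub> y') \<ominus>\<^bsub>G n\<^esub> (sg p x q y \<oplus>\<^bsub>G n\<^esub> sg p x q y') \<in> R n"
      by (rule bil_R) (unfold bilinearity_def Let_def, use x y n in blast)
    then have "cl n (sg p x q (y \<oplus>\<^bsub>cmp B q\<^esub> y')) = cl n (sg p x q y \<oplus>\<^bsub>G n\<^esub> sg p x q y')"
      using R_iff[OF i(3) G.M.a_closed[OF i(1,2)]] by blast
    then show ?thesis using is_linearD(2)[OF cl_linear i(1,2)] by (simp only:)
  qed
  show "cl n (sg p x q (a \<odot>\<^bsub>cmp B q\<^esub> y)) = a \<odot>\<^bsub>Qm n\<^esub> cl n (sg p x q y)" if y: "a \<in> carrier K" "y \<in> elts B q" for y a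
  proof -
    note i = sg_in[OF x y(2) n] sg_in[OF x B.s_in[OF y] n]
    have "sg p x q (a \<odot>\<^bsub>cmp B q\<^esub> y) \<ominus>\<^bsub>G n\<^esub> a \<odot>\<^bsub>G n\<^esub> sg p x q y \<in> R n"
      by (rule bil_R) (unfold bilinearity_def Let_def, use x y n in blast)
    then have "cl n (sg p x q (a \<odot>\<^bsub>cmp B q\<^esub> y)) = cl n (a \<odot>\<^bsub>G n\<^esub> sg p x q y)"
      using R_iff[OF i(2) G.smult_closed[OF y(1) i(1)]] by blast
    then show ?thesis using is_linearD(3)[OF cl_linear y(1) i(1)] by (simp only:)
  qed
qed

lemma selT: "cmp FT n = G n" "gone FT = sg 0 (gone A) 0 (gone B)"
  by (simp_all add: free_tensor_def)

definition ds where "ds N s = (case s of (p, x, q, y) \<Rightarrow> sg (p - 1) (diff A p x) q y \<oplus>\<^bsub>G N\<^esub> koszul (G N) p (sg p x (q - 1) (diff B q y)))"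
definition ms where "ms N s t = (case s of (p, x, q, y) \<Rightarrow> case t of (p', x', q', y') \<Rightarrow>
   koszul (G N) (q * p') (sg (p + p') (gmult A p p' x x') (q + q') (gmult B q q' y y')))"

lemma dT: "diff FT n = lin_ext K (G (n - 1)) (ds (n - 1))"
  unfolding free_tensor_def Let_def ds_def[abs_def] by simp
lemma mT: "gmult FT m n c c' = lin_ext K (G (m + n)) (\<lambda>s. lin_ext K (G (m + n)) (ms (m + n) s) c') c"
  unfolding free_tensor_def Let_def ms_def[abs_def] by (simp add: case_prod_unfold)

lemma ds_in: "s \<in> tsyms A B n \<Longrightarrow> ds (n - 1) s \<in> carrier (G (n - 1))"
  by (erule tsE) (auto simp: ds_def simp del: free_sel intro!: G_a G_k sg_in A.d_in B.d_in)

lemma ms_in: "s \<in> tsyms A B m \<Longrightarrow> t \<in> tsyms A B n \<Longrightarrow> ms (m + n) s t \<in> carrier (G (m + n))"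
  by (elim tsE) (auto simp: ms_def intro!: G_k sg_in A.mult_in B.mult_in)

lemma ext_dT: "lin_extension K (G (n - 1)) (tsyms A B n) (ds (n - 1))"
  by (intro lin_extension.intro kmodG lin_extension_axioms.intro field_axioms ds_in)
lemma dT_lin: "is_linear K (G n) (G (n - 1)) (diff FT n)"
  unfolding dT by (rule lin_extension.ext_linear[OF ext_dT])
lemma dT_s: "x \<in> elts A p \<Longrightarrow> y \<in> elts B q \<Longrightarrow> p + q = n \<Longrightarrow>
   diff FT n (sg p x q y) = sg (p - 1) (diff A p x) q y \<oplus>\<^bsub>G (n - 1)\<^esub> koszul (G (n - 1)) p (sg p x (q - 1) (diff B q y))"
  unfolding dT by (subst lin_extension.ext_single[OF ext_dT]) (auto simp: tsyms_def ds_def)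

lemma ext_in: "s \<in> tsyms A B m \<Longrightarrow> lin_extension K (G (m + n)) (tsyms A B n) (ms (m + n) s)"
  by (intro lin_extension.intro kmodG lin_extension_axioms.intro field_axioms ms_in)
lemma ext_out: "c' \<in> carrier (G n) \<Longrightarrow> lin_extension K (G (m + n)) (tsyms A B m) (\<lambda>s. lin_ext K (G (m + n)) (ms (m + n) s) c')"
  by (intro lin_extension.intro kmodG lin_extension_axioms.intro field_axioms lin_extension.ext_closed[OF ext_in])
lemma mT_l: "c' \<in> carrier (G n) \<Longrightarrow> is_linear K (G m) (G (m + n)) (\<lambda>c. gmult FT m n c c')"
  unfolding mT by (rule lin_extension.ext_linear[OF ext_out])
lemma mT_r: "c \<in> carrier (G m) \<Longrightarrow> is_linear K (G n) (G (m + n)) (gmult FT m n c)"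
  using kmod.lin_ext_param[OF kmodG field_axioms modG _ lin_extension.ext_linear[OF ext_in]]
  by (simp add: mT[abs_def])
lemma mT_s: "x \<in> elts A p \<Longrightarrow> y \<in> elts B q \<Longrightarrow> p + q = m \<Longrightarrow> x' \<in> elts A p' \<Longrightarrow> y' \<in> elts B q' \<Longrightarrow> p' + q' = n \<Longrightarrow>
   gmult FT m n (sg p x q y) (sg p' x' q' y') = koszul (G (m + n)) (q * p') (sg (p + p') (gmult A p p' x x') (q + q') (gmult B q q' y y'))"
  unfolding mT using lin_extension.ext_single[OF ext_out[OF sg_in], of x' p' y' q' n "(p, x, q, y)" m]
    lin_extension.ext_single[OF ext_in, of "(p, x, q, y)" m "(p', x', q', y')" n]
  by (simp add: tsyms_def ms_def)
lemma mT_in: "c \<in> carrier (G m) \<Longrightarrow> c' \<in> carrier (G n) \<Longrightarrow> gmult FT m n c c' \<in> carrier (G (m + n))"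
  using is_linearD(1)[OF mT_r] by blast
lemma dT_in: "c \<in> carrier (G n) \<Longrightarrow> diff FT n c \<in> carrier (G (n - 1))"
  using is_linearD(1)[OF dT_lin] by blast

lemma bil_eq:
  assumes "\<And>y. y \<in> carrier (G n) \<Longrightarrow> is_linear K (G m) M (\<lambda>x. f x y)" "\<And>x. x \<in> carrier (G m) \<Longrightarrow> is_linear K (G n) M (f x)"
     "\<And>y. y \<in> carrier (G n) \<Longrightarrow> is_linear K (G m) M (\<lambda>x. g x y)" "\<And>x. x \<in> carrier (G m) \<Longrightarrow> is_linear K (G n) M (g x)"
     "module K M" "\<And>u v. u \<in> tsyms A B m \<Longrightarrow> v \<in> tsyms A B n \<Longrightarrow> f (single K u) (single K v) = g (single K u) (single K v)"
     "x \<in> carrier (G m)" "y \<in> carrier (G n)"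
   shows "f x y = g x y"
proof -
  have 1: "f (single K u) y = g (single K u) y" if "u \<in> tsyms A B m" for u
    by (rule free_linear_eq[OF assms(2,4,5)]) (use that assms single_closed in auto)
  show ?thesis
    by (rule free_linear_eq[OF assms(1,3,5)]) (use 1 assms in auto)
qed

lemma dT_R: assumes "c \<in> R n" shows "diff FT n c \<in> R (n - 1)"
proof -
  let ?N = "n - 1"
  interpret Q: kmod K "Qm ?N" by (rule kmodQm)
  interpret G: kmod K "G ?N" by (rule kmodG)
  have H: "is_linear K (G n) (Qm ?N) (\<lambda>c. cl ?N (diff FT n c))" using is_linear_comp[OF dT_lin cl_linear] .
  have H_s: "cl ?N (diff FT n (sg p x q y)) = cl ?N (sg (p - 1) (diff A p x) q y) \<oplus>\<^bsub>Qm ?N\<^esub> koszul (Qm ?N) p (cl ?N (sg p x (q - 1) (diff B q y)))"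
    if x: "x \<in> elts A p" and y: "y \<in> elts B q" and n: "p + q = n" for p q x y
  proof -
    have i: "sg (p - 1) (diff A p x) q y \<in> carrier (G ?N)" "sg p x (q - 1) (diff B q y) \<in> carrier (G ?N)"
      using x y n by (auto intro!: sg_in A.d_in B.d_in)
    show ?thesis unfolding dT_s[OF x y n] is_linearD(2)[OF cl_linear i(1) G.koszul_closed[OF i(2)]] lin_koszul[OF cl_linear modG modQm i(2)] ..
  qed
  have "cl ?N (diff FT n c) = \<zero>\<^bsub>Qm ?N\<^esub>"
  proof (rule kill[OF H modQm _ _ assms])
    fix p q y assume n: "p + q = n" and y: "y \<in> elts B q"
    have e: "p - 1 + q = ?N" "p + (q - 1) = ?N" using n by auto
    have "is_linear K (cmp A p) (Qm ?N) (\<lambda>x. cl ?N (sg (p - 1) (diff A p x) q y) \<oplus>\<^bsub>Qm ?N\<^esub> koszul (Qm ?N) p (cl ?N (sg p x (q - 1) (diff B q y))))"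
      by (intro Q.is_linear_add Q.is_linear_koszul is_linear_comp[OF A.d_lin cl_l[OF e(1) y]] cl_l[OF e(2) B.d_in[OF y]])
    then show "is_linear K (cmp A p) (Qm ?N) (\<lambda>x. cl ?N (diff FT n (sg p x q y)))"
      unfolding is_linear_def using H_s[OF _ y n] A.a_in A.s_in by (simp add: Pi_def del: quot_module_sel)
  next
    fix p q x assume n: "p + q = n" and x: "x \<in> elts A p"
    have e: "p - 1 + q = ?N" "p + (q - 1) = ?N" using n by auto
    have "is_linear K (cmp B q) (Qm ?N) (\<lambda>y. cl ?N (sg (p - 1) (diff A p x) q y) \<oplus>\<^bsub>Qm ?N\<^esub> koszul (Qm ?N) p (cl ?N (sg p x (q - 1) (diff B q y))))"
      by (intro Q.is_linear_add Q.is_linear_koszul is_linear_comp[OF B.d_lin cl_r[OF e(2) x]] cl_r[OF e(1) A.d_in[OF x]])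
    then show "is_linear K (cmp B q) (Qm ?N) (\<lambda>y. cl ?N (diff FT n (sg p x q y)))"
      unfolding is_linear_def using H_s[OF x _ n] B.a_in B.s_in by (simp add: Pi_def del: quot_module_sel)
  qed
  then show ?thesis using R_0[OF dT_in[OF R_in[OF assms]]] by blast
qed

lemma mT_s_cl: "x \<in> elts A p \<Longrightarrow> y \<in> elts B q \<Longrightarrow> p + q = m \<Longrightarrow> x' \<in> elts A p' \<Longrightarrow> y' \<in> elts B q' \<Longrightarrow> p' + q' = n \<Longrightarrow>
   cl (m + n) (gmult FT m n (sg p x q y) (sg p' x' q' y')) = koszul (Qm (m + n)) (q * p') (cl (m + n) (sg (p + p') (gmult A p p' x x') (q + q') (gmult B q q' y y')))"
  unfolding mT_s by (rule lin_koszul[OF cl_linear modG modQm]) (auto intro!: sg_in A.mult_in B.mult_in)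

lemma mT_R_r: assumes c: "c \<in> carrier (G m)" and r: "r \<in> R n" shows "gmult FT m n c r \<in> R (m + n)"
proof -
  interpret Q: kmod K "Qm (m + n)" by (rule kmodQm)
  have "cl (m + n) (gmult FT m n c r) = \<zero>\<^bsub>Qm (m + n)\<^esub>"
  proof (rule free_linear_eq[OF is_linear_comp[OF mT_l[OF R_in[OF r]] cl_linear] Q.is_linear_zero[OF modG] modQm _ c])
    fix s assume "s \<in> tsyms A B m"
    then obtain p x q y where s: "s = (p, x, q, y)" and m: "p + q = m" and x: "x \<in> elts A p" and y: "y \<in> elts B q" by (rule tsE)
    have H: "is_linear K (G n) (Qm (m + n)) (\<lambda>r. cl (m + n) (gmult FT m n (sg p x q y) r))"
      using is_linear_comp[OF mT_r[OF sg_in[OF x y m]] cl_linear] .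
    show "cl (m + n) (gmult FT m n (single K s) r) = \<zero>\<^bsub>Qm (m + n)\<^esub>"
      unfolding s
    proof (rule kill[OF H modQm _ _ r])
      fix p' q' y' assume n: "p' + q' = n" and y': "y' \<in> elts B q'"
      have e: "p + p' + (q + q') = m + n" using m n by auto
      have "is_linear K (cmp A p') (Qm (m + n)) (\<lambda>x'. koszul (Qm (m + n)) (q * p') (cl (m + n) (sg (p + p') (gmult A p p' x x') (q + q') (gmult B q q' y y'))))"
        by (intro Q.is_linear_koszul is_linear_comp[OF A.mult_r[OF x] cl_l[OF e B.mult_in[OF y y']]])
      then show "is_linear K (cmp A p') (Qm (m + n)) (\<lambda>x'. cl (m + n) (gmult FT m n (sg p x q y) (sg p' x' q' y')))"
        unfolding is_linear_def using mT_s_cl[OF x y m _ y' n] A.a_in A.s_in by (simp add: Pi_def del: quot_module_sel)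
    next
      fix p' q' x' assume n: "p' + q' = n" and x': "x' \<in> elts A p'"
      have e: "p + p' + (q + q') = m + n" using m n by auto
      have "is_linear K (cmp B q') (Qm (m + n)) (\<lambda>y'. koszul (Qm (m + n)) (q * p') (cl (m + n) (sg (p + p') (gmult A p p' x x') (q + q') (gmult B q q' y y'))))"
        by (intro Q.is_linear_koszul is_linear_comp[OF B.mult_r[OF y] cl_r[OF e A.mult_in[OF x x']]])
      then show "is_linear K (cmp B q') (Qm (m + n)) (\<lambda>y'. cl (m + n) (gmult FT m n (sg p x q y) (sg p' x' q' y')))"
        unfolding is_linear_def using mT_s_cl[OF x y m x' _ n] B.a_in B.s_in by (simp add: Pi_def del: quot_module_sel)
    qed
  qed
  then show ?thesis using R_0[OF mT_in[OF c R_in[OF r]]] by blast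
qed

lemma mT_R_l: assumes c: "c \<in> carrier (G n)" and r: "r \<in> R m" shows "gmult FT m n r c \<in> R (m + n)"
proof -
  interpret Q: kmod K "Qm (m + n)" by (rule kmodQm)
  have "cl (m + n) (gmult FT m n r c) = \<zero>\<^bsub>Qm (m + n)\<^esub>"
  proof (rule free_linear_eq[OF is_linear_comp[OF mT_r[OF R_in[OF r]] cl_linear] Q.is_linear_zero[OF modG] modQm _ c])
    fix s assume "s \<in> tsyms A B n"
    then obtain p' x' q' y' where s: "s = (p', x', q', y')" and n: "p' + q' = n" and x': "x' \<in> elts A p'" and y': "y' \<in> elts B q'" by (rule tsE)
    have H: "is_linear K (G m) (Qm (m + n)) (\<lambda>r. cl (m + n) (gmult FT m n r (sg p' x' q' y')))"
      using is_linear_comp[OF mT_l[OF sg_in[OF x' y' n]] cl_linear] .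
    show "cl (m + n) (gmult FT m n r (single K s)) = \<zero>\<^bsub>Qm (m + n)\<^esub>"
      unfolding s
    proof (rule kill[OF H modQm _ _ r])
      fix p q y assume m: "p + q = m" and y: "y \<in> elts B q"
      have e: "p + p' + (q + q') = m + n" using m n by auto
      have "is_linear K (cmp A p) (Qm (m + n)) (\<lambda>x. koszul (Qm (m + n)) (q * p') (cl (m + n) (sg (p + p') (gmult A p p' x x') (q + q') (gmult B q q' y y'))))"
        by (intro Q.is_linear_koszul is_linear_comp[OF A.mult_l[OF x'] cl_l[OF e B.mult_in[OF y y']]])
      then show "is_linear K (cmp A p) (Qm (m + n)) (\<lambda>x. cl (m + n) (gmult FT m n (sg p x q y) (sg p' x' q' y')))"
        unfolding is_linear_def using mT_s_cl[OF _ y m x' y' n] A.a_in A.s_in by (simp add: Pi_def del: quot_module_sel)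
    next
      fix p q x assume m: "p + q = m" and x: "x \<in> elts A p"
      have e: "p + p' + (q + q') = m + n" using m n by auto
      have "is_linear K (cmp B q) (Qm (m + n)) (\<lambda>y. koszul (Qm (m + n)) (q * p') (cl (m + n) (sg (p + p') (gmult A p p' x x') (q + q') (gmult B q q' y y'))))"
        by (intro Q.is_linear_koszul is_linear_comp[OF B.mult_l[OF y'] cl_r[OF e A.mult_in[OF x x']]])
      then show "is_linear K (cmp B q) (Qm (m + n)) (\<lambda>y. cl (m + n) (gmult FT m n (sg p x q y) (sg p' x' q' y')))"
        unfolding is_linear_def using mT_s_cl[OF x _ m x' y' n] B.a_in B.s_in by (simp add: Pi_def del: quot_module_sel)
    qed
  qed
  then show ?thesis using R_0[OF mT_in[OF R_in[OF r] c]] by blast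
qed

abbreviation "T \<equiv> tensor_dga K A B"

lemma T_cmp: "cmp T n = Qm n" by (simp add: tensor_dga_def quot_dga_def selT)
lemma T_d: "c \<in> carrier (G n) \<Longrightarrow> diff T n (cl n c) = cl (n - 1) (diff FT n c)"
  using quot_map_rcos[OF modG modG R_sub R_sub dT_lin dT_R] by (simp add: tensor_dga_def quot_dga_def selT)
lemma T_m: "c \<in> carrier (G m) \<Longrightarrow> c' \<in> carrier (G n) \<Longrightarrow> gmult T m n (cl m c) (cl n c') = cl (m + n) (gmult FT m n c c')"
  using quot_map2_rcos[OF modG modG modG R_sub R_sub R_sub mT_l mT_r mT_R_l mT_R_r] by (simp add: tensor_dga_def quot_dga_def selT)
lemma T_1: "gone T = cl 0 (sg 0 (gone A) 0 (gone B))"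
  by (simp add: tensor_dga_def quot_dga_def selT)

lemma G_assoc:
  assumes "x \<in> carrier (G m)" "y \<in> carrier (G n)" "z \<in> carrier (G p)"
  shows "gmult FT (m + n) p (gmult FT m n x y) z = gmult FT m (n + p) x (gmult FT n p y z)"
proof -
  let ?N = "m + n + p"
  interpret N: kmod K "G ?N" by (rule kmodG)
  have lin: "z \<in> carrier (G p) \<Longrightarrow> is_linear K (G (m+n)) (G (m + n + p)) (\<lambda>x. gmult FT (m+n) p x z)" 
    "x \<in> carrier (G m) \<Longrightarrow> is_linear K (G (n+p)) (G (m + n + p)) (gmult FT m (n+p) x)"
    "z \<in> carrier (G (n + p)) \<Longrightarrow> is_linear K (G m) (G (m + n + p)) (\<lambda>x. gmult FT m (n+p) x z)" for x z
    using mT_l[of z p "m + n"] mT_r[of x m "n + p"] mT_l[of z "n + p" m] by (auto simp: add.assoc)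
  have 1: "gmult FT (m + n) p (gmult FT m n x y) (single K w) = gmult FT m (n + p) x (gmult FT n p y (single K w))"
    if w: "w \<in> tsyms A B p" and "x \<in> carrier (G m)" "y \<in> carrier (G n)" for x y w
  proof (rule bil_eq[OF _ _ _ _ modG[of "m + n + p"] _ \<open>x \<in> _\<close> \<open>y \<in> _\<close>])
    note s = single_closed[OF w]
    show "is_linear K (G m) (G (m + n + p)) (\<lambda>x. gmult FT (m + n) p (gmult FT m n x y) (single K w))" if "y \<in> carrier (G n)" for y
      using is_linear_comp[OF mT_l[OF that] lin(1)[OF s]] .
    show "is_linear K (G n) (G (m + n + p)) (\<lambda>y. gmult FT (m + n) p (gmult FT m n x y) (single K w))" if "x \<in> carrier (G m)" for x
      using is_linear_comp[OF mT_r[OF that] lin(1)[OF s]] .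
    show "is_linear K (G m) (G (m + n + p)) (\<lambda>x. gmult FT m (n + p) x (gmult FT n p y (single K w)))" if "y \<in> carrier (G n)" for y
      using lin(3)[OF mT_in[OF that s]] .
    show "is_linear K (G n) (G (m + n + p)) (\<lambda>y. gmult FT m (n + p) x (gmult FT n p y (single K w)))" if "x \<in> carrier (G m)" for x
      using is_linear_comp[OF mT_l[OF s] lin(2)[OF that]] .
    show "gmult FT (m + n) p (gmult FT m n (single K u) (single K v)) (single K w) = gmult FT m (n + p) (single K u) (gmult FT n p (single K v) (single K w))"
      if u: "u \<in> tsyms A B m" and v: "v \<in> tsyms A B n" for u v
    proof -
      obtain a x b y where u': "u = (a, x, b, y)" "a + b = m" "x \<in> elts A a" "y \<in> elts B b" using u by (rule tsE)
      obtain a' x' b' y' where v': "v = (a', x', b', y')" "a' + b' = n" "x' \<in> elts A a'" "y' \<in> elts B b'" using v by (rule tsE)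
      obtain a'' x'' b'' y'' where w': "w = (a'', x'', b'', y'')" "a'' + b'' = p" "x'' \<in> elts A a''" "y'' \<in> elts B b''" using w by (rule tsE)
      note xx = A.mult_in[OF u'(3) v'(3)] and yy = B.mult_in[OF u'(4) v'(4)]
      note xx' = A.mult_in[OF v'(3) w'(3)] and yy' = B.mult_in[OF v'(4) w'(4)]
      have d: "a + a' + (b + b') = m + n" "a' + a'' + (b' + b'') = n + p" "m + (n + p) = ?N" using u' v' w' by auto
      let ?s = "sg (a + a' + a'') (gmult A (a + a') a'' (gmult A a a' x x') x'') (b + b' + b'') (gmult B (b + b') b'' (gmult B b b' y y') y'')"
      have s: "?s \<in> carrier (G ?N)" using u' v' w' by (intro sg_in A.mult_in B.mult_in) auto
      have L: "gmult FT (m + n) p (gmult FT m n (single K u) (single K v)) (single K w) = koszul (G ?N) (b * a') (koszul (G ?N) ((b + b') * a'') ?s)"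
        unfolding u'(1) v'(1) w'(1) mT_s[OF u'(3,4,2) v'(3,4,2)] 
          lin_koszul[OF lin(1)[OF sg_in[OF w'(3,4,2)]] modG modG sg_in[OF xx yy d(1)]] mT_s[OF xx yy d(1) w'(3,4,2)] ..
      have R: "gmult FT m (n + p) (single K u) (gmult FT n p (single K v) (single K w)) = koszul (G ?N) (b' * a'') (koszul (G ?N) (b * (a' + a'')) ?s)"
        unfolding u'(1) v'(1) w'(1) mT_s[OF v'(3,4,2) w'(3,4,2)] 
          lin_koszul[OF lin(2)[OF sg_in[OF u'(3,4,2)]] modG modG sg_in[OF xx' yy' d(2)]] mT_s[OF u'(3,4,2) xx' yy' d(2)] d(3)
          A.assoc[OF u'(3) v'(3) w'(3)] B.assoc[OF u'(4) v'(4) w'(4)] add.assoc[of a a' a''] add.assoc[of b b' b''] ..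
      show ?thesis unfolding L R N.koszul_koszul[OF s] by (simp add: algebra_simps)
    qed
  qed
  show ?thesis
  proof (rule free_linear_eq[OF _ _ modG[of "m + n + p"] _ \<open>z \<in> _\<close>])
    show "is_linear K (G p) (G (m + n + p)) (gmult FT (m + n) p (gmult FT m n x y))"
      using mT_r[OF mT_in[OF assms(1,2)]] .
    show "is_linear K (G p) (G (m + n + p)) (\<lambda>z. gmult FT m (n + p) x (gmult FT n p y z))"
      using is_linear_comp[OF mT_r[OF assms(2)] lin(2)[OF assms(1)]] .
  qed (use 1 assms in auto)
qed

lemma one_G: "sg 0 (gone A) 0 (gone B) \<in> carrier (G 0)" by (intro sg_in A.one_in B.one_in) simp

lemma G_one_l: "c \<in> carrier (G n) \<Longrightarrow> gmult FT 0 n (sg 0 (gone A) 0 (gone B)) c = c"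
proof (rule free_linear_eq[where g = "\<lambda>x. x" and M = "G n" and X = "tsyms A B n"])
  show "is_linear K (G n) (G n) (gmult FT 0 n (sg 0 (gone A) 0 (gone B)))" using mT_r[OF one_G, of n] by simp
  show "is_linear K (G n) (G n) (\<lambda>x. x)" by (rule is_linearI) auto
  show "gmult FT 0 n (sg 0 (gone A) 0 (gone B)) (single K s) = single K s" if "s \<in> tsyms A B n" for s
    using that by (rule tsE) (simp add: mT_s[OF A.one_in B.one_in] A.one_l B.one_l koszul_def)
qed (rule modG)

lemma G_one_r: "c \<in> carrier (G n) \<Longrightarrow> gmult FT n 0 c (sg 0 (gone A) 0 (gone B)) = c"
proof (rule free_linear_eq[where f = "\<lambda>c. gmult FT n 0 c (sg 0 (gone A) 0 (gone B))" and g = "\<lambda>x. x" and M = "G n" and X = "tsyms A B n"])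
  show "is_linear K (G n) (G n) (\<lambda>c. gmult FT n 0 c (sg 0 (gone A) 0 (gone B)))" using mT_l[OF one_G, of n] by simp
  show "is_linear K (G n) (G n) (\<lambda>x. x)" by (rule is_linearI) auto
  show "gmult FT n 0 (single K s) (sg 0 (gone A) 0 (gone B)) = single K s" if "s \<in> tsyms A B n" for s
    using that by (rule tsE) (simp add: mT_s[OF _ _ _ A.one_in B.one_in] A.one_r B.one_r koszul_def)
qed (rule modG)

lemma G_dd: assumes "c \<in> carrier (G n)" shows "cl (n - 2) (diff FT (n - 1) (diff FT n c)) = \<zero>\<^bsub>Qm (n - 2)\<^esub>"
proof -
  let ?N = "n - 2"
  have e: "n - 1 - 1 = ?N" by simp
  interpret Q: kmod K "Qm ?N" by (rule kmodQm)
  interpret G: kmod K "G ?N" by (rule kmodG)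
  interpret G1: kmod K "G (n - 1)" by (rule kmodG)
  have l: "is_linear K (G (n - 1)) (G ?N) (diff FT (n - 1))" using dT_lin[of "n - 1"] unfolding e .
  show ?thesis
  proof (rule free_linear_eq[OF is_linear_comp[OF is_linear_comp[OF dT_lin l] cl_linear] Q.is_linear_zero[OF modG] modQm _ assms])
    fix s assume "s \<in> tsyms A B n"
    then obtain p x q y where s: "s = (p, x, q, y)" and n: "p + q = n" and x: "x \<in> elts A p" and y: "y \<in> elts B q" by (rule tsE)
    have d: "p - 1 + q = n - 1" "p + (q - 1) = n - 1" "p - 1 - 1 = p - 2" "q - 1 - 1 = q - 2" "p - 2 + q = ?N" "p + (q - 2) = ?N" "p - 1 + (q - 1) = ?N" using n by auto
    note dx = A.d_in[OF x] and dy = B.d_in[OF y]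
    have i: "sg (p - 1) (diff A p x) q y \<in> carrier (G (n - 1))" "sg p x (q - 1) (diff B q y) \<in> carrier (G (n - 1))"
      using sg_in[OF dx y d(1)] sg_in[OF x dy d(2)] .
    let ?z = "sg (p - 1) (diff A p x) (q - 1) (diff B q y)"
    have z: "?z \<in> carrier (G ?N)" using sg_in[OF dx dy d(7)] .
    let ?u = "sg (p - 2) \<zero>\<^bsub>cmp A (p - 2)\<^esub> q y" and ?v = "sg p x (q - 2) \<zero>\<^bsub>cmp B (q - 2)\<^esub>"
    have uv: "?u \<in> carrier (G ?N)" "?v \<in> carrier (G ?N)" using sg_in[OF A.z_in y d(5)] sg_in[OF x B.z_in d(6)] .
    have cuv: "cl ?N ?u = \<zero>\<^bsub>Qm ?N\<^esub>" "cl ?N ?v = \<zero>\<^bsub>Qm ?N\<^esub>"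
      using lin_zero[OF cl_l[OF d(5) y] A.mod modQm] lin_zero[OF cl_r[OF d(6) x] B.mod modQm] .
    have 1: "diff FT (n - 1) (sg (p - 1) (diff A p x) q y) = ?u \<oplus>\<^bsub>G ?N\<^esub> koszul (G ?N) (p - 1) ?z"
      using dT_s[OF dx y d(1)] A0.diff_diff[OF x] unfolding e d(3) by simp
    have 2: "diff FT (n - 1) (sg p x (q - 1) (diff B q y)) = ?z \<oplus>\<^bsub>G ?N\<^esub> koszul (G ?N) p ?v"
      using dT_s[OF x dy d(2)] B0.diff_diff[OF y] unfolding e d(4) by simp
    have "diff FT (n - 1) (diff FT n (single K s)) = (?u \<oplus>\<^bsub>G ?N\<^esub> koszul (G ?N) (p - 1) ?z) \<oplus>\<^bsub>G ?N\<^esub> koszul (G ?N) p (?z \<oplus>\<^bsub>G ?N\<^esub> koszul (G ?N) p ?v)"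
      unfolding s dT_s[OF x y n] is_linearD(2)[OF l i(1) G1.koszul_closed[OF i(2)]] lin_koszul[OF l modG modG i(2)] 1 2 ..
    then have "cl ?N (diff FT (n - 1) (diff FT n (single K s))) = 
       (\<zero>\<^bsub>Qm ?N\<^esub> \<oplus>\<^bsub>Qm ?N\<^esub> koszul (Qm ?N) (p - 1) (cl ?N ?z)) \<oplus>\<^bsub>Qm ?N\<^esub> koszul (Qm ?N) p (cl ?N ?z \<oplus>\<^bsub>Qm ?N\<^esub> koszul (Qm ?N) p \<zero>\<^bsub>Qm ?N\<^esub>)"
      using z uv cuv by (simp add: is_linearD(2)[OF cl_linear] lin_koszul[OF cl_linear modG modQm] del: free_sel quot_module_sel)
    also have "\<dots> = \<zero>\<^bsub>Qm ?N\<^esub>" using cl_in[OF z]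
      by (simp add: koszul_def Q.M.l_neg Q.M.r_neg Q.M.minus_equality[of "\<zero>\<^bsub>Qm ?N\<^esub>" "\<zero>\<^bsub>Qm ?N\<^esub>"] del: quot_module_sel)
    finally show "cl ?N (diff FT (n - 1) (diff FT n (single K s))) = \<zero>\<^bsub>Qm ?N\<^esub>" .
  qed
qed

lemma G_leib:
  assumes "c \<in> carrier (G m)" "c' \<in> carrier (G n)"
  shows "cl (m + n - 1) (diff FT (m + n) (gmult FT m n c c')) =
     cl (m + n - 1) (gmult FT (m - 1) n (diff FT m c) c' \<oplus>\<^bsub>G (m + n - 1)\<^esub> koszul (G (m + n - 1)) m (gmult FT m (n - 1) c (diff FT n c')))"
proof -
  let ?N = "m + n - 1"
  interpret Q: kmod K "Qm ?N" by (rule kmodQm)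
  interpret G: kmod K "G ?N" by (rule kmodG)
  have e: "m - 1 + n = ?N" "m + (n - 1) = ?N" by auto
  have l: "z \<in> carrier (G n) \<Longrightarrow> is_linear K (G (m - 1)) (G ?N) (\<lambda>x. gmult FT (m - 1) n x z)"
     "x \<in> carrier (G (m - 1)) \<Longrightarrow> is_linear K (G n) (G ?N) (\<lambda>z. gmult FT (m - 1) n x z)" 
     "z \<in> carrier (G (n - 1)) \<Longrightarrow> is_linear K (G m) (G ?N) (\<lambda>x. gmult FT m (n - 1) x z)" 
     "x \<in> carrier (G m) \<Longrightarrow> is_linear K (G (n - 1)) (G ?N) (\<lambda>z. gmult FT m (n - 1) x z)" for x z
    using mT_l[of z n "m - 1"] mT_l[of z "n - 1" m] mT_r[of x "m - 1" n] mT_r[of x m "n - 1"] by (simp_all add: e)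
  show ?thesis
  proof (rule bil_eq[OF _ _ _ _ modQm _ assms])
    fix y assume y: "y \<in> carrier (G n)"
    show "is_linear K (G m) (Qm ?N) (\<lambda>x. cl ?N (diff FT (m + n) (gmult FT m n x y)))"
      using is_linear_comp[OF is_linear_comp[OF mT_l[OF y] dT_lin] cl_linear] .
    show "is_linear K (G m) (Qm ?N) (\<lambda>x. cl ?N (gmult FT (m - 1) n (diff FT m x) y \<oplus>\<^bsub>G ?N\<^esub> koszul (G ?N) m (gmult FT m (n - 1) x (diff FT n y))))"
      by (intro is_linear_comp[OF _ cl_linear] G.is_linear_add G.is_linear_koszul is_linear_comp[OF dT_lin l(1)[OF y]] l(3)[OF dT_in[OF y]])
  next
    fix x assume x: "x \<in> carrier (G m)"
    show "is_linear K (G n) (Qm ?N) (\<lambda>y. cl ?N (diff FT (m + n) (gmult FT m n x y)))"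
      using is_linear_comp[OF is_linear_comp[OF mT_r[OF x] dT_lin] cl_linear] .
    show "is_linear K (G n) (Qm ?N) (\<lambda>y. cl ?N (gmult FT (m - 1) n (diff FT m x) y \<oplus>\<^bsub>G ?N\<^esub> koszul (G ?N) m (gmult FT m (n - 1) x (diff FT n y))))"
      by (intro is_linear_comp[OF _ cl_linear] G.is_linear_add G.is_linear_koszul is_linear_comp[OF dT_lin l(4)[OF x]] l(2)[OF dT_in[OF x]])
  next
    fix u v assume u: "u \<in> tsyms A B m" and v: "v \<in> tsyms A B n"
    obtain p x q y where u': "u = (p, x, q, y)" "p + q = m" "x \<in> elts A p" "y \<in> elts B q" using u by (rule tsE)
    obtain p' x' q' y' where v': "v = (p', x', q', y')" "p' + q' = n" "x' \<in> elts A p'" "y' \<in> elts B q'" using v by (rule tsE)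
    note x = u'(3) and y = u'(4) and x' = v'(3) and y' = v'(4)
    note dx = A.d_in[OF x] and dy = B.d_in[OF y] and dx' = A.d_in[OF x'] and dy' = B.d_in[OF y']
    have d: "p + p' + (q + q') = m + n" "p - 1 + q = m - 1" "p + (q - 1) = m - 1" "p' - 1 + q' = n - 1" "p' + (q' - 1) = n - 1"
       "p + p' - 1 + (q + q') = ?N" "p + p' + (q + q' - 1) = ?N" using u' v' by auto
    have ip: "p - 1 + p' = p + p' - 1" "p + (p' - 1) = p + p' - 1" "q - 1 + q' = q + q' - 1" "q + (q' - 1) = q + q' - 1" by auto
    let ?x1 = "gmult A (p - 1) p' (diff A p x) x'" and ?x2 = "gmult A p (p' - 1) x (diff A p' x')" and ?xx = "gmult A p p' x x'"
    let ?y1 = "gmult B (q - 1) q' (diff B q y) y'" and ?y2 = "gmult B q (q' - 1) y (diff B q' y')" and ?yy = "gmult B q q' y y'"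
    note xx = A.mult_in[OF x x'] and yy = B.mult_in[OF y y']
    have x12: "?x1 \<in> elts A (p + p' - 1)" "?x2 \<in> elts A (p + p' - 1)" and y12: "?y1 \<in> elts B (q + q' - 1)" "?y2 \<in> elts B (q + q' - 1)"
      using A.mult_in[OF dx x'] A.mult_in[OF x dx'] B.mult_in[OF dy y'] B.mult_in[OF y dy'] unfolding ip .
    let ?t1 = "sg (p + p' - 1) ?x1 (q + q') ?yy" and ?t2 = "sg (p + p' - 1) ?x2 (q + q') ?yy"
    let ?t3 = "sg (p + p') ?xx (q + q' - 1) ?y1" and ?t4 = "sg (p + p') ?xx (q + q' - 1) ?y2"
    have t: "?t1 \<in> carrier (G ?N)" "?t2 \<in> carrier (G ?N)" "?t3 \<in> carrier (G ?N)" "?t4 \<in> carrier (G ?N)"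
      using sg_in[OF x12(1) yy d(6)] sg_in[OF x12(2) yy d(6)] sg_in[OF xx y12(1) d(7)] sg_in[OF xx y12(2) d(7)] .
    let ?k = "koszul (Qm ?N)"
    let ?c1 = "cl ?N ?t1" and ?c2 = "cl ?N ?t2" and ?c3 = "cl ?N ?t3" and ?c4 = "cl ?N ?t4"
    note c = cl_in[OF t(1)] cl_in[OF t(2)] cl_in[OF t(3)] cl_in[OF t(4)]
    have c': "R ?N +>\<^bsub>G ?N\<^esub> ?t1 \<in> carrier (Qm ?N)" using c by blast
    let ?w = "sg (p + p') ?xx (q + q') ?yy"
    have w: "?w \<in> carrier (G (m + n))" by (rule sg_in[OF xx yy d(1)])
    have dw1: "cl ?N (sg (p + p' - 1) (diff A (p + p') ?xx) (q + q') ?yy) = ?c1 \<oplus>\<^bsub>Qm ?N\<^esub> ?k p ?c2"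
      unfolding A.leib[OF x x'] is_linearD(2)[OF cl_l[OF d(6) yy] x12(1) A.k_in[OF x12(2)]]
        lin_koszul[OF cl_l[OF d(6) yy] A.mod modQm x12(2)] ..
    have dw2: "cl ?N (sg (p + p') ?xx (q + q' - 1) (diff B (q + q') ?yy)) = ?c3 \<oplus>\<^bsub>Qm ?N\<^esub> ?k q ?c4"
      unfolding B.leib[OF y y'] is_linearD(2)[OF cl_r[OF d(7) xx] y12(1) B.k_in[OF y12(2)]]
        lin_koszul[OF cl_r[OF d(7) xx] B.mod modQm y12(2)] ..
    have i1: "sg (p + p' - 1) (diff A (p + p') ?xx) (q + q') ?yy \<in> carrier (G ?N)" "sg (p + p') ?xx (q + q' - 1) (diff B (q + q') ?yy) \<in> carrier (G ?N)"
      using sg_in[OF A.d_in[OF xx] yy d(6)] sg_in[OF xx B.d_in[OF yy] d(7)] .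
    have L: "cl ?N (diff FT (m + n) (gmult FT m n (single K u) (single K v))) =
       ?k (q * p') ((?c1 \<oplus>\<^bsub>Qm ?N\<^esub> ?k p ?c2) \<oplus>\<^bsub>Qm ?N\<^esub> ?k (p + p') (?c3 \<oplus>\<^bsub>Qm ?N\<^esub> ?k q ?c4))"
      unfolding u'(1) v'(1) mT_s[OF x y u'(2) x' y' v'(2)] lin_koszul[OF is_linear_comp[OF dT_lin cl_linear] modG modQm w] dT_s[OF xx yy d(1)]
        is_linearD(2)[OF cl_linear i1(1) G.koszul_closed[OF i1(2)]] lin_koszul[OF cl_linear modG modQm i1(2)] dw1 dw2 ..
    note s1 = sg_in[OF dx y d(2)] and s2 = sg_in[OF x dy d(3)] and s' = sg_in[OF x' y' v'(2)]
    have R1: "cl ?N (gmult FT (m - 1) n (diff FT m (single K u)) (single K v)) = ?k (q * p') ?c1 \<oplus>\<^bsub>Qm ?N\<^esub> ?k p (?k ((q - 1) * p') ?c3)"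
      unfolding u'(1) v'(1) dT_s[OF x y u'(2)]
        is_linearD(2)[OF is_linear_comp[OF l(1)[OF s'] cl_linear] s1 kmod.koszul_closed[OF kmodG s2]]
        lin_koszul[OF is_linear_comp[OF l(1)[OF s'] cl_linear] modG modQm s2]
        mT_s_cl[OF dx y d(2) x' y' v'(2), unfolded e ip] mT_s_cl[OF x dy d(3) x' y' v'(2), unfolded e ip] ..
    note s1' = sg_in[OF dx' y' d(4)] and s2' = sg_in[OF x' dy' d(5)] and s = sg_in[OF x y u'(2)]
    have R2: "cl ?N (gmult FT m (n - 1) (single K u) (diff FT n (single K v))) = ?k (q * (p' - 1)) ?c2 \<oplus>\<^bsub>Qm ?N\<^esub> ?k p' (?k (q * p') ?c4)"
      unfolding u'(1) v'(1) dT_s[OF x' y' v'(2)]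
        is_linearD(2)[OF is_linear_comp[OF l(4)[OF s] cl_linear] s1' kmod.koszul_closed[OF kmodG s2']]
        lin_koszul[OF is_linear_comp[OF l(4)[OF s] cl_linear] modG modQm s2']
        mT_s_cl[OF x y u'(2) dx' y' d(4), unfolded e ip] mT_s_cl[OF x y u'(2) x' dy' d(5), unfolded e ip] ..
    have i2: "gmult FT (m - 1) n (diff FT m (single K u)) (single K v) \<in> carrier (G ?N)" "gmult FT m (n - 1) (single K u) (diff FT n (single K v)) \<in> carrier (G ?N)"
      using mT_in[OF dT_in[OF single_closed[OF u]] single_closed[OF v]] mT_in[OF single_closed[OF u] dT_in[OF single_closed[OF v]]] unfolding e .
    have k2: "?k (q * p' + p) ?c2 = ?k (m + q * (p' - 1)) ?c2" "?k (q * p' + (p + p')) ?c3 = ?k (p + (q - 1) * p') ?c3"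
       "?k (q * p' + (p + p' + q)) ?c4 = ?k (m + (p' + q * p')) ?c4"
      by (rule A.koszul_cong; simp add: algebra_simps flip: u'(2))+
    have "cl ?N (diff FT (m + n) (gmult FT m n (single K u) (single K v))) =
      ?k (q * p') ?c1 \<oplus>\<^bsub>Qm ?N\<^esub> ?k (m + q * (p' - 1)) ?c2 \<oplus>\<^bsub>Qm ?N\<^esub> (?k (p + (q - 1) * p') ?c3 \<oplus>\<^bsub>Qm ?N\<^esub> ?k (m + (p' + q * p')) ?c4)"
      unfolding L k2[symmetric] using c by (simp add: Q.koszul_add Q.koszul_koszul add.assoc del: quot_module_sel)
    also have "\<dots> = (?k (q * p') ?c1 \<oplus>\<^bsub>Qm ?N\<^esub> ?k (p + (q - 1) * p') ?c3) \<oplus>\<^bsub>Qm ?N\<^esub> (?k (m + q * (p' - 1)) ?c2 \<oplus>\<^bsub>Qm ?N\<^esub> ?k (m + (p' + q * p')) ?c4)"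
      using c by (simp add: Q.M.a_ac del: quot_module_sel)
    also have "\<dots> = cl ?N (gmult FT (m - 1) n (diff FT m (single K u)) (single K v) \<oplus>\<^bsub>G ?N\<^esub> koszul (G ?N) m (gmult FT m (n - 1) (single K u) (diff FT n (single K v))))"
      unfolding is_linearD(2)[OF cl_linear i2(1) G.koszul_closed[OF i2(2)]] lin_koszul[OF cl_linear modG modQm i2(2)] R1 R2
      using c by (simp add: Q.koszul_add Q.koszul_koszul del: quot_module_sel)
    finally show "cl ?N (diff FT (m + n) (gmult FT m n (single K u) (single K v))) =
       cl ?N (gmult FT (m - 1) n (diff FT m (single K u)) (single K v) \<oplus>\<^bsub>G ?N\<^esub> koszul (G ?N) m (gmult FT m (n - 1) (single K u) (diff FT n (single K v))))" .
  qed
qed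

lemma Q_linI:
  assumes "\<And>c. c \<in> carrier (G n) \<Longrightarrow> Fn (cl n c) = cl m (f c)" "is_linear K (G n) (G m) f"
  shows "is_linear K (Qm n) (Qm m) Fn"
proof (rule is_linearI)
  interpret G: kmod K "G n" by (rule kmodG)
  have l: "is_linear K (G n) (Qm m) (\<lambda>c. Fn (cl n c))"
    using is_linear_comp[OF assms(2) cl_linear] assms(1) G.M.a_closed G.smult_closed 
    by (auto simp: is_linear_def simp del: free_sel quot_module_sel)
  fix X Y assume "X \<in> carrier (Qm n)" "Y \<in> carrier (Qm n)"
  then obtain c d where cd: "c \<in> carrier (G n)" "X = cl n c" "d \<in> carrier (G n)" "Y = cl n d" by (elim Q_E)
  show "Fn X \<in> carrier (Qm m)" using is_linearD(1)[OF l cd(1)] cd by simp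
  show "Fn (X \<oplus>\<^bsub>Qm n\<^esub> Y) = Fn X \<oplus>\<^bsub>Qm m\<^esub> Fn Y"
    unfolding cd(2,4) is_linearD(2)[OF cl_linear cd(1,3), symmetric] using is_linearD(2)[OF l cd(1,3)] .
next
  interpret G: kmod K "G n" by (rule kmodG)
  have l: "is_linear K (G n) (Qm m) (\<lambda>c. Fn (cl n c))"
    using is_linear_comp[OF assms(2) cl_linear] assms(1) G.M.a_closed G.smult_closed 
    by (auto simp: is_linear_def simp del: free_sel quot_module_sel)
  fix a X assume a: "a \<in> carrier K" and "X \<in> carrier (Qm n)"
  then obtain c where c: "c \<in> carrier (G n)" "X = cl n c" by (elim Q_E)
  show "Fn (a \<odot>\<^bsub>Qm n\<^esub> X) = a \<odot>\<^bsub>Qm m\<^esub> Fn X"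
    unfolding c(2) is_linearD(3)[OF cl_linear a c(1), symmetric] using is_linearD(3)[OF l a c(1)] .
qed

lemma T_dga: "dga K T"
proof (intro dga.intro dga_axioms.intro chain_complex.intro chain_complex_axioms.intro field_axioms; (simp only: T_cmp)?)
  show "is_linear K (Qm n) (Qm (n - 1)) (diff T n)" for n by (rule Q_linI[OF T_d dT_lin])
  show "is_linear K (Qm m) (Qm (m + n)) (\<lambda>X. gmult T m n X Y)" if "Y \<in> carrier (Qm n)" for Y m n
    using that by (elim Q_E, simp only:) (rule Q_linI[OF T_m mT_l])
  show "is_linear K (Qm n) (Qm (m + n)) (gmult T m n X)" if "X \<in> carrier (Qm m)" for X m n
    using that by (elim Q_E, simp only:) (rule Q_linI[OF T_m mT_r])
  show "gone T \<in> carrier (Qm 0)" unfolding T_1 by (rule cl_in[OF one_G])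
  show "gmult T 0 n (gone T) X = X" if "X \<in> carrier (Qm n)" for X n
    using that by (rule Q_E) (use T_m[OF one_G, of _ n] G_one_l in \<open>simp add: T_1\<close>)
  show "gmult T n 0 X (gone T) = X" if "X \<in> carrier (Qm n)" for X n
    using that by (rule Q_E) (use T_m[OF _ one_G, of _ n] G_one_r in \<open>simp add: T_1\<close>)
  show "gmult T (m + n) p (gmult T m n X Y) Z = gmult T m (n + p) X (gmult T n p Y Z)"
    if XYZ: "X \<in> carrier (Qm m)" "Y \<in> carrier (Qm n)" "Z \<in> carrier (Qm p)" for X Y Z m n p
  proof -
    obtain x y z where x: "x \<in> carrier (G m)" "X = cl m x" and y: "y \<in> carrier (G n)" "Y = cl n y" and z: "z \<in> carrier (G p)" "Z = cl p z"
      using XYZ by (elim Q_E)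
    show ?thesis unfolding x(2) y(2) z(2) T_m[OF x(1) y(1)] T_m[OF y(1) z(1)] T_m[OF mT_in[OF x(1) y(1)] z(1)] T_m[OF x(1) mT_in[OF y(1) z(1)]]
      G_assoc[OF x(1) y(1) z(1)] add.assoc ..
  qed
  show "diff T (n - 1) (diff T n X) = \<zero>\<^bsub>Qm (n - 2)\<^esub>" if X: "X \<in> carrier (Qm n)" for X n
  proof -
    obtain x where x: "x \<in> carrier (G n)" "X = cl n x" using X by (elim Q_E)
    have "n - 1 - 1 = n - 2" by simp
    then show ?thesis using T_d[OF dT_in[OF x(1)]] T_d[OF x(1)] G_dd[OF x(1)] unfolding x(2) by simp
  qed
  show "diff T (m + n) (gmult T m n X Y) = gmult T (m - 1) n (diff T m X) Y \<oplus>\<^bsub>Qm (m + n - 1)\<^esub>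
      koszul (Qm (m + n - 1)) m (gmult T m (n - 1) X (diff T n Y))"
    if XY: "X \<in> carrier (Qm m)" "Y \<in> carrier (Qm n)" for X Y m n
  proof -
    obtain x y where x: "x \<in> carrier (G m)" "X = cl m x" and y: "y \<in> carrier (G n)" "Y = cl n y" using XY by (elim Q_E)
    have e: "m - 1 + n = m + n - 1" "m + (n - 1) = m + n - 1" by auto
    have i: "gmult FT (m - 1) n (diff FT m x) y \<in> carrier (G (m + n - 1))" "gmult FT m (n - 1) x (diff FT n y) \<in> carrier (G (m + n - 1))"
      using mT_in[OF dT_in[OF x(1)] y(1)] mT_in[OF x(1) dT_in[OF y(1)]] unfolding e .
    show ?thesis unfolding x(2) y(2) T_m[OF x(1) y(1)] T_d[OF x(1)] T_d[OF y(1)] T_d[OF mT_in[OF x(1) y(1)]]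
      T_m[OF dT_in[OF x(1)] y(1)] T_m[OF x(1) dT_in[OF y(1)]] G_leib[OF x(1) y(1)] e
      is_linearD(2)[OF cl_linear i(1) kmod.koszul_closed[OF kmodG i(2)]] lin_koszul[OF cl_linear modG modQm i(2)] ..
  qed
qed (fact modQm)+

end

theorem tensor_is_dga:
  assumes "dga K A" "dga K B"
  shows "dga K (tensor_dga K A B)"
proof -
  have "field K" using assms(1) by (simp add: dga_def chain_complex_def)
  then interpret tens K A B using assms by (intro tens.intro)
  show ?thesis by (rule T_dga)
qed


subsection \<open>Graded endomorphisms\<close>

locale endo = chain_complex K V for K :: "('k, 'r) ring_scheme" (structure) and V :: "('k, 'v) complex_rec"
begin

abbreviation "En \<equiv> End_module K V"
abbreviation "kv n i \<equiv> koszul (cmp V n) i"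

lemma kmodV: "kmod K (cmp V n)" using module_cmp by (simp add: kmod_def)
lemma Va: "x \<in> elts V n \<Longrightarrow> y \<in> elts V n \<Longrightarrow> x \<oplus>\<^bsub>cmp V n\<^esub> y \<in> elts V n"
  using module_cmp[of n] by (meson abelian_group.axioms(1) abelian_monoid.a_closed module.axioms(2))
lemma Vs: "a \<in> carrier K \<Longrightarrow> x \<in> elts V n \<Longrightarrow> a \<odot>\<^bsub>cmp V n\<^esub> x \<in> elts V n"
  using module_cmp[of n] by (meson module.smult_closed)
lemma Vd: "x \<in> elts V n \<Longrightarrow> diff V n x \<in> elts V (n - 1)"
  using is_linearD(1)[OF diff_linear] by blast

lemma E_sel [simp]:
  "\<zero>\<^bsub>En n\<^esub> = (\<lambda>p. \<lambda>x\<in>elts V p. \<zero>\<^bsub>cmp V (p + n)\<^esub>)"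
  "f \<oplus>\<^bsub>En n\<^esub> g = (\<lambda>p. \<lambda>x\<in>elts V p. f p x \<oplus>\<^bsub>cmp V (p + n)\<^esub> g p x)"
  "a \<odot>\<^bsub>En n\<^esub> f = (\<lambda>p. \<lambda>x\<in>elts V p. a \<odot>\<^bsub>cmp V (p + n)\<^esub> f p x)"
  by (simp_all add: End_module_def)

lemma E_iff: "f \<in> carrier (En n) \<longleftrightarrow> (\<forall>p. f p \<in> extensional (elts V p) \<and> is_linear K (cmp V p) (cmp V (p + n)) (f p))"
  by (simp add: End_module_def lin_hom_def)

lemma is_linear_restrict: "module K M \<Longrightarrow> is_linear K M N f \<Longrightarrow> is_linear K M N (restrict f (carrier M))"
  by (simp add: is_linear_def Pi_def)
    (meson abelian_group.axioms(1) abelian_monoid.a_closed module.axioms(2) module.smult_closed)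

lemma E_I: "(\<And>p. is_linear K (cmp V p) (cmp V (p + n)) (f p)) \<Longrightarrow> (\<lambda>p. restrict (f p) (elts V p)) \<in> carrier (En n)"
  unfolding E_iff by (intro allI conjI restrict_extensional is_linear_restrict module_cmp)

lemma E_lin: "f \<in> carrier (En n) \<Longrightarrow> is_linear K (cmp V p) (cmp V (p + n)) (f p)"
  by (simp add: E_iff)
lemma E_in: "f \<in> carrier (En n) \<Longrightarrow> x \<in> elts V p \<Longrightarrow> f p x \<in> elts V (p + n)"
  using is_linearD(1)[OF E_lin] by blast

lemma E_eq:
  assumes "f \<in> carrier (En n)" "g \<in> carrier (En m)" "\<And>p x. x \<in> elts V p \<Longrightarrow> f p x = g p x"
  shows "f = g"
proof
  fix p
  show "f p = g p" by (rule extensionalityI[of _ "elts V p"]) (use assms in \<open>auto simp: E_iff\<close>)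
qed

lemma E_add: "f \<in> carrier (En n) \<Longrightarrow> g \<in> carrier (En n) \<Longrightarrow> f \<oplus>\<^bsub>En n\<^esub> g \<in> carrier (En n)"
  unfolding E_sel by (intro E_I kmod.is_linear_add[OF kmodV] E_lin)
lemma E_smult: "a \<in> carrier K \<Longrightarrow> g \<in> carrier (En n) \<Longrightarrow> a \<odot>\<^bsub>En n\<^esub> g \<in> carrier (En n)"
  unfolding E_sel by (intro E_I kmod.is_linear_smult[OF kmodV] E_lin)
lemma E_zero: "\<zero>\<^bsub>En n\<^esub> \<in> carrier (En n)"
  unfolding E_sel by (intro E_I kmod.is_linear_zero[OF kmodV] module_cmp)

lemma E_mod: "module K (En n)"
proof -
  have ag: "abelian_group (En n)"
  proof (rule abelian_groupI)
    fix f g assume f: "f \<in> carrier (En n)" and g: "g \<in> carrier (En n)"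
    show "f \<oplus>\<^bsub>En n\<^esub> g \<in> carrier (En n)" by (rule E_add[OF f g])
    show "f \<oplus>\<^bsub>En n\<^esub> g = g \<oplus>\<^bsub>En n\<^esub> f"
    proof (rule E_eq[OF E_add[OF f g] E_add[OF g f]])
      fix p x assume x: "x \<in> elts V p"
      interpret M: module K "cmp V (p + n)" by (rule module_cmp)
      show "(f \<oplus>\<^bsub>En n\<^esub> g) p x = (g \<oplus>\<^bsub>En n\<^esub> f) p x"
        using x M.M.a_comm[OF E_in[OF f x] E_in[OF g x]] by simp
    qed
    fix h assume h: "h \<in> carrier (En n)"
    show "f \<oplus>\<^bsub>En n\<^esub> g \<oplus>\<^bsub>En n\<^esub> h = f \<oplus>\<^bsub>En n\<^esub> (g \<oplus>\<^bsub>En n\<^esub> h)"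
    proof (rule E_eq[OF E_add[OF E_add[OF f g] h] E_add[OF f E_add[OF g h]]])
      fix p x assume x: "x \<in> elts V p"
      interpret M: module K "cmp V (p + n)" by (rule module_cmp)
      show "(f \<oplus>\<^bsub>En n\<^esub> g \<oplus>\<^bsub>En n\<^esub> h) p x = (f \<oplus>\<^bsub>En n\<^esub> (g \<oplus>\<^bsub>En n\<^esub> h)) p x"
        using x M.M.a_assoc[OF E_in[OF f x] E_in[OF g x] E_in[OF h x]] by simp
    qed
  next
    fix f assume f: "f \<in> carrier (En n)"
    show "\<zero>\<^bsub>En n\<^esub> \<oplus>\<^bsub>En n\<^esub> f = f"
    proof (rule E_eq[OF E_add[OF E_zero f] f])
      fix p x assume x: "x \<in> elts V p"
      interpret M: module K "cmp V (p + n)" by (rule module_cmp)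
      show "(\<zero>\<^bsub>En n\<^esub> \<oplus>\<^bsub>En n\<^esub> f) p x = f p x" using x E_in[OF f x] by simp
    qed
    have m: "\<ominus> \<one> \<in> carrier K" by simp
    show "\<exists>g\<in>carrier (En n). g \<oplus>\<^bsub>En n\<^esub> f = \<zero>\<^bsub>En n\<^esub>"
    proof (rule bexI[OF _ E_smult[OF m f]], rule E_eq[OF E_add[OF E_smult[OF m f] f] E_zero])
      fix p x assume x: "x \<in> elts V p"
      interpret M: module K "cmp V (p + n)" by (rule module_cmp)
      show "((\<ominus> \<one>) \<odot>\<^bsub>En n\<^esub> f \<oplus>\<^bsub>En n\<^esub> f) p x = \<zero>\<^bsub>En n\<^esub> p x"
        using x E_in[OF f x] by (simp add: M.smult_l_minus M.M.l_neg)
    qed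
  qed (rule E_zero)
  show ?thesis
  proof (rule moduleI[OF cring_axioms ag])
    fix a b f g assume a: "a \<in> carrier K" and b: "b \<in> carrier K" and f: "f \<in> carrier (En n)" and g: "g \<in> carrier (En n)"
    show "(a \<oplus> b) \<odot>\<^bsub>En n\<^esub> f = a \<odot>\<^bsub>En n\<^esub> f \<oplus>\<^bsub>En n\<^esub> b \<odot>\<^bsub>En n\<^esub> f"
      by (auto simp: fun_eq_iff module.smult_l_distr[OF module_cmp a b E_in[OF f]])
    show "a \<otimes> b \<odot>\<^bsub>En n\<^esub> f = a \<odot>\<^bsub>En n\<^esub> (b \<odot>\<^bsub>En n\<^esub> f)"
      by (auto simp: fun_eq_iff module.smult_assoc1[OF module_cmp a b E_in[OF f]])
    show "a \<odot>\<^bsub>En n\<^esub> (f \<oplus>\<^bsub>En n\<^esub> g) = a \<odot>\<^bsub>En n\<^esub> f \<oplus>\<^bsub>En n\<^esub> a \<odot>\<^bsub>En n\<^esub> g"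
      by (auto simp: fun_eq_iff module.smult_r_distr[OF module_cmp a E_in[OF f] E_in[OF g]])
  next
    fix f assume f: "f \<in> carrier (En n)"
    have o: "\<one> \<in> carrier K" by simp
    show "\<one> \<odot>\<^bsub>En n\<^esub> f = f"
      by (rule E_eq[OF E_smult[OF o f] f]) (simp add: module.smult_one[OF module_cmp E_in[OF f]])
  qed (rule E_smult)
qed

lemma ev_lin: "x \<in> elts V p \<Longrightarrow> is_linear K (En n) (cmp V (p + n)) (\<lambda>f. f p x)"
  by (rule is_linearI) (auto simp: E_in)

lemma E_koszul: "f \<in> carrier (En n) \<Longrightarrow> x \<in> elts V p \<Longrightarrow> koszul (En n) i f p x = kv (p + n) i (f p x)"
  using lin_koszul[OF ev_lin E_mod module_cmp] .

abbreviation "EV \<equiv> End_dga K V"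

lemma EV_sel: "cmp EV = En" "gone EV = (\<lambda>p. \<lambda>x\<in>elts V p. x)" "gmult EV m n f g = (\<lambda>p. compose (elts V p) (f (p + n)) (g p))"
  "diff EV n f = (\<lambda>p. \<lambda>x\<in>elts V p. diff V (p + n) (f p x) \<ominus>\<^bsub>cmp V (p + n - 1)\<^esub> kv (p + n - 1) n (f (p - 1) (diff V p x)))"
  by (simp_all add: End_dga_def)

lemma E_mult: assumes f: "f \<in> carrier (En m)" and g: "g \<in> carrier (En n)" shows "gmult EV m n f g \<in> carrier (En (m + n))"
proof -
  have "is_linear K (cmp V p) (cmp V (p + (m + n))) (\<lambda>x. f (p + n) (g p x))" for p
    using is_linear_comp[OF E_lin[OF g, of p] E_lin[OF f, of "p + n"]] by (simp add: ac_simps)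
  then show ?thesis unfolding EV_sel compose_def by (rule E_I)
qed

lemma E_d: assumes f: "f \<in> carrier (En n)" shows "diff EV n f \<in> carrier (En (n - 1))"
proof -
  have "is_linear K (cmp V p) (cmp V (p + (n - 1))) (\<lambda>x. diff V (p + n) (f p x) \<ominus>\<^bsub>cmp V (p + n - 1)\<^esub> kv (p + n - 1) n (f (p - 1) (diff V p x)))" for p
  proof -
    interpret M: kmod K "cmp V (p + n - 1)" by (rule kmodV)
    have 1: "is_linear K (cmp V p) (cmp V (p + n - 1)) (\<lambda>x. diff V (p + n) (f p x))"
      using is_linear_comp[OF E_lin[OF f] diff_linear] .
    have 2: "is_linear K (cmp V p) (cmp V (p + n - 1)) (\<lambda>x. f (p - 1) (diff V p x))"
      using is_linear_comp[OF diff_linear E_lin[OF f, of "p - 1"]] by (simp add: algebra_simps)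
    have 3: "kv (p + n - 1) 1 = a_inv (cmp V (p + n - 1))" by (simp add: koszul_def fun_eq_iff)
    show ?thesis
      using M.is_linear_add[OF 1 M.is_linear_koszul[OF M.is_linear_koszul[OF 2], of 1 n]]
      unfolding 3 a_minus_def by (simp add: add_diff_eq)
  qed
  then show ?thesis unfolding EV_sel by (rule E_I)
qed

lemma mult_ap: "x \<in> elts V p \<Longrightarrow> gmult EV m n f g p x = f (p + n) (g p x)"
  by (simp add: EV_sel compose_def)
lemma d_ap: "x \<in> elts V p \<Longrightarrow> diff EV n f p x = diff V (p + n) (f p x) \<ominus>\<^bsub>cmp V (p + n - 1)\<^esub> kv (p + n - 1) n (f (p - 1) (diff V p x))"
  by (simp add: EV_sel)

lemma E_one: "gone EV \<in> carrier (En 0)"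
  unfolding EV_sel by (rule E_I) (auto simp: is_linear_def)

lemma E_linI:
  assumes "\<And>f. f \<in> carrier (En n) \<Longrightarrow> F f \<in> carrier (En m)"
    "\<And>p x. x \<in> elts V p \<Longrightarrow> is_linear K (En n) (cmp V (p + m)) (\<lambda>f. F f p x)"
  shows "is_linear K (En n) (En m) F"
proof (rule is_linearI)
  fix f g assume fg: "f \<in> carrier (En n)" "g \<in> carrier (En n)"
  show "F (f \<oplus>\<^bsub>En n\<^esub> g) = F f \<oplus>\<^bsub>En m\<^esub> F g"
  proof (rule E_eq[OF assms(1)[OF E_add[OF fg]] E_add[OF assms(1)[OF fg(1)] assms(1)[OF fg(2)]]])
    fix p x assume x: "x \<in> elts V p"
    show "F (f \<oplus>\<^bsub>En n\<^esub> g) p x = (F f \<oplus>\<^bsub>En m\<^esub> F g) p x"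
      using is_linearD(2)[OF assms(2)[OF x] fg] x by (simp only: E_sel restrict_apply if_True)
  qed
next
  fix a f assume a: "a \<in> carrier K" and f: "f \<in> carrier (En n)"
  show "F (a \<odot>\<^bsub>En n\<^esub> f) = a \<odot>\<^bsub>En m\<^esub> F f"
  proof (rule E_eq[OF assms(1)[OF E_smult[OF a f]] E_smult[OF a assms(1)[OF f]]])
    fix p x assume x: "x \<in> elts V p"
    show "F (a \<odot>\<^bsub>En n\<^esub> f) p x = (a \<odot>\<^bsub>En m\<^esub> F f) p x"
      using is_linearD(3)[OF assms(2)[OF x] a f] x by (simp only: E_sel restrict_apply if_True)
  qed
qed (rule assms(1))

lemma End_is_dga: "dga K EV"
proof (intro dga.intro dga_axioms.intro chain_complex.intro chain_complex_axioms.intro field_axioms; (simp only: EV_sel(1))?)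
  show "is_linear K (En n) (En (n - 1)) (diff EV n)" for n
  proof (rule E_linI[OF E_d])
    fix p x assume x: "x \<in> elts V p"
    interpret M: kmod K "cmp V (p + n - 1)" by (rule kmodV)
    have 1: "is_linear K (En n) (cmp V (p + n - 1)) (\<lambda>f. diff V (p + n) (f p x))"
      using is_linear_comp[OF ev_lin[OF x] diff_linear] .
    have 2: "is_linear K (En n) (cmp V (p + n - 1)) (\<lambda>f. f (p - 1) (diff V p x))"
      using ev_lin[OF Vd[OF x], of n] by (simp add: algebra_simps)
    have 3: "kv (p + n - 1) 1 = a_inv (cmp V (p + n - 1))" by (simp add: koszul_def fun_eq_iff)
    show "is_linear K (En n) (cmp V (p + (n - 1))) (\<lambda>f. diff EV n f p x)"
      using M.is_linear_add[OF 1 M.is_linear_koszul[OF M.is_linear_koszul[OF 2], of 1 n]] x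
      unfolding 3 d_ap[OF x] a_minus_def by (simp add: add_diff_eq)
  qed
  show "is_linear K (En m) (En (m + n)) (\<lambda>f. gmult EV m n f g)" if g: "g \<in> carrier (En n)" for g n m
  proof (rule E_linI[OF E_mult[OF _ g]])
    fix p x assume x: "x \<in> elts V p"
    show "is_linear K (En m) (cmp V (p + (m + n))) (\<lambda>f. gmult EV m n f g p x)"
      using ev_lin[OF E_in[OF g x], of m] unfolding mult_ap[OF x] by (simp add: ac_simps)
  qed
  show "is_linear K (En n) (En (m + n)) (gmult EV m n f)" if f: "f \<in> carrier (En m)" for f n m
  proof (rule E_linI[OF E_mult[OF f]])
    fix p x assume x: "x \<in> elts V p"
    show "is_linear K (En n) (cmp V (p + (m + n))) (\<lambda>g. gmult EV m n f g p x)"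
      using is_linear_comp[OF ev_lin[OF x] E_lin[OF f], of n] unfolding mult_ap[OF x] by (simp add: ac_simps)
  qed
  show "gmult EV (m + n) r (gmult EV m n f g) h = gmult EV m (n + r) f (gmult EV n r g h)"
    if f: "f \<in> carrier (En m)" "g \<in> carrier (En n)" "h \<in> carrier (En r)" for f g h m n r
    by (rule E_eq[OF E_mult[OF E_mult[OF f(1,2)] f(3)] E_mult[OF f(1) E_mult[OF f(2,3)]]])
      (simp add: mult_ap E_in[OF f(3)] ac_simps)
  show "gmult EV 0 n (gone EV) f = f" if f: "f \<in> carrier (En n)" for f n
    using E_mult[OF E_one f] f by (intro E_eq[of _ "0 + n" _ n]) (auto simp: compose_def E_in[OF f] EV_sel)
  show "gmult EV n 0 f (gone EV) = f" if f: "f \<in> carrier (En n)" for f n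
    using E_mult[OF f E_one] f by (intro E_eq[of _ "n + 0" _ n]) (auto simp: compose_def E_in[OF f] EV_sel)
  show "diff EV (n - 1) (diff EV n f) = \<zero>\<^bsub>En (n - 2)\<^esub>" if f: "f \<in> carrier (En n)" for f n
  proof (rule E_eq[OF E_d[OF E_d[OF f]] E_zero])
    fix p x assume x: "x \<in> elts V p"
    let ?N = "p + n - 2"
    interpret N: kmod K "cmp V ?N" by (rule kmodV)
    interpret N1: kmod K "cmp V (p + n - 1)" by (rule kmodV)
    have eq: "p + (n - 1) = p + n - 1" "p - 1 + n = p + n - 1" "p - 1 - 1 = p - 2" "p + n - 1 - 1 = ?N" "p - 1 + n - 1 = ?N" "p - 2 + n = ?N" "p + (n - 2) = ?N" by auto
    let ?a = "f (p - 1) (diff V p x)"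
    have i: "f p x \<in> elts V (p + n)" "?a \<in> elts V (p + n - 1)" "diff V (p + n) (f p x) \<in> elts V (p + n - 1)"
      using E_in[OF f x] E_in[OF f Vd[OF x]] Vd[OF E_in[OF f x]] by (simp_all only: eq)
    have ia: "diff V (p + n - 1) ?a \<in> elts V ?N" using Vd[OF i(2)] by (simp only: eq)
    have 1: "diff EV n f p x = diff V (p + n) (f p x) \<ominus>\<^bsub>cmp V (p + n - 1)\<^esub> kv (p + n - 1) n ?a" by (rule d_ap[OF x])
    have 2: "diff EV n f (p - 1) (diff V p x) = diff V (p + n - 1) ?a"
    proof -
      interpret P2: module K "cmp V (p - 2)" by (rule module_cmp)
      have "f (p - 2) (diff V (p - 1) (diff V p x)) = \<zero>\<^bsub>cmp V ?N\<^esub>"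
        using lin_zero[OF E_lin[OF f, of "p - 2"] module_cmp module_cmp] diff_diff[OF x] by (simp only: eq)
      then show ?thesis using d_ap[OF Vd[OF x], of n f] ia
        unfolding eq by (simp add: a_minus_def N.M.minus_equality[of "\<zero>\<^bsub>cmp V ?N\<^esub>" "\<zero>\<^bsub>cmp V ?N\<^esub>"])
    qed
    have l: "is_linear K (cmp V (p + n - 1)) (cmp V ?N) (diff V (p + n - 1))"
      using diff_linear[of "p + n - 1"] unfolding eq .
    have 3: "diff V (p + n - 1) (diff EV n f p x) = \<zero>\<^bsub>cmp V ?N\<^esub> \<ominus>\<^bsub>cmp V ?N\<^esub> kv ?N n (diff V (p + n - 1) ?a)"
      unfolding 1 using lin_minus[OF l module_cmp module_cmp i(3) N1.koszul_closed[OF i(2)]] lin_koszul[OF l module_cmp module_cmp i(2)] diff_diff[OF i(1)] by simp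
    have "diff EV (n - 1) (diff EV n f) p x = diff V (p + n - 1) (diff EV n f p x) \<ominus>\<^bsub>cmp V ?N\<^esub> kv ?N (n - 1) (diff V (p + n - 1) ?a)"
      using d_ap[OF x, of "n - 1" "diff EV n f"] unfolding eq 2 .
    also have "\<dots> = \<zero>\<^bsub>cmp V ?N\<^esub>"
      unfolding 3 using ia by (simp add: koszul_def a_minus_def N.M.l_neg N.M.r_neg)
    finally show "diff EV (n - 1) (diff EV n f) p x = \<zero>\<^bsub>En (n - 2)\<^esub> p x" using x by (simp add: eq)
  qed
  show "diff EV (m + n) (gmult EV m n f g) = gmult EV (m - 1) n (diff EV m f) g \<oplus>\<^bsub>En (m + n - 1)\<^esub>
          koszul (En (m + n - 1)) m (gmult EV m (n - 1) f (diff EV n g))"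
    if f: "f \<in> carrier (En m)" and g: "g \<in> carrier (En n)" for f g m n
  proof -
    have eq0: "m - 1 + n = m + n - 1" "m + (n - 1) = m + n - 1" by auto
    have c1: "gmult EV (m - 1) n (diff EV m f) g \<in> carrier (En (m + n - 1))" and c2: "gmult EV m (n - 1) f (diff EV n g) \<in> carrier (En (m + n - 1))"
      using E_mult[OF E_d[OF f] g] E_mult[OF f E_d[OF g]] unfolding eq0 .
    show ?thesis
    proof (rule E_eq[OF E_d[OF E_mult[OF f g]] E_add[OF c1 kmod.koszul_closed[OF kmod.intro[OF E_mod] c2]]])
      fix p x assume x: "x \<in> elts V p"
      let ?N = "p + m + n - 1"
      interpret N: kmod K "cmp V ?N" by (rule kmodV)
      interpret N2: kmod K "cmp V (p + n - 1)" by (rule kmodV)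
      have eq: "p + (m + n) = p + m + n" "p + n + m = p + m + n" "p + (m + n - 1) = ?N" "p - 1 + n = p + n - 1" "p + n - 1 + m = ?N"
         "p + (n - 1) = p + n - 1" by auto
      let ?A = "diff V (p + m + n) (f (p + n) (g p x))" and ?B = "f (p + n - 1) (diff V (p + n) (g p x))"
      let ?C = "f (p + n - 1) (g (p - 1) (diff V p x))"
      note gx = E_in[OF g x] and dx = Vd[OF x]
      have i: "?A \<in> elts V ?N" "?B \<in> elts V ?N" "?C \<in> elts V ?N"
        using Vd[OF E_in[OF f gx]] E_in[OF f Vd[OF gx]] E_in[OF f E_in[OF g dx]] unfolding eq by auto
      have j: "diff V (p + n) (g p x) \<in> elts V (p + n - 1)" "g (p - 1) (diff V p x) \<in> elts V (p + n - 1)"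
        using Vd[OF gx] E_in[OF g dx] unfolding eq by auto
      have L: "diff EV (m + n) (gmult EV m n f g) p x = ?A \<ominus>\<^bsub>cmp V ?N\<^esub> kv ?N (m + n) ?C"
        using d_ap[OF x, of "m + n" "gmult EV m n f g"] mult_ap[OF x, of m n f g] mult_ap[OF dx, of m n f g] unfolding eq by simp
      have R1: "gmult EV (m - 1) n (diff EV m f) g p x = ?A \<ominus>\<^bsub>cmp V ?N\<^esub> kv ?N m ?B"
        using mult_ap[OF x, of "m - 1" n "diff EV m f" g] d_ap[OF gx, of m f] unfolding eq by simp
      have lf: "is_linear K (cmp V (p + n - 1)) (cmp V ?N) (f (p + n - 1))"
        using E_lin[OF f, of "p + n - 1"] unfolding eq .
      have R2: "gmult EV m (n - 1) f (diff EV n g) p x = ?B \<ominus>\<^bsub>cmp V ?N\<^esub> kv ?N n ?C"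
        using mult_ap[OF x, of m "n - 1" f "diff EV n g"] d_ap[OF x, of n g]
         lin_minus[OF lf module_cmp module_cmp j(1) N2.koszul_closed[OF j(2)]] lin_koszul[OF lf module_cmp module_cmp j(2)] unfolding eq by simp
      have km: "kv ?N m (?B \<ominus>\<^bsub>cmp V ?N\<^esub> kv ?N n ?C) = kv ?N m ?B \<ominus>\<^bsub>cmp V ?N\<^esub> kv ?N (m + n) ?C"
        using lin_minus[OF N.koszul_linear module_cmp module_cmp i(2) N.koszul_closed[OF i(3)]] N.koszul_koszul[OF i(3)] by simp
      have "(gmult EV (m - 1) n (diff EV m f) g \<oplus>\<^bsub>En (m + n - 1)\<^esub> koszul (En (m + n - 1)) m (gmult EV m (n - 1) f (diff EV n g))) p x
        = (?A \<ominus>\<^bsub>cmp V ?N\<^esub> kv ?N m ?B) \<oplus>\<^bsub>cmp V ?N\<^esub> (kv ?N m ?B \<ominus>\<^bsub>cmp V ?N\<^esub> kv ?N (m + n) ?C)"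
        using x R1 R2 km E_koszul[OF c2 x, of m] by (simp add: eq)
      also have "\<dots> = ?A \<ominus>\<^bsub>cmp V ?N\<^esub> kv ?N (m + n) ?C"
        using i by (simp add: a_minus_def N.M.a_assoc N.M.r_neg1)
      finally show "diff EV (m + n) (gmult EV m n f g) p x = (gmult EV (m - 1) n (diff EV m f) g \<oplus>\<^bsub>En (m + n - 1)\<^esub>
         koszul (En (m + n - 1)) m (gmult EV m (n - 1) f (diff EV n g))) p x" using L by simp
    qed
  qed
qed (fact E_mod E_one)+

end

theorem End_is_dga:
  assumes "chain_complex K V"
  shows "dga K (End_dga K V)"
  using endo.End_is_dga[OF endo.intro[OF assms]] .

theorem root_is_dga:
  assumes "chain_complex K V" "dga K S" "\<rho> \<in> dga_hom K S (End_dga K V)" "dga_under K S A \<alpha>"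
  shows "dga K (root_dga K S V \<rho> A \<alpha>)"
proof -
  interpret endo K V using assms(1) by (simp add: endo_def)
  interpret c: coprod_loc K S "End_dga K V" A \<rho> \<alpha>
    using assms End_is_dga field_axioms unfolding dga_under_def
    by (intro coprod_loc.intro coprod_loc_axioms.intro) auto
  interpret z: centralizer K "End_dga K V" "coprod_dga K S (End_dga K V) \<rho> A \<alpha>" "coprod_inl K S (End_dga K V) \<rho> A \<alpha>"
    by (intro centralizer.intro centralizer_axioms.intro End_is_dga field_axioms c.P_dga c.inl_hom)
  show ?thesis unfolding root_dga_def by (rule z.dgaZ)
qed

theorem rep_is_cdga:
  assumes "chain_complex K V" "dga K S" "\<rho> \<in> dga_hom K S (End_dga K V)" "dga_under K S A \<alpha>"
  shows "cdga K (rep_dga K S V \<rho> A \<alpha>)"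
  unfolding rep_dga_def by (rule abelianization_cdga[OF root_is_dga[OF assms]])

end

theory Submission
  imports Defs
begin

text \<open>A homogeneous basis of \<open>V\<close> turns \<open>E = End V\<close> into an algebra of graded matrices. The
  proof rests on one property of such algebras: for every morphism of DG algebras from \<open>E\<close> to
  \<open>D\<close>, with \<open>C\<close> the graded centralizer of its image, \<open>D\<close> is the graded tensor product of
  \<open>E\<close> and \<open>C\<close>. Two facts give this. The average $y \mapsto \sum_k \pm u_k y w_k$, where
  $\sum_k u_k \otimes w_k$ is the Casimir element of the matrix algebra, takes values in \<open>C\<close>
  (\<open>casimir_central\<close>, \<open>average_central\<close>); and every $x$ in \<open>D\<close> is the sum over $i, j$ of
  $u_i z_{ij} w_j$, where its matrix entry $z_{ij}$ in \<open>C\<close> is the average of $w_i x u_j$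
  (\<open>matrix_decomposition\<close>). Hence linear maps on \<open>D\<close> are determined by their values on the
  products $e z$ with $e$ in \<open>E\<close> and $z$ in \<open>C\<close> (\<open>linear_eq_on_products\<close>), and two morphisms
  from \<open>E\<close> and from \<open>C\<close> to a third DG algebra whose values commute in the graded sense extend
  to a morphism from \<open>D\<close> (\<open>pair_extends\<close>). The latter is the universal property of the tensor
  product, so that the inverse of the multiplication map never has to be written down.

  Let \<open>D\<close> be the coproduct of \<open>E\<close> and \<open>A\<close> under \<open>S\<close>, so that \<open>C\<close> is the root algebra. A
  morphism \<open>h\<close> from \<open>C\<close> to \<open>B\<close> gives the pair $e \mapsto e \otimes 1$,
  $z \mapsto 1 \otimes h(z)$, hence a morphism from \<open>D\<close> to $E \otimes B$, and its restriction
  to \<open>A\<close> is the map under \<open>S\<close> assigned to \<open>h\<close>. Conversely a map from \<open>A\<close> to $E \otimes B$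
  under \<open>S\<close> and $e \mapsto e \otimes 1$ together are a morphism on the coproduct \<open>D\<close>. It maps
  \<open>C\<close> into the centralizer of $E \otimes 1$ in $E \otimes B$, which by averaging is
  $1 \otimes B$ (\<open>centralizer_inl\<close>), and so restricts to a morphism \<open>h\<close>. The two constructions
  are inverse to each other because a morphism on \<open>D\<close> is determined on \<open>E\<close> and \<open>A\<close>, and also on
  \<open>E\<close> and \<open>C\<close>. Naturality in both variables is again a comparison on the products $e z$.

  The second bijection follows from the first: morphisms to a graded-commutative algebra kill
  commutators, hence factor uniquely through the abelianization.\<close>

section \<open>Linear maps and homomorphisms of DG algebras\<close>

lemma is_linear_cong:
  assumes "module K M" "is_linear K M N f" "\<And>x. x \<in> carrier M \<Longrightarrow> f x = g x"
  shows "is_linear K M N g"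
proof -
  interpret M: module K M by fact
  show ?thesis using assms(2,3) by (simp add: is_linear_def Pi_def)
qed

context kmod begin

text \<open>Sums over a module are only congruent when their terms lie in the carrier. This form takes
  the membership for the right-hand terms alone, as it is usually the simpler of the two.\<close>

lemma finsum_cong_terms:
  "(\<And>i. i \<in> I \<Longrightarrow> f i = g i) \<Longrightarrow> (\<And>i. i \<in> I \<Longrightarrow> g i \<in> carrier M) \<Longrightarrow>
    (\<Oplus>\<^bsub>M\<^esub>i\<in>I. f i) = (\<Oplus>\<^bsub>M\<^esub>i\<in>I. g i)"
  by (intro M.add.finprod_cong') auto

lemma finsum_in: "(\<And>i. i \<in> I \<Longrightarrow> f i \<in> carrier M) \<Longrightarrow> (\<Oplus>\<^bsub>M\<^esub>i\<in>I. f i) \<in> carrier M"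
  by (intro M.finsum_closed) auto

lemma finsum_swap:
  assumes "finite I" "finite J" "\<And>i j. i \<in> I \<Longrightarrow> j \<in> J \<Longrightarrow> f i j \<in> carrier M"
  shows "(\<Oplus>\<^bsub>M\<^esub>i\<in>I. \<Oplus>\<^bsub>M\<^esub>j\<in>J. f i j) = (\<Oplus>\<^bsub>M\<^esub>j\<in>J. \<Oplus>\<^bsub>M\<^esub>i\<in>I. f i j)"
  using assms(1,3)
proof (induction I)
  case empty
  then show ?case by simp
next
  case (insert i I)
  have "(\<Oplus>\<^bsub>M\<^esub>j\<in>J. \<Oplus>\<^bsub>M\<^esub>k\<in>insert i I. f k j) = (\<Oplus>\<^bsub>M\<^esub>j\<in>J. f i j \<oplus>\<^bsub>M\<^esub> (\<Oplus>\<^bsub>M\<^esub>k\<in>I. f k j))"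
  proof (rule finsum_cong_terms)
    fix j assume "j \<in> J"
    then have "(\<lambda>k. f k j) \<in> I \<rightarrow> carrier M" "f i j \<in> carrier M" using insert.prems by auto
    then show "(\<Oplus>\<^bsub>M\<^esub>k\<in>insert i I. f k j) = f i j \<oplus>\<^bsub>M\<^esub> (\<Oplus>\<^bsub>M\<^esub>k\<in>I. f k j)"
      "f i j \<oplus>\<^bsub>M\<^esub> (\<Oplus>\<^bsub>M\<^esub>k\<in>I. f k j) \<in> carrier M"
      using insert.hyps by simp_all
  qed
  also have "\<dots> = (\<Oplus>\<^bsub>M\<^esub>j\<in>J. f i j) \<oplus>\<^bsub>M\<^esub> (\<Oplus>\<^bsub>M\<^esub>j\<in>J. \<Oplus>\<^bsub>M\<^esub>k\<in>I. f k j)"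
    using insert.prems by (intro M.finsum_addf) (auto intro!: finsum_in)
  also have "\<dots> = (\<Oplus>\<^bsub>M\<^esub>j\<in>J. f i j) \<oplus>\<^bsub>M\<^esub> (\<Oplus>\<^bsub>M\<^esub>k\<in>I. \<Oplus>\<^bsub>M\<^esub>j\<in>J. f k j)"
    using insert by simp
  also have "\<dots> = (\<Oplus>\<^bsub>M\<^esub>k\<in>insert i I. \<Oplus>\<^bsub>M\<^esub>j\<in>J. f k j)"
    using insert by (subst M.finsum_insert) (auto intro!: finsum_in)
  finally show ?case by simp
qed

lemma is_linear_finsum:
  assumes "module K N" "finite I" "\<And>i. i \<in> I \<Longrightarrow> is_linear K N M (f i)"
  shows "is_linear K N M (\<lambda>x. \<Oplus>\<^bsub>M\<^esub>i\<in>I. f i x)"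
  using assms(2,3)
proof (induction I)
  case empty
  then show ?case using is_linear_zero[OF assms(1)] by simp
next
  case (insert i I)
  interpret N: module K N by fact
  have "is_linear K N M (\<lambda>x. f i x \<oplus>\<^bsub>M\<^esub> (\<Oplus>\<^bsub>M\<^esub>k\<in>I. f k x))"
    using insert by (intro is_linear_add) auto
  moreover have "f i x \<oplus>\<^bsub>M\<^esub> (\<Oplus>\<^bsub>M\<^esub>k\<in>I. f k x) = (\<Oplus>\<^bsub>M\<^esub>k\<in>insert i I. f k x)" if "x \<in> carrier N" for x
    using insert.hyps that is_linearD(1)[OF insert.prems] by (intro M.finsum_insert[symmetric]) auto
  ultimately show ?case by (rule is_linear_cong[OF assms(1)])
qed

end

lemma dga_homD:
  assumes "f \<in> dga_hom K A B"
  shows "is_linear K (cmp A n) (cmp B n) (f n)"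
    and "x \<in> elts A n \<Longrightarrow> f n x \<in> elts B n"
    and "x \<in> elts A n \<Longrightarrow> f (n - 1) (diff A n x) = diff B n (f n x)"
    and "x \<in> elts A m \<Longrightarrow> y \<in> elts A n \<Longrightarrow> f (m + n) (gmult A m n x y) = gmult B m n (f m x) (f n y)"
    and "f 0 (gone A) = gone B"
    and "f n \<in> extensional (elts A n)"
  using assms by (auto simp: dga_hom_def lin_hom_def is_linear_def)

lemma dga_homI:
  assumes "\<And>n. is_linear K (cmp A n) (cmp B n) (f n)"
    and "\<And>n x. x \<in> elts A n \<Longrightarrow> f (n - 1) (diff A n x) = diff B n (f n x)"
    and "\<And>m n x y. x \<in> elts A m \<Longrightarrow> y \<in> elts A n \<Longrightarrow> f (m + n) (gmult A m n x y) = gmult B m n (f m x) (f n y)"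
    and "f 0 (gone A) = gone B"
    and "\<And>n. f n \<in> extensional (elts A n)"
  shows "f \<in> dga_hom K A B"
  using assms by (auto simp: dga_hom_def lin_hom_def)

text \<open>Sets of homomorphisms consist of extensional families, so a family given by a formula has
  to be cut down to the components of its source before it is a homomorphism.\<close>

lemma restrict_dga_hom:
  assumes A: "dga K A"
    and "\<And>n. is_linear K (cmp A n) (cmp B n) (f n)"
    and "\<And>n x. x \<in> elts A n \<Longrightarrow> f (n - 1) (diff A n x) = diff B n (f n x)"
    and "\<And>m n x y. x \<in> elts A m \<Longrightarrow> y \<in> elts A n \<Longrightarrow> f (m + n) (gmult A m n x y) = gmult B m n (f m x) (f n y)"
    and "f 0 (gone A) = gone B"
  shows "(\<lambda>n. \<lambda>x\<in>elts A n. f n x) \<in> dga_hom K A B"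
proof -
  interpret pre_dga K A by (rule dga_pre[OF A])
  show ?thesis
    using assms(3-) by (intro dga_homI)
      (auto simp: d_in mult_in one_in intro: is_linear_cong[OF mod assms(2)])
qed

lemma dga_hom_eqI:
  assumes "f \<in> dga_hom K A B" "g \<in> dga_hom K A C" "\<And>n x. x \<in> elts A n \<Longrightarrow> f n x = g n x"
  shows "f = g"
proof
  fix n
  show "f n = g n"
    by (rule extensionalityI[OF dga_homD(6)[OF assms(1)] dga_homD(6)[OF assms(2)] assms(3)])
qed

lemma dga_comp_apply [simp]: "x \<in> elts A n \<Longrightarrow> dga_comp A g f n x = g n (f n x)"
  by (simp add: dga_comp_def compose_def)

lemma dga_comp_hom:
  assumes A: "dga K A" and f: "f \<in> dga_hom K A B" and g: "g \<in> dga_hom K B C"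
  shows "dga_comp A g f \<in> dga_hom K A C"
proof -
  have "(\<lambda>n. \<lambda>x\<in>elts A n. g n (f n x)) \<in> dga_hom K A C"
    using is_linear_comp[OF dga_homD(1)[OF f] dga_homD(1)[OF g]]
    by (intro restrict_dga_hom[OF A]) (auto simp: dga_homD[OF f] dga_homD[OF g] simp flip: dga_homD(3)[OF g])
  then show ?thesis by (simp add: dga_comp_def compose_def)
qed

lemma dga_comp_eqI:
  "(\<And>n x. x \<in> elts A n \<Longrightarrow> g n (f n x) = g' n (f' n x)) \<Longrightarrow> dga_comp A g f = dga_comp A g' f'"
  by (auto simp: dga_comp_def compose_def fun_eq_iff)

lemma dga_comp_assoc:
  "f \<in> dga_hom K A B \<Longrightarrow> dga_comp A h (dga_comp A g f) = dga_comp A (dga_comp B h g) f"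
  by (rule dga_comp_eqI) (simp add: dga_homD)

lemma dga_hom_koszul:
  assumes "dga K A" "dga K B" "f \<in> dga_hom K A B" "x \<in> elts A n"
  shows "f n (koszul (cmp A n) i x) = koszul (cmp B n) i (f n x)"
  by (rule lin_koszul[OF dga_homD(1)[OF assms(3)] _ _ assms(4)])
    (fact pre_dga.mod[OF dga_pre[OF assms(1)]] pre_dga.mod[OF dga_pre[OF assms(2)]])+

context pre_dga begin

text \<open>The degrees of a product are arguments of the multiplication, so the two sides of an
  identity often carry syntactically different degrees. The following forms of the axioms take
  degree equations as premises, which makes them applicable up to arithmetic.\<close>

lemma m_in: "x \<in> elts A m \<Longrightarrow> y \<in> elts A n \<Longrightarrow> m + n = p \<Longrightarrow> gmult A m n x y \<in> elts A p"
  using mult_in by blast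

lemma m_assoc:
  "x \<in> elts A m \<Longrightarrow> y \<in> elts A n \<Longrightarrow> z \<in> elts A p \<Longrightarrow> m + n = mn \<Longrightarrow> n + p = np \<Longrightarrow>
    gmult A mn p (gmult A m n x y) z = gmult A m np x (gmult A n p y z)"
  using assoc by blast

lemma m_lin_l: "y \<in> elts A n \<Longrightarrow> m + n = p \<Longrightarrow> is_linear K (cmp A m) (cmp A p) (\<lambda>x. gmult A m n x y)"
  using mult_l by blast
lemma m_lin_r: "x \<in> elts A m \<Longrightarrow> m + n = p \<Longrightarrow> is_linear K (cmp A n) (cmp A p) (gmult A m n x)"
  using mult_r by blast

lemma m_zero_l: "y \<in> elts A n \<Longrightarrow> m + n = p \<Longrightarrow> gmult A m n \<zero>\<^bsub>cmp A m\<^esub> y = \<zero>\<^bsub>cmp A p\<^esub>"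
  by (rule lin_zero[OF m_lin_l mod mod])
lemma m_zero_r: "x \<in> elts A m \<Longrightarrow> m + n = p \<Longrightarrow> gmult A m n x \<zero>\<^bsub>cmp A n\<^esub> = \<zero>\<^bsub>cmp A p\<^esub>"
  by (rule lin_zero[OF m_lin_r mod mod])

lemma m_koszul_l: "x \<in> elts A m \<Longrightarrow> y \<in> elts A n \<Longrightarrow> m + n = p \<Longrightarrow> gmult A m n (kz m i x) y = kz p i (gmult A m n x y)"
  using m_k_l by blast
lemma m_koszul_r: "x \<in> elts A m \<Longrightarrow> y \<in> elts A n \<Longrightarrow> m + n = p \<Longrightarrow> gmult A m n x (kz n i y) = kz p i (gmult A m n x y)"
  using m_k_r by blast

lemma m_smult_l: "a \<in> carrier K \<Longrightarrow> x \<in> elts A m \<Longrightarrow> y \<in> elts A n \<Longrightarrow> m + n = p \<Longrightarrow>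
    gmult A m n (a \<odot>\<^bsub>cmp A m\<^esub> x) y = a \<odot>\<^bsub>cmp A p\<^esub> gmult A m n x y"
  by (rule is_linearD(3)[OF m_lin_l])
lemma m_smult_r: "a \<in> carrier K \<Longrightarrow> x \<in> elts A m \<Longrightarrow> y \<in> elts A n \<Longrightarrow> m + n = p \<Longrightarrow>
    gmult A m n x (a \<odot>\<^bsub>cmp A n\<^esub> y) = a \<odot>\<^bsub>cmp A p\<^esub> gmult A m n x y"
  by (rule is_linearD(3)[OF m_lin_r])

lemma m_finsum_l:
  "finite I \<Longrightarrow> (\<And>i. i \<in> I \<Longrightarrow> f i \<in> elts A m) \<Longrightarrow> y \<in> elts A n \<Longrightarrow> m + n = p \<Longrightarrow>
    gmult A m n (\<Oplus>\<^bsub>cmp A m\<^esub>i\<in>I. f i) y = (\<Oplus>\<^bsub>cmp A p\<^esub>i\<in>I. gmult A m n (f i) y)"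
  by (rule lin_finsum[OF m_lin_l mod mod]) auto
lemma m_finsum_r:
  "finite I \<Longrightarrow> (\<And>i. i \<in> I \<Longrightarrow> f i \<in> elts A n) \<Longrightarrow> x \<in> elts A m \<Longrightarrow> m + n = p \<Longrightarrow>
    gmult A m n x (\<Oplus>\<^bsub>cmp A n\<^esub>i\<in>I. f i) = (\<Oplus>\<^bsub>cmp A p\<^esub>i\<in>I. gmult A m n x (f i))"
  by (rule lin_finsum[OF m_lin_r mod mod]) auto

lemma kz_kz: "x \<in> elts A n \<Longrightarrow> kz n i (kz n j x) = kz n (i + j) x"
  by (rule kmod.koszul_koszul[OF kmod])

lemma kz_even: "even i \<Longrightarrow> kz n i x = x"
  by (simp add: koszul_def)

text \<open>This is the multiplication rule of a tensor product, derived inside an algebra from one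
  commutation relation. Comparing two algebras in which the same relation holds shows that a map
  respecting products \<open>e z\<close> is multiplicative.\<close>

lemma interchange:
  assumes e: "e \<in> elts A p" "e' \<in> elts A p'" and z: "z \<in> elts A q" "z' \<in> elts A q'"
    and c: "gmult A q p' z e' = kz (q + p') (q * p') (gmult A p' q e' z)"
    and n: "p + q = m" "p' + q' = n"
  shows "gmult A m n (gmult A p q e z) (gmult A p' q' e' z') =
    kz (m + n) (q * p') (gmult A (p + p') (q + q') (gmult A p p' e e') (gmult A q q' z z'))"
proof -
  have "gmult A m n (gmult A p q e z) (gmult A p' q' e' z')
      = gmult A p (q + n) e (gmult A (q + p') q' (gmult A q p' z e') z')"
    using m_assoc[OF z(1) e(2) z(2) refl n(2)] m_assoc[OF e(1) z(1) m_in[OF e(2) z(2) n(2)] n(1) refl] by simp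
  also have "gmult A (q + p') q' (gmult A q p' z e') z' = kz (q + n) (q * p') (gmult A p' (q + q') e' (gmult A q q' z z'))"
    unfolding c using m_assoc[OF e(2) z(1) z(2) _ refl, of "q + p'"] m_in[OF e(2) z(1), of "q + p'"] n(2) z(2)
    by (subst m_koszul_l[of _ _ _ _ "q + n"]) (auto simp: ac_simps)
  also have "gmult A p (q + n) e \<dots> = kz (m + n) (q * p') (gmult A p (q + n) e (gmult A p' (q + q') e' (gmult A q q' z z')))"
    using e z n by (intro m_koszul_r m_in) auto
  also have "gmult A p (q + n) e (gmult A p' (q + q') e' (gmult A q q' z z')) = 
      gmult A (p + p') (q + q') (gmult A p p' e e') (gmult A q q' z z')"
    using e z n by (intro m_assoc[symmetric] m_in) auto
  finally show ?thesis .
qed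

end

section \<open>Frames of graded matrix algebras\<close>

text \<open>A frame records what the proofs need of a graded matrix algebra with a distinguished index
  \<open>o\<close>: the column \<open>u i\<close> $= e_{io}$, the row \<open>w i\<close> $= e_{oi}$ and the idempotent \<open>eps\<close>
  $= e_{oo}$, in degrees normalized so that \<open>o\<close> has degree \<open>0\<close>. The corner $e_{oo} E e_{oo}$
  is one-dimensional and concentrated in degree \<open>0\<close>; \<open>chi\<close> is the resulting matrix coefficient.\<close>

locale frame = pre_dga K E for K :: "('k, 'r) ring_scheme" (structure) and E :: "('k, 'e) dga_rec" +
  fixes I :: "'i set" and d :: "'i \<Rightarrow> int" and u w :: "'i \<Rightarrow> 'e" and eps :: 'e and chi :: "'e \<Rightarrow> 'k"
  assumes fin: "finite I"
    and u_in: "i \<in> I \<Longrightarrow> u i \<in> elts E (d i)"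
    and w_in: "i \<in> I \<Longrightarrow> w i \<in> elts E (- d i)"
    and eps_in: "eps \<in> elts E 0"
    and unit: "(\<Oplus>\<^bsub>cmp E 0\<^esub>i\<in>I. gmult E (d i) (- d i) (u i) (w i)) = gone E"
    and u_eps: "i \<in> I \<Longrightarrow> gmult E (d i) 0 (u i) eps = u i"
    and eps_w: "i \<in> I \<Longrightarrow> gmult E 0 (- d i) eps (w i) = w i"
    and corner_0: "e \<in> elts E 0 \<Longrightarrow> gmult E 0 0 eps (gmult E 0 0 e eps) = chi e \<odot>\<^bsub>cmp E 0\<^esub> eps"
    and corner_ne: "e \<in> elts E n \<Longrightarrow> n \<noteq> 0 \<Longrightarrow> gmult E 0 n eps (gmult E n 0 e eps) = \<zero>\<^bsub>cmp E n\<^esub>"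
    and chi_in: "e \<in> elts E 0 \<Longrightarrow> chi e \<in> carrier K"
    and chi_add: "e \<in> elts E 0 \<Longrightarrow> e' \<in> elts E 0 \<Longrightarrow> chi (e \<oplus>\<^bsub>cmp E 0\<^esub> e') = chi e \<oplus> chi e'"
    and chi_smult: "a \<in> carrier K \<Longrightarrow> e \<in> elts E 0 \<Longrightarrow> chi (a \<odot>\<^bsub>cmp E 0\<^esub> e) = a \<otimes> chi e"
    and chi_one: "chi (gone E) = \<one>"
begin

lemma eps_eps: "gmult E 0 0 eps eps = eps"
proof -
  interpret M: module K "cmp E 0" by (rule mod)
  show ?thesis using corner_0[OF one_in] one_l[OF eps_in] eps_in by (simp add: chi_one)
qed

text \<open>The \<open>(i, j)\<close> entry of the matrix of \<open>e\<close>. It is meaningful only if the degree \<open>m\<close> of \<open>e\<close>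
  is \<open>d i - d j\<close>; all other entries of a homogeneous matrix vanish, which is why the sums below
  carry a case distinction on degrees.\<close>

definition coef where
  "coef m e i j = chi (gmult E (- d i) (m + d j) (w i) (gmult E m (d j) e (u j)))"

lemma coef_in: "i \<in> I \<Longrightarrow> j \<in> I \<Longrightarrow> e \<in> elts E m \<Longrightarrow> d i = m + d j \<Longrightarrow> coef m e i j \<in> carrier K"
  unfolding coef_def by (intro chi_in m_in w_in u_in refl) auto

text \<open>The element \<open>w i e u j\<close> absorbs \<open>eps\<close> on both sides, hence lies in the one-dimensional
  corner.\<close>

lemma matrix_entry:
  assumes i: "i \<in> I" and j: "j \<in> I" and e: "e \<in> elts E m"
  shows "gmult E (- d i) (m + d j) (w i) (gmult E m (d j) e (u j)) =
    (if d i = m + d j then coef m e i j \<odot>\<^bsub>cmp E 0\<^esub> eps else \<zero>\<^bsub>cmp E (m + d j - d i)\<^esub>)"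
proof -
  let ?r = "m + d j - d i" and ?eu = "gmult E m (d j) e (u j)"
  let ?X = "gmult E (- d i) (m + d j) (w i) ?eu"
  have eu: "?eu \<in> elts E (m + d j)" by (intro m_in e u_in j refl)
  have X: "?X \<in> elts E ?r" by (intro m_in w_in i eu) simp
  have "gmult E ?r 0 ?X eps = gmult E (- d i) (m + d j) (w i) (gmult E (m + d j) 0 ?eu eps)"
    by (rule m_assoc[OF w_in[OF i] eu eps_in]) auto
  also have "gmult E (m + d j) 0 ?eu eps = ?eu"
    using m_assoc[OF e u_in[OF j] eps_in, of "m + d j" "d j"] u_eps[OF j] by simp
  finally have r: "gmult E ?r 0 ?X eps = ?X" .
  have "gmult E 0 ?r eps ?X = gmult E (- d i) (m + d j) (gmult E 0 (- d i) eps (w i)) ?eu"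
    by (rule m_assoc[OF eps_in w_in[OF i] eu, symmetric]) auto
  then have l: "gmult E 0 ?r eps ?X = ?X" using eps_w[OF i] by simp
  show ?thesis
  proof (cases "d i = m + d j")
    case True
    then have "?X \<in> elts E 0" using X by simp
    from corner_0[OF this] show ?thesis using r l True by (simp add: coef_def)
  next
    case False
    from corner_ne[OF X] show ?thesis using r l False by simp
  qed
qed

text \<open>The columns span a left ideal on which \<open>e\<close> acts by its matrix: insert
  $1 = \sum_i u_i w_i$ on the left of $e u_j$.\<close>

lemma mult_u:
  assumes j: "j \<in> I" and e: "e \<in> elts E m"
  shows "gmult E m (d j) e (u j) =
    (\<Oplus>\<^bsub>cmp E (m + d j)\<^esub>i\<in>I. if d i = m + d j then coef m e i j \<odot>\<^bsub>cmp E (m + d j)\<^esub> u i else \<zero>\<^bsub>cmp E (m + d j)\<^esub>)"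
proof -
  let ?N = "m + d j" and ?eu = "gmult E m (d j) e (u j)"
  interpret N: kmod K "cmp E ?N" by (rule kmod)
  have eu: "?eu \<in> elts E ?N" by (intro m_in e u_in j refl)
  have "?eu = gmult E 0 ?N (\<Oplus>\<^bsub>cmp E 0\<^esub>i\<in>I. gmult E (d i) (- d i) (u i) (w i)) ?eu"
    using one_l[OF eu] unit by simp
  also have "\<dots> = (\<Oplus>\<^bsub>cmp E ?N\<^esub>i\<in>I. gmult E 0 ?N (gmult E (d i) (- d i) (u i) (w i)) ?eu)"
    by (rule m_finsum_l[OF fin _ eu]) (auto intro!: m_in u_in w_in)
  also have "\<dots> = (\<Oplus>\<^bsub>cmp E ?N\<^esub>i\<in>I. if d i = ?N then coef m e i j \<odot>\<^bsub>cmp E ?N\<^esub> u i else \<zero>\<^bsub>cmp E ?N\<^esub>)"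
  proof (rule N.finsum_cong_terms)
    fix i assume i: "i \<in> I"
    have "gmult E 0 ?N (gmult E (d i) (- d i) (u i) (w i)) ?eu = gmult E (d i) (?N - d i) (u i) (gmult E (- d i) ?N (w i) ?eu)"
      by (rule m_assoc[OF u_in[OF i] w_in[OF i] eu]) auto
    also have "\<dots> = (if d i = ?N then coef m e i j \<odot>\<^bsub>cmp E ?N\<^esub> u i else \<zero>\<^bsub>cmp E ?N\<^esub>)"
      unfolding matrix_entry[OF i j e]
      using m_smult_r[OF coef_in[OF i j e] u_in[OF i] eps_in, of ?N] m_zero_r[OF u_in[OF i], of "?N - d i" ?N] u_eps[OF i] by auto
    finally show "gmult E 0 ?N (gmult E (d i) (- d i) (u i) (w i)) ?eu =
       (if d i = ?N then coef m e i j \<odot>\<^bsub>cmp E ?N\<^esub> u i else \<zero>\<^bsub>cmp E ?N\<^esub>)" .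
    show "(if d i = ?N then coef m e i j \<odot>\<^bsub>cmp E ?N\<^esub> u i else \<zero>\<^bsub>cmp E ?N\<^esub>) \<in> elts E ?N"
      using coef_in[OF i j e] u_in[OF i] by auto
  qed
  finally show ?thesis .
qed

text \<open>The same matrix describes the action of \<open>e\<close> on rows from the right: insert
  $1 = \sum_j u_j w_j$ on the right of $w_i e$.\<close>

lemma w_mult:
  assumes i: "i \<in> I" and e: "e \<in> elts E m"
  shows "gmult E (- d i) m (w i) e =
    (\<Oplus>\<^bsub>cmp E (m - d i)\<^esub>j\<in>I. if d i = m + d j then coef m e i j \<odot>\<^bsub>cmp E (m - d i)\<^esub> w j else \<zero>\<^bsub>cmp E (m - d i)\<^esub>)"
proof -
  let ?N = "m - d i" and ?we = "gmult E (- d i) m (w i) e"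
  interpret N: kmod K "cmp E ?N" by (rule kmod)
  have we: "?we \<in> elts E ?N" by (intro m_in e w_in i) simp
  have "?we = gmult E ?N 0 ?we (\<Oplus>\<^bsub>cmp E 0\<^esub>j\<in>I. gmult E (d j) (- d j) (u j) (w j))"
    using one_r[OF we] unit by simp
  also have "\<dots> = (\<Oplus>\<^bsub>cmp E ?N\<^esub>j\<in>I. gmult E ?N 0 ?we (gmult E (d j) (- d j) (u j) (w j)))"
    by (rule m_finsum_r[OF fin _ we]) (auto intro!: m_in u_in w_in)
  also have "\<dots> = (\<Oplus>\<^bsub>cmp E ?N\<^esub>j\<in>I. if d i = m + d j then coef m e i j \<odot>\<^bsub>cmp E ?N\<^esub> w j else \<zero>\<^bsub>cmp E ?N\<^esub>)"
  proof (rule N.finsum_cong_terms)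
    fix j assume j: "j \<in> I"
    have "gmult E ?N 0 ?we (gmult E (d j) (- d j) (u j) (w j)) = gmult E (?N + d j) (- d j) (gmult E ?N (d j) ?we (u j)) (w j)"
      by (rule m_assoc[OF we u_in[OF j] w_in[OF j], symmetric]) auto
    also have "gmult E ?N (d j) ?we (u j) = gmult E (- d i) (m + d j) (w i) (gmult E m (d j) e (u j))"
      by (rule m_assoc[OF w_in[OF i] e u_in[OF j]]) auto
    also have "gmult E (?N + d j) (- d j) \<dots> (w j) = (if d i = m + d j then coef m e i j \<odot>\<^bsub>cmp E ?N\<^esub> w j else \<zero>\<^bsub>cmp E ?N\<^esub>)"
    proof (cases "d i = m + d j")
      case True
      then have "?N + d j = 0" "?N = - d j" by auto
      then show ?thesis unfolding matrix_entry[OF i j e] using True eps_w[OF j] m_smult_l[OF coef_in[OF i j e True] eps_in w_in[OF j], of "- d j"] by auto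
    next
      case False
      have eq: "?N + d j = m + d j - d i" by simp
      show ?thesis unfolding matrix_entry[OF i j e] eq using False m_zero_l[OF w_in[OF j], of "m + d j - d i" ?N] by simp
    qed
    finally show "gmult E ?N 0 ?we (gmult E (d j) (- d j) (u j) (w j)) =
       (if d i = m + d j then coef m e i j \<odot>\<^bsub>cmp E ?N\<^esub> w j else \<zero>\<^bsub>cmp E ?N\<^esub>)" .
    show "(if d i = m + d j then coef m e i j \<odot>\<^bsub>cmp E ?N\<^esub> w j else \<zero>\<^bsub>cmp E ?N\<^esub>) \<in> elts E ?N"
      using coef_in[OF i j e] w_in[OF j] by (auto intro: s_in)
  qed
  finally show ?thesis .
qed

text \<open>Applying \<open>mult_u\<close> to $e = \sum_j (e u_j) w_j$ expands \<open>e\<close> in the matrix units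
  $u_i w_j$.\<close>

lemma matrix_expansion:
  assumes e: "e \<in> elts E p"
  shows "(\<Oplus>\<^bsub>cmp E p\<^esub>i\<in>I. \<Oplus>\<^bsub>cmp E p\<^esub>j\<in>I.
    if d i = p + d j then coef p e i j \<odot>\<^bsub>cmp E p\<^esub> gmult E (d i) (- d j) (u i) (w j) else \<zero>\<^bsub>cmp E p\<^esub>) = e"
proof -
  interpret M: kmod K "cmp E p" by (rule kmod)
  let ?t = "\<lambda>i j. if d i = p + d j then coef p e i j \<odot>\<^bsub>cmp E p\<^esub> gmult E (d i) (- d j) (u i) (w j) else \<zero>\<^bsub>cmp E p\<^esub>"
  have t: "?t i j \<in> elts E p" if ij: "i \<in> I" "j \<in> I" for i j
    using coef_in[OF ij e] m_in[OF u_in[OF ij(1)] w_in[OF ij(2)], of p] by (auto simp: z_in intro: s_in)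
  have uw: "gmult E (d j) (- d j) (u j) (w j) \<in> elts E 0" if "j \<in> I" for j by (intro m_in u_in w_in that) simp
  have euw: "gmult E p 0 e (gmult E (d j) (- d j) (u j) (w j)) \<in> elts E p" if "j \<in> I" for j
    by (intro m_in e uw that) simp
  have *: "(\<Oplus>\<^bsub>cmp E p\<^esub>i\<in>I. ?t i j) = gmult E p 0 e (gmult E (d j) (- d j) (u j) (w j))" if j: "j \<in> I" for j
  proof -
    let ?N = "p + d j"
    let ?c = "\<lambda>i. if d i = ?N then coef p e i j \<odot>\<^bsub>cmp E ?N\<^esub> u i else \<zero>\<^bsub>cmp E ?N\<^esub>"
    have ui: "d i = ?N \<Longrightarrow> i \<in> I \<Longrightarrow> u i \<in> elts E ?N" for i using u_in by metis
    have c: "?c i \<in> elts E ?N" if "i \<in> I" for i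
      using coef_in[OF that j e] ui[OF _ that] by (auto simp: z_in intro: s_in)
    have "gmult E p 0 e (gmult E (d j) (- d j) (u j) (w j)) = gmult E ?N (- d j) (gmult E p (d j) e (u j)) (w j)"
      by (rule m_assoc[OF e u_in[OF j] w_in[OF j], symmetric]) auto
    also have "\<dots> = (\<Oplus>\<^bsub>cmp E p\<^esub>i\<in>I. gmult E ?N (- d j) (?c i) (w j))"
      unfolding mult_u[OF j e] by (rule m_finsum_l[OF fin c w_in[OF j]]) auto
    also have "\<dots> = (\<Oplus>\<^bsub>cmp E p\<^esub>i\<in>I. ?t i j)"
    proof (rule M.finsum_cong_terms[OF _ t[OF _ j]])
      fix i assume i: "i \<in> I"
      show "gmult E ?N (- d j) (?c i) (w j) = ?t i j"
        using m_smult_l[OF coef_in[OF i j e] ui[OF _ i] w_in[OF j], of p] m_zero_l[OF w_in[OF j], of ?N p] by auto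
    qed
    finally show ?thesis by simp
  qed
  have "(\<Oplus>\<^bsub>cmp E p\<^esub>i\<in>I. \<Oplus>\<^bsub>cmp E p\<^esub>j\<in>I. ?t i j) = (\<Oplus>\<^bsub>cmp E p\<^esub>j\<in>I. \<Oplus>\<^bsub>cmp E p\<^esub>i\<in>I. ?t i j)"
    by (rule M.finsum_swap[OF fin fin t])
  also have "\<dots> = (\<Oplus>\<^bsub>cmp E p\<^esub>j\<in>I. gmult E p 0 e (gmult E (d j) (- d j) (u j) (w j)))"
    using * euw by (intro M.finsum_cong_terms) auto
  also have "\<dots> = gmult E p 0 e (\<Oplus>\<^bsub>cmp E 0\<^esub>j\<in>I. gmult E (d j) (- d j) (u j) (w j))"
    by (rule m_finsum_r[OF fin uw e, symmetric]) auto
  finally show ?thesis using one_r[OF e] by (simp add: unit)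
qed

text \<open>Centrality of the Casimir element, $\sum_j e u_j \otimes w_j = \sum_i u_i \otimes w_i e$,
  because \<open>mult_u\<close> and \<open>w_mult\<close> expand both sides with the same coefficients. The tensor product
  is replaced by an arbitrary bilinear map \<open>\<beta>\<close>, which may depend on the degree \<open>p\<close> of its first
  argument; Koszul signs enter through this dependence.\<close>

lemma casimir_central:
  assumes M: "module K M" and e: "e \<in> elts E m"
    and r: "\<And>p a. a \<in> elts E p \<Longrightarrow> is_linear K (cmp E (m - p)) M (\<beta> p a)"
    and l: "\<And>p b. b \<in> elts E (m - p) \<Longrightarrow> is_linear K (cmp E p) M (\<lambda>a. \<beta> p a b)"
  shows "(\<Oplus>\<^bsub>M\<^esub>j\<in>I. \<beta> (m + d j) (gmult E m (d j) e (u j)) (w j)) =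
    (\<Oplus>\<^bsub>M\<^esub>i\<in>I. \<beta> (d i) (u i) (gmult E (- d i) m (w i) e))"
proof -
  interpret M: kmod K M using M by (simp add: kmod_def)
  let ?t = "\<lambda>i j. if d i = m + d j then coef m e i j \<odot>\<^bsub>M\<^esub> \<beta> (d i) (u i) (w j) else \<zero>\<^bsub>M\<^esub>"
  have w': "w j \<in> elts E (m - (m + d j))" if "j \<in> I" for j using w_in[OF that] by simp
  have t: "?t i j \<in> carrier M" if ij: "i \<in> I" "j \<in> I" for i j
    using coef_in[OF ij e] is_linearD(1)[OF r[OF u_in[OF ij(1)]]] w_in[OF ij(2)] by auto
  have 1: "\<beta> (m + d j) (gmult E m (d j) e (u j)) (w j) = (\<Oplus>\<^bsub>M\<^esub>i\<in>I. ?t i j)" if j: "j \<in> I" for j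
  proof -
    interpret N: kmod K "cmp E (m + d j)" by (rule kmod)
    note L = l[OF w'[OF j]]
    have u'': "d i = m + d j \<Longrightarrow> i \<in> I \<Longrightarrow> u i \<in> elts E (m + d j)" for i using u_in by metis
    have "\<beta> (m + d j) (gmult E m (d j) e (u j)) (w j) =
      (\<Oplus>\<^bsub>M\<^esub>i\<in>I. \<beta> (m + d j) (if d i = m + d j then coef m e i j \<odot>\<^bsub>cmp E (m + d j)\<^esub> u i else \<zero>\<^bsub>cmp E (m + d j)\<^esub>) (w j))"
      unfolding mult_u[OF j e] using coef_in[OF _ j e] u'' by (intro lin_finsum[OF L mod M fin]) (simp add: Pi_def z_in s_in)
    also have "\<dots> = (\<Oplus>\<^bsub>M\<^esub>i\<in>I. ?t i j)"
    proof (rule M.finsum_cong_terms[OF _ t[OF _ j]])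
      fix i assume i: "i \<in> I"
      show "\<beta> (m + d j) (if d i = m + d j then coef m e i j \<odot>\<^bsub>cmp E (m + d j)\<^esub> u i else \<zero>\<^bsub>cmp E (m + d j)\<^esub>) (w j) = ?t i j"
        using is_linearD(3)[OF L coef_in[OF i j e], of "u i"] u_in[OF i] lin_zero[OF L mod M] by auto
    qed
    finally show ?thesis .
  qed
  have 2: "\<beta> (d i) (u i) (gmult E (- d i) m (w i) e) = (\<Oplus>\<^bsub>M\<^esub>j\<in>I. ?t i j)" if i: "i \<in> I" for i
  proof -
    interpret N: kmod K "cmp E (m - d i)" by (rule kmod)
    note L = r[OF u_in[OF i]]
    have w'': "d i = m + d j \<Longrightarrow> j \<in> I \<Longrightarrow> w j \<in> elts E (m - d i)" for j using w_in by simp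
    have "\<beta> (d i) (u i) (gmult E (- d i) m (w i) e) =
      (\<Oplus>\<^bsub>M\<^esub>j\<in>I. \<beta> (d i) (u i) (if d i = m + d j then coef m e i j \<odot>\<^bsub>cmp E (m - d i)\<^esub> w j else \<zero>\<^bsub>cmp E (m - d i)\<^esub>))"
      unfolding w_mult[OF i e] using coef_in[OF i _ e] w'' by (intro lin_finsum[OF L mod M fin]) (simp add: Pi_def z_in s_in)
    also have "\<dots> = (\<Oplus>\<^bsub>M\<^esub>j\<in>I. ?t i j)"
    proof (rule M.finsum_cong_terms[OF _ t[OF i]])
      fix j assume j: "j \<in> I"
      show "\<beta> (d i) (u i) (if d i = m + d j then coef m e i j \<odot>\<^bsub>cmp E (m - d i)\<^esub> w j else \<zero>\<^bsub>cmp E (m - d i)\<^esub>) = ?t i j"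
        using is_linearD(3)[OF L coef_in[OF i j e], of "w j"] w''[OF _ j] lin_zero[OF L mod M] by auto
    qed
    finally show ?thesis .
  qed
  have "(\<Oplus>\<^bsub>M\<^esub>j\<in>I. \<beta> (m + d j) (gmult E m (d j) e (u j)) (w j)) = (\<Oplus>\<^bsub>M\<^esub>j\<in>I. \<Oplus>\<^bsub>M\<^esub>i\<in>I. ?t i j)"
    using 1 t by (intro M.finsum_cong_terms M.finsum_in) auto
  also have "\<dots> = (\<Oplus>\<^bsub>M\<^esub>i\<in>I. \<Oplus>\<^bsub>M\<^esub>j\<in>I. ?t i j)" by (rule M.finsum_swap[OF fin fin t])
  also have "\<dots> = (\<Oplus>\<^bsub>M\<^esub>i\<in>I. \<beta> (d i) (u i) (gmult E (- d i) m (w i) e))"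
    using 2 t by (intro M.finsum_cong_terms[OF sym]) (auto intro!: M.finsum_in)
  finally show ?thesis .
qed

text \<open>Multiplying the Casimir element by \<open>eps\<close> leaves $\epsilon \otimes \epsilon$: the element
  $\epsilon u_k$ lies in the corner, so it is a multiple of $\epsilon$ which can be moved across
  to give $\epsilon \otimes \epsilon u_k w_k$, and these sum to the claim.\<close>

lemma casimir_eps:
  assumes M: "module K M"
    and r: "\<And>p a. a \<in> elts E p \<Longrightarrow> is_linear K (cmp E (- p)) M (\<beta> p a)"
    and l: "\<And>p b. b \<in> elts E (- p) \<Longrightarrow> is_linear K (cmp E p) M (\<lambda>a. \<beta> p a b)"
  shows "(\<Oplus>\<^bsub>M\<^esub>k\<in>I. \<beta> (d k) (gmult E 0 (d k) eps (u k)) (w k)) = \<beta> 0 eps eps"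
proof -
  interpret M: kmod K M using M by (simp add: kmod_def)
  interpret E0: kmod K "cmp E 0" by (rule kmod)
  note L = r[OF eps_in, simplified]
  have uw: "gmult E (d k) (- d k) (u k) (w k) \<in> elts E 0" if "k \<in> I" for k by (intro m_in u_in w_in that) simp
  have euw: "gmult E 0 0 eps (gmult E (d k) (- d k) (u k) (w k)) \<in> elts E 0" if "k \<in> I" for k by (intro m_in uw that eps_in) simp
  have *: "\<beta> (d k) (gmult E 0 (d k) eps (u k)) (w k) = \<beta> 0 eps (gmult E 0 0 eps (gmult E (d k) (- d k) (u k) (w k)))"
    if k: "k \<in> I" for k
  proof -
    have as: "gmult E 0 0 eps (gmult E (d k) (- d k) (u k) (w k)) = gmult E (d k) (- d k) (gmult E 0 (d k) eps (u k)) (w k)"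
      by (rule m_assoc[OF eps_in u_in[OF k] w_in[OF k], symmetric]) auto
    show ?thesis
    proof (cases "d k = 0")
      case True
      have uk: "u k \<in> elts E 0" and wk: "w k \<in> elts E 0" using u_in[OF k] w_in[OF k] True by auto
      have eu: "gmult E 0 0 eps (u k) = chi (u k) \<odot>\<^bsub>cmp E 0\<^esub> eps"
        using corner_0[OF uk] u_eps[OF k] True by simp
      have ew: "gmult E 0 0 eps (w k) = w k" using eps_w[OF k] True by simp
      have l0: "is_linear K (cmp E 0) M (\<lambda>a. \<beta> 0 a (w k))" using l[of "w k" 0] wk by simp
      show ?thesis using as True eu ew
        by (simp add: m_smult_l[OF chi_in[OF uk] eps_in wk] is_linearD(3)[OF l0 chi_in[OF uk] eps_in] is_linearD(3)[OF L chi_in[OF uk] wk])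
    next
      case False
      have "gmult E 0 (d k) eps (u k) = \<zero>\<^bsub>cmp E (d k)\<^esub>"
        using corner_ne[OF u_in[OF k] False] u_eps[OF k] by simp
      then show ?thesis using as m_zero_l[OF w_in[OF k], of "d k" 0] lin_zero[OF l[OF w_in[OF k]] mod M] lin_zero[OF L mod M] by simp
    qed
  qed
  have "(\<Oplus>\<^bsub>M\<^esub>k\<in>I. \<beta> (d k) (gmult E 0 (d k) eps (u k)) (w k)) =
      (\<Oplus>\<^bsub>M\<^esub>k\<in>I. \<beta> 0 eps (gmult E 0 0 eps (gmult E (d k) (- d k) (u k) (w k))))"
    using * is_linearD(1)[OF L] euw by (intro M.finsum_cong_terms) auto
  also have "\<dots> = \<beta> 0 eps (gmult E 0 0 eps (\<Oplus>\<^bsub>cmp E 0\<^esub>k\<in>I. gmult E (d k) (- d k) (u k) (w k)))"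
    using lin_finsum[OF is_linear_comp[OF m_lin_r[OF eps_in] L] mod M fin] uw by simp
  finally show ?thesis using one_r[OF eps_in] by (simp add: unit)
qed

end

section \<open>Centralizers of graded matrix algebras\<close>

context centralizer begin

lemma into_Z: "is_linear K M (cmp A n) f \<Longrightarrow> (\<And>x. x \<in> carrier M \<Longrightarrow> f x \<in> C n) \<Longrightarrow> is_linear K M (cmp Z n) f"
  by (rule is_linearI) (simp_all add: selZ is_linearD[of K M "cmp A n" f])

lemma from_Z: "is_linear K (cmp A n) N f \<Longrightarrow> is_linear K (cmp Z n) N f"
  by (rule is_linearI) (simp_all add: selZ C_in is_linearD[of K "cmp A n" N f])

end

text \<open>The setting for the tensor decomposition. The graded centralizer of the image of \<open>E\<close>
  occurs in two forms: \<open>C\<close> is the family of its components, \<open>Z\<close> the DG algebra.\<close>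

locale framed_map = centralizer K E A \<iota> + frame K E I d u w eps chi
  for K :: "('k, 'r) ring_scheme" (structure) and E :: "('k, 'e) dga_rec" and A :: "('k, 'a) dga_rec" and \<iota>
    and I :: "'i set" and d u w eps chi
begin

lemma eltsZ: "elts Z n = C n" by (simp add: selZ)

lemma io_lin: "is_linear K (cmp E n) (cmp A n) (\<iota> n)" by (rule dga_homD(1)[OF io])

lemma io_mult: "x \<in> elts E m \<Longrightarrow> y \<in> elts E n \<Longrightarrow> m + n = p \<Longrightarrow>
    \<iota> p (gmult E m n x y) = gmult A m n (\<iota> m x) (\<iota> n y)"
  using dga_homD(4)[OF io] by blast

text \<open>The signed sum $\sum_k (-1)^{d_k n} u_k y w_k$. The sign is the one that turns centrality of
  the Casimir element into graded commutation with elements of \<open>E\<close>.\<close>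

definition average where
  "average n y = (\<Oplus>\<^bsub>cmp A n\<^esub>k\<in>I. A.kz n (d k * n) (gmult A (d k) (n - d k) (\<iota> (d k) (u k)) (gmult A n (- d k) y (\<iota> (- d k) (w k)))))"

text \<open>Linearity in the outer factors of $\pm a y b$, as needed to substitute this expression for
  the bilinear map in the lemmas on the Casimir element.\<close>

lemma sandwich_lin_l:
  assumes "y \<in> elts A n" "b \<in> elts E q" "p + (n + q) = N"
  shows "is_linear K (cmp E p) (cmp A N) (\<lambda>a. A.kz N i (gmult A p (n + q) (\<iota> p a) (gmult A n q y (\<iota> q b))))"
  using assms by (intro kmod.is_linear_koszul[OF A.kmod] is_linear_comp[OF io_lin A.m_lin_l] A.m_in io_in) auto

lemma sandwich_lin_r:
  assumes "y \<in> elts A n" "a \<in> elts E p" "p + (n + q) = N"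
  shows "is_linear K (cmp E q) (cmp A N) (\<lambda>b. A.kz N i (gmult A p (n + q) (\<iota> p a) (gmult A n q y (\<iota> q b))))"
  using assms by (intro kmod.is_linear_koszul[OF A.kmod]
    is_linear_comp[OF is_linear_comp[OF io_lin A.m_lin_r[OF assms(1) refl]] A.m_lin_r] io_in) auto

lemma average_term_in:
  assumes "y \<in> elts A n" "k \<in> I"
  shows "A.kz n i (gmult A (d k) (n - d k) (\<iota> (d k) (u k)) (gmult A n (- d k) y (\<iota> (- d k) (w k)))) \<in> elts A n"
  using assms u_in w_in by (intro A.k_in A.m_in io_in) auto

lemma average_in: "y \<in> elts A n \<Longrightarrow> average n y \<in> elts A n"
  unfolding average_def by (intro kmod.finsum_in[OF A.kmod] average_term_in)

lemma average_lin: "is_linear K (cmp A n) (cmp A n) (average n)"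
  unfolding average_def[abs_def] using u_in w_in
  by (intro kmod.is_linear_finsum[OF A.kmod A.mod fin] kmod.is_linear_koszul[OF A.kmod]
      is_linear_comp[OF A.m_lin_l A.m_lin_r] io_in) auto

text \<open>Both products of the average with \<open>e\<close> are values of one bilinear map
  $(a, b) \mapsto (-1)^{pn} a y b$, with \<open>p\<close> the degree of \<open>a\<close>, on the two sides of
  \<open>casimir_central\<close>.\<close>

lemma average_central:
  assumes y: "y \<in> elts A n"
  shows "average n y \<in> C n"
  unfolding C_def
proof (intro CollectI conjI allI ballI average_in[OF y])
  fix m e assume e: "e \<in> elts E m"
  interpret M: kmod K "cmp A (n + m)" by (rule A.kmod)
  let ?\<beta> = "\<lambda>p a b. A.kz (n + m) (p * n) (gmult A p (n + (m - p)) (\<iota> p a) (gmult A n (m - p) y (\<iota> (m - p) b)))"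
  have cas: "(\<Oplus>\<^bsub>cmp A (n + m)\<^esub>j\<in>I. ?\<beta> (m + d j) (gmult E m (d j) e (u j)) (w j)) =
    (\<Oplus>\<^bsub>cmp A (n + m)\<^esub>i\<in>I. ?\<beta> (d i) (u i) (gmult E (- d i) m (w i) e))"
    by (rule casimir_central[OF A.mod e]; intro sandwich_lin_l sandwich_lin_r y; simp)
  \<comment> \<open>The right side of the Casimir identity: \<open>e\<close> is absorbed into the rows \<open>w k\<close>, without signs.\<close>
  have r: "gmult A n m (average n y) (\<iota> m e) = (\<Oplus>\<^bsub>cmp A (n + m)\<^esub>i\<in>I. ?\<beta> (d i) (u i) (gmult E (- d i) m (w i) e))"
  proof -
    have "gmult A n m (average n y) (\<iota> m e) = (\<Oplus>\<^bsub>cmp A (n + m)\<^esub>k\<in>I. gmult A n m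
       (A.kz n (d k * n) (gmult A (d k) (n - d k) (\<iota> (d k) (u k)) (gmult A n (- d k) y (\<iota> (- d k) (w k))))) (\<iota> m e))"
      unfolding average_def by (rule A.m_finsum_l[OF fin average_term_in[OF y] io_in[OF e] refl])
    also have "\<dots> = (\<Oplus>\<^bsub>cmp A (n + m)\<^esub>i\<in>I. ?\<beta> (d i) (u i) (gmult E (- d i) m (w i) e))"
    proof (rule M.finsum_cong_terms)
      fix k assume k: "k \<in> I"
      note U = io_in[OF u_in[OF k]] and W = io_in[OF w_in[OF k]]
      have yW: "gmult A n (- d k) y (\<iota> (- d k) (w k)) \<in> elts A (n - d k)" by (intro A.m_in y W) simp
      have UyW: "gmult A (d k) (n - d k) (\<iota> (d k) (u k)) (gmult A n (- d k) y (\<iota> (- d k) (w k))) \<in> elts A n"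
        by (intro A.m_in U yW) simp
      have we: "gmult E (- d k) m (w k) e \<in> elts E (m - d k)" by (intro E.m_in w_in k e) simp
      show "?\<beta> (d k) (u k) (gmult E (- d k) m (w k) e) \<in> elts A (n + m)"
        by (intro A.k_in A.m_in U y io_in we) auto
      have a1: "gmult A n m (gmult A (d k) (n - d k) (\<iota> (d k) (u k)) (gmult A n (- d k) y (\<iota> (- d k) (w k)))) (\<iota> m e)
        = gmult A (d k) (n + (m - d k)) (\<iota> (d k) (u k)) (gmult A (n - d k) m (gmult A n (- d k) y (\<iota> (- d k) (w k))) (\<iota> m e))"
        by (rule A.m_assoc[OF U yW io_in[OF e]]) auto
      have a2: "gmult A (n - d k) m (gmult A n (- d k) y (\<iota> (- d k) (w k))) (\<iota> m e) = gmult A n (m - d k) y (\<iota> (m - d k) (gmult E (- d k) m (w k) e))"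
        using A.m_assoc[OF y W io_in[OF e], of "n - d k" "m - d k"] io_mult[OF w_in[OF k] e, of "m - d k"] by simp
      show "gmult A n m (A.kz n (d k * n) (gmult A (d k) (n - d k) (\<iota> (d k) (u k)) (gmult A n (- d k) y (\<iota> (- d k) (w k))))) (\<iota> m e)
        = ?\<beta> (d k) (u k) (gmult E (- d k) m (w k) e)"
        using A.m_koszul_l[OF UyW io_in[OF e] refl] a1 a2 by simp
    qed
    finally show ?thesis .
  qed
  \<comment> \<open>The left side: \<open>e\<close> is absorbed into the columns, which raises their degree by \<open>m\<close>. The sign of the bilinear map changes by the Koszul sign of \<open>e\<close> and \<open>y\<close>.\<close>
  have l: "A.kz (n + m) (n * m) (gmult A m n (\<iota> m e) (average n y)) =
     (\<Oplus>\<^bsub>cmp A (n + m)\<^esub>j\<in>I. ?\<beta> (m + d j) (gmult E m (d j) e (u j)) (w j))"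
  proof -
    have mn: "m + n = n + m" by simp
    let ?t = "\<lambda>k. gmult A m n (\<iota> m e)
       (A.kz n (d k * n) (gmult A (d k) (n - d k) (\<iota> (d k) (u k)) (gmult A n (- d k) y (\<iota> (- d k) (w k)))))"
    have t: "?t k \<in> elts A (n + m)" if "k \<in> I" for k by (rule A.m_in[OF io_in[OF e] average_term_in[OF y that] mn])
    have "gmult A m n (\<iota> m e) (average n y) = (\<Oplus>\<^bsub>cmp A (n + m)\<^esub>k\<in>I. ?t k)"
      unfolding average_def by (rule A.m_finsum_r[OF fin average_term_in[OF y] io_in[OF e] mn])
    then have "A.kz (n + m) (n * m) (gmult A m n (\<iota> m e) (average n y)) = (\<Oplus>\<^bsub>cmp A (n + m)\<^esub>k\<in>I. A.kz (n + m) (n * m) (?t k))"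
      using lin_finsum[OF M.koszul_linear A.mod A.mod fin] t by simp
    also have "\<dots> = (\<Oplus>\<^bsub>cmp A (n + m)\<^esub>j\<in>I. ?\<beta> (m + d j) (gmult E m (d j) e (u j)) (w j))"
    proof (rule M.finsum_cong_terms)
      fix k assume k: "k \<in> I"
      note U = io_in[OF u_in[OF k]] and W = io_in[OF w_in[OF k]]
      have yW: "gmult A n (- d k) y (\<iota> (- d k) (w k)) \<in> elts A (n - d k)" by (intro A.m_in y W) simp
      have UyW: "gmult A (d k) (n - d k) (\<iota> (d k) (u k)) (gmult A n (- d k) y (\<iota> (- d k) (w k))) \<in> elts A n"
        by (intro A.m_in U yW) simp
      have eu: "gmult E m (d k) e (u k) \<in> elts E (m + d k)" by (intro E.m_in u_in k e) simp
      show "?\<beta> (m + d k) (gmult E m (d k) e (u k)) (w k) \<in> elts A (n + m)"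
        using w_in[OF k] by (intro A.k_in A.m_in y io_in eu) auto
      have a: "gmult A m n (\<iota> m e) (gmult A (d k) (n - d k) (\<iota> (d k) (u k)) (gmult A n (- d k) y (\<iota> (- d k) (w k)))) =
        gmult A (m + d k) (n - d k) (\<iota> (m + d k) (gmult E m (d k) e (u k))) (gmult A n (- d k) y (\<iota> (- d k) (w k)))"
        using A.m_assoc[OF io_in[OF e] U yW refl, of n] io_mult[OF e u_in[OF k] refl] by simp
      have i: "gmult A (m + d k) (n - d k) (\<iota> (m + d k) (gmult E m (d k) e (u k))) (gmult A n (- d k) y (\<iota> (- d k) (w k))) \<in> elts A (n + m)"
        by (intro A.m_in io_in eu yW) simp
      show "A.kz (n + m) (n * m) (?t k) = ?\<beta> (m + d k) (gmult E m (d k) e (u k)) (w k)"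
        using A.m_koszul_r[OF io_in[OF e] UyW mn] a A.kz_kz[OF i] by (simp add: algebra_simps)
    qed
    finally show ?thesis .
  qed
  show "gmult A n m (average n y) (\<iota> m e) = A.kz (n + m) (n * m) (gmult A m n (\<iota> m e) (average n y))"
    using cas l r by simp
qed

lemma C_swap:
  assumes "z \<in> C n" "e \<in> elts E m" "n + m = p"
  shows "gmult A n m z (\<iota> m e) = A.kz p (n * m) (gmult A m n (\<iota> m e) z)"
  using C_c assms by blast

lemma sum_UW: "(\<Oplus>\<^bsub>cmp A 0\<^esub>k\<in>I. gmult A (d k) (- d k) (\<iota> (d k) (u k)) (\<iota> (- d k) (w k))) = gone A"
proof -
  have i: "gmult E (d k) (- d k) (u k) (w k) \<in> elts E 0" if "k \<in> I" for k by (intro E.m_in u_in w_in that) simp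
  have "gone A = \<iota> 0 (\<Oplus>\<^bsub>cmp E 0\<^esub>k\<in>I. gmult E (d k) (- d k) (u k) (w k))" using dga_homD(5)[OF io] unit by simp
  also have "\<dots> = (\<Oplus>\<^bsub>cmp A 0\<^esub>k\<in>I. \<iota> 0 (gmult E (d k) (- d k) (u k) (w k)))"
    using i by (intro lin_finsum[OF io_lin E.mod A.mod fin]) auto
  also have "\<dots> = (\<Oplus>\<^bsub>cmp A 0\<^esub>k\<in>I. gmult A (d k) (- d k) (\<iota> (d k) (u k)) (\<iota> (- d k) (w k)))"
    using u_in w_in by (intro kmod.finsum_cong_terms[OF A.kmod] io_mult A.m_in io_in) auto
  finally show ?thesis by simp
qed

text \<open>A central \<open>z\<close> moves past each \<open>w k\<close> at the cost of exactly the sign in the average, which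
  leaves $\sum_k u_k \epsilon w_k z = z$. In particular \<open>z\<close> is recovered from \<open>eps z\<close>.\<close>

lemma average_eps_central:
  assumes z: "z \<in> C n"
  shows "average n (gmult A 0 n (\<iota> 0 eps) z) = z"
proof -
  note zA = C_in[OF z] and ep = io_in[OF eps_in]
  interpret M: kmod K "cmp A n" by (rule A.kmod)
  have "average n (gmult A 0 n (\<iota> 0 eps) z) = (\<Oplus>\<^bsub>cmp A n\<^esub>k\<in>I. gmult A 0 n (gmult A (d k) (- d k) (\<iota> (d k) (u k)) (\<iota> (- d k) (w k))) z)"
    unfolding average_def
  proof (rule M.finsum_cong_terms)
    fix k assume k: "k \<in> I"
    note U = io_in[OF u_in[OF k]] and W = io_in[OF w_in[OF k]]
    have Wz: "gmult A (- d k) n (\<iota> (- d k) (w k)) z \<in> elts A (n - d k)" by (intro A.m_in W zA) simp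
    show "gmult A 0 n (gmult A (d k) (- d k) (\<iota> (d k) (u k)) (\<iota> (- d k) (w k))) z \<in> elts A n"
      by (intro A.m_in U W zA) auto
    have 1: "gmult A n (- d k) (gmult A 0 n (\<iota> 0 eps) z) (\<iota> (- d k) (w k)) = gmult A 0 (n - d k) (\<iota> 0 eps) (gmult A n (- d k) z (\<iota> (- d k) (w k)))"
      by (rule A.m_assoc[OF ep zA W]) auto
    have 2: "gmult A n (- d k) z (\<iota> (- d k) (w k)) = A.kz (n - d k) (n * - d k) (gmult A (- d k) n (\<iota> (- d k) (w k)) z)"
      by (rule C_swap[OF z w_in[OF k]]) simp
    have 3: "gmult A (d k) (n - d k) (\<iota> (d k) (u k)) (gmult A 0 (n - d k) (\<iota> 0 eps) x) = gmult A (d k) (n - d k) (\<iota> (d k) (u k)) x"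
      if "x \<in> elts A (n - d k)" for x
      using A.m_assoc[OF U ep that, of "d k" "n - d k"] io_mult[OF u_in[OF k] eps_in, of "d k"] u_eps[OF k] by simp
    have 4: "gmult A (d k) (n - d k) (\<iota> (d k) (u k)) (A.kz (n - d k) (n * - d k) (gmult A (- d k) n (\<iota> (- d k) (w k)) z)) =
      A.kz n (n * - d k) (gmult A 0 n (gmult A (d k) (- d k) (\<iota> (d k) (u k)) (\<iota> (- d k) (w k))) z)"
      using A.m_koszul_r[OF U Wz, of n] A.m_assoc[OF U W zA, of 0 "n - d k"] by simp
    have 5: "gmult A 0 n (gmult A (d k) (- d k) (\<iota> (d k) (u k)) (\<iota> (- d k) (w k))) z \<in> elts A n"
      by (intro A.m_in U W zA) auto
    show "A.kz n (d k * n) (gmult A (d k) (n - d k) (\<iota> (d k) (u k)) (gmult A n (- d k) (gmult A 0 n (\<iota> 0 eps) z) (\<iota> (- d k) (w k)))) =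
       gmult A 0 n (gmult A (d k) (- d k) (\<iota> (d k) (u k)) (\<iota> (- d k) (w k))) z"
      unfolding 1 2 3[OF A.k_in[OF Wz]] 4 A.kz_kz[OF 5] by (simp add: A.kz_even algebra_simps)
  qed
  also have "\<dots> = gmult A 0 n (\<Oplus>\<^bsub>cmp A 0\<^esub>k\<in>I. gmult A (d k) (- d k) (\<iota> (d k) (u k)) (\<iota> (- d k) (w k))) z"
    using u_in w_in by (intro A.m_finsum_l[OF fin _ zA, symmetric] A.m_in io_in) simp_all
  also have "\<dots> = z" using A.one_l[OF zA] by (simp add: sum_UW)
  finally show ?thesis .
qed

text \<open>The average of \<open>y\<close> has the same corner as \<open>y\<close>; this is \<open>casimir_eps\<close> for the bilinear map
  $(a, b) \mapsto (-1)^{pn} a y b$.\<close>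

lemma eps_average:
  assumes y: "y \<in> elts A n"
  shows "gmult A 0 n (\<iota> 0 eps) (average n y) = gmult A 0 n (\<iota> 0 eps) (gmult A n 0 y (\<iota> 0 eps))"
proof -
  interpret M: kmod K "cmp A n" by (rule A.kmod)
  note ep = io_in[OF eps_in]
  let ?\<beta> = "\<lambda>p a b. A.kz n (p * n) (gmult A p (n + - p) (\<iota> p a) (gmult A n (- p) y (\<iota> (- p) b)))"
  have cas: "(\<Oplus>\<^bsub>cmp A n\<^esub>k\<in>I. ?\<beta> (d k) (gmult E 0 (d k) eps (u k)) (w k)) = ?\<beta> 0 eps eps"
    by (rule casimir_eps[OF A.mod]; intro sandwich_lin_l sandwich_lin_r y; simp)
  have "gmult A 0 n (\<iota> 0 eps) (average n y) = (\<Oplus>\<^bsub>cmp A n\<^esub>k\<in>I. gmult A 0 n (\<iota> 0 eps)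
       (A.kz n (d k * n) (gmult A (d k) (n - d k) (\<iota> (d k) (u k)) (gmult A n (- d k) y (\<iota> (- d k) (w k))))))"
    unfolding average_def by (rule A.m_finsum_r[OF fin average_term_in[OF y] ep]) simp_all
  also have "\<dots> = (\<Oplus>\<^bsub>cmp A n\<^esub>k\<in>I. ?\<beta> (d k) (gmult E 0 (d k) eps (u k)) (w k))"
  proof (rule M.finsum_cong_terms)
    fix k assume k: "k \<in> I"
    note U = io_in[OF u_in[OF k]] and W = io_in[OF w_in[OF k]]
    have yW: "gmult A n (- d k) y (\<iota> (- d k) (w k)) \<in> elts A (n - d k)" by (intro A.m_in y W) simp
    have UyW: "gmult A (d k) (n - d k) (\<iota> (d k) (u k)) (gmult A n (- d k) y (\<iota> (- d k) (w k))) \<in> elts A n"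
      by (intro A.m_in U yW) simp
    have eu: "gmult E 0 (d k) eps (u k) \<in> elts E (d k)" by (intro E.m_in u_in k eps_in) simp
    show "?\<beta> (d k) (gmult E 0 (d k) eps (u k)) (w k) \<in> elts A n"
      using w_in[OF k] by (intro A.k_in A.m_in y io_in eu) auto
    show "gmult A 0 n (\<iota> 0 eps) (A.kz n (d k * n) (gmult A (d k) (n - d k) (\<iota> (d k) (u k)) (gmult A n (- d k) y (\<iota> (- d k) (w k)))))
      = ?\<beta> (d k) (gmult E 0 (d k) eps (u k)) (w k)"
      using A.m_koszul_r[OF ep UyW, of n] A.m_assoc[OF ep U yW, of "d k" n] io_mult[OF eps_in u_in[OF k], of "d k"] by simp
  qed
  also have "\<dots> = ?\<beta> 0 eps eps" by (rule cas)
  finally show ?thesis by (simp add: A.kz_even)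
qed


definition corner where
  "corner n x i j = gmult A (- d i) (n + d j) (\<iota> (- d i) (w i)) (gmult A n (d j) x (\<iota> (d j) (u j)))"

lemma corner_in: "x \<in> elts A n \<Longrightarrow> i \<in> I \<Longrightarrow> j \<in> I \<Longrightarrow> corner n x i j \<in> elts A (n + d j - d i)"
  unfolding corner_def by (intro A.m_in io_in w_in u_in) auto

lemma corner_lin: "i \<in> I \<Longrightarrow> j \<in> I \<Longrightarrow> is_linear K (cmp A n) (cmp A (n + d j - d i)) (\<lambda>x. corner n x i j)"
  unfolding corner_def by (intro is_linear_comp[OF A.m_lin_l A.m_lin_r] io_in w_in u_in) auto

lemma U_eps:
  assumes "i \<in> I" "x \<in> elts A q" "d i + q = N"
  shows "gmult A (d i) q (\<iota> (d i) (u i)) (gmult A 0 q (\<iota> 0 eps) x) = gmult A (d i) q (\<iota> (d i) (u i)) x"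
  using A.m_assoc[OF io_in[OF u_in] io_in[OF eps_in] assms(2), of i "d i" q] io_mult[OF u_in eps_in, of i "d i"] u_eps assms by simp

text \<open>Since $u_i = u_i \epsilon$ and $w_j = \epsilon w_j$, only the corner of the middle factor
  matters between \<open>u i\<close> and \<open>w j\<close>, and averaging preserves it.\<close>

lemma sandwich_average:
  assumes y: "y \<in> elts A r" and i: "i \<in> I" and j: "j \<in> I"
  shows "gmult A (d i) (r - d j) (\<iota> (d i) (u i)) (gmult A r (- d j) (average r y) (\<iota> (- d j) (w j))) =
    gmult A (d i) (r - d j) (\<iota> (d i) (u i)) (gmult A r (- d j) y (\<iota> (- d j) (w j)))"
proof -
  note U = io_in[OF u_in[OF i]] and W = io_in[OF w_in[OF j]] and ep = io_in[OF eps_in] and ty = average_in[OF y]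
  have tW: "gmult A r (- d j) (average r y) (\<iota> (- d j) (w j)) \<in> elts A (r - d j)" by (intro A.m_in ty W) simp
  have yW: "gmult A r (- d j) y (\<iota> (- d j) (w j)) \<in> elts A (r - d j)" by (intro A.m_in y W) simp
  have ye: "gmult A r 0 y (\<iota> 0 eps) \<in> elts A r" by (intro A.m_in y ep) simp
  have eW: "gmult A 0 (- d j) (\<iota> 0 eps) (\<iota> (- d j) (w j)) = \<iota> (- d j) (w j)"
    using io_mult[OF eps_in w_in[OF j], of "- d j"] eps_w[OF j] by simp
  have "gmult A 0 (r - d j) (\<iota> 0 eps) (gmult A r (- d j) (average r y) (\<iota> (- d j) (w j))) =
      gmult A r (- d j) (gmult A 0 r (\<iota> 0 eps) (gmult A r 0 y (\<iota> 0 eps))) (\<iota> (- d j) (w j))"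
    using A.m_assoc[OF ep ty W, of r "r - d j"] eps_average[OF y] by simp
  also have "\<dots> = gmult A 0 (r - d j) (\<iota> 0 eps) (gmult A r (- d j) (gmult A r 0 y (\<iota> 0 eps)) (\<iota> (- d j) (w j)))"
    by (rule A.m_assoc[OF ep ye W]) auto
  also have "gmult A r (- d j) (gmult A r 0 y (\<iota> 0 eps)) (\<iota> (- d j) (w j)) = gmult A r (- d j) y (\<iota> (- d j) (w j))"
    using A.m_assoc[OF y ep W, of r "- d j"] eW by simp
  finally show ?thesis using U_eps[OF i tW refl] U_eps[OF i yW refl] by simp
qed

text \<open>By \<open>sandwich_average\<close> the term of index \<open>(i, j)\<close> is $u_i w_i x u_j w_j$, and $\sum_i u_i w_i$ is
  the unit. This writes \<open>x\<close> as a matrix with entries in the centralizer.\<close>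

lemma matrix_decomposition:
  assumes x: "x \<in> elts A n"
  shows "(\<Oplus>\<^bsub>cmp A n\<^esub>i\<in>I. \<Oplus>\<^bsub>cmp A n\<^esub>j\<in>I. gmult A (d i) (n - d i) (\<iota> (d i) (u i))
    (gmult A (n + d j - d i) (- d j) (average (n + d j - d i) (corner n x i j)) (\<iota> (- d j) (w j)))) = x"
proof -
  interpret M: kmod K "cmp A n" by (rule A.kmod)
  let ?uw = "\<lambda>i. gmult A (d i) (- d i) (\<iota> (d i) (u i)) (\<iota> (- d i) (w i))"
  have uw: "?uw i \<in> elts A 0" if "i \<in> I" for i by (intro A.m_in io_in u_in w_in that) simp
  have xuw: "gmult A n 0 x (?uw j) \<in> elts A n" if "j \<in> I" for j by (intro A.m_in x uw that) simp
  have uwx: "gmult A 0 n (?uw i) x \<in> elts A n" if "i \<in> I" for i by (intro A.m_in x uw that) simp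
  have t: "gmult A (d i) (n - d i) (\<iota> (d i) (u i)) (gmult A (n + d j - d i) (- d j) (average (n + d j - d i) (corner n x i j)) (\<iota> (- d j) (w j))) =
      gmult A 0 n (?uw i) (gmult A n 0 x (?uw j))" if i: "i \<in> I" and j: "j \<in> I" for i j
  proof -
    let ?r = "n + d j - d i"
    note Ui = io_in[OF u_in[OF i]] and Wi = io_in[OF w_in[OF i]] and Uj = io_in[OF u_in[OF j]] and Wj = io_in[OF w_in[OF j]]
    have xU: "gmult A n (d j) x (\<iota> (d j) (u j)) \<in> elts A (n + d j)" by (intro A.m_in x Uj refl)
    have 1: "gmult A ?r (- d j) (corner n x i j) (\<iota> (- d j) (w j)) = gmult A (- d i) n (\<iota> (- d i) (w i)) (gmult A n 0 x (?uw j))"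
      unfolding corner_def using A.m_assoc[OF Wi xU Wj, of ?r n] A.m_assoc[OF x Uj Wj, of "n + d j" 0] by simp
    have "?r - d j = n - d i" by simp
    then show ?thesis using sandwich_average[OF corner_in[OF x i j] i j] 1 A.m_assoc[OF Ui Wi xuw[OF j], of 0 "n - d i"] by simp
  qed
  have "(\<Oplus>\<^bsub>cmp A n\<^esub>i\<in>I. \<Oplus>\<^bsub>cmp A n\<^esub>j\<in>I. gmult A (d i) (n - d i) (\<iota> (d i) (u i))
      (gmult A (n + d j - d i) (- d j) (average (n + d j - d i) (corner n x i j)) (\<iota> (- d j) (w j))))
    = (\<Oplus>\<^bsub>cmp A n\<^esub>i\<in>I. \<Oplus>\<^bsub>cmp A n\<^esub>j\<in>I. gmult A 0 n (?uw i) (gmult A n 0 x (?uw j)))"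
    using t A.m_in[OF uw xuw] by (intro M.finsum_cong_terms M.finsum_in) auto
  also have "\<dots> = (\<Oplus>\<^bsub>cmp A n\<^esub>i\<in>I. gmult A 0 n (?uw i) x)"
  proof (rule M.finsum_cong_terms[OF _ uwx])
    fix i assume i: "i \<in> I"
    have "(\<Oplus>\<^bsub>cmp A n\<^esub>j\<in>I. gmult A n 0 x (?uw j)) = gmult A n 0 x (\<Oplus>\<^bsub>cmp A 0\<^esub>j\<in>I. ?uw j)"
      by (rule A.m_finsum_r[OF fin uw x, symmetric]) auto
    then have "(\<Oplus>\<^bsub>cmp A n\<^esub>j\<in>I. gmult A n 0 x (?uw j)) = x" using A.one_r[OF x] by (simp add: sum_UW)
    then show "(\<Oplus>\<^bsub>cmp A n\<^esub>j\<in>I. gmult A 0 n (?uw i) (gmult A n 0 x (?uw j))) = gmult A 0 n (?uw i) x"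
      using A.m_finsum_r[where f="\<lambda>j. gmult A n 0 x (?uw j)", OF fin xuw uw[OF i], of n] by simp
  qed
  also have "\<dots> = gmult A 0 n (\<Oplus>\<^bsub>cmp A 0\<^esub>i\<in>I. ?uw i) x"
    by (rule A.m_finsum_l[OF fin uw x, symmetric]) auto
  also have "\<dots> = x" using A.one_l[OF x] by (simp add: sum_UW)
  finally show ?thesis .
qed

text \<open>A term $u_i z w_j$ of the decomposition equals $\pm (u_i w_j) z$, so the products of elements
  of \<open>E\<close> and of the centralizer span. This is how all identities between maps on \<open>A\<close> are
  checked.\<close>

lemma linear_eq_on_products:
  assumes H: "is_linear K (cmp A n) M H" and H': "is_linear K (cmp A n) M H'" and M: "module K M"
    and eq: "\<And>p q e z. p + q = n \<Longrightarrow> e \<in> elts E p \<Longrightarrow> z \<in> C q \<Longrightarrow>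
      H (gmult A p q (\<iota> p e) z) = H' (gmult A p q (\<iota> p e) z)"
    and x: "x \<in> elts A n"
  shows "H x = H' x"
proof -
  interpret M: kmod K M using M by (simp add: kmod_def)
  interpret N: kmod K "cmp A n" by (rule A.kmod)
  let ?t = "\<lambda>i j. gmult A (d i) (n - d i) (\<iota> (d i) (u i))
    (gmult A (n + d j - d i) (- d j) (average (n + d j - d i) (corner n x i j)) (\<iota> (- d j) (w j)))"
  have t: "?t i j \<in> elts A n" "H (?t i j) = H' (?t i j)" if i: "i \<in> I" and j: "j \<in> I" for i j
  proof -
    let ?r = "n + d j - d i"
    let ?z = "average ?r (corner n x i j)"
    have z: "?z \<in> C ?r" by (rule average_central[OF corner_in[OF x i j]])
    note U = io_in[OF u_in[OF i]] and W = io_in[OF w_in[OF j]] and zA = C_in[OF z]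
    show tA: "?t i j \<in> elts A n" by (intro A.m_in U W zA) auto
    have uw: "gmult E (d i) (- d j) (u i) (w j) \<in> elts E (d i - d j)" by (intro E.m_in u_in w_in i j) simp
    let ?p = "gmult A (d i - d j) ?r (\<iota> (d i - d j) (gmult E (d i) (- d j) (u i) (w j))) ?z"
    have p: "?p \<in> elts A n" by (intro A.m_in io_in uw zA) simp
    have "?t i j = A.kz n (?r * - d j) ?p"
      using C_swap[OF z w_in[OF j], of "n - d i"] A.m_koszul_r[OF U A.m_in[OF W zA], of "n - d i" n]
        A.m_assoc[OF U W zA, of "d i - d j" "n - d i"] io_mult[OF u_in[OF i] w_in[OF j], of "d i - d j"] by simp
    then show "H (?t i j) = H' (?t i j)"
      using lin_koszul[OF H A.mod M p] lin_koszul[OF H' A.mod M p] eq[OF _ uw z] by simp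
  qed
  have s: "(\<Oplus>\<^bsub>cmp A n\<^esub>j\<in>I. ?t i j) \<in> elts A n" if "i \<in> I" for i by (intro N.finsum_in t that)
  have *: "F x = (\<Oplus>\<^bsub>M\<^esub>i\<in>I. \<Oplus>\<^bsub>M\<^esub>j\<in>I. F (?t i j))" if F: "is_linear K (cmp A n) M F" for F
  proof -
    have "F x = F (\<Oplus>\<^bsub>cmp A n\<^esub>i\<in>I. \<Oplus>\<^bsub>cmp A n\<^esub>j\<in>I. ?t i j)" using matrix_decomposition[OF x] by simp
    also have "\<dots> = (\<Oplus>\<^bsub>M\<^esub>i\<in>I. F (\<Oplus>\<^bsub>cmp A n\<^esub>j\<in>I. ?t i j))" using s by (intro lin_finsum[OF F A.mod M fin]) auto
    also have "\<dots> = (\<Oplus>\<^bsub>M\<^esub>i\<in>I. \<Oplus>\<^bsub>M\<^esub>j\<in>I. F (?t i j))"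
      using t is_linearD(1)[OF F] by (intro M.finsum_cong_terms M.finsum_in lin_finsum[OF F A.mod M fin]) auto
    finally show ?thesis .
  qed
  show ?thesis unfolding *[OF H] *[OF H']
    using t is_linearD(1)[OF H'] by (intro M.finsum_cong_terms M.finsum_in) auto
qed

lemma average_lin_Z: "is_linear K (cmp A n) (cmp Z n) (average n)"
  by (rule into_Z[OF average_lin average_central])

end

section \<open>A framed map exhibits its target as a graded tensor product\<close>

text \<open>The data of a morphism out of a graded tensor product: morphisms \<open>f\<close> on \<open>E\<close> and \<open>g\<close> on the
  centralizer whose values commute up to the Koszul sign.\<close>

locale framed_pair = framed_map K E A \<iota> I d u w eps chi + T0: dga K T
  for K :: "('k, 'r) ring_scheme" (structure) and E :: "('k, 'e) dga_rec" and A :: "('k, 'a) dga_rec" and \<iota>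
    and I :: "'i set" and d u w eps chi and T :: "('k, 't) dga_rec" +
  fixes f g
  assumes f: "f \<in> dga_hom K E T" and g: "g \<in> dga_hom K Z T"
    and fg: "e \<in> elts E p \<Longrightarrow> z \<in> C q \<Longrightarrow>
      gmult T q p (g q z) (f p e) = koszul (cmp T (q + p)) (q * p) (gmult T p q (f p e) (g q z))"
begin

sublocale T: pre_dga K T by (rule dga_pre[OF T0.dga_axioms])

lemma f_in: "e \<in> elts E p \<Longrightarrow> f p e \<in> elts T p" by (rule dga_homD(2)[OF f])
lemma g_in: "z \<in> C q \<Longrightarrow> g q z \<in> elts T q" using dga_homD(2)[OF g] by (simp add: eltsZ)
lemma f_mult: "x \<in> elts E m \<Longrightarrow> y \<in> elts E n \<Longrightarrow> m + n = p \<Longrightarrow> f p (gmult E m n x y) = gmult T m n (f m x) (f n y)"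
  using dga_homD(4)[OF f] by blast
lemma g_mult: "x \<in> C m \<Longrightarrow> y \<in> C n \<Longrightarrow> m + n = p \<Longrightarrow> g p (gmult A m n x y) = gmult T m n (g m x) (g n y)"
  using dga_homD(4)[OF g, of x m y n] by (auto simp: eltsZ selZ)

text \<open>The map to be constructed is forced by \<open>matrix_decomposition\<close>: apply \<open>f\<close> to the outer factors
  and \<open>g\<close> to the entries. As a formula in \<open>x\<close> it is visibly linear and well defined.\<close>

definition extension where
  "extension n x = (\<Oplus>\<^bsub>cmp T n\<^esub>i\<in>I. \<Oplus>\<^bsub>cmp T n\<^esub>j\<in>I. gmult T (d i) (n - d i) (f (d i) (u i))
    (gmult T (n + d j - d i) (- d j) (g (n + d j - d i) (average (n + d j - d i) (corner n x i j))) (f (- d j) (w j))))"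

lemma extension_lin: "is_linear K (cmp A n) (cmp T n) (extension n)"
  unfolding extension_def[abs_def]
proof (intro kmod.is_linear_finsum[OF T.kmod A.mod fin])
  fix i j assume i: "i \<in> I" and j: "j \<in> I"
  let ?r = "n + d j - d i"
  have "is_linear K (cmp A n) (cmp T ?r) (\<lambda>x. g ?r (average ?r (corner n x i j)))"
    by (rule is_linear_comp[OF is_linear_comp[OF corner_lin[OF i j] average_lin_Z] dga_homD(1)[OF g]])
  moreover have "is_linear K (cmp T ?r) (cmp T (n - d i)) (\<lambda>y. gmult T ?r (- d j) y (f (- d j) (w j)))"
    by (intro T.m_lin_l f_in w_in j) simp
  moreover have "is_linear K (cmp T (n - d i)) (cmp T n) (gmult T (d i) (n - d i) (f (d i) (u i)))"
    by (intro T.m_lin_r f_in u_in i) simp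
  ultimately show "is_linear K (cmp A n) (cmp T n) (\<lambda>x. gmult T (d i) (n - d i) (f (d i) (u i))
     (gmult T ?r (- d j) (g ?r (average ?r (corner n x i j))) (f (- d j) (w j))))"
    using is_linear_comp by blast
qed

text \<open>For $x = e z$ the corner $w_i x u_j$ is, up to sign, the multiple of $\epsilon z$ by the
  \<open>(i, j)\<close> entry of \<open>e\<close>, so its average is that multiple of \<open>z\<close>. The sum then collapses to
  \<open>f e g z\<close> by \<open>matrix_expansion\<close>. The sign from moving \<open>z\<close> past \<open>u j\<close> cancels the one from
  moving \<open>g z\<close> past \<open>f (w j)\<close>.\<close>

lemma extension_product:
  assumes e: "e \<in> elts E p" and z: "z \<in> C q" and n: "p + q = n"
  shows "extension n (gmult A p q (\<iota> p e) z) = gmult T p q (f p e) (g q z)"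
proof -
  interpret N: kmod K "cmp T n" by (rule T.kmod)
  interpret P: kmod K "cmp E p" by (rule E.kmod)
  let ?t = "\<lambda>i j. if d i = p + d j then coef p e i j \<odot>\<^bsub>cmp E p\<^esub> gmult E (d i) (- d j) (u i) (w j) else \<zero>\<^bsub>cmp E p\<^esub>"
  let ?L = "\<lambda>e. gmult T p q (f p e) (g q z)"
  note gz = g_in[OF z] and zA = C_in[OF z] and ep = io_in[OF eps_in]
  have L: "is_linear K (cmp E p) (cmp T n) ?L"
    by (rule is_linear_comp[OF dga_homD(1)[OF f] T.m_lin_l[OF gz n]])
  have t: "?t i j \<in> elts E p" if ij: "i \<in> I" "j \<in> I" for i j
    using coef_in[OF ij e] E.m_in[OF u_in[OF ij(1)] w_in[OF ij(2)], of p] by (auto intro: E.s_in)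
  have s: "(\<Oplus>\<^bsub>cmp E p\<^esub>j\<in>I. ?t i j) \<in> elts E p" if "i \<in> I" for i by (intro P.finsum_in t that)
  have Lt: "?L (?t i j) \<in> elts T n" if ij: "i \<in> I" "j \<in> I" for i j by (rule is_linearD(1)[OF L t[OF ij]])
  have "extension n (gmult A p q (\<iota> p e) z) = (\<Oplus>\<^bsub>cmp T n\<^esub>i\<in>I. \<Oplus>\<^bsub>cmp T n\<^esub>j\<in>I. ?L (?t i j))"
    unfolding extension_def
  proof (intro N.finsum_cong_terms N.finsum_in Lt; assumption?)
    fix i j assume i: "i \<in> I" and j: "j \<in> I"
    let ?r = "n + d j - d i"
    note Ui = io_in[OF u_in[OF i]] and Wi = io_in[OF w_in[OF i]] and Uj = io_in[OF u_in[OF j]] and Wj = io_in[OF w_in[OF j]]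
    have eu: "gmult E p (d j) e (u j) \<in> elts E (p + d j)" by (intro E.m_in e u_in j refl)
    have euz: "gmult A (p + d j) q (\<iota> (p + d j) (gmult E p (d j) e (u j))) z \<in> elts A (n + d j)" using n by (intro A.m_in io_in eu zA) simp
    have weu: "gmult E (- d i) (p + d j) (w i) (gmult E p (d j) e (u j)) \<in> elts E (p + d j - d i)" by (intro E.m_in eu w_in i) simp
    have "gmult A n (d j) (gmult A p q (\<iota> p e) z) (\<iota> (d j) (u j)) = gmult A p (q + d j) (\<iota> p e) (A.kz (q + d j) (q * d j) (gmult A (d j) q (\<iota> (d j) (u j)) z))"
      using A.m_assoc[OF io_in[OF e] zA Uj n refl] C_swap[OF z u_in[OF j] refl] by simp
    also have "\<dots> = A.kz (n + d j) (q * d j) (gmult A (p + d j) q (\<iota> (p + d j) (gmult E p (d j) e (u j))) z)"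
      using A.m_koszul_r[OF io_in[OF e] A.m_in[OF Uj zA], of "q + d j" "n + d j"] n
        A.m_assoc[OF io_in[OF e] Uj zA, of "p + d j" "q + d j"] io_mult[OF e u_in[OF j] refl] by simp
    finally have xU: "gmult A n (d j) (gmult A p q (\<iota> p e) z) (\<iota> (d j) (u j)) = A.kz (n + d j) (q * d j) (gmult A (p + d j) q (\<iota> (p + d j) (gmult E p (d j) e (u j))) z)" .
    have corner: "corner n (gmult A p q (\<iota> p e) z) i j =
        A.kz ?r (q * d j) (gmult A (p + d j - d i) q (\<iota> (p + d j - d i) (gmult E (- d i) (p + d j) (w i) (gmult E p (d j) e (u j)))) z)"
      unfolding corner_def xU using A.m_koszul_r[OF Wi euz, of ?r] n
        A.m_assoc[OF Wi io_in[OF eu] zA, of "p + d j - d i" "n + d j"] io_mult[OF w_in[OF i] eu, of "p + d j - d i"] by (simp add: ac_simps)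
    show "gmult T (d i) (n - d i) (f (d i) (u i)) (gmult T ?r (- d j) (g ?r (average ?r (corner n (gmult A p q (\<iota> p e) z) i j))) (f (- d j) (w j))) = ?L (?t i j)"
    proof (cases "d i = p + d j")
      case True
      note c = coef_in[OF i j e True]
      have r: "?r = q" "p + d j - d i = 0" "n - d i = q - d j" using True n by auto
      have ez: "gmult A 0 q (\<iota> 0 eps) z \<in> elts A q" by (intro A.m_in ep zA) simp
      have io: "\<iota> 0 (coef p e i j \<odot>\<^bsub>cmp E 0\<^esub> eps) = coef p e i j \<odot>\<^bsub>cmp A 0\<^esub> \<iota> 0 eps" by (rule is_linearD(3)[OF io_lin c eps_in])
      have "corner n (gmult A p q (\<iota> p e) z) i j = A.kz q (q * d j) (coef p e i j \<odot>\<^bsub>cmp A q\<^esub> gmult A 0 q (\<iota> 0 eps) z)"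
        unfolding corner r matrix_entry[OF i j e] using True io A.m_smult_l[OF c ep zA, of q] by simp
      then have "average q (corner n (gmult A p q (\<iota> p e) z) i j) = A.kz q (q * d j) (coef p e i j \<odot>\<^bsub>cmp A q\<^esub> z)"
        using lin_koszul[OF average_lin A.mod A.mod A.s_in[OF c ez]] is_linearD(3)[OF average_lin c ez] average_eps_central[OF z] by simp
      moreover have cz: "coef p e i j \<odot>\<^bsub>cmp A q\<^esub> z \<in> C q" using module.submoduleE(4)[OF A.mod C_sub c z] .
      moreover have "g q (coef p e i j \<odot>\<^bsub>cmp A q\<^esub> z) = coef p e i j \<odot>\<^bsub>cmp T q\<^esub> g q z"
        using is_linearD(3)[OF dga_homD(1)[OF g, of q] c, of z] z by (simp add: eltsZ selZ)
      moreover have "g q (A.kz q (q * d j) (coef p e i j \<odot>\<^bsub>cmp A q\<^esub> z)) = T.kz q (q * d j) (g q (coef p e i j \<odot>\<^bsub>cmp A q\<^esub> z))"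
        using dga_hom_koszul[OF dgaZ T0.dga_axioms g cz[folded eltsZ], of "q * d j"] restrict_koszul[OF A.mod C_sub cz] by (simp add: selZ)
      ultimately have gt: "g q (average q (corner n (gmult A p q (\<iota> p e) z) i j)) = T.kz q (q * d j) (coef p e i j \<odot>\<^bsub>cmp T q\<^esub> g q z)"
        by simp
      have uw: "gmult E (d i) (- d j) (u i) (w j) \<in> elts E p" using True by (intro E.m_in u_in w_in i j) simp
      note fu = f_in[OF u_in[OF i]] and fw = f_in[OF w_in[OF j]]
      have fwg: "gmult T (- d j) q (f (- d j) (w j)) (g q z) \<in> elts T (q - d j)" by (intro T.m_in fw gz) simp
      have "gmult T q (- d j) (T.kz q (q * d j) (coef p e i j \<odot>\<^bsub>cmp T q\<^esub> g q z)) (f (- d j) (w j)) =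
          T.kz (q - d j) (q * d j) (coef p e i j \<odot>\<^bsub>cmp T (q - d j)\<^esub> T.kz (q - d j) (q * - d j) (gmult T (- d j) q (f (- d j) (w j)) (g q z)))"
        using T.m_koszul_l[OF T.s_in[OF c gz] fw, of "q - d j"] T.m_smult_l[OF c gz fw, of "q - d j"] fg[OF w_in[OF j] z] by simp
      also have "\<dots> = coef p e i j \<odot>\<^bsub>cmp T (q - d j)\<^esub> gmult T (- d j) q (f (- d j) (w j)) (g q z)"
        using kmod.koszul_smult[OF T.kmod c] T.k_in[OF fwg] T.kz_kz[OF fwg] by (simp add: T.kz_even)
      finally have *: "gmult T q (- d j) (T.kz q (q * d j) (coef p e i j \<odot>\<^bsub>cmp T q\<^esub> g q z)) (f (- d j) (w j)) =
        coef p e i j \<odot>\<^bsub>cmp T (q - d j)\<^esub> gmult T (- d j) q (f (- d j) (w j)) (g q z)" .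
      have "gmult T (d i) (q - d j) (f (d i) (u i)) (coef p e i j \<odot>\<^bsub>cmp T (q - d j)\<^esub> gmult T (- d j) q (f (- d j) (w j)) (g q z))
        = coef p e i j \<odot>\<^bsub>cmp T n\<^esub> ?L (gmult E (d i) (- d j) (u i) (w j))"
        using T.m_smult_r[OF c fu fwg, of n] T.m_assoc[OF fu fw gz, of p "q - d j"] f_mult[OF u_in[OF i] w_in[OF j], of p] True n by simp
      then show ?thesis unfolding r gt * using True is_linearD(3)[OF L c uw] by simp
    next
      case False
      have "\<iota> (p + d j - d i) (gmult E (- d i) (p + d j) (w i) (gmult E p (d j) e (u j))) = \<zero>\<^bsub>cmp A (p + d j - d i)\<^esub>"
        using matrix_entry[OF i j e] False lin_zero[OF io_lin E.mod A.mod] by simp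
      then have "corner n (gmult A p q (\<iota> p e) z) i j = \<zero>\<^bsub>cmp A ?r\<^esub>"
        unfolding corner using A.m_zero_l[OF zA, of "p + d j - d i" ?r] n kmod.koszul_0[OF A.kmod] by simp
      then have "g ?r (average ?r (corner n (gmult A p q (\<iota> p e) z) i j)) = \<zero>\<^bsub>cmp T ?r\<^esub>"
        using lin_zero[OF is_linear_comp[OF average_lin_Z dga_homD(1)[OF g]] A.mod T.mod] by simp
      then show ?thesis
        using T.m_zero_l[OF f_in[OF w_in[OF j]], of ?r "n - d i"] T.m_zero_r[OF f_in[OF u_in[OF i]], of "n - d i" n]
          lin_zero[OF L E.mod T.mod] False by simp
    qed
  qed
  also have "\<dots> = (\<Oplus>\<^bsub>cmp T n\<^esub>i\<in>I. ?L (\<Oplus>\<^bsub>cmp E p\<^esub>j\<in>I. ?t i j))"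
    using t s is_linearD(1)[OF L] by (intro N.finsum_cong_terms lin_finsum[OF L E.mod T.mod fin, symmetric]) blast+
  also have "\<dots> = ?L (\<Oplus>\<^bsub>cmp E p\<^esub>i\<in>I. \<Oplus>\<^bsub>cmp E p\<^esub>j\<in>I. ?t i j)"
    using s by (intro lin_finsum[OF L E.mod T.mod fin, symmetric]) blast
  also have "\<dots> = ?L e" unfolding matrix_expansion[OF e] ..
  finally show ?thesis .
qed


lemma extension_diff:
  assumes x: "x \<in> elts A n"
  shows "extension (n - 1) (diff A n x) = diff T n (extension n x)"
proof (rule linear_eq_on_products[OF is_linear_comp[OF A.d_lin extension_lin] is_linear_comp[OF extension_lin T.d_lin] T.mod _ x])
  fix p q e z
  assume n: "p + q = n" and e: "e \<in> elts E p" and z: "z \<in> C q"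
  note zA = C_in[OF z] and dz = C_d[OF z] and de = E.d_in[OF e]
  have eq: "p - 1 + q = n - 1" "p + (q - 1) = n - 1" "p + q - 1 = n - 1" using n by auto
  have i: "gmult A (p - 1) q (\<iota> (p - 1) (diff E p e)) z \<in> elts A (n - 1)" "gmult A p (q - 1) (\<iota> p e) (diff A q z) \<in> elts A (n - 1)"
    using eq by (auto intro!: A.m_in io_in de e zA C_in[OF dz])
  have "diff A n (gmult A p q (\<iota> p e) z) = gmult A (p - 1) q (\<iota> (p - 1) (diff E p e)) z \<oplus>\<^bsub>cmp A (n - 1)\<^esub>
      A.kz (n - 1) p (gmult A p (q - 1) (\<iota> p e) (diff A q z))"
    using A.leib[OF io_in[OF e] zA] io_d[OF e] unfolding n eq by simp
  then have "extension (n - 1) (diff A n (gmult A p q (\<iota> p e) z)) =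
      gmult T (p - 1) q (f (p - 1) (diff E p e)) (g q z) \<oplus>\<^bsub>cmp T (n - 1)\<^esub> T.kz (n - 1) p (gmult T p (q - 1) (f p e) (g (q - 1) (diff A q z)))"
    using is_linearD(2)[OF extension_lin i(1) A.k_in[OF i(2)]] lin_koszul[OF extension_lin A.mod T.mod i(2)]
      extension_product[OF de z eq(1)] extension_product[OF e dz eq(2)] by simp
  also have "\<dots> = diff T n (gmult T p q (f p e) (g q z))"
    using T.leib[OF f_in[OF e] g_in[OF z]] dga_homD(3)[OF f e] dga_homD(3)[OF g, of z q] z unfolding n eq by (simp add: eltsZ selZ)
  finally show "extension (n - 1) (diff A n (gmult A p q (\<iota> p e) z)) = diff T n (extension n (gmult A p q (\<iota> p e) z))"
    using extension_product[OF e z n] by simp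
qed

lemma extension_in: "x \<in> elts A n \<Longrightarrow> extension n x \<in> elts T n" by (rule is_linearD(1)[OF extension_lin])

lemma extension_mult_products:
  assumes n: "p + q = m" "p' + q' = n" and e: "e \<in> elts E p" "e' \<in> elts E p'" and z: "z \<in> C q" "z' \<in> C q'"
  shows "extension (m + n) (gmult A m n (gmult A p q (\<iota> p e) z) (gmult A p' q' (\<iota> p' e') z')) =
    gmult T m n (extension m (gmult A p q (\<iota> p e) z)) (extension n (gmult A p' q' (\<iota> p' e') z'))"
proof -
  note zA = C_in[OF z(1)] C_in[OF z(2)]
  have ee: "gmult E p p' e e' \<in> elts E (p + p')" by (rule E.mult_in[OF e])
  have zz: "gmult A q q' z z' \<in> C (q + q')" by (rule C_mult[OF z])
  have N: "p + p' + (q + q') = m + n" using n by simp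
  have i: "gmult A (p + p') (q + q') (\<iota> (p + p') (gmult E p p' e e')) (gmult A q q' z z') \<in> elts A (m + n)"
    by (rule A.m_in[OF io_in[OF ee] C_in[OF zz] N])
  have "gmult A m n (gmult A p q (\<iota> p e) z) (gmult A p' q' (\<iota> p' e') z') =
      A.kz (m + n) (q * p') (gmult A (p + p') (q + q') (\<iota> (p + p') (gmult E p p' e e')) (gmult A q q' z z'))"
    using A.interchange[OF io_in[OF e(1)] io_in[OF e(2)] zA C_swap[OF z(1) e(2) refl] n] io_mult[OF e refl] by simp
  then have "extension (m + n) (gmult A m n (gmult A p q (\<iota> p e) z) (gmult A p' q' (\<iota> p' e') z')) =
      T.kz (m + n) (q * p') (gmult T (p + p') (q + q') (gmult T p p' (f p e) (f p' e')) (gmult T q q' (g q z) (g q' z')))"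
    using lin_koszul[OF extension_lin A.mod T.mod i] extension_product[OF ee zz N] f_mult[OF e refl] g_mult[OF z refl] by simp
  also have "\<dots> = gmult T m n (gmult T p q (f p e) (g q z)) (gmult T p' q' (f p' e') (g q' z'))"
    by (rule T.interchange[OF f_in[OF e(1)] f_in[OF e(2)] g_in[OF z(1)] g_in[OF z(2)] fg[OF e(2) z(1)] n, symmetric])
  finally show ?thesis using extension_product[OF e(1) z(1) n(1)] extension_product[OF e(2) z(2) n(2)] by simp
qed

lemma extension_mult:
  assumes x: "x \<in> elts A m" and y: "y \<in> elts A n"
  shows "extension (m + n) (gmult A m n x y) = gmult T m n (extension m x) (extension n y)"
proof (rule linear_eq_on_products[OF _ _ T.mod _ x, where H="\<lambda>x. extension (m + n) (gmult A m n x y)" and H'="\<lambda>x. gmult T m n (extension m x) (extension n y)"])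
  show "is_linear K (cmp A m) (cmp T (m + n)) (\<lambda>x. extension (m + n) (gmult A m n x y))"
    by (rule is_linear_comp[OF A.mult_l[OF y] extension_lin])
  show "is_linear K (cmp A m) (cmp T (m + n)) (\<lambda>x. gmult T m n (extension m x) (extension n y))"
    by (rule is_linear_comp[OF extension_lin T.mult_l[OF extension_in[OF y]]])
  fix p q e z
  assume m: "p + q = m" and e: "e \<in> elts E p" and z: "z \<in> C q"
  let ?x = "gmult A p q (\<iota> p e) z"
  have x: "?x \<in> elts A m" by (rule A.m_in[OF io_in[OF e] C_in[OF z] m])
  show "extension (m + n) (gmult A m n ?x y) = gmult T m n (extension m ?x) (extension n y)"
    by (rule linear_eq_on_products[OF is_linear_comp[OF A.mult_r[OF x] extension_lin] is_linear_comp[OF extension_lin T.mult_r[OF extension_in[OF x]]] T.mod _ y])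
      (rule extension_mult_products[OF m _ e _ z])
qed

lemma extension_one: "extension 0 (gone A) = gone T"
proof -
  have "gone A = gmult A 0 0 (\<iota> 0 (gone E)) (gone A)" using A.one_l[OF A.one_in] dga_homD(5)[OF io] by simp
  moreover have "extension 0 (gmult A 0 0 (\<iota> 0 (gone E)) (gone A)) = gmult T 0 0 (gone T) (gone T)"
    using extension_product[OF E.one_in C_one, of 0] dga_homD(5)[OF f] dga_homD(5)[OF g] by (simp add: selZ)
  ultimately show ?thesis using T.one_l[OF T.one_in] by simp
qed

text \<open>The extension is multiplicative and compatible with the differentials because on products
  \<open>e z\<close> both properties follow from the same rules, \<open>interchange\<close> and the Leibniz rule, in
  \<open>A\<close> and in \<open>T\<close>.\<close>

theorem pair_extends:
  "\<exists>\<theta>\<in>dga_hom K A T. \<forall>p q e z. e \<in> elts E p \<longrightarrow> z \<in> C q \<longrightarrow>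
     \<theta> (p + q) (gmult A p q (\<iota> p e) z) = gmult T p q (f p e) (g q z)"
proof
  show "(\<lambda>n. \<lambda>x\<in>elts A n. extension n x) \<in> dga_hom K A T"
    by (rule restrict_dga_hom[OF A.dga_axioms extension_lin extension_diff extension_mult extension_one])
  show "\<forall>p q e z. e \<in> elts E p \<longrightarrow> z \<in> C q \<longrightarrow>
     (\<lambda>x\<in>elts A (p + q). extension (p + q) x) (gmult A p q (\<iota> p e) z) = gmult T p q (f p e) (g q z)"
    using extension_product A.mult_in[OF io_in C_in] by auto
qed

end


section \<open>Endomorphism algebras have frames\<close>

text \<open>A field is not itself a module record, so linear forms get a predicate of their own.\<close>

definition functional where
  "functional K M \<phi> \<longleftrightarrow> (\<forall>x\<in>carrier M. \<phi> x \<in> carrier K) \<and>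
     (\<forall>x\<in>carrier M. \<forall>y\<in>carrier M. \<phi> (x \<oplus>\<^bsub>M\<^esub> y) = \<phi> x \<oplus>\<^bsub>K\<^esub> \<phi> y) \<and>
     (\<forall>a\<in>carrier K. \<forall>x\<in>carrier M. \<phi> (a \<odot>\<^bsub>M\<^esub> x) = a \<otimes>\<^bsub>K\<^esub> \<phi> x)"

lemma functionalD:
  assumes "functional K M \<phi>"
  shows "x \<in> carrier M \<Longrightarrow> \<phi> x \<in> carrier K"
    "x \<in> carrier M \<Longrightarrow> y \<in> carrier M \<Longrightarrow> \<phi> (x \<oplus>\<^bsub>M\<^esub> y) = \<phi> x \<oplus>\<^bsub>K\<^esub> \<phi> y"
    "a \<in> carrier K \<Longrightarrow> x \<in> carrier M \<Longrightarrow> \<phi> (a \<odot>\<^bsub>M\<^esub> x) = a \<otimes>\<^bsub>K\<^esub> \<phi> x"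
  using assms by (auto simp: functional_def)

context kmod begin

lemma functional_rank_one:
  assumes "module K N" "functional K N \<phi>" "v \<in> carrier M"
  shows "is_linear K N M (\<lambda>x. \<phi> x \<odot>\<^bsub>M\<^esub> v)"
  by (rule is_linearI) (auto simp: functionalD[OF assms(2)] assms(3) smult_l_distr smult_assoc1)

lemma submod_finsum:
  assumes N: "submodule N K M" and "finite J" "\<And>j. j \<in> J \<Longrightarrow> f j \<in> N"
  shows "(\<Oplus>\<^bsub>M\<^esub>j\<in>J. f j) \<in> N"
  using assms(2,3)
proof (induction J)
  case empty
  then show ?case using submod_zero[OF N] by simp
next
  case (insert j J)
  have "f ` insert j J \<subseteq> carrier M" using insert.prems submod_subset[OF N] by blast
  then have "(\<Oplus>\<^bsub>M\<^esub>j\<in>insert j J. f j) = f j \<oplus>\<^bsub>M\<^esub> (\<Oplus>\<^bsub>M\<^esub>j\<in>J. f j)"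
    using insert.hyps by (intro M.finsum_insert) auto
  then show ?case using insert submoduleE(5)[OF N] by simp
qed

text \<open>In a nontrivial relation among generators any generator with nonzero coefficient can be
  expressed through the others.\<close>

lemma smaller_generating_set:
  assumes K: "field K" and fin: "finite Y" and Y: "Y \<subseteq> carrier M" and gen: "submod_gen K M Y = carrier M"
    and y: "y \<in> Y" and c: "c \<in> Y \<rightarrow> carrier K" and cy: "c y \<noteq> \<zero>" and zero: "(\<Oplus>\<^bsub>M\<^esub>x\<in>Y. c x \<odot>\<^bsub>M\<^esub> x) = \<zero>\<^bsub>M\<^esub>"
  shows "submod_gen K M (Y - {y}) = carrier M"
proof -
  interpret field K by fact
  have "carrier M \<subseteq> N" if N: "submodule N K M" "Y - {y} \<subseteq> N" for N
  proof -
    let ?s = "\<Oplus>\<^bsub>M\<^esub>x\<in>Y - {y}. c x \<odot>\<^bsub>M\<^esub> x"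
    have c': "x \<in> Y \<Longrightarrow> c x \<in> carrier K" for x using c by auto
    have s: "?s \<in> N" using fin N c' submoduleE(4)[OF N(1)] by (intro submod_finsum) auto
    have yM: "y \<in> carrier M" using y Y by blast
    have "(\<Oplus>\<^bsub>M\<^esub>x\<in>insert y (Y - {y}). c x \<odot>\<^bsub>M\<^esub> x) = c y \<odot>\<^bsub>M\<^esub> y \<oplus>\<^bsub>M\<^esub> ?s"
      using fin c' Y y by (intro M.finsum_insert) auto
    moreover have "insert y (Y - {y}) = Y" using y by blast
    ultimately have "c y \<odot>\<^bsub>M\<^esub> y \<oplus>\<^bsub>M\<^esub> ?s = \<zero>\<^bsub>M\<^esub>" using zero by simp
    then have "\<ominus>\<^bsub>M\<^esub> ?s = c y \<odot>\<^bsub>M\<^esub> y"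
      using submod_subset[OF N(1) s] c'[OF y] yM by (intro M.minus_equality) auto
    then have "c y \<odot>\<^bsub>M\<^esub> y \<in> N" using submoduleE(3)[OF N(1) s] by simp
    moreover have inv: "inv c y \<in> carrier K" "inv c y \<otimes> c y = \<one>" using c'[OF y] cy field_Units by auto
    ultimately have "inv c y \<odot>\<^bsub>M\<^esub> (c y \<odot>\<^bsub>M\<^esub> y) \<in> N" using submoduleE(4)[OF N(1)] by blast
    then have "y \<in> N" using inv c'[OF y] yM by (simp flip: smult_assoc1)
    then have "Y \<subseteq> N" using N(2) by blast
    then show ?thesis using gen N(1) unfolding submod_gen_def by blast
  qed
  moreover have "submodule (carrier M) K M" by (rule carrier_is_submodule)
  ultimately show ?thesis using Y unfolding submod_gen_def by blast
qed

text \<open>A generating set of least cardinality has no nontrivial relations, so the evaluation map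
  from the free module on it is bijective; the forms \<open>\<phi> y\<close> are the coordinates of its inverse.\<close>

theorem dual_basis:
  assumes K: "field K" and X: "finite X" "X \<subseteq> carrier M" "submod_gen K M X = carrier M"
  obtains Y \<phi> where "finite Y" "Y \<subseteq> carrier M" "\<And>y. y \<in> Y \<Longrightarrow> functional K M (\<phi> y)" "\<And>y. y \<in> Y \<Longrightarrow> \<phi> y y = \<one>"
    "\<And>x. x \<in> carrier M \<Longrightarrow> (\<Oplus>\<^bsub>M\<^esub>y\<in>Y. \<phi> y x \<odot>\<^bsub>M\<^esub> y) = x"
proof -
  interpret field K by fact
  let ?P = "\<lambda>Y. finite Y \<and> Y \<subseteq> carrier M \<and> submod_gen K M Y = carrier M"
  obtain Y where Y: "?P Y" and min: "\<And>Z. ?P Z \<Longrightarrow> card Y \<le> card Z"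
    using ex_has_least_nat[of ?P X card] X by auto
  let ?F = "free_module K Y" and ?L = "lin_ext K M (\<lambda>x. x)"
  interpret lin_extension K M Y "\<lambda>x. x" by unfold_locales (use Y in auto)
  have L: "?L c = (\<Oplus>\<^bsub>M\<^esub>y\<in>Y. c y \<odot>\<^bsub>M\<^esub> y)" if "c \<in> carrier ?F" for c
    using Y free_carrierD(2)[OF that] by (intro ext_mono that) auto
  have ker: "c = (\<lambda>y. \<zero>)" if c: "c \<in> carrier ?F" and z: "?L c = \<zero>\<^bsub>M\<^esub>" for c
  proof (rule ccontr)
    assume "c \<noteq> (\<lambda>y. \<zero>)"
    then obtain y where cy: "c y \<noteq> \<zero>" by blast
    then have y: "y \<in> Y" by (rule free_carrierD(2)[OF c])
    have "?P (Y - {y})" using smaller_generating_set[where c = c, OF K _ _ _ y _ cy] Y z L[OF c] free_carrierD(1)[OF c] by auto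
    from min[OF this] show False using Y y by (metis card_Diff1_less not_le)
  qed
  interpret F: kmod K ?F using free_is_module by (simp add: kmod_def)
  have inj: "c = c'" if c: "c \<in> carrier ?F" "c' \<in> carrier ?F" "?L c = ?L c'" for c c'
  proof -
    have "?L (c \<ominus>\<^bsub>?F\<^esub> c') = \<zero>\<^bsub>M\<^esub>"
      using lin_minus[OF ext_linear F.module_axioms module_axioms c(1,2)] c(3) ext_closed[OF c(2)] by (simp add: a_minus_def M.r_neg)
    then have "c \<ominus>\<^bsub>?F\<^esub> c' = \<zero>\<^bsub>?F\<^esub>" using ker[of "c \<ominus>\<^bsub>?F\<^esub> c'"] F.M.minus_closed[OF c(1,2)] by simp
    moreover have "c = (c \<ominus>\<^bsub>?F\<^esub> c') \<oplus>\<^bsub>?F\<^esub> c'"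
      using c(1,2) by (simp add: a_minus_def F.M.a_assoc F.M.l_neg del: free_sel)
    ultimately show ?thesis using F.M.l_zero[OF c(2)] by simp
  qed
  have surj: "\<exists>c\<in>carrier ?F. ?L c = x" if "x \<in> carrier M" for x
  proof -
    have "submodule (?L ` carrier ?F) K M"
    proof (rule submoduleI)
      show "\<zero>\<^bsub>M\<^esub> \<in> ?L ` carrier ?F"
        using lin_zero[OF ext_linear F.module_axioms module_axioms] by (rule image_eqI[OF sym F.M.zero_closed])
      show "\<ominus>\<^bsub>M\<^esub> a \<in> ?L ` carrier ?F" if "a \<in> ?L ` carrier ?F" for a
      proof -
        from that obtain c where c: "c \<in> carrier ?F" "a = ?L c" by blast
        show ?thesis unfolding c(2)
          using lin_neg[OF ext_linear F.module_axioms module_axioms c(1)] by (rule image_eqI[OF sym F.M.a_inv_closed[OF c(1)]])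
      qed
      show "a \<oplus>\<^bsub>M\<^esub> b \<in> ?L ` carrier ?F" if "a \<in> ?L ` carrier ?F" "b \<in> ?L ` carrier ?F" for a b
      proof -
        from that obtain c c' where c: "c \<in> carrier ?F" "a = ?L c" "c' \<in> carrier ?F" "b = ?L c'" by blast
        show ?thesis unfolding c(2,4)
          using is_linearD(2)[OF ext_linear c(1,3)] by (rule image_eqI[OF sym F.M.a_closed[OF c(1,3)]])
      qed
      show "a \<odot>\<^bsub>M\<^esub> b \<in> ?L ` carrier ?F" if a: "a \<in> carrier K" and "b \<in> ?L ` carrier ?F" for a b
      proof -
        from that obtain c where c: "c \<in> carrier ?F" "b = ?L c" by blast
        show ?thesis unfolding c(2)
          using is_linearD(3)[OF ext_linear a c(1)] by (rule image_eqI[OF sym F.smult_closed[OF a c(1)]])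
      qed
    qed (use ext_closed in blast)
    moreover have "Y \<subseteq> ?L ` carrier ?F"
    proof
      fix y assume "y \<in> Y"
      then show "y \<in> ?L ` carrier ?F"
        using image_eqI[where f = ?L, OF ext_single[symmetric] single_closed] by blast
    qed
    ultimately have "submod_gen K M Y \<subseteq> ?L ` carrier ?F" unfolding submod_gen_def by blast
    then have "x \<in> ?L ` carrier ?F" using that Y by blast
    then show ?thesis by blast
  qed
  define co where "co x = (SOME c. c \<in> carrier ?F \<and> ?L c = x)" for x
  have co: "co x \<in> carrier ?F \<and> ?L (co x) = x" if "x \<in> carrier M" for x
    unfolding co_def using someI_ex[of "\<lambda>c. c \<in> carrier ?F \<and> ?L c = x"] surj[OF that] by blast
  have coI: "co x = c" if "c \<in> carrier ?F" "?L c = x" for x c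
    using inj[of "co x" c] that co[of x] ext_closed[OF that(1)] by simp
  show ?thesis
  proof (rule that[of Y "\<lambda>y x. co x y"])
    show "functional K M (\<lambda>x. co x y)" for y
      unfolding functional_def
    proof (intro conjI ballI)
      fix x assume x: "x \<in> carrier M"
      show "co x y \<in> carrier K" by (rule free_carrierD(1)[OF conjunct1[OF co[OF x]]])
      fix x' assume x': "x' \<in> carrier M"
      have "co (x \<oplus>\<^bsub>M\<^esub> x') = co x \<oplus>\<^bsub>?F\<^esub> co x'"
        using coI[OF F.M.a_closed, of "co x" "co x'"] co[OF x] co[OF x'] is_linearD(2)[OF ext_linear, of "co x" "co x'"] by simp
      then show "co (x \<oplus>\<^bsub>M\<^esub> x') y = co x y \<oplus> co x' y" by simp
    next
      fix a x assume a: "a \<in> carrier K" and x: "x \<in> carrier M"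
      have "co (a \<odot>\<^bsub>M\<^esub> x) = a \<odot>\<^bsub>?F\<^esub> co x"
        using coI[OF F.smult_closed[OF a], of "co x"] co[OF x] is_linearD(3)[OF ext_linear a, of "co x"] by simp
      then show "co (a \<odot>\<^bsub>M\<^esub> x) y = a \<otimes> co x y" by simp
    qed
    show "co y y = \<one>" if "y \<in> Y" for y
      using coI[OF single_closed ext_single] that by (simp add: single_def)
    show "(\<Oplus>\<^bsub>M\<^esub>y\<in>Y. co x y \<odot>\<^bsub>M\<^esub> y) = x" if "x \<in> carrier M" for x
      by (rule trans[OF L[OF conjunct1[OF co[OF that]], symmetric] conjunct2[OF co[OF that]]])
  qed (use Y in auto)
qed

end

text \<open>Dual bases of all components of a complex, with \<open>D\<close> a finite set of degrees outside which
  the complex vanishes, and with a distinguished basis vector \<open>v\<close> of degree \<open>b\<close>.\<close>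

locale based_endo = endo K V for K :: "('k, 'r) ring_scheme" (structure) and V :: "('k, 'v) complex_rec" +
  fixes D :: "int set" and Y :: "int \<Rightarrow> 'v set" and \<phi> :: "int \<Rightarrow> 'v \<Rightarrow> 'v \<Rightarrow> 'k" and b :: int and v :: 'v
  assumes fin_D: "finite D" and outside: "n \<notin> D \<Longrightarrow> elts V n = {\<zero>\<^bsub>cmp V n\<^esub>}"
    and fin_Y: "finite (Y n)" and Y_in: "Y n \<subseteq> elts V n"
    and func: "y \<in> Y n \<Longrightarrow> functional K (cmp V n) (\<phi> n y)"
    and expand: "x \<in> elts V n \<Longrightarrow> (\<Oplus>\<^bsub>cmp V n\<^esub>y\<in>Y n. \<phi> n y x \<odot>\<^bsub>cmp V n\<^esub> y) = x"
    and b: "v \<in> Y b" "\<phi> b v v = \<one>"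
begin

text \<open>The endomorphism \<open>x \<mapsto> \<psi>(x) y\<close> of degree \<open>q - p\<close>, for a linear form \<open>\<psi>\<close> on \<open>V p\<close> and a
  vector \<open>y\<close> in \<open>V q\<close>; it vanishes on all other components.\<close>

definition rank_one :: "int \<Rightarrow> ('v \<Rightarrow> 'k) \<Rightarrow> int \<Rightarrow> 'v \<Rightarrow> int \<Rightarrow> 'v \<Rightarrow> 'v" where
  "rank_one p \<psi> q y = (\<lambda>r. \<lambda>x\<in>elts V r. if r = p then \<psi> x \<odot>\<^bsub>cmp V q\<^esub> y else \<zero>\<^bsub>cmp V (r + (q - p))\<^esub>)"

lemma rank_one_apply: "x \<in> elts V r \<Longrightarrow> rank_one p \<psi> q y r x = (if r = p then \<psi> x \<odot>\<^bsub>cmp V q\<^esub> y else \<zero>\<^bsub>cmp V (r + (q - p))\<^esub>)"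
  by (simp add: rank_one_def)

lemma rank_one_in:
  assumes "functional K (cmp V p) \<psi>" "y \<in> elts V q" "n = q - p"
  shows "rank_one p \<psi> q y \<in> carrier (En n)"
  unfolding rank_one_def assms(3)
proof (rule E_I)
  fix r
  have "is_linear K (cmp V p) (cmp V q) (\<lambda>x. \<psi> x \<odot>\<^bsub>cmp V q\<^esub> y)"
    by (rule kmod.functional_rank_one[OF kmodV module_cmp assms(1,2)])
  then show "is_linear K (cmp V r) (cmp V (r + (q - p))) (\<lambda>x. if r = p then \<psi> x \<odot>\<^bsub>cmp V q\<^esub> y else \<zero>\<^bsub>cmp V (r + (q - p))\<^esub>)"
    using kmod.is_linear_zero[OF kmodV module_cmp] by (cases "r = p") auto
qed

lemma E_ap_zero: "f \<in> carrier (En n) \<Longrightarrow> f p \<zero>\<^bsub>cmp V p\<^esub> = \<zero>\<^bsub>cmp V (p + n)\<^esub>"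
  by (rule lin_zero[OF E_lin module_cmp module_cmp])

lemma Y_elts: "y \<in> Y n \<Longrightarrow> y \<in> elts V n"
  using Y_in by blast

abbreviation "\<psi> \<equiv> \<phi> b v"
abbreviation "frame_index \<equiv> Sigma D Y"
abbreviation "frame_deg \<equiv> (\<lambda>(n, y). n - b)"
abbreviation "frame_u \<equiv> (\<lambda>(n, y). rank_one b \<psi> n y)"
abbreviation "frame_w \<equiv> (\<lambda>(n, y). rank_one n (\<phi> n y) b v)"
abbreviation "frame_eps \<equiv> rank_one b \<psi> b v"
abbreviation "chi \<equiv> (\<lambda>e. \<psi> (e b v))"

lemma psi: "functional K (cmp V b) \<psi>" by (rule func[OF b(1)])
lemma v_in: "v \<in> elts V b" by (rule Y_elts[OF b(1)])

lemma psi_v: "a \<in> carrier K \<Longrightarrow> \<psi> (a \<odot>\<^bsub>cmp V b\<^esub> v) = a"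
  using functionalD(3)[OF psi _ v_in, of a] b(2) by simp

lemma rank_one_comp:
  assumes \<psi>': "functional K (cmp V p) \<psi>'" and y: "y \<in> elts V q"
  shows "gmult EV (q - b) (b - p) (rank_one b \<psi> q y) (rank_one p \<psi>' b v) = rank_one p \<psi>' q y"
proof (rule E_eq[OF E_mult[OF rank_one_in[OF psi y refl] rank_one_in[OF \<psi>' v_in refl]] rank_one_in[OF \<psi>' y refl]])
  fix r x assume x: "x \<in> elts V r"
  show "gmult EV (q - b) (b - p) (rank_one b \<psi> q y) (rank_one p \<psi>' b v) r x = rank_one p \<psi>' q y r x"
  proof (cases "r = p")
    case True
    then have "\<psi>' x \<in> carrier K" using functionalD(1)[OF \<psi>'] x by simp
    then show ?thesis using x True by (simp add: mult_ap rank_one_apply Vs v_in psi_v)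
  next
    case False
    have "r + (b - p) + (q - b) = r + (q - p)" by simp
    then show ?thesis using x False E_ap_zero[OF rank_one_in[OF psi y refl], of "r + (b - p)"] by (simp add: mult_ap rank_one_apply)
  qed
qed

text \<open>Evaluated at a vector of degree \<open>p\<close>, only the summands of degree \<open>p\<close> survive, and these
  form the expansion of the vector in the dual basis.\<close>

lemma rank_one_sum: "(\<Oplus>\<^bsub>cmp EV 0\<^esub>i\<in>frame_index. rank_one (fst i) (\<phi> (fst i) (snd i)) (fst i) (snd i)) = gone EV"
proof -
  let ?g = "\<lambda>i. rank_one (fst i) (\<phi> (fst i) (snd i)) (fst i) (snd i)"
  have g: "?g i \<in> carrier (En 0)" if "i \<in> frame_index" for i
    using that by (auto intro!: rank_one_in func Y_elts)
  interpret E0: kmod K "En 0" using E_mod by (simp add: kmod_def)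
  have fin: "finite frame_index" using fin_D fin_Y by simp
  show ?thesis unfolding EV_sel(1)
  proof (rule E_eq[OF E0.finsum_in[OF g] E_one])
    fix p x assume x: "x \<in> elts V p"
    interpret M: kmod K "cmp V p" by (rule kmodV)
    have val: "?g i p x = (if fst i = p then \<phi> p (snd i) x \<odot>\<^bsub>cmp V p\<^esub> snd i else \<zero>\<^bsub>cmp V p\<^esub>)" if "i \<in> frame_index" for i
      using x by (auto simp: rank_one_apply)
    have gV: "?g i p x \<in> elts V p" if "i \<in> frame_index" for i using E_in[OF g[OF that] x] by simp
    have "(\<Oplus>\<^bsub>En 0\<^esub>i\<in>frame_index. ?g i) p x = (\<Oplus>\<^bsub>cmp V p\<^esub>i\<in>frame_index. ?g i p x)"
      using lin_finsum[OF ev_lin[OF x, of 0] E_mod module_cmp fin] g by simp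
    also have "\<dots> = x"
    proof (cases "p \<in> D")
      case True
      have c: "\<phi> p y x \<odot>\<^bsub>cmp V p\<^esub> y \<in> elts V p" if "y \<in> Y p" for y
        using functionalD(1)[OF func[OF that] x] Y_elts[OF that] by (rule Vs)
      have "(\<Oplus>\<^bsub>cmp V p\<^esub>i\<in>frame_index. ?g i p x) = (\<Oplus>\<^bsub>cmp V p\<^esub>i\<in>Pair p ` Y p. ?g i p x)"
        using True gV val by (intro M.M.add.finprod_mono_neutral_cong_right[OF fin]) auto
      also have "\<dots> = (\<Oplus>\<^bsub>cmp V p\<^esub>y\<in>Y p. ?g (p, y) p x)"
        using True gV by (intro M.M.finsum_reindex) (auto simp: inj_on_def)
      also have "\<dots> = (\<Oplus>\<^bsub>cmp V p\<^esub>y\<in>Y p. \<phi> p y x \<odot>\<^bsub>cmp V p\<^esub> y)"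
        using val[of "(p, _)"] True c by (intro M.finsum_cong_terms) auto
      finally show ?thesis using expand[OF x] by simp
    next
      case False
      have "(\<Oplus>\<^bsub>cmp V p\<^esub>i\<in>frame_index. ?g i p x) \<in> elts V p" using gV by (rule M.finsum_in)
      then show ?thesis using outside[OF False] x by simp
    qed
    finally show "(\<Oplus>\<^bsub>En 0\<^esub>i\<in>frame_index. ?g i) p x = gone EV p x" using x by (simp add: EV_sel)
  qed
qed

text \<open>Columns and rows of the matrix algebra with respect to the distinguished vector \<open>v\<close>: \<open>u\<close>
  sends \<open>v\<close> to a basis vector, \<open>w\<close> takes a coordinate and puts it on \<open>v\<close>, and \<open>eps\<close> projects
  onto the line of \<open>v\<close>. Compressing an endomorphism to this line leaves the matrix coefficient
  at \<open>v\<close>.\<close>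

lemma End_frame: "frame K EV frame_index frame_deg frame_u frame_w frame_eps chi"
proof (intro frame.intro dga_pre End_is_dga frame_axioms.intro)
  show "finite frame_index" using fin_D fin_Y by simp
  show u: "frame_u i \<in> elts EV (frame_deg i)" if "i \<in> frame_index" for i
    using that by (auto simp: EV_sel(1) intro!: rank_one_in psi Y_elts)
  show w: "frame_w i \<in> elts EV (- frame_deg i)" if "i \<in> frame_index" for i
    using that by (auto simp: EV_sel(1) intro!: rank_one_in func v_in)
  show eps: "frame_eps \<in> elts EV 0" by (auto simp: EV_sel(1) intro!: rank_one_in psi v_in)
  have epsE: "frame_eps \<in> carrier (En 0)" using eps by (simp add: EV_sel(1))
  have "(\<Oplus>\<^bsub>cmp EV 0\<^esub>i\<in>frame_index. gmult EV (frame_deg i) (- frame_deg i) (frame_u i) (frame_w i)) = (\<Oplus>\<^bsub>cmp EV 0\<^esub>i\<in>frame_index. rank_one (fst i) (\<phi> (fst i) (snd i)) (fst i) (snd i))"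
  proof (rule kmod.finsum_cong_terms)
    show "kmod K (cmp EV 0)" using E_mod by (simp add: kmod_def EV_sel(1))
    fix i assume i: "i \<in> frame_index"
    show "gmult EV (frame_deg i) (- frame_deg i) (frame_u i) (frame_w i) = rank_one (fst i) (\<phi> (fst i) (snd i)) (fst i) (snd i)"
      using i rank_one_comp[OF func Y_elts, of _ "fst i"] by (auto split: prod.splits)
    show "rank_one (fst i) (\<phi> (fst i) (snd i)) (fst i) (snd i) \<in> elts EV 0"
      using i by (auto simp: EV_sel(1) intro!: rank_one_in func Y_elts)
  qed
  then show "(\<Oplus>\<^bsub>cmp EV 0\<^esub>i\<in>frame_index. gmult EV (frame_deg i) (- frame_deg i) (frame_u i) (frame_w i)) = gone EV" by (simp add: rank_one_sum)
  show "gmult EV (frame_deg i) 0 (frame_u i) frame_eps = frame_u i" if "i \<in> frame_index" for i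
    using that rank_one_comp[OF psi Y_elts, of "snd i" "fst i"] by (auto split: prod.splits)
  show "gmult EV 0 (- frame_deg i) frame_eps (frame_w i) = frame_w i" if "i \<in> frame_index" for i
    using that rank_one_comp[OF func v_in, of "snd i" "fst i"] by (auto split: prod.splits)
  have esm: "a \<odot>\<^bsub>En 0\<^esub> frame_eps \<in> carrier (En 0)" if "a \<in> carrier K" for a by (rule E_smult[OF that epsE])
  show chi: "chi e \<in> carrier K" if "e \<in> elts EV 0" for e
    using functionalD(1)[OF psi] E_in[OF _ v_in, of e 0] that by (simp add: EV_sel(1))
  show "gmult EV 0 0 frame_eps (gmult EV 0 0 e frame_eps) = chi e \<odot>\<^bsub>cmp EV 0\<^esub> frame_eps" if e: "e \<in> elts EV 0" for e
  proof -
    have eE: "e \<in> carrier (En 0)" using e by (simp add: EV_sel(1))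
    have l: "gmult EV 0 0 frame_eps (gmult EV 0 0 e frame_eps) \<in> carrier (En 0)" using E_mult[OF epsE E_mult[OF eE epsE]] by simp
    show ?thesis unfolding EV_sel(1)
    proof (rule E_eq[OF l esm[OF chi[OF e]]])
      fix r x assume x: "x \<in> elts V r"
      show "gmult EV 0 0 frame_eps (gmult EV 0 0 e frame_eps) r x = (chi e \<odot>\<^bsub>En 0\<^esub> frame_eps) r x"
      proof (cases "r = b")
        case True
        interpret M: kmod K "cmp V b" by (rule kmodV)
        have xb: "x \<in> elts V b" using x True by simp
        note px = functionalD(1)[OF psi xb]
        have ev: "e b v \<in> elts V b" using E_in[OF eE v_in] by simp
        have le: "is_linear K (cmp V b) (cmp V b) (e b)" using E_lin[OF eE, of b] by simp
        have "e b (\<psi> x \<odot>\<^bsub>cmp V b\<^esub> v) = \<psi> x \<odot>\<^bsub>cmp V b\<^esub> e b v" by (rule is_linearD(3)[OF le px v_in])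
        then have "gmult EV 0 0 frame_eps (gmult EV 0 0 e frame_eps) r x = (\<psi> x \<otimes> \<psi> (e b v)) \<odot>\<^bsub>cmp V b\<^esub> v"
          using xb True functionalD(3)[OF psi px ev] Vs[OF px ev] by (simp add: mult_ap rank_one_apply)
        also have "\<dots> = (chi e \<odot>\<^bsub>En 0\<^esub> frame_eps) r x"
          using xb True px chi[OF e] v_in by (simp add: rank_one_apply m_comm flip: M.smult_assoc1)
        finally show ?thesis .
      next
        case False
        interpret M: kmod K "cmp V r" by (rule kmodV)
        show ?thesis using x False E_ap_zero[OF eE, of r] E_ap_zero[OF epsE, of r] chi[OF e] by (simp add: mult_ap rank_one_apply M.smult_r_null)
      qed
    qed
  qed
  show "gmult EV 0 n frame_eps (gmult EV n 0 e frame_eps) = \<zero>\<^bsub>cmp EV n\<^esub>" if e: "e \<in> elts EV n" and n: "n \<noteq> 0" for e n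
  proof -
    have eE: "e \<in> carrier (En n)" using e by (simp add: EV_sel(1))
    have l: "gmult EV 0 n frame_eps (gmult EV n 0 e frame_eps) \<in> carrier (En n)" using E_mult[OF epsE E_mult[OF eE epsE]] by simp
    show ?thesis unfolding EV_sel(1)
    proof (rule E_eq[OF l E_zero])
      fix r x assume x: "x \<in> elts V r"
      have ex: "frame_eps r x \<in> elts V r" using E_in[OF epsE x] by simp
      have "gmult EV 0 n frame_eps (gmult EV n 0 e frame_eps) r x = frame_eps (r + n) (e r (frame_eps r x))"
        using x by (simp add: mult_ap)
      also have "\<dots> = \<zero>\<^bsub>cmp V (r + n)\<^esub>"
      proof (cases "r = b")
        case True
        then show ?thesis using n E_in[OF eE ex] by (simp add: rank_one_apply)
      next
        case False
        then have "frame_eps r x = \<zero>\<^bsub>cmp V r\<^esub>" using x by (simp add: rank_one_apply)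
        then show ?thesis using E_ap_zero[OF eE, of r] E_ap_zero[OF epsE, of "r + n"] by simp
      qed
      finally show "gmult EV 0 n frame_eps (gmult EV n 0 e frame_eps) r x = \<zero>\<^bsub>En n\<^esub> r x" using x by simp
    qed
  qed
  show "chi (e \<oplus>\<^bsub>cmp EV 0\<^esub> e') = chi e \<oplus> chi e'" if "e \<in> elts EV 0" "e' \<in> elts EV 0" for e e'
    using that functionalD(2)[OF psi, of "e b v" "e' b v"] E_in[OF _ v_in, of _ 0] v_in by (simp add: EV_sel(1))
  show "chi (a \<odot>\<^bsub>cmp EV 0\<^esub> e) = a \<otimes> chi e" if "a \<in> carrier K" "e \<in> elts EV 0" for a e
    using that functionalD(3)[OF psi, of a "e b v"] E_in[OF _ v_in, of _ 0] v_in by (simp add: EV_sel(1))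
  show "chi (gone EV) = \<one>" using v_in b(2) by (simp add: EV_sel(2))
qed

end

text \<open>A nonzero component provides the distinguished vector. A complex that vanishes has no frame:
  the coefficient of the unit would have to be \<open>1\<close> in a zero algebra.\<close>

theorem End_has_frame:
  fixes V :: "('k, 'v) complex_rec"
  assumes V: "chain_complex K V" and dim: "fin_total_dim K V" and nz: "\<exists>n. elts V n \<noteq> {\<zero>\<^bsub>cmp V n\<^esub>}"
  shows "\<exists>(I :: (int \<times> 'v) set) d u w eps chi. frame K (End_dga K V) I d u w eps chi"
proof -
  interpret endo K V using V by (simp add: endo_def)
  let ?P = "\<lambda>n Y \<phi>. finite Y \<and> Y \<subseteq> elts V n \<and> (\<forall>y\<in>Y. functional K (cmp V n) (\<phi> y)) \<and> (\<forall>y\<in>Y. \<phi> y y = \<one>\<^bsub>K\<^esub>) \<and>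
      (\<forall>x\<in>elts V n. (\<Oplus>\<^bsub>cmp V n\<^esub>y\<in>Y. \<phi> y x \<odot>\<^bsub>cmp V n\<^esub> y) = x)"
  have "\<exists>Y \<phi>. ?P n Y \<phi>" for n
  proof -
    obtain X where X: "finite X" "X \<subseteq> elts V n" "submod_gen K (cmp V n) X = elts V n"
      using dim unfolding fin_total_dim_def by blast
    show ?thesis
    proof (rule kmod.dual_basis[OF kmodV field_axioms X])
      fix Y \<phi>
      assume "finite Y" "Y \<subseteq> elts V n" "\<And>y. y \<in> Y \<Longrightarrow> functional K (cmp V n) (\<phi> y)" "\<And>y. y \<in> Y \<Longrightarrow> \<phi> y y = \<one>\<^bsub>K\<^esub>"
        "\<And>x. x \<in> elts V n \<Longrightarrow> (\<Oplus>\<^bsub>cmp V n\<^esub>y\<in>Y. \<phi> y x \<odot>\<^bsub>cmp V n\<^esub> y) = x"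
      then have "?P n Y \<phi>" by simp
      then show ?thesis by (intro exI)
    qed
  qed
  then have "\<forall>n. \<exists>p. ?P n (fst p) (snd p)" by simp
  from choice[OF this] obtain p where p: "\<forall>n. ?P n (fst (p n)) (snd (p n))" by (elim exE)
  define Y where "Y n = fst (p n)" for n
  define \<phi> where "\<phi> n = snd (p n)" for n
  have Y: "\<And>n. finite (Y n)" "\<And>n. Y n \<subseteq> elts V n"
    and \<phi>: "\<And>n y. y \<in> Y n \<Longrightarrow> functional K (cmp V n) (\<phi> n y)" "\<And>n y. y \<in> Y n \<Longrightarrow> \<phi> n y y = \<one>\<^bsub>K\<^esub>"
      "\<And>n x. x \<in> elts V n \<Longrightarrow> (\<Oplus>\<^bsub>cmp V n\<^esub>y\<in>Y n. \<phi> n y x \<odot>\<^bsub>cmp V n\<^esub> y) = x"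
    using p unfolding Y_def \<phi>_def by blast+
  obtain b where b: "elts V b \<noteq> {\<zero>\<^bsub>cmp V b\<^esub>}" using nz by blast
  interpret B: kmod K "cmp V b" by (rule kmodV)
  have "Y b \<noteq> {}"
  proof
    assume "Y b = {}"
    then have "elts V b \<subseteq> {\<zero>\<^bsub>cmp V b\<^esub>}" using \<phi>(3)[of _ b] by auto
    then show False using b by auto
  qed
  then obtain v where v: "v \<in> Y b" by blast
  interpret based_endo K V "{n. elts V n \<noteq> {\<zero>\<^bsub>cmp V n\<^esub>}}" Y \<phi> b v
    using dim Y \<phi> v by unfold_locales (auto simp: fin_total_dim_def)
  show ?thesis using End_frame by blast
qed

section \<open>Tensor products\<close>

lemma (in pre_dga) diff_one: "diff A 0 (gone A) = \<zero>\<^bsub>cmp A (- 1)\<^esub>"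
proof -
  interpret M: kmod K "cmp A (-1)" by (rule kmod)
  have d1: "diff A 0 (gone A) \<in> elts A (-1)" using d_in[OF one_in] by simp
  have "diff A 0 (gone A) = diff A 0 (gone A) \<oplus>\<^bsub>cmp A (- 1)\<^esub> diff A 0 (gone A)"
    using leib[OF one_in one_in] one_l[OF one_in] one_l[OF d1] one_r[OF d1] by (simp add: kz_even)
  then show ?thesis using d1 by (metis M.M.add.r_cancel_one')
qed

context tens begin

text \<open>The pure tensor of \<open>x\<close> and \<open>y\<close>, with the total degree \<open>n\<close> as a free parameter; in
  \<open>tensor\<close> it is fixed to be \<open>p + q\<close>.\<close>

abbreviation "ptensor n p x q y \<equiv> cl n (sg p x q y)"

lemma tensor_eq_ptensor: "tensor K A B p q x y = ptensor (p + q) p x q y"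
  by (simp add: tensor_def)

lemma ptensor_in: "x \<in> elts A p \<Longrightarrow> y \<in> elts B q \<Longrightarrow> p + q = n \<Longrightarrow> ptensor n p x q y \<in> elts T n"
  unfolding T_cmp by (intro cl_in sg_in)

lemma ptensor_lin_l: "y \<in> elts B q \<Longrightarrow> p + q = n \<Longrightarrow> is_linear K (cmp A p) (cmp T n) (\<lambda>x. ptensor n p x q y)"
  unfolding T_cmp by (rule cl_l)
lemma ptensor_lin_r: "x \<in> elts A p \<Longrightarrow> p + q = n \<Longrightarrow> is_linear K (cmp B q) (cmp T n) (\<lambda>y. ptensor n p x q y)"
  unfolding T_cmp by (rule cl_r)

lemma ptensor_mult:
  assumes "x \<in> elts A p" "y \<in> elts B q" "p + q = m" "x' \<in> elts A p'" "y' \<in> elts B q'" "p' + q' = n"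
  shows "gmult T m n (ptensor m p x q y) (ptensor n p' x' q' y') =
    koszul (cmp T (m + n)) (q * p') (ptensor (m + n) (p + p') (gmult A p p' x x') (q + q') (gmult B q q' y y'))"
proof -
  have i: "sg (p + p') (gmult A p p' x x') (q + q') (gmult B q q' y y') \<in> carrier (G (m + n))"
    using assms by (intro sg_in A.mult_in B.mult_in) auto
  show ?thesis
    using T_m[OF sg_in[OF assms(1-3)] sg_in[OF assms(4-6)]] mT_s[OF assms] lin_koszul[OF cl_linear modG modQm i]
    by (simp only: T_cmp)
qed

lemma ptensor_diff:
  assumes "x \<in> elts A p" "y \<in> elts B q" "p + q = n"
  shows "diff T n (ptensor n p x q y) = ptensor (n - 1) (p - 1) (diff A p x) q y \<oplus>\<^bsub>cmp T (n - 1)\<^esub>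
    koszul (cmp T (n - 1)) p (ptensor (n - 1) p x (q - 1) (diff B q y))"
proof -
  have i: "sg (p - 1) (diff A p x) q y \<in> carrier (G (n - 1))" "sg p x (q - 1) (diff B q y) \<in> carrier (G (n - 1))"
    using assms by (auto intro!: sg_in A.d_in B.d_in)
  show ?thesis
    using T_d[OF sg_in[OF assms]] dT_s[OF assms] is_linearD(2)[OF cl_linear i(1) G_k[OF i(2)]]
      lin_koszul[OF cl_linear modG modQm i(2)] by (simp only: T_cmp)
qed

lemma ptensor_linear_eq:
  assumes "is_linear K (cmp T n) M H" "is_linear K (cmp T n) M H'" "module K M"
    and "\<And>p q x y. p + q = n \<Longrightarrow> x \<in> elts A p \<Longrightarrow> y \<in> elts B q \<Longrightarrow> H (ptensor n p x q y) = H' (ptensor n p x q y)"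
    and "X \<in> elts T n"
  shows "H X = H' X"
proof -
  obtain c where c: "c \<in> carrier (G n)" "X = cl n c" using assms(5) unfolding T_cmp by (rule Q_E)
  have "H (cl n c) = H' (cl n c)"
  proof (rule free_linear_eq[OF _ _ assms(3) _ c(1)])
    show "is_linear K (G n) M (\<lambda>c. H (cl n c))" "is_linear K (G n) M (\<lambda>c. H' (cl n c))"
      using is_linear_comp[OF cl_linear] assms(1,2) unfolding T_cmp by blast+
    show "H (cl n (single K s)) = H' (cl n (single K s))" if "s \<in> tsyms A B n" for s
      using that by (rule tsE) (use assms(4) in simp)
  qed
  then show ?thesis using c(2) by simp
qed

text \<open>The linear extension of \<open>\<beta>\<close> to the free module respects the defining relations by
  \<open>kill\<close>, hence is constant on cosets.\<close>

lemma ptensor_universal: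
  assumes M: "module K M"
    and l: "\<And>p q y. p + q = n \<Longrightarrow> y \<in> elts B q \<Longrightarrow> is_linear K (cmp A p) M (\<lambda>x. \<beta> p x q y)"
    and r: "\<And>p q x. p + q = n \<Longrightarrow> x \<in> elts A p \<Longrightarrow> is_linear K (cmp B q) M (\<lambda>y. \<beta> p x q y)"
  shows "\<exists>H. is_linear K (cmp T n) M H \<and>
    (\<forall>p q x y. p + q = n \<longrightarrow> x \<in> elts A p \<longrightarrow> y \<in> elts B q \<longrightarrow> H (ptensor n p x q y) = \<beta> p x q y)"
proof -
  interpret M: kmod K M using M by (simp add: kmod_def)
  interpret G: kmod K "G n" by (rule kmodG)
  let ?F = "lin_ext K M (\<lambda>(p, x, q, y). \<beta> p x q y)"
  interpret F: lin_extension K M "tsyms A B n" "\<lambda>(p, x, q, y). \<beta> p x q y"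
    by unfold_locales (auto elim!: tsE intro: is_linearD(1)[OF l])
  have s: "?F (sg p x q y) = \<beta> p x q y" if "p + q = n" "x \<in> elts A p" "y \<in> elts B q" for p x q y
    using F.ext_single[of "(p, x, q, y)"] that by (simp add: tsyms_def)
  have kill: "?F c = \<zero>\<^bsub>M\<^esub>" if "c \<in> R n" for c
    using F.ext_linear M _ _ that
  proof (rule kill)
    show "is_linear K (cmp A p) M (\<lambda>x. ?F (sg p x q y))" if "p + q = n" "y \<in> elts B q" for p q y
      by (rule is_linear_cong[OF A.mod l[OF that] s[OF that(1) _ that(2), symmetric]])
    show "is_linear K (cmp B q) M (\<lambda>y. ?F (sg p x q y))" if "p + q = n" "x \<in> elts A p" for p q x
      by (rule is_linear_cong[OF B.mod r[OF that] s[OF that, symmetric]])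
  qed
  define H where "H X = ?F (SOME c. c \<in> carrier (G n) \<and> X = cl n c)" for X
  have H: "H (cl n c) = ?F c" if c: "c \<in> carrier (G n)" for c
  proof -
    let ?e = "SOME e. e \<in> carrier (G n) \<and> cl n c = cl n e"
    have e: "?e \<in> carrier (G n) \<and> cl n c = cl n ?e" by (rule someI[of _ c]) (simp add: c)
    then have "?e \<ominus>\<^bsub>G n\<^esub> c \<in> R n" using R_iff[OF conjunct1[OF e] c] by simp
    from kill[OF this] have "?F ?e \<ominus>\<^bsub>M\<^esub> ?F c = \<zero>\<^bsub>M\<^esub>"
      using lin_minus[OF F.ext_linear modG M conjunct1[OF e] c] by (rule trans[OF sym, rotated])
    moreover have "?F ?e = (?F ?e \<ominus>\<^bsub>M\<^esub> ?F c) \<oplus>\<^bsub>M\<^esub> ?F c"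
      using F.ext_closed c e by (simp add: a_minus_def M.M.a_assoc M.M.l_neg)
    ultimately show ?thesis using F.ext_closed[OF c] by (simp add: H_def)
  qed
  have "is_linear K (cmp T n) M H"
    unfolding T_cmp
  proof (rule is_linearI)
    fix X assume "X \<in> carrier (Qm n)"
    then obtain c where c: "c \<in> carrier (G n)" "X = cl n c" by (rule Q_E)
    show "H X \<in> carrier M" using H[OF c(1)] F.ext_closed[OF c(1)] c(2) by simp
    show "H (a \<odot>\<^bsub>Qm n\<^esub> X) = a \<odot>\<^bsub>M\<^esub> H X" if a: "a \<in> carrier K" for a
      unfolding c(2) is_linearD(3)[OF cl_linear a c(1), symmetric] H[OF c(1)] H[OF G_s[OF a c(1)]]
      by (rule is_linearD(3)[OF F.ext_linear a c(1)])
    fix Y assume "Y \<in> carrier (Qm n)"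
    then obtain e where e: "e \<in> carrier (G n)" "Y = cl n e" by (rule Q_E)
    show "H (X \<oplus>\<^bsub>Qm n\<^esub> Y) = H X \<oplus>\<^bsub>M\<^esub> H Y"
      unfolding c(2) e(2) is_linearD(2)[OF cl_linear c(1) e(1), symmetric] H[OF c(1)] H[OF e(1)] H[OF G_a[OF c(1) e(1)]]
      by (rule is_linearD(2)[OF F.ext_linear c(1) e(1)])
  qed
  moreover have "H (ptensor n p x q y) = \<beta> p x q y" if "p + q = n" "x \<in> elts A p" "y \<in> elts B q" for p q x y
    using H[OF sg_in[OF that(2,3,1)]] s[OF that] by simp
  ultimately show ?thesis by blast
qed

definition inl where "inl n = (\<lambda>x\<in>elts A n. ptensor n n x 0 (gone B))"
definition inr where "inr n = (\<lambda>y\<in>elts B n. ptensor n 0 (gone A) n y)"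

lemma inl_apply: "x \<in> elts A n \<Longrightarrow> inl n x = ptensor n n x 0 (gone B)" by (simp add: inl_def)
lemma inr_apply: "y \<in> elts B n \<Longrightarrow> inr n y = ptensor n 0 (gone A) n y" by (simp add: inr_def)

sublocale TT: pre_dga K T by (rule dga_pre[OF T_dga])

lemma inl_hom: "inl \<in> dga_hom K A T"
proof -
  have z: "ptensor (n - 1) n x (- 1) \<zero>\<^bsub>cmp B (- 1)\<^esub> = \<zero>\<^bsub>cmp T (n - 1)\<^esub>" if "x \<in> elts A n" for n x
    using lin_zero[OF ptensor_lin_r[OF that, of "- 1" "n - 1"] B.mod TT.mod] by simp
  have "(\<lambda>n. \<lambda>x\<in>elts A n. ptensor n n x 0 (gone B)) \<in> dga_hom K A T"
  proof (rule restrict_dga_hom[OF A0.dga_axioms])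
    show "is_linear K (cmp A n) (cmp T n) (\<lambda>x. ptensor n n x 0 (gone B))" for n
      by (rule ptensor_lin_l[OF B.one_in]) simp
    show "ptensor (n - 1) (n - 1) (diff A n x) 0 (gone B) = diff T n (ptensor n n x 0 (gone B))" if x: "x \<in> elts A n" for n x
    proof -
      interpret N: kmod K "cmp T (n - 1)" by (rule TT.kmod)
      show ?thesis
        using ptensor_diff[OF x B.one_in, of n] z[OF x] B.diff_one ptensor_in[OF A.d_in[OF x] B.one_in, of "n - 1"] by simp
    qed
    show "ptensor (m + n) (m + n) (gmult A m n x y) 0 (gone B) = gmult T m n (ptensor m m x 0 (gone B)) (ptensor n n y 0 (gone B))"
      if "x \<in> elts A m" "y \<in> elts A n" for m n x y
      using ptensor_mult[OF that(1) B.one_in _ that(2) B.one_in, of m n] B.one_l[OF B.one_in] by (simp add: TT.kz_even)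
    show "ptensor 0 0 (gone A) 0 (gone B) = gone T" by (simp add: T_1)
  qed
  then show ?thesis by (simp add: inl_def[abs_def])
qed

lemma inr_hom: "inr \<in> dga_hom K B T"
proof -
  have z: "ptensor (n - 1) (- 1) \<zero>\<^bsub>cmp A (- 1)\<^esub> n y = \<zero>\<^bsub>cmp T (n - 1)\<^esub>" if "y \<in> elts B n" for n y
    using lin_zero[OF ptensor_lin_l[OF that, of "- 1" "n - 1"] A.mod TT.mod] by simp
  have "(\<lambda>n. \<lambda>y\<in>elts B n. ptensor n 0 (gone A) n y) \<in> dga_hom K B T"
  proof (rule restrict_dga_hom[OF B0.dga_axioms])
    show "is_linear K (cmp B n) (cmp T n) (\<lambda>y. ptensor n 0 (gone A) n y)" for n
      by (rule ptensor_lin_r[OF A.one_in]) simp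
    show "ptensor (n - 1) 0 (gone A) (n - 1) (diff B n y) = diff T n (ptensor n 0 (gone A) n y)" if y: "y \<in> elts B n" for n y
    proof -
      interpret N: kmod K "cmp T (n - 1)" by (rule TT.kmod)
      show ?thesis
        using ptensor_diff[OF A.one_in y, of n] z[OF y] A.diff_one ptensor_in[OF A.one_in B.d_in[OF y], of "n - 1"] by (simp add: TT.kz_even)
    qed
    show "ptensor (m + n) 0 (gone A) (m + n) (gmult B m n x y) = gmult T m n (ptensor m 0 (gone A) m x) (ptensor n 0 (gone A) n y)"
      if "x \<in> elts B m" "y \<in> elts B n" for m n x y
      using ptensor_mult[OF A.one_in that(1) _ A.one_in that(2), of m n] A.one_l[OF A.one_in] by (simp add: TT.kz_even)
    show "ptensor 0 0 (gone A) 0 (gone B) = gone T" by (simp add: T_1)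
  qed
  then show ?thesis by (simp add: inr_def[abs_def])
qed

lemma inl_inr:
  assumes "x \<in> elts A p" "y \<in> elts B q" "p + q = n"
  shows "gmult T p q (inl p x) (inr q y) = ptensor n p x q y"
  using ptensor_mult[OF assms(1) B.one_in _ A.one_in assms(2), of p q] A.one_r[OF assms(1)] B.one_l[OF assms(2)] assms
  by (simp add: inl_apply inr_apply TT.kz_even)

lemma inr_inl:
  assumes "x \<in> elts A p" "y \<in> elts B q" "q + p = n"
  shows "gmult T q p (inr q y) (inl p x) = koszul (cmp T n) (q * p) (gmult T p q (inl p x) (inr q y))"
  using ptensor_mult[OF A.one_in assms(2) _ assms(1) B.one_in, of q p] A.one_l[OF assms(1)] B.one_r[OF assms(2)] inl_inr[OF assms(1,2), of n] assms
  by (auto simp: inl_apply inr_apply add.commute)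

end

text \<open>The map on cosets induced by \<open>L\<close> is defined as a union over representatives. If some function
  \<open>H\<close> of the coset gives the class of \<open>L c\<close> for every representative, the union has a single
  member. This identifies such maps with morphisms obtained from universal properties, without
  a separate proof that \<open>L\<close> preserves the submodules.\<close>

lemma coset_map_eq:
  fixes M :: "('k, 'a) module"
  assumes M: "module K M" and N: "submodule N K M" and H: "\<And>c. c \<in> carrier M \<Longrightarrow> H (N +>\<^bsub>M\<^esub> c) = N' +>\<^bsub>M'\<^esub> L c"
    and X: "X \<in> a_rcosets\<^bsub>M\<^esub> N"
  shows "quot_map M' N' L X = H X"
proof -
  interpret M: kmod K M using M by (simp add: kmod_def)
  obtain c where c: "c \<in> carrier M" "X = N +>\<^bsub>M\<^esub> c" using X by (rule quot_carrierE)
  have "N' +>\<^bsub>M'\<^esub> L x = H X" if x: "x \<in> X" for x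
  proof -
    have xc: "x \<in> carrier M" using M.rcos_subset[OF N c(1)] x c(2) by blast
    have "x \<ominus>\<^bsub>M\<^esub> c \<in> N" using M.mem_rcos_iff[OF N xc c(1)] x c(2) by simp
    then have "N +>\<^bsub>M\<^esub> x = X" using M.rcos_eq_iff[OF N xc c(1)] c(2) by simp
    then show ?thesis using H[OF xc] by simp
  qed
  moreover have "c \<in> X" using M.rcos_self[OF N c(1)] c(2) by simp
  ultimately show ?thesis unfolding quot_map_def by blast
qed

text \<open>The map obtained from the universal property of the first tensor product satisfies the
  hypotheses of \<open>coset_map_eq\<close>.\<close>

lemma tensor_map_id:
  assumes E: "dga K E" and B: "dga K B" and B': "dga K B'" and g: "g \<in> dga_hom K B B'"
  shows "is_linear K (cmp (tensor_dga K E B) n) (cmp (tensor_dga K E B') n) (tensor_map K E B E B' (dga_id E) g n)"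
    and "p + q = n \<Longrightarrow> e \<in> elts E p \<Longrightarrow> y \<in> elts B q \<Longrightarrow>
      tensor_map K E B E B' (dga_id E) g n (tensor_rel K E B n +>\<^bsub>free_module K (tsyms E B n)\<^esub> single K (p, e, q, y)) =
      tensor_rel K E B' n +>\<^bsub>free_module K (tsyms E B' n)\<^esub> single K (p, e, q, g q y)"
proof -
  have "field K" using E by (simp add: dga_def chain_complex_def)
  then interpret t: tens K E B using E B by (intro tens.intro)
  interpret t': tens K E B' using \<open>field K\<close> E B' by (intro tens.intro)
  let ?L = "lin_ext K (t'.G n) (\<lambda>(p, x, q, y). single K (p, dga_id E p x, q, g q y))"
  note gy = dga_homD(2)[OF g]
  interpret L: lin_extension K "t'.G n" "tsyms E B n" "\<lambda>(p, x, q, y). single K (p, dga_id E p x, q, g q y)"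
    by (intro lin_extension.intro t'.kmodG \<open>field K\<close> lin_extension_axioms.intro)
      (auto simp: dga_id_def gy elim!: t.tsE intro!: t'.sg_in)
  have Ls: "?L (single K (p, e, q, y)) = single K (p, e, q, g q y)" if "p + q = n" "e \<in> elts E p" "y \<in> elts B q" for p q e y
    using L.ext_single[of "(p, e, q, y)"] that by (simp add: tsyms_def dga_id_def)
  obtain H where Hl: "is_linear K (cmp t.T n) (cmp t'.T n) H"
    and Hs: "\<And>p q e y. p + q = n \<Longrightarrow> e \<in> elts E p \<Longrightarrow> y \<in> elts B q \<Longrightarrow> H (t.ptensor n p e q y) = t'.ptensor n p e q (g q y)"
    using t.ptensor_universal[where \<beta>="\<lambda>p e q y. t'.ptensor n p e q (g q y)" and M="cmp t'.T n" and n=n,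
        OF t'.TT.mod t'.ptensor_lin_l[OF gy] is_linear_comp[OF dga_homD(1)[OF g] t'.ptensor_lin_r]] by blast
  have H: "H (t.cl n c) = t'.cl n (?L c)" if c: "c \<in> carrier (t.G n)" for c
  proof (rule t.free_linear_eq[OF _ _ t'.TT.mod _ c])
    show "is_linear K (t.G n) (cmp t'.T n) (\<lambda>c. H (t.cl n c))"
      using is_linear_comp[OF t.cl_linear] Hl unfolding t.T_cmp by blast
    show "is_linear K (t.G n) (cmp t'.T n) (\<lambda>c. t'.cl n (?L c))"
      unfolding t'.T_cmp by (rule is_linear_comp[OF L.ext_linear t'.cl_linear])
    show "H (t.cl n (single K s)) = t'.cl n (?L (single K s))" if "s \<in> tsyms E B n" for s
      using that by (rule t.tsE) (simp add: Hs Ls)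
  qed
  have tm: "tensor_map K E B E B' (dga_id E) g n X = H X" if X: "X \<in> elts t.T n" for X
    using coset_map_eq[where L="?L" and M'="t'.G n" and N'="t'.R n", OF t.modG t.R_sub H, of X] X by (simp add: tensor_map_def t.T_cmp)
  show "is_linear K (cmp t.T n) (cmp t'.T n) (tensor_map K E B E B' (dga_id E) g n)"
    by (rule is_linear_cong[OF t.TT.mod Hl tm[symmetric]])
  show "p + q = n \<Longrightarrow> e \<in> elts E p \<Longrightarrow> y \<in> elts B q \<Longrightarrow>
      tensor_map K E B E B' (dga_id E) g n (t.ptensor n p e q y) = t'.ptensor n p e q (g q y)"
    using tm[OF t.ptensor_in] Hs by simp
qed

locale framed_tens = tens K E B + frame K E I d u w eps chi
  for K :: "('k, 'r) ring_scheme" (structure) and E :: "('k, 'e) dga_rec" and B :: "('k, 'b) dga_rec"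
    and I :: "'i set" and d u w eps chi
begin

lemma framed_inl: "framed_map K E T inl I d u w eps chi"
  by (intro framed_map.intro centralizer.intro centralizer_axioms.intro frame_axioms T_dga inl_hom A0.dga_axioms field_axioms)

text \<open>The linear map $e \otimes y \mapsto \chi(e) y$ from \<open>E \<otimes> B\<close> to \<open>B\<close>. It is a left inverse of
  $y \mapsto 1 \otimes y$ and reads off the corner of a matrix with entries in \<open>B\<close>.\<close>

definition coordinate where
  "coordinate n = (SOME H. is_linear K (cmp T n) (cmp B n) H \<and>
    (\<forall>p q x y. p + q = n \<longrightarrow> x \<in> elts E p \<longrightarrow> y \<in> elts B q \<longrightarrow>
      H (ptensor n p x q y) = (if p = 0 then chi x \<odot>\<^bsub>cmp B n\<^esub> y else \<zero>\<^bsub>cmp B n\<^esub>)))"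

lemma coordinate:
  shows coordinate_lin: "is_linear K (cmp T n) (cmp B n) (coordinate n)"
    and coordinate_ptensor: "p + q = n \<Longrightarrow> x \<in> elts E p \<Longrightarrow> y \<in> elts B q \<Longrightarrow>
      coordinate n (ptensor n p x q y) = (if p = 0 then chi x \<odot>\<^bsub>cmp B n\<^esub> y else \<zero>\<^bsub>cmp B n\<^esub>)"
proof -
  interpret M: kmod K "cmp B n" by (rule B.kmod)
  have "\<exists>H. is_linear K (cmp T n) (cmp B n) H \<and>
    (\<forall>p q x y. p + q = n \<longrightarrow> x \<in> elts E p \<longrightarrow> y \<in> elts B q \<longrightarrow>
      H (ptensor n p x q y) = (if p = 0 then chi x \<odot>\<^bsub>cmp B n\<^esub> y else \<zero>\<^bsub>cmp B n\<^esub>))"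
  proof (rule ptensor_universal[OF B.mod])
    fix p q :: int assume n: "p + q = n"
    show "is_linear K (cmp E p) (cmp B n) (\<lambda>x. if p = 0 then chi x \<odot>\<^bsub>cmp B n\<^esub> y else \<zero>\<^bsub>cmp B n\<^esub>)" if y: "y \<in> elts B q" for y
    proof (cases "p = 0")
      case True
      then have "y \<in> elts B n" using y n by simp
      then show ?thesis using True
        by (auto intro!: is_linearI simp: chi_in chi_add chi_smult M.smult_l_distr M.smult_assoc1)
    next
      case False
      then show ?thesis using M.is_linear_zero[OF A.mod] by simp
    qed
    show "is_linear K (cmp B q) (cmp B n) (\<lambda>y. if p = 0 then chi x \<odot>\<^bsub>cmp B n\<^esub> y else \<zero>\<^bsub>cmp B n\<^esub>)" if x: "x \<in> elts E p" for x
    proof (cases "p = 0")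
      case True
      then show ?thesis using n x chi_in M.smult_linear by simp
    next
      case False
      then show ?thesis using M.is_linear_zero[OF B.mod] by simp
    qed
  qed
  from someI_ex[OF this] show "is_linear K (cmp T n) (cmp B n) (coordinate n)"
    "p + q = n \<Longrightarrow> x \<in> elts E p \<Longrightarrow> y \<in> elts B q \<Longrightarrow>
      coordinate n (ptensor n p x q y) = (if p = 0 then chi x \<odot>\<^bsub>cmp B n\<^esub> y else \<zero>\<^bsub>cmp B n\<^esub>)"
    unfolding coordinate_def by blast+
qed

lemma coordinate_inr: "y \<in> elts B n \<Longrightarrow> coordinate n (inr n y) = y"
  using coordinate_ptensor[OF _ A.one_in, of n n y] module.smult_one[OF B.mod] by (simp add: inr_apply chi_one)

lemma coordinate_in: "X \<in> elts T n \<Longrightarrow> coordinate n X \<in> elts B n"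
  by (rule is_linearD(1)[OF coordinate_lin])

text \<open>On a pure tensor this is $\epsilon e \epsilon \otimes y = \epsilon \otimes \chi(e) y$.\<close>

lemma corner_inr:
  assumes X: "X \<in> elts T n"
  shows "gmult T 0 n (inl 0 eps) (gmult T n 0 X (inl 0 eps)) = gmult T 0 n (inl 0 eps) (inr n (coordinate n X))"
proof (rule ptensor_linear_eq[OF _ _ TT.mod _ X, where H="\<lambda>X. gmult T 0 n (inl 0 eps) (gmult T n 0 X (inl 0 eps))"
      and H'="\<lambda>X. gmult T 0 n (inl 0 eps) (inr n (coordinate n X))"])
  note ep = dga_homD(2)[OF inl_hom eps_in]
  show "is_linear K (cmp T n) (cmp T n) (\<lambda>X. gmult T 0 n (inl 0 eps) (gmult T n 0 X (inl 0 eps)))"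
    by (rule is_linear_comp[OF TT.m_lin_l[OF ep] TT.m_lin_r[OF ep]]) auto
  show "is_linear K (cmp T n) (cmp T n) (\<lambda>X. gmult T 0 n (inl 0 eps) (inr n (coordinate n X)))"
    by (rule is_linear_comp[OF is_linear_comp[OF coordinate_lin dga_homD(1)[OF inr_hom]] TT.m_lin_r[OF ep]]) auto
  fix p q x y assume n: "p + q = n" and x: "x \<in> elts E p" and y: "y \<in> elts B q"
  have xe: "gmult E p 0 x eps \<in> elts E p" by (intro A.m_in x eps_in) simp
  have l: "gmult T 0 n (inl 0 eps) (gmult T n 0 (ptensor n p x q y) (inl 0 eps)) = ptensor n p (gmult E 0 p eps (gmult E p 0 x eps)) q y"
    using ptensor_mult[OF x y n eps_in B.one_in, of 0] B.one_r[OF y] ptensor_mult[OF eps_in B.one_in _ xe y n, of 0] B.one_l[OF y]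
    by (simp add: inl_apply[OF eps_in] TT.kz_even)
  show "gmult T 0 n (inl 0 eps) (gmult T n 0 (ptensor n p x q y) (inl 0 eps)) = gmult T 0 n (inl 0 eps) (inr n (coordinate n (ptensor n p x q y)))"
  proof (cases "p = 0")
    case True
    have x0: "x \<in> elts E 0" and yn: "y \<in> elts B n" and q: "q = n" using x y n True by auto
    note c = chi_in[OF x0]
    have "gmult T 0 n (inl 0 eps) (inr n (coordinate n (ptensor n p x q y))) = gmult T 0 n (inl 0 eps) (chi x \<odot>\<^bsub>cmp T n\<^esub> inr n y)"
      using coordinate_ptensor[OF n x y] True is_linearD(3)[OF dga_homD(1)[OF inr_hom] c yn] q by simp
    also have "\<dots> = chi x \<odot>\<^bsub>cmp T n\<^esub> ptensor n 0 eps n y"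
      using TT.m_smult_r[OF c ep dga_homD(2)[OF inr_hom yn], of n] inl_inr[OF eps_in yn, of n] by simp
    also have "\<dots> = ptensor n 0 (chi x \<odot>\<^bsub>cmp E 0\<^esub> eps) n y"
      using is_linearD(3)[OF ptensor_lin_l[OF yn] c eps_in, of n] by simp
    finally show ?thesis unfolding l using corner_0[OF x0] True q by simp
  next
    case False
    have "gmult T 0 n (inl 0 eps) (inr n (coordinate n (ptensor n p x q y))) = \<zero>\<^bsub>cmp T n\<^esub>"
      using coordinate_ptensor[OF n x y] False lin_zero[OF dga_homD(1)[OF inr_hom] B.mod TT.mod] TT.m_zero_r[OF ep, of n n] by simp
    moreover have "ptensor n p (gmult E 0 p eps (gmult E p 0 x eps)) q y = \<zero>\<^bsub>cmp T n\<^esub>"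
      using corner_ne[OF x False] lin_zero[OF ptensor_lin_l[OF y n] A.mod TT.mod] by simp
    ultimately show ?thesis unfolding l by simp
  qed
qed

text \<open>The elements \<open>X\<close> and \<open>1 \<otimes> coordinate X\<close> of the centralizer agree after multiplication with
  \<open>eps\<close>, by \<open>corner_inr\<close>, and \<open>average_eps_central\<close> recovers both from this product.\<close>

lemma centralizer_inl:
  assumes X: "X \<in> elts (graded_centralizer E inl T) n"
  shows "inr n (coordinate n X) = X"
proof -
  interpret C: framed_map K E T inl I d u w eps chi by (rule framed_inl)
  have XC: "X \<in> C.C n" using X by (simp add: C.eltsZ)
  note XT = C.C_in[OF XC] and ep = C.io_in[OF eps_in]
  have iC: "inr n (coordinate n X) \<in> C.C n"
    unfolding C.C_def by (intro CollectI conjI allI ballI inr_inl coordinate_in XT dga_homD(2)[OF inr_hom] refl)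
  have Xe: "gmult T n 0 X (inl 0 eps) = gmult T 0 n (inl 0 eps) X"
    using C.C_swap[OF XC eps_in, of n] by (simp add: TT.kz_even)
  have "gmult T 0 n (inl 0 eps) X = gmult T 0 n (inl 0 eps) (gmult T n 0 X (inl 0 eps))"
    using TT.m_assoc[OF ep ep XT, of 0 n] C.io_mult[OF eps_in eps_in, of 0] eps_eps Xe by simp
  also have "\<dots> = gmult T 0 n (inl 0 eps) (inr n (coordinate n X))" by (rule corner_inr[OF XT])
  finally have "C.average n (gmult T 0 n (inl 0 eps) X) = C.average n (gmult T 0 n (inl 0 eps) (inr n (coordinate n X)))"
    by (rule arg_cong)
  then show ?thesis unfolding C.average_eps_central[OF XC] C.average_eps_central[OF iC] by (rule sym)
qed

end

section \<open>Functoriality of coproducts and of abelianizations\<close>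

text \<open>The morphism given by the universal property of the coproduct evaluates a word letter by
  letter, hence takes the class of a word to the class of the substituted word. By
  \<open>coset_map_eq\<close> it is the map defined by substitution.\<close>

lemma coprod_map_hom:
  fixes E :: "('k, 'e) dga_rec" and A :: "('k, 'a) dga_rec" and B :: "('k, 'b) dga_rec"
  assumes S: "dga K S" and E: "dga_under K S E \<rho>" and A: "dga_under K S A \<alpha>" and B: "dga_under K S B \<beta>"
    and f: "f \<in> dga_under_hom K S A \<alpha> B \<beta>"
  shows "coprod_map K S E \<rho> A \<alpha> B \<beta> f \<in> dga_hom K (coprod_dga K S E \<rho> A \<alpha>) (coprod_dga K S E \<rho> B \<beta>)"
    and "x \<in> elts E n \<Longrightarrow> coprod_map K S E \<rho> A \<alpha> B \<beta> f n (coprod_inl K S E \<rho> A \<alpha> n x) = coprod_inl K S E \<rho> B \<beta> n x"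
    and "y \<in> elts A n \<Longrightarrow> coprod_map K S E \<rho> A \<alpha> B \<beta> f n (coprod_inr K S E \<rho> A \<alpha> n y) = coprod_inr K S E \<rho> B \<beta> n (f n y)"
proof -
  have K: "field K" using S by (simp add: dga_def chain_complex_def)
  have fh: "f \<in> dga_hom K A B" and f\<alpha>: "dga_comp S f \<alpha> = \<beta>" using f by (auto simp: dga_under_hom_def)
  note fi = dga_homD(2)[OF fh]
  interpret c: coprod_loc K S E B \<rho> \<beta>
    using S E B K unfolding dga_under_def by (intro coprod_loc.intro coprod_loc_axioms.intro) auto
  let ?r = "dga_comp A (coprod_inr K S E \<rho> B \<beta>) f"
  have A': "dga K A" "\<alpha> \<in> dga_hom K S A" using A by (auto simp: dga_under_def)
  have r: "?r \<in> dga_hom K A c.P" by (rule dga_comp_hom[OF A'(1) fh c.inr_hom])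
  have sq: "dga_comp S (coprod_inl K S E \<rho> B \<beta>) \<rho> = dga_comp S ?r \<alpha>"
    using c.square f\<alpha> dga_comp_assoc[OF A'(2), of "coprod_inr K S E \<rho> B \<beta>" f] by simp
  interpret u: coprod_univ K S E A \<rho> \<alpha> c.P "coprod_inl K S E \<rho> B \<beta>" ?r
    using S E A K c.P_dga c.inl_hom r sq unfolding dga_under_def
    by (intro coprod_univ.intro coprod_univ_axioms.intro coprod_loc.intro coprod_loc_axioms.intro) auto
  have in_cl: "x \<in> elts E n \<Longrightarrow> coprod_inl K S E \<rho> B \<beta> n x = c.cl n (single K [(n, Inl x)])"
    "y \<in> elts B n \<Longrightarrow> coprod_inr K S E \<rho> B \<beta> n y = c.cl n (single K [(n, Inr y)])" for x y n
    by (simp_all add: coprod_inl_def coprod_inr_def)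
  define \<phi> :: "int \<times> ('e + 'a) \<Rightarrow> int \<times> ('e + 'b)" where "\<phi> = (\<lambda>(i, z). (i, map_sum id (f i) z))"
  have \<phi> [simp]: "\<phi> (i, Inl x) = (i, Inl x)" "\<phi> (i, Inr y) = (i, Inr (f i y))" for i x y
    by (simp_all add: \<phi>_def)
  have let_in: "\<phi> l \<in> letters E B" "fst (\<phi> l) = fst l" if "l \<in> letters E A" for l
    using that fi by (auto simp: letters_def)
  have word_in: "map \<phi> w \<in> words E B n" if "w \<in> words E A n" for w n
  proof -
    have "set w \<subseteq> letters E A \<Longrightarrow> word_deg (map \<phi> w) = word_deg w" for w
      by (induction w) (auto simp: let_in(2) simp del: split_paired_All)
    then show ?thesis using that let_in(1) by (auto simp: words_def)
  qed
  have ev: "u.ev w = c.cl n (single K (map \<phi> w))" if "w \<in> words E A n" for w n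
    using that
  proof (induction w arbitrary: n)
    case Nil
    then show ?case by (simp add: words_def c.P_1)
  next
    case (Cons l w)
    have l: "l \<in> letters E A" and w: "w \<in> words E A (word_deg w)" and n: "n = fst l + word_deg w"
      using Cons.prems by (auto simp: words_def)
    have lw: "[\<phi> l] \<in> words E B (fst l)" using let_in[OF l] by (intro c.words_sgl) simp_all
    have "u.lv l = c.cl (fst l) (single K [\<phi> l])"
      using l by (rule u.letterE) (simp_all add: in_cl fi)
    then have "u.ev (l # w) = gmult c.P (fst l) (word_deg w) (c.cl (fst l) (single K [\<phi> l])) (c.cl (word_deg w) (single K (map \<phi> w)))"
      using Cons.IH[OF w] by simp
    also have "\<dots> = c.cl n (single K (map \<phi> (l # w)))"
      using c.P_m[OF c.single_closed[OF lw] c.single_closed[OF word_in[OF w]]] c.mult_single[OF lw word_in[OF w]] n by simp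
    finally show ?case .
  qed
  have eq: "coprod_map K S E \<rho> A \<alpha> B \<beta> f = u.h"
  proof (intro ext)
    fix n X
    let ?L = "lin_ext K (c.F n) (\<lambda>w. single K (map \<phi> w))"
    interpret L: lin_extension K "c.F n" "words E A n" "\<lambda>w. single K (map \<phi> w)"
      by (intro lin_extension.intro c.kmodF lin_extension_axioms.intro K c.single_closed word_in)
    have H: "u.h n (u.cl n c) = c.cl n (?L c)" if c: "c \<in> carrier (u.F n)" for c
      unfolding u.h_cl[OF c]
    proof (rule c.free_linear_eq[OF u.eval_lin _ c.P.module_cmp _ c])
      show "is_linear K (u.F n) (cmp c.P n) (\<lambda>c. c.cl n (?L c))"
        unfolding c.P_cmp by (rule is_linear_comp[OF L.ext_linear c.cl_linear])
      show "u.eval n (single K w) = c.cl n (?L (single K w))" if "w \<in> words E A n" for w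
        using that ev u.eval_single L.ext_single by simp
    qed
    show "coprod_map K S E \<rho> A \<alpha> B \<beta> f n X = u.h n X"
    proof (cases "X \<in> elts u.P n")
      case True
      then have "X \<in> a_rcosets\<^bsub>u.F n\<^esub> (u.JJ n)" by (simp add: u.P_cmp)
      from coset_map_eq[where L="?L" and M'="c.F n" and N'="c.JJ n", OF u.modF u.subJ H this]
      show ?thesis using True by (simp add: coprod_map_def \<phi>_def)
    next
      case False
      then show ?thesis using dga_homD(6)[OF u.h_hom, of n] by (simp add: coprod_map_def extensional_def)
    qed
  qed
  show "coprod_map K S E \<rho> A \<alpha> B \<beta> f \<in> dga_hom K (coprod_dga K S E \<rho> A \<alpha>) (coprod_dga K S E \<rho> B \<beta>)"
    unfolding eq by (rule u.h_hom)
  show "coprod_map K S E \<rho> A \<alpha> B \<beta> f n (coprod_inl K S E \<rho> A \<alpha> n x) = coprod_inl K S E \<rho> B \<beta> n x" if "x \<in> elts E n"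
    using fun_cong[OF fun_cong[OF u.h_inl, of n], of x] that unfolding eq by simp
  show "coprod_map K S E \<rho> A \<alpha> B \<beta> f n (coprod_inr K S E \<rho> A \<alpha> n y) = coprod_inr K S E \<rho> B \<beta> n (f n y)" if "y \<in> elts A n"
    using fun_cong[OF fun_cong[OF u.h_inr, of n], of y] that unfolding eq by simp
qed

lemma (in pre_quot) cl_hom:
  assumes A: "dga K A"
  shows "(\<lambda>n. \<lambda>x\<in>elts A n. cl n x) \<in> dga_hom K A Q"
  by (rule restrict_dga_hom[OF A cl_lin]) (simp_all add: dQ mQ oneQ)

lemma (in pre_quot) quotient_extends:
  assumes f: "f \<in> dga_hom K A T" and T: "dga K T" and kill: "\<And>n x. x \<in> I n \<Longrightarrow> f n x = \<zero>\<^bsub>cmp T n\<^esub>"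
  shows "\<exists>g\<in>dga_hom K Q T. \<forall>n. \<forall>x\<in>elts A n. g n (cl n x) = f n x"
proof -
  interpret T: pre_dga K T by (rule dga_pre[OF T])
  define g where "g n = (\<lambda>X\<in>elts Q n. f n (SOME x. x \<in> elts A n \<and> X = cl n x))" for n
  have g: "g n (cl n x) = f n x" if x: "x \<in> elts A n" for n x
  proof -
    interpret M: kmod K "cmp T n" by (rule T.kmod)
    let ?e = "SOME e. e \<in> elts A n \<and> cl n x = cl n e"
    have e: "?e \<in> elts A n \<and> cl n x = cl n ?e" by (rule someI[of _ x]) (simp add: x)
    then have "?e \<ominus>\<^bsub>cmp A n\<^esub> x \<in> I n" using kmod.rcos_eq_iff[OF kmod sub conjunct1[OF e] x] by simp
    from kill[OF this] have "f n ?e \<ominus>\<^bsub>cmp T n\<^esub> f n x = \<zero>\<^bsub>cmp T n\<^esub>"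
      using lin_minus[OF dga_homD(1)[OF f] mod T.mod conjunct1[OF e] x] by simp
    moreover have "f n ?e = (f n ?e \<ominus>\<^bsub>cmp T n\<^esub> f n x) \<oplus>\<^bsub>cmp T n\<^esub> f n x"
      using dga_homD(2)[OF f conjunct1[OF e]] dga_homD(2)[OF f x] by (simp add: a_minus_def M.M.a_assoc M.M.l_neg)
    ultimately show ?thesis using dga_homD(2)[OF f x] cl_in[OF x] by (simp add: g_def)
  qed
  have "g \<in> dga_hom K Q T"
  proof (rule dga_homI)
    show "is_linear K (cmp Q n) (cmp T n) (g n)" for n
    proof (rule is_linearI)
      fix X assume "X \<in> elts Q n"
      then obtain x where x: "x \<in> elts A n" "X = cl n x" by (rule elQE)
      show "g n X \<in> elts T n" using x g dga_homD(2)[OF f] by simp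
      show "g n (a \<odot>\<^bsub>cmp Q n\<^esub> X) = a \<odot>\<^bsub>cmp T n\<^esub> g n X" if a: "a \<in> carrier K" for a
        using x g smultQ[OF a x(1)] s_in[OF a x(1)] is_linearD(3)[OF dga_homD(1)[OF f] a x(1)] by simp
      fix Y assume "Y \<in> elts Q n"
      then obtain y where y: "y \<in> elts A n" "Y = cl n y" by (rule elQE)
      show "g n (X \<oplus>\<^bsub>cmp Q n\<^esub> Y) = g n X \<oplus>\<^bsub>cmp T n\<^esub> g n Y"
        using x y g addQ[OF x(1) y(1)] a_in[OF x(1) y(1)] is_linearD(2)[OF dga_homD(1)[OF f] x(1) y(1)] by simp
    qed
    show "g (n - 1) (diff Q n X) = diff T n (g n X)" if "X \<in> elts Q n" for n X
      using that by (rule elQE) (simp add: dQ g d_in dga_homD(3)[OF f])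
    show "g (m + n) (gmult Q m n X Y) = gmult T m n (g m X) (g n Y)" if "X \<in> elts Q m" "Y \<in> elts Q n" for m n X Y
      using that by (elim elQE) (simp add: mQ g mult_in dga_homD(4)[OF f])
    show "g 0 (gone Q) = gone T" by (simp add: oneQ g one_in dga_homD(5)[OF f])
    show "g n \<in> extensional (elts Q n)" for n by (simp add: g_def)
  qed
  then show ?thesis using g by blast
qed

definition ab_proj where
  "ab_proj K A = (\<lambda>n. \<lambda>x\<in>elts A n. comm_ideal K A n +>\<^bsub>cmp A n\<^esub> x)"

lemma abelianization_quot:
  assumes "dga K A"
  shows "pre_quot K A (comm_ideal K A)"
proof -
  interpret A0: dga K A by fact
  interpret pre_dga K A by (rule dga_pre[OF assms])
  show ?thesis
  proof (intro pre_quot.intro pre_dga_axioms pre_quot_axioms.intro comm_gi)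
    show "diff A n x \<in> comm_ideal K A (n - 1)" if "x \<in> comm_ideal K A n" for n x
      using that ideal_gen_diff[OF comm_in comm_d[unfolded comm_ideal_def]] unfolding comm_ideal_def by blast
    show "diff A (n - 1) (diff A n x) \<in> comm_ideal K A (n - 2)" if "x \<in> elts A n" for n x
      using A0.diff_diff[OF that] kmod.submod_zero[OF kmod] comm_gi unfolding graded_ideal_def by metis
  qed
qed

lemma ab_proj_hom: "dga K A \<Longrightarrow> ab_proj K A \<in> dga_hom K A (abelianization K A)"
  unfolding ab_proj_def abelianization_def by (rule pre_quot.cl_hom[OF abelianization_quot])

lemma ab_proj_surj:
  assumes "dga K A" "X \<in> elts (abelianization K A) n"
  obtains x where "x \<in> elts A n" "X = ab_proj K A n x"
proof -
  interpret pre_quot K A "comm_ideal K A" by (rule abelianization_quot[OF assms(1)])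
  obtain x where "x \<in> elts A n" "X = cl n x" using assms(2) unfolding abelianization_def by (rule elQE)
  then show ?thesis using that by (simp add: ab_proj_def)
qed

lemma kernel_graded_ideal:
  assumes A: "dga K A" and T: "dga K T" and f: "f \<in> dga_hom K A T"
  shows "graded_ideal K A (\<lambda>n. {x \<in> elts A n. f n x = \<zero>\<^bsub>cmp T n\<^esub>})"
proof -
  interpret A: pre_dga K A by (rule dga_pre[OF A])
  interpret T: pre_dga K T by (rule dga_pre[OF T])
  have "submodule {x \<in> elts A n. f n x = \<zero>\<^bsub>cmp T n\<^esub>} K (cmp A n)" for n
  proof -
    interpret M: kmod K "cmp A n" by (rule A.kmod)
    interpret N: kmod K "cmp T n" by (rule T.kmod)
    have z: "\<ominus>\<^bsub>cmp T n\<^esub> \<zero>\<^bsub>cmp T n\<^esub> = \<zero>\<^bsub>cmp T n\<^esub>" by (rule N.M.minus_equality) simp_all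
    show ?thesis using is_linearD[OF dga_homD(1)[OF f]] lin_zero[OF dga_homD(1)[OF f] A.mod T.mod]
        lin_neg[OF dga_homD(1)[OF f] A.mod T.mod] z
      by (intro M.submoduleI) (auto simp: N.smult_r_null)
  qed
  then show ?thesis
    unfolding graded_ideal_def
    by (auto simp: A.mult_in dga_homD(4)[OF f] T.m_zero_l T.m_zero_r dga_homD(2)[OF f])
qed

text \<open>The kernel of a morphism to a graded-commutative algebra is an ideal that contains all
  commutators.\<close>

lemma abelianization_extends:
  assumes A: "dga K A" and C: "cdga K C" and f: "f \<in> dga_hom K A C"
  shows "\<exists>g\<in>dga_hom K (abelianization K A) C. dga_comp A g (ab_proj K A) = f"
proof -
  interpret C: cdga K C by fact
  interpret A: pre_quot K A "comm_ideal K A" by (rule abelianization_quot[OF A])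
  interpret T: pre_dga K C by (rule dga_pre[OF C.dga_axioms])
  have comm: "f n r = \<zero>\<^bsub>cmp C n\<^esub>" if r: "r \<in> graded_commutators A n" for n r
  proof -
    interpret N: kmod K "cmp C n" by (rule T.kmod)
    obtain p q x y where r: "r = gmult A p q x y \<ominus>\<^bsub>cmp A n\<^esub> A.kz n (p * q) (gmult A q p y x)"
      and n: "p + q = n" "q + p = n" and x: "x \<in> elts A p" and y: "y \<in> elts A q"
      using r by (auto simp: graded_commutators_def)
    have i: "gmult A p q x y \<in> elts A n" "gmult A q p y x \<in> elts A n" using A.m_in x y n by auto
    have yx: "gmult C q p (f q y) (f p x) \<in> elts C n" using T.m_in dga_homD(2)[OF f] x y n by auto
    have "f n r = f n (gmult A p q x y) \<ominus>\<^bsub>cmp C n\<^esub> koszul (cmp C n) (p * q) (f n (gmult A q p y x))"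
      unfolding r using lin_minus[OF dga_homD(1)[OF f] A.mod T.mod i(1) A.k_in[OF i(2)]]
        dga_hom_koszul[OF A C.dga_axioms f i(2)] by simp
    also have "\<dots> = \<zero>\<^bsub>cmp C n\<^esub>"
      using dga_homD(4)[OF f x y] dga_homD(4)[OF f y x] n yx
        C.graded_commutative[OF dga_homD(2)[OF f x] dga_homD(2)[OF f y]] by (simp add: a_minus_def N.M.r_neg)
    finally show ?thesis .
  qed
  have "f n x = \<zero>\<^bsub>cmp C n\<^esub>" if "x \<in> comm_ideal K A n" for n x
  proof -
    have "x \<in> {x \<in> elts A n. f n x = \<zero>\<^bsub>cmp C n\<^esub>}"
      using that comm A.comm_in unfolding comm_ideal_def
      by (intro A.ideal_gen_least[OF kernel_graded_ideal[OF A C.dga_axioms f], of "graded_commutators A"]) auto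
    then show ?thesis by simp
  qed
  from A.quotient_extends[OF f C.dga_axioms this] obtain g where g: "g \<in> dga_hom K A.Q C"
    "\<And>n x. x \<in> elts A n \<Longrightarrow> g n (A.cl n x) = f n x" by blast
  have "dga_comp A g (ab_proj K A) = f"
    by (rule dga_hom_eqI[OF dga_comp_hom[OF A ab_proj_hom[OF A]] f]) (use g in \<open>auto simp: abelianization_def ab_proj_def\<close>)
  then show ?thesis using g(1) unfolding abelianization_def by blast
qed

lemma abelianization_hom_eq:
  assumes A: "dga K A" and g: "g \<in> dga_hom K (abelianization K A) C" "g' \<in> dga_hom K (abelianization K A) C"
    and eq: "dga_comp A g (ab_proj K A) = dga_comp A g' (ab_proj K A)"
  shows "g = g'"
proof (rule dga_hom_eqI[OF g])
  fix n X assume "X \<in> elts (abelianization K A) n"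
  then obtain x where "x \<in> elts A n" "X = ab_proj K A n x" by (rule ab_proj_surj[OF A])
  then show "g n X = g' n X" using fun_cong[OF fun_cong[OF eq, of n], of x] by simp
qed

lemma abelianization_bij:
  assumes A: "dga K A" and C: "cdga K C"
  shows "bij_betw (\<lambda>g. dga_comp A g (ab_proj K A)) (dga_hom K (abelianization K A) C) (dga_hom K A C)"
  unfolding bij_betw_def
proof
  show "inj_on (\<lambda>g. dga_comp A g (ab_proj K A)) (dga_hom K (abelianization K A) C)"
    by (intro inj_onI abelianization_hom_eq[OF A])
  show "(\<lambda>g. dga_comp A g (ab_proj K A)) ` dga_hom K (abelianization K A) C = dga_hom K A C"
    using abelianization_extends[OF A C] dga_comp_hom[OF A ab_proj_hom[OF A]] by (auto simp: image_iff)
qed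

text \<open>The morphism induced by \<open>f\<close> on abelianizations exists by \<open>abelianization_extends\<close>, applied to
  the composite of \<open>f\<close> with the projection, and equals the map on cosets by \<open>coset_map_eq\<close>.\<close>

lemma abelianization_map_proj:
  assumes A: "dga K A" and B: "dga K B" and f: "f \<in> dga_hom K A B"
  shows "abelianization_map K A B f \<in> dga_hom K (abelianization K A) (abelianization K B)"
    and "dga_comp A (abelianization_map K A B f) (ab_proj K A) = dga_comp A (ab_proj K B) f"
proof -
  interpret A: pre_quot K A "comm_ideal K A" by (rule abelianization_quot[OF A])
  obtain g where g: "g \<in> dga_hom K (abelianization K A) (abelianization K B)"
    "dga_comp A g (ab_proj K A) = dga_comp A (ab_proj K B) f"
    using abelianization_extends[OF A abelianization_cdga[OF B] dga_comp_hom[OF A f ab_proj_hom[OF B]]] by blast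
  have H: "g n (A.cl n c) = comm_ideal K B n +>\<^bsub>cmp B n\<^esub> f n c" if "c \<in> elts A n" for n c
    using fun_cong[OF fun_cong[OF g(2), of n], of c] that dga_homD(2)[OF f that] by (simp add: ab_proj_def)
  have "abelianization_map K A B f = g"
  proof (intro ext)
    fix n X
    show "abelianization_map K A B f n X = g n X"
    proof (cases "X \<in> elts (abelianization K A) n")
      case True
      then have "X \<in> a_rcosets\<^bsub>cmp A n\<^esub> (comm_ideal K A n)" by (simp add: abelianization_def A.eltsQ)
      from coset_map_eq[where L="f n" and M'="cmp B n" and N'="comm_ideal K B n", OF A.mod A.sub H this] show ?thesis using True by (simp add: abelianization_map_def)
    next
      case False
      then show ?thesis using dga_homD(6)[OF g(1), of n] by (simp add: abelianization_map_def extensional_def)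
    qed
  qed
  then show "abelianization_map K A B f \<in> dga_hom K (abelianization K A) (abelianization K B)"
    "dga_comp A (abelianization_map K A B f) (ab_proj K A) = dga_comp A (ab_proj K B) f" using g by simp_all
qed

section \<open>The adjunctions\<close>

lemma tensor_unit_inl:
  assumes "dga K E" "dga K B" "\<rho> \<in> dga_hom K S E"
  shows "tensor_unit K S E \<rho> B = dga_comp S (tens.inl K E B) \<rho>"
proof -
  have "field K" using assms(1) by (simp add: dga_def chain_complex_def)
  then interpret tens K E B using assms by (intro tens.intro)
  show ?thesis
    by (auto simp: tensor_unit_def dga_comp_def compose_def fun_eq_iff tensor_eq_ptensor inl_apply dga_homD(2)[OF assms(3)])
qed

text \<open>The correspondences are established for an arbitrary framed DG algebra \<open>E\<close> under \<open>S\<close>;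
  \<open>Root A \<alpha>\<close> is then the analogue of the root algebra.\<close>

locale rep_setting = frame K E I d u w eps chi + E0: dga K E + S: dga K S
  for K :: "('k, 'r) ring_scheme" (structure) and E :: "('k, 'e) dga_rec" and S :: "('k, 's) dga_rec"
    and I :: "'i set" and d u w eps chi +
  fixes \<rho>
  assumes rho: "\<rho> \<in> dga_hom K S E"
begin

abbreviation "P A \<alpha> \<equiv> coprod_dga K S E \<rho> A \<alpha>"
abbreviation "cinl A \<alpha> \<equiv> coprod_inl K S E \<rho> A \<alpha>"
abbreviation "cinr A \<alpha> \<equiv> coprod_inr K S E \<rho> A \<alpha>"
abbreviation "Root A \<alpha> \<equiv> graded_centralizer E (cinl A \<alpha>) (P A \<alpha>)"
abbreviation "EB B \<equiv> tensor_dga K E B"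
abbreviation "tinl B \<equiv> tens.inl K E B"
abbreviation "tinr B \<equiv> tens.inr K E B"

lemma E_under: "dga_under K S E \<rho>"
  using rho E0.dga_axioms by (simp add: dga_under_def)

lemma under_dga: "dga_under K S A \<alpha> \<Longrightarrow> dga K A" by (simp add: dga_under_def)

lemmas coprod_facts = coprod_under[OF S.dga_axioms E_under]

lemma framed_P: "dga_under K S A \<alpha> \<Longrightarrow> framed_map K E (P A \<alpha>) (cinl A \<alpha>) I d u w eps chi"
  by (intro framed_map.intro centralizer.intro centralizer_axioms.intro frame_axioms coprod_facts E0.dga_axioms field_axioms)

lemma framed_T: "dga K B \<Longrightarrow> framed_tens K E B I d u w eps chi"
  by (intro framed_tens.intro tens.intro frame_axioms E0.dga_axioms field_axioms)

lemma Root_dga: "dga_under K S A \<alpha> \<Longrightarrow> dga K (Root A \<alpha>)"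
  using centralizer.dgaZ[OF framed_map.axioms(1)[OF framed_P]] .

lemma Root_P: "dga_under K S A \<alpha> \<Longrightarrow> z \<in> elts (Root A \<alpha>) n \<Longrightarrow> z \<in> elts (P A \<alpha>) n"
  by (simp add: graded_centralizer_def)

text \<open>\<open>\<theta>\<close> is the morphism on the coproduct that \<open>h\<close> determines, characterized on products.\<close>

definition extends where
  "extends A \<alpha> B h \<theta> \<longleftrightarrow> \<theta> \<in> dga_hom K (P A \<alpha>) (EB B) \<and>
    (\<forall>p q e z. e \<in> elts E p \<longrightarrow> z \<in> elts (Root A \<alpha>) q \<longrightarrow>
       \<theta> (p + q) (gmult (P A \<alpha>) p q (cinl A \<alpha> p e) z) = gmult (EB B) p q (tinl B p e) (tinr B q (h q z)))"

lemma extends_exists: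
  assumes A: "dga_under K S A \<alpha>" and B: "dga K B" and h: "h \<in> dga_hom K (Root A \<alpha>) B"
  shows "\<exists>\<theta>. extends A \<alpha> B h \<theta>"
proof -
  interpret F: framed_map K E "P A \<alpha>" "cinl A \<alpha>" I d u w eps chi by (rule framed_P[OF A])
  interpret T: framed_tens K E B I d u w eps chi by (rule framed_T[OF B])
  have g: "dga_comp (Root A \<alpha>) (tinr B) h \<in> dga_hom K (Root A \<alpha>) (EB B)"
    by (rule dga_comp_hom[OF Root_dga[OF A] h T.inr_hom])
  \<comment> \<open>The two morphisms $e \mapsto e \otimes 1$ and $z \mapsto 1 \otimes h(z)$ commute up to sign in \<open>E \<otimes> B\<close>.\<close>
  interpret framed_pair K E "P A \<alpha>" "cinl A \<alpha>" I d u w eps chi "EB B" "tinl B" "dga_comp (Root A \<alpha>) (tinr B) h"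
  proof (intro framed_pair.intro framed_pair_axioms.intro F.framed_map_axioms T.T_dga T.inl_hom g)
    fix e p z q assume e: "e \<in> elts E p" and z: "z \<in> F.C q"
    then show "gmult (EB B) q p (dga_comp (Root A \<alpha>) (tinr B) h q z) (tinl B p e) =
       koszul (cmp (EB B) (q + p)) (q * p) (gmult (EB B) p q (tinl B p e) (dga_comp (Root A \<alpha>) (tinr B) h q z))"
      using T.inr_inl[OF e dga_homD(2)[OF h], of z q "q + p"] by (simp add: F.eltsZ)
  qed
  show ?thesis using pair_extends unfolding extends_def by (auto simp: F.eltsZ) 
qed

lemma extends_inl:
  assumes A: "dga_under K S A \<alpha>" and B: "dga K B" and h: "h \<in> dga_hom K (Root A \<alpha>) B" and t: "extends A \<alpha> B h \<theta>"
    and e: "e \<in> elts E n"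
  shows "\<theta> n (cinl A \<alpha> n e) = tinl B n e"
proof -
  interpret F: framed_map K E "P A \<alpha>" "cinl A \<alpha>" I d u w eps chi by (rule framed_P[OF A])
  interpret T: framed_tens K E B I d u w eps chi by (rule framed_T[OF B])
  have 1: "gone (P A \<alpha>) \<in> elts (Root A \<alpha>) 0" using F.C_one by (simp add: F.eltsZ)
  have "h 0 (gone (P A \<alpha>)) = gone B" using dga_homD(5)[OF h] by (simp add: F.selZ)
  moreover have "\<theta> (n + 0) (gmult (P A \<alpha>) n 0 (cinl A \<alpha> n e) (gone (P A \<alpha>))) =
      gmult (EB B) n 0 (tinl B n e) (tinr B 0 (h 0 (gone (P A \<alpha>))))"
    using t e 1 unfolding extends_def by blast
  ultimately show ?thesis
    using F.A.one_r[OF F.io_in[OF e]] T.TT.one_r[OF dga_homD(2)[OF T.inl_hom e]] dga_homD(5)[OF T.inr_hom] by simp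
qed

lemma extends_root:
  assumes A: "dga_under K S A \<alpha>" and B: "dga K B" and h: "h \<in> dga_hom K (Root A \<alpha>) B" and t: "extends A \<alpha> B h \<theta>"
    and z: "z \<in> elts (Root A \<alpha>) n"
  shows "\<theta> n z = tinr B n (h n z)"
proof -
  interpret F: framed_map K E "P A \<alpha>" "cinl A \<alpha>" I d u w eps chi by (rule framed_P[OF A])
  interpret T: framed_tens K E B I d u w eps chi by (rule framed_T[OF B])
  have "\<theta> (0 + n) (gmult (P A \<alpha>) 0 n (cinl A \<alpha> 0 (gone E)) z) = gmult (EB B) 0 n (tinl B 0 (gone E)) (tinr B n (h n z))"
    using t z one_in unfolding extends_def by blast
  then show ?thesis
    using F.A.one_l[OF Root_P[OF A z]] T.TT.one_l[OF dga_homD(2)[OF T.inr_hom dga_homD(2)[OF h z]]]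
      dga_homD(5)[OF F.io] dga_homD(5)[OF T.inl_hom] by simp
qed

lemma linear_eq_on_coprod:
  assumes A: "dga_under K S A \<alpha>" and M: "module K M"
    and H: "is_linear K (cmp (P A \<alpha>) n) M H" "is_linear K (cmp (P A \<alpha>) n) M H'"
    and eq: "\<And>p q e z. p + q = n \<Longrightarrow> e \<in> elts E p \<Longrightarrow> z \<in> elts (Root A \<alpha>) q \<Longrightarrow>
      H (gmult (P A \<alpha>) p q (cinl A \<alpha> p e) z) = H' (gmult (P A \<alpha>) p q (cinl A \<alpha> p e) z)"
    and x: "x \<in> elts (P A \<alpha>) n"
  shows "H x = H' x"
proof -
  interpret F: framed_map K E "P A \<alpha>" "cinl A \<alpha>" I d u w eps chi by (rule framed_P[OF A])
  show ?thesis by (rule F.linear_eq_on_products[OF H M eq x]) (simp_all add: F.eltsZ)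
qed

lemma extends_unique:
  assumes A: "dga_under K S A \<alpha>" and B: "dga K B" and t: "extends A \<alpha> B h \<theta>" "extends A \<alpha> B h \<theta>'"
  shows "\<theta> = \<theta>'"
proof -
  interpret T: framed_tens K E B I d u w eps chi by (rule framed_T[OF B])
  have hom: "\<theta> \<in> dga_hom K (P A \<alpha>) (EB B)" "\<theta>' \<in> dga_hom K (P A \<alpha>) (EB B)" using t by (auto simp: extends_def)
  show ?thesis
  proof (rule dga_hom_eqI[OF hom])
    fix n x assume x: "x \<in> elts (P A \<alpha>) n"
    show "\<theta> n x = \<theta>' n x"
      by (rule linear_eq_on_coprod[OF A T.TT.mod dga_homD(1)[OF hom(1)] dga_homD(1)[OF hom(2)] _ x])
        (use t in \<open>auto simp: extends_def\<close>)
  qed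
qed

text \<open>The correspondence of the first bijection. The description is meaningful because \<open>\<theta>\<close>
  exists and is unique, by \<open>extends_exists\<close> and \<open>extends_unique\<close>.\<close>

definition Phi where
  "Phi A \<alpha> B h = dga_comp A (THE \<theta>. extends A \<alpha> B h \<theta>) (cinr A \<alpha>)"

lemma Phi_eq:
  assumes "dga_under K S A \<alpha>" "dga K B" "extends A \<alpha> B h \<theta>"
  shows "Phi A \<alpha> B h = dga_comp A \<theta> (cinr A \<alpha>)"
proof -
  have "(THE \<theta>. extends A \<alpha> B h \<theta>) = \<theta>" using assms extends_unique by (intro the_equality) auto
  then show ?thesis by (simp add: Phi_def)
qed

lemma Phi_under:
  assumes A: "dga_under K S A \<alpha>" and B: "dga K B" and h: "h \<in> dga_hom K (Root A \<alpha>) B"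
  shows "Phi A \<alpha> B h \<in> dga_under_hom K S A \<alpha> (EB B) (tensor_unit K S E \<rho> B)"
proof -
  obtain \<theta> where t: "extends A \<alpha> B h \<theta>" using extends_exists[OF A B h] by blast
  have hom: "\<theta> \<in> dga_hom K (P A \<alpha>) (EB B)" using t by (simp add: extends_def)
  have al: "\<alpha> \<in> dga_hom K S A" using A by (simp add: dga_under_def)
  have "dga_comp S (dga_comp A \<theta> (cinr A \<alpha>)) \<alpha> = dga_comp S \<theta> (dga_comp S (cinr A \<alpha>) \<alpha>)"
    by (rule dga_comp_assoc[OF al, symmetric])
  also have "\<dots> = dga_comp S \<theta> (dga_comp S (cinl A \<alpha>) \<rho>)" using coprod_facts(4)[OF A] by simp
  also have "\<dots> = dga_comp S (tinl B) \<rho>"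
    by (rule dga_comp_eqI) (simp add: extends_inl[OF A B h t] dga_homD(2)[OF rho])
  also have "\<dots> = tensor_unit K S E \<rho> B" using tensor_unit_inl[OF E0.dga_axioms B rho] by simp
  finally show ?thesis
    using dga_comp_hom[OF under_dga[OF A] coprod_facts(3)[OF A] hom] by (simp add: dga_under_hom_def Phi_eq[OF A B t])
qed

text \<open>Equal restrictions to \<open>A\<close> mean equal morphisms on the coproduct, since the restrictions to
  \<open>E\<close> are always $e \mapsto e \otimes 1$. On the root algebra these are $z \mapsto 1 \otimes h(z)$,
  and \<open>coordinate\<close> recovers \<open>h\<close>.\<close>

lemma Phi_inj:
  assumes A: "dga_under K S A \<alpha>" and B: "dga K B"
    and h: "h \<in> dga_hom K (Root A \<alpha>) B" "h' \<in> dga_hom K (Root A \<alpha>) B" and eq: "Phi A \<alpha> B h = Phi A \<alpha> B h'"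
  shows "h = h'"
proof -
  interpret T: framed_tens K E B I d u w eps chi by (rule framed_T[OF B])
  obtain \<theta> where t: "extends A \<alpha> B h \<theta>" using extends_exists[OF A B h(1)] by blast
  obtain \<theta>' where t': "extends A \<alpha> B h' \<theta>'" using extends_exists[OF A B h(2)] by blast
  have hom: "\<theta> \<in> dga_hom K (P A \<alpha>) (EB B)" "\<theta>' \<in> dga_hom K (P A \<alpha>) (EB B)" using t t' by (auto simp: extends_def)
  have l: "dga_comp E \<theta> (cinl A \<alpha>) = tinl B" "dga_comp E \<theta>' (cinl A \<alpha>) = tinl B"
    using extends_inl[OF A B h(1) t] extends_inl[OF A B h(2) t'] hom
    by (auto intro!: dga_hom_eqI[OF dga_comp_hom[OF E0.dga_axioms coprod_facts(2)[OF A]] T.inl_hom])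
  have r: "dga_comp A \<theta> (cinr A \<alpha>) = Phi A \<alpha> B h" "dga_comp A \<theta>' (cinr A \<alpha>) = Phi A \<alpha> B h"
    using Phi_eq[OF A B t] Phi_eq[OF A B t'] eq by auto
  have ph: "Phi A \<alpha> B h \<in> dga_hom K A (EB B)" and sq: "dga_comp S (tinl B) \<rho> = dga_comp S (Phi A \<alpha> B h) \<alpha>"
    using Phi_under[OF A B h(1)] tensor_unit_inl[OF E0.dga_axioms B rho] by (auto simp: dga_under_hom_def)
  note ex1 = coprod_universal[OF S.dga_axioms E_under A T.T_dga T.inl_hom ph sq]
  have "\<theta> = \<theta>'"
    by (rule trans[OF sym[OF the1_equality[OF ex1]] the1_equality[OF ex1]]; intro conjI hom l r)
  show ?thesis
  proof (rule dga_hom_eqI[OF h])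
    fix n z assume z: "z \<in> elts (Root A \<alpha>) n"
    have "tinr B n (h n z) = tinr B n (h' n z)"
      using extends_root[OF A B h(1) t z] extends_root[OF A B h(2) t' z] \<open>\<theta> = \<theta>'\<close> by simp
    then have "T.coordinate n (tinr B n (h n z)) = T.coordinate n (tinr B n (h' n z))" by (rule arg_cong)
    then show "h n z = h' n z"
      unfolding T.coordinate_inr[OF dga_homD(2)[OF h(1) z]] T.coordinate_inr[OF dga_homD(2)[OF h(2) z]] .
  qed
qed

text \<open>The morphism \<open>\<psi>\<close> on the coproduct that \<open>g\<close> determines maps the root algebra into the
  centralizer of \<open>E \<otimes> 1\<close>, hence into \<open>1 \<otimes> B\<close>; \<open>h\<close> is \<open>\<psi>\<close> followed by the inverse of
  $y \mapsto 1 \otimes y$.\<close>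

lemma Phi_surj:
  assumes A: "dga_under K S A \<alpha>" and B: "dga K B"
    and g: "g \<in> dga_under_hom K S A \<alpha> (EB B) (tensor_unit K S E \<rho> B)"
  shows "\<exists>h\<in>dga_hom K (Root A \<alpha>) B. Phi A \<alpha> B h = g"
proof -
  interpret F: framed_map K E "P A \<alpha>" "cinl A \<alpha>" I d u w eps chi by (rule framed_P[OF A])
  interpret T: framed_tens K E B I d u w eps chi by (rule framed_T[OF B])
  interpret R: pre_dga K "Root A \<alpha>" by (rule dga_pre[OF Root_dga[OF A]])
  have gh: "g \<in> dga_hom K A (EB B)" and sq: "dga_comp S (tinl B) \<rho> = dga_comp S g \<alpha>"
    using g tensor_unit_inl[OF E0.dga_axioms B rho] by (auto simp: dga_under_hom_def)
  obtain \<psi> where psi: "\<psi> \<in> dga_hom K (P A \<alpha>) (EB B)" "dga_comp E \<psi> (cinl A \<alpha>) = tinl B" "dga_comp A \<psi> (cinr A \<alpha>) = g"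
    using coprod_universal[OF S.dga_axioms E_under A T.T_dga T.inl_hom gh sq] by blast
  have psi_l: "\<psi> n (cinl A \<alpha> n e) = tinl B n e" if "e \<in> elts E n" for n e
    using fun_cong[OF fun_cong[OF psi(2), of n], of e] that by simp
  \<comment> \<open>A morphism preserves graded commutation, and \<open>\<psi>\<close> carries the image of \<open>E\<close> to \<open>E \<otimes> 1\<close>.\<close>
  have psi_C: "\<psi> n z \<in> elts (graded_centralizer E (tinl B) (EB B)) n" if z: "z \<in> elts (Root A \<alpha>) n" for n z
  proof -
    have zC: "z \<in> F.C n" using z by (simp add: F.eltsZ)
    note zP = Root_P[OF A z]
    have "gmult (EB B) n m (\<psi> n z) (tinl B m e) = koszul (cmp (EB B) (n + m)) (n * m) (gmult (EB B) m n (tinl B m e) (\<psi> n z))"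
      if e: "e \<in> elts E m" for m e
    proof -
      have i: "gmult (P A \<alpha>) m n (cinl A \<alpha> m e) z \<in> elts (P A \<alpha>) (n + m)" by (intro F.A.m_in F.io_in e zP) simp
      have "gmult (EB B) n m (\<psi> n z) (tinl B m e) = \<psi> (n + m) (gmult (P A \<alpha>) n m z (cinl A \<alpha> m e))"
        using dga_homD(4)[OF psi(1) zP F.io_in[OF e]] psi_l[OF e] by simp
      also have "\<dots> = koszul (cmp (EB B) (n + m)) (n * m) (\<psi> (n + m) (gmult (P A \<alpha>) m n (cinl A \<alpha> m e) z))"
        unfolding F.C_c[OF zC e] by (rule dga_hom_koszul[OF coprod_facts(1)[OF A] T.T_dga psi(1) i])
      also have "\<psi> (n + m) (gmult (P A \<alpha>) m n (cinl A \<alpha> m e) z) = gmult (EB B) m n (tinl B m e) (\<psi> n z)"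
        using dga_homD(4)[OF psi(1) F.io_in[OF e] zP] psi_l[OF e] by (simp add: add.commute)
      finally show ?thesis .
    qed
    then show ?thesis using dga_homD(2)[OF psi(1) zP] by (simp add: graded_centralizer_def)
  qed
  define h where "h n = (\<lambda>z\<in>elts (Root A \<alpha>) n. T.coordinate n (\<psi> n z))" for n
  have trh: "tinr B n (h n z) = \<psi> n z" if "z \<in> elts (Root A \<alpha>) n" for n z
    using T.centralizer_inl[OF psi_C[OF that]] that by (simp add: h_def)
  have h_in: "h n z \<in> elts B n" if "z \<in> elts (Root A \<alpha>) n" for n z
    using T.coordinate_in dga_homD(2)[OF psi(1) Root_P[OF A that]] that by (simp add: h_def)
  \<comment> \<open>All properties of \<open>h\<close> are checked after applying the injective morphism \<open>y \<mapsto> 1 \<otimes> y\<close>.\<close>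
  have tr_inj: "x = y" if "x \<in> elts B n" "y \<in> elts B n" "tinr B n x = tinr B n y" for n x y
    using T.coordinate_inr[OF that(1)] T.coordinate_inr[OF that(2)] unfolding that(3) by (rule trans[OF sym])
  have Root_sel: "diff (Root A \<alpha>) = diff (P A \<alpha>)" "gmult (Root A \<alpha>) = gmult (P A \<alpha>)" "gone (Root A \<alpha>) = gone (P A \<alpha>)"
    by (simp_all add: F.selZ)
  have h: "h \<in> dga_hom K (Root A \<alpha>) B"
  proof (rule dga_homI)
    show "is_linear K (cmp (Root A \<alpha>) n) (cmp B n) (h n)" for n
    proof (rule is_linear_cong[OF R.mod])
      show "is_linear K (cmp (Root A \<alpha>) n) (cmp B n) (\<lambda>z. T.coordinate n (\<psi> n z))"
        by (rule F.from_Z[OF is_linear_comp[OF dga_homD(1)[OF psi(1)] T.coordinate_lin]])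
    qed (simp add: h_def)
    show "h (n - 1) (diff (Root A \<alpha>) n z) = diff B n (h n z)" if z: "z \<in> elts (Root A \<alpha>) n" for n z
      using trh[OF R.d_in[OF z]] dga_homD(3)[OF psi(1) Root_P[OF A z]] dga_homD(3)[OF T.inr_hom h_in[OF z]] trh[OF z]
      by (intro tr_inj[OF h_in[OF R.d_in[OF z]] T.B.d_in[OF h_in[OF z]]]) (simp add: Root_sel)
    show "h (m + n) (gmult (Root A \<alpha>) m n z z') = gmult B m n (h m z) (h n z')"
      if z: "z \<in> elts (Root A \<alpha>) m" "z' \<in> elts (Root A \<alpha>) n" for m n z z'
      using trh[OF R.mult_in[OF z]] dga_homD(4)[OF psi(1) Root_P[OF A z(1)] Root_P[OF A z(2)]]
        dga_homD(4)[OF T.inr_hom h_in[OF z(1)] h_in[OF z(2)]] trh[OF z(1)] trh[OF z(2)]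
      by (intro tr_inj[OF h_in[OF R.mult_in[OF z]] T.B.mult_in[OF h_in[OF z(1)] h_in[OF z(2)]]]) (simp add: Root_sel)
    show "h 0 (gone (Root A \<alpha>)) = gone B"
      using trh[OF R.one_in] dga_homD(5)[OF psi(1)] dga_homD(5)[OF T.inr_hom]
      by (intro tr_inj[OF h_in[OF R.one_in] T.B.one_in]) (simp add: Root_sel)
    show "h n \<in> extensional (elts (Root A \<alpha>) n)" for n by (simp add: h_def)
  qed
  have "extends A \<alpha> B h \<psi>"
    unfolding extends_def
  proof (intro conjI allI impI psi(1))
    fix p q e z assume e: "e \<in> elts E p" and z: "z \<in> elts (Root A \<alpha>) q"
    show "\<psi> (p + q) (gmult (P A \<alpha>) p q (cinl A \<alpha> p e) z) = gmult (EB B) p q (tinl B p e) (tinr B q (h q z))"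
      using dga_homD(4)[OF psi(1) F.io_in[OF e] Root_P[OF A z]] psi_l[OF e] trh[OF z] by simp
  qed
  then show ?thesis using h Phi_eq[OF A B] psi(3) by auto
qed

theorem Phi_bij:
  assumes "dga_under K S A \<alpha>" "dga K B"
  shows "bij_betw (Phi A \<alpha> B) (dga_hom K (Root A \<alpha>) B) (dga_under_hom K S A \<alpha> (EB B) (tensor_unit K S E \<rho> B))"
  unfolding bij_betw_def
proof (intro conjI subset_antisym subsetI)
  show "inj_on (Phi A \<alpha> B) (dga_hom K (Root A \<alpha>) B)"
    by (intro inj_onI Phi_inj[OF assms])
  show "g \<in> Phi A \<alpha> B ` dga_hom K (Root A \<alpha>) B" if "g \<in> dga_under_hom K S A \<alpha> (EB B) (tensor_unit K S E \<rho> B)" for g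
    using Phi_surj[OF assms that] by blast
qed (auto intro: Phi_under[OF assms])

text \<open>The induced map of coproducts fixes \<open>E\<close>, so it preserves graded commutation with \<open>E\<close>.\<close>

lemma root_map_hom:
  assumes A: "dga_under K S A \<alpha>" and A': "dga_under K S A' \<alpha>'" and f: "f \<in> dga_under_hom K S A \<alpha> A' \<alpha>'"
  shows "(\<lambda>n. restrict (coprod_map K S E \<rho> A \<alpha> A' \<alpha>' f n) (elts (Root A \<alpha>) n)) \<in> dga_hom K (Root A \<alpha>) (Root A' \<alpha>')"
proof -
  interpret F: framed_map K E "P A \<alpha>" "cinl A \<alpha>" I d u w eps chi by (rule framed_P[OF A])
  interpret F': framed_map K E "P A' \<alpha>'" "cinl A' \<alpha>'" I d u w eps chi by (rule framed_P[OF A'])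
  let ?c = "coprod_map K S E \<rho> A \<alpha> A' \<alpha>' f"
  note c = coprod_map_hom[OF S.dga_axioms E_under A A' f]
  have cC: "?c n z \<in> F'.C n" if z: "z \<in> F.C n" for n z
  proof -
    note zP = F.C_in[OF z]
    have "gmult (P A' \<alpha>') n m (?c n z) (cinl A' \<alpha>' m e) = F'.A.kz (n + m) (n * m) (gmult (P A' \<alpha>') m n (cinl A' \<alpha>' m e) (?c n z))"
      if e: "e \<in> elts E m" for m e
    proof -
      have i: "gmult (P A \<alpha>) m n (cinl A \<alpha> m e) z \<in> elts (P A \<alpha>) (n + m)" by (intro F.A.m_in F.io_in e zP) simp
      have "gmult (P A' \<alpha>') n m (?c n z) (cinl A' \<alpha>' m e) = ?c (n + m) (gmult (P A \<alpha>) n m z (cinl A \<alpha> m e))"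
        using dga_homD(4)[OF c(1) zP F.io_in[OF e]] c(2)[OF e] by simp
      also have "\<dots> = F'.A.kz (n + m) (n * m) (?c (n + m) (gmult (P A \<alpha>) m n (cinl A \<alpha> m e) z))"
        unfolding F.C_c[OF z e] by (rule dga_hom_koszul[OF coprod_facts(1)[OF A] coprod_facts(1)[OF A'] c(1) i])
      also have "?c (n + m) (gmult (P A \<alpha>) m n (cinl A \<alpha> m e) z) = gmult (P A' \<alpha>') m n (cinl A' \<alpha>' m e) (?c n z)"
        using dga_homD(4)[OF c(1) F.io_in[OF e] zP] c(2)[OF e] by (simp add: add.commute)
      finally show ?thesis .
    qed
    then show ?thesis using dga_homD(2)[OF c(1) zP] by (simp add: F'.C_def)
  qed
  show ?thesis
  proof (rule restrict_dga_hom[OF Root_dga[OF A]])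
    show "is_linear K (cmp (Root A \<alpha>) n) (cmp (Root A' \<alpha>') n) (?c n)" for n
      by (rule F'.into_Z[OF F.from_Z[OF dga_homD(1)[OF c(1)]]]) (simp add: cC F.eltsZ)
  qed (use dga_homD[OF c(1)] F.C_in in \<open>auto simp: F.selZ F'.selZ\<close>)
qed

text \<open>If \<open>\<theta>\<close> extends \<open>h\<close>, then \<open>\<theta>\<close> composed with the map of coproducts extends the composite of
  \<open>h\<close> with the map of root algebras.\<close>

lemma Phi_natural_left:
  assumes A: "dga_under K S A \<alpha>" and A': "dga_under K S A' \<alpha>'" and B: "dga K B"
    and f: "f \<in> dga_under_hom K S A \<alpha> A' \<alpha>'" and h: "h \<in> dga_hom K (Root A' \<alpha>') B"
  shows "Phi A \<alpha> B (dga_comp (Root A \<alpha>) h (\<lambda>n. restrict (coprod_map K S E \<rho> A \<alpha> A' \<alpha>' f n) (elts (Root A \<alpha>) n))) =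
    dga_comp A (Phi A' \<alpha>' B h) f"
proof -
  interpret F: framed_map K E "P A \<alpha>" "cinl A \<alpha>" I d u w eps chi by (rule framed_P[OF A])
  let ?c = "coprod_map K S E \<rho> A \<alpha> A' \<alpha>' f"
  let ?r = "\<lambda>n. restrict (?c n) (elts (Root A \<alpha>) n)"
  note c = coprod_map_hom[OF S.dga_axioms E_under A A' f] and r = root_map_hom[OF A A' f]
  obtain \<theta> where t: "extends A' \<alpha>' B h \<theta>" using extends_exists[OF A' B h] by blast
  have hom: "\<theta> \<in> dga_hom K (P A' \<alpha>') (EB B)" using t by (simp add: extends_def)
  have "extends A \<alpha> B (dga_comp (Root A \<alpha>) h ?r) (dga_comp (P A \<alpha>) \<theta> ?c)"
    unfolding extends_def
  proof (intro conjI allI impI dga_comp_hom[OF coprod_facts(1)[OF A] c(1) hom])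
    fix p q e z assume e: "e \<in> elts E p" and z: "z \<in> elts (Root A \<alpha>) q"
    have i: "gmult (P A \<alpha>) p q (cinl A \<alpha> p e) z \<in> elts (P A \<alpha>) (p + q)" by (intro F.A.mult_in F.io_in e Root_P[OF A z])
    have "?c q z \<in> elts (Root A' \<alpha>') q" using dga_homD(2)[OF r z] z by simp
    then have "\<theta> (p + q) (gmult (P A' \<alpha>') p q (cinl A' \<alpha>' p e) (?c q z)) = gmult (EB B) p q (tinl B p e) (tinr B q (h q (?c q z)))"
      using t e unfolding extends_def by blast
    then show "dga_comp (P A \<alpha>) \<theta> ?c (p + q) (gmult (P A \<alpha>) p q (cinl A \<alpha> p e) z) =
        gmult (EB B) p q (tinl B p e) (tinr B q (dga_comp (Root A \<alpha>) h ?r q z))"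
      using i z dga_homD(4)[OF c(1) F.io_in[OF e] Root_P[OF A z]] c(2)[OF e] by simp
  qed
  from Phi_eq[OF A B this] have "Phi A \<alpha> B (dga_comp (Root A \<alpha>) h ?r) = dga_comp A (dga_comp (P A \<alpha>) \<theta> ?c) (cinr A \<alpha>)" .
  also have "\<dots> = dga_comp A (dga_comp A' \<theta> (cinr A' \<alpha>')) f"
    using f dga_homD(2)[OF coprod_facts(3)[OF A]] c(3) by (intro dga_comp_eqI) (auto simp: dga_under_hom_def dga_homD(2))
  finally show ?thesis using Phi_eq[OF A' B t] by simp
qed

text \<open>The extensions of \<open>h\<close> and of \<open>g h\<close> are compared on products, where both sides are
  $e \otimes g(h(z))$.\<close>

lemma Phi_natural_right:
  assumes A: "dga_under K S A \<alpha>" and B: "dga K B" and B': "dga K B'"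
    and g: "g \<in> dga_hom K B B'" and h: "h \<in> dga_hom K (Root A \<alpha>) B"
  shows "Phi A \<alpha> B' (dga_comp (Root A \<alpha>) g h) = dga_comp A (tensor_map K E B E B' (dga_id E) g) (Phi A \<alpha> B h)"
proof -
  interpret T: framed_tens K E B I d u w eps chi by (rule framed_T[OF B])
  interpret T': framed_tens K E B' I d u w eps chi by (rule framed_T[OF B'])
  let ?m = "tensor_map K E B E B' (dga_id E) g"
  note m = tensor_map_id[OF E0.dga_axioms B B' g]
  have gh: "dga_comp (Root A \<alpha>) g h \<in> dga_hom K (Root A \<alpha>) B'" by (rule dga_comp_hom[OF Root_dga[OF A] h g])
  obtain \<theta> where t: "extends A \<alpha> B h \<theta>" using extends_exists[OF A B h] by blast
  obtain \<theta>' where t': "extends A \<alpha> B' (dga_comp (Root A \<alpha>) g h) \<theta>'" using extends_exists[OF A B' gh] by blast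
  have hom: "\<theta> \<in> dga_hom K (P A \<alpha>) (EB B)" "\<theta>' \<in> dga_hom K (P A \<alpha>) (EB B')" using t t' by (auto simp: extends_def)
  have "\<theta>' n x = ?m n (\<theta> n x)" if x: "x \<in> elts (P A \<alpha>) n" for n x
  proof (rule linear_eq_on_coprod[OF A T'.TT.mod dga_homD(1)[OF hom(2)] is_linear_comp[OF dga_homD(1)[OF hom(1)] m(1)] _ x])
    fix p q e z assume n: "p + q = n" and e: "e \<in> elts E p" and z: "z \<in> elts (Root A \<alpha>) q"
    note hz = dga_homD(2)[OF h z]
    have "\<theta>' n (gmult (P A \<alpha>) p q (cinl A \<alpha> p e) z) = T'.ptensor n p e q (g q (h q z))"
      using t' e z n T'.inl_inr[OF e dga_homD(2)[OF g hz] n] unfolding extends_def by auto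
    moreover have "\<theta> n (gmult (P A \<alpha>) p q (cinl A \<alpha> p e) z) = T.ptensor n p e q (h q z)"
      using t e z n T.inl_inr[OF e hz n] unfolding extends_def by auto
    ultimately show "\<theta>' n (gmult (P A \<alpha>) p q (cinl A \<alpha> p e) z) = ?m n (\<theta> n (gmult (P A \<alpha>) p q (cinl A \<alpha> p e) z))"
      using m(2)[OF n e hz] by simp
  qed
  then show ?thesis
    unfolding Phi_eq[OF A B t] Phi_eq[OF A B' t']
    by (intro dga_comp_eqI) (simp add: dga_homD(2)[OF coprod_facts(3)[OF A]])
qed

text \<open>The correspondence of the second bijection: morphisms from the abelianization of the root
  algebra are the morphisms from the root algebra itself, as the target is graded-commutative.\<close>

definition Psi where
  "Psi A \<alpha> C h = Phi A \<alpha> C (dga_comp (Root A \<alpha>) h (ab_proj K (Root A \<alpha>)))"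

theorem Psi_bij:
  assumes A: "dga_under K S A \<alpha>" and C: "cdga K C"
  shows "bij_betw (Psi A \<alpha> C) (dga_hom K (abelianization K (Root A \<alpha>)) C)
    (dga_under_hom K S A \<alpha> (EB C) (tensor_unit K S E \<rho> C))"
  using bij_betw_trans[OF abelianization_bij[OF Root_dga[OF A] C] Phi_bij[OF A cdga.axioms(1)[OF C]]]
  by (simp add: Psi_def[abs_def] comp_def)

lemma Psi_natural_left:
  assumes A: "dga_under K S A \<alpha>" and A': "dga_under K S A' \<alpha>'" and C: "cdga K C"
    and f: "f \<in> dga_under_hom K S A \<alpha> A' \<alpha>'" and h: "h \<in> dga_hom K (abelianization K (Root A' \<alpha>')) C"
  shows "Psi A \<alpha> C (dga_comp (abelianization K (Root A \<alpha>)) h (abelianization_map K (Root A \<alpha>) (Root A' \<alpha>')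
      (\<lambda>n. restrict (coprod_map K S E \<rho> A \<alpha> A' \<alpha>' f n) (elts (Root A \<alpha>) n)))) = dga_comp A (Psi A' \<alpha>' C h) f"
proof -
  let ?r = "\<lambda>n. restrict (coprod_map K S E \<rho> A \<alpha> A' \<alpha>' f n) (elts (Root A \<alpha>) n)"
  note r = root_map_hom[OF A A' f]
  note q = ab_proj_hom[OF Root_dga[OF A]] and q' = ab_proj_hom[OF Root_dga[OF A']]
  let ?a = "abelianization_map K (Root A \<alpha>) (Root A' \<alpha>') ?r"
  have "dga_comp (Root A \<alpha>) (dga_comp (abelianization K (Root A \<alpha>)) h ?a) (ab_proj K (Root A \<alpha>)) =
      dga_comp (Root A \<alpha>) h (dga_comp (Root A \<alpha>) ?a (ab_proj K (Root A \<alpha>)))"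
    by (rule dga_comp_assoc[OF q, symmetric])
  also have "\<dots> = dga_comp (Root A \<alpha>) h (dga_comp (Root A \<alpha>) (ab_proj K (Root A' \<alpha>')) ?r)"
    using abelianization_map_proj(2)[OF Root_dga[OF A] Root_dga[OF A'] r] by simp
  also have "\<dots> = dga_comp (Root A \<alpha>) (dga_comp (Root A' \<alpha>') h (ab_proj K (Root A' \<alpha>'))) ?r"
    by (rule dga_comp_assoc[OF r])
  finally show ?thesis
    using Phi_natural_left[OF A A' cdga.axioms(1)[OF C] f dga_comp_hom[OF Root_dga[OF A'] q' h]] by (simp add: Psi_def)
qed

lemma Psi_natural_right:
  assumes A: "dga_under K S A \<alpha>" and C: "cdga K C" and C': "cdga K C'"
    and g: "g \<in> dga_hom K C C'" and h: "h \<in> dga_hom K (abelianization K (Root A \<alpha>)) C"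
  shows "Psi A \<alpha> C' (dga_comp (abelianization K (Root A \<alpha>)) g h) =
    dga_comp A (tensor_map K E C E C' (dga_id E) g) (Psi A \<alpha> C h)"
proof -
  note q = ab_proj_hom[OF Root_dga[OF A]]
  show ?thesis
    using Phi_natural_right[OF A cdga.axioms(1)[OF C] cdga.axioms(1)[OF C'] g dga_comp_hom[OF Root_dga[OF A] q h]]
      dga_comp_assoc[OF q, of g h] by (simp add: Psi_def)
qed

end

theorem proposition2p1:
  fixes K :: "('k, 'r) ring_scheme"
    and S :: "('k, 's) dga_rec"
    and V :: "('k, 'v) complex_rec"
    and \<rho> :: "int \<Rightarrow> 's \<Rightarrow> (int \<Rightarrow> 'v \<Rightarrow> 'v)"
  assumes "field K"
    and char_zero: "\<And>n::nat. n > 0 \<Longrightarrow> [n] \<cdot>\<^bsub>K\<^esub> \<one>\<^bsub>K\<^esub> \<noteq> \<zero>\<^bsub>K\<^esub>"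
    and "dga K S"
    and "chain_complex K V"
    and "fin_total_dim K V"
    and nonzero: "\<exists>n. elts V n \<noteq> {\<zero>\<^bsub>cmp V n\<^esub>}"
    and "\<rho> \<in> dga_hom K S (End_dga K V)"
  defines "E \<equiv> End_dga K V"
  shows
    "(\<exists>\<Phi> :: ('k, 'a) dga_rec \<Rightarrow> (int \<Rightarrow> 's \<Rightarrow> 'a) \<Rightarrow> ('k, 'b) dga_rec \<Rightarrow> _.
        (\<forall>A \<alpha> B. dga_under K S A \<alpha> \<and> dga K B \<longrightarrow>
           bij_betw (\<Phi> A \<alpha> B)
             (dga_hom K (root_dga K S V \<rho> A \<alpha>) B)
             (dga_under_hom K S A \<alpha> (tensor_dga K E B) (tensor_unit K S E \<rho> B))) \<and>
        (\<forall>A \<alpha> A' \<alpha>' B f h. dga_under K S A \<alpha> \<and> dga_under K S A' \<alpha>' \<and> dga K B \<and>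
             f \<in> dga_under_hom K S A \<alpha> A' \<alpha>' \<and>
             h \<in> dga_hom K (root_dga K S V \<rho> A' \<alpha>') B \<longrightarrow>
           \<Phi> A \<alpha> B (dga_comp (root_dga K S V \<rho> A \<alpha>) h (root_map K S V \<rho> A \<alpha> A' \<alpha>' f)) =
             dga_comp A (\<Phi> A' \<alpha>' B h) f) \<and>
        (\<forall>A \<alpha> B B' g h. dga_under K S A \<alpha> \<and> dga K B \<and> dga K B' \<and>
             g \<in> dga_hom K B B' \<and>
             h \<in> dga_hom K (root_dga K S V \<rho> A \<alpha>) B \<longrightarrow>
           \<Phi> A \<alpha> B' (dga_comp (root_dga K S V \<rho> A \<alpha>) g h) =
             dga_comp A (tensor_map K E B E B' (dga_id E) g) (\<Phi> A \<alpha> B h))) \<and>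
     (\<exists>\<Psi> :: ('k, 'a) dga_rec \<Rightarrow> (int \<Rightarrow> 's \<Rightarrow> 'a) \<Rightarrow> ('k, 'c) dga_rec \<Rightarrow> _.
        (\<forall>A \<alpha> C. dga_under K S A \<alpha> \<and> cdga K C \<longrightarrow>
           bij_betw (\<Psi> A \<alpha> C)
             (dga_hom K (rep_dga K S V \<rho> A \<alpha>) C)
             (dga_under_hom K S A \<alpha> (tensor_dga K E C) (tensor_unit K S E \<rho> C))) \<and>
        (\<forall>A \<alpha> A' \<alpha>' C f h. dga_under K S A \<alpha> \<and> dga_under K S A' \<alpha>' \<and> cdga K C \<and>
             f \<in> dga_under_hom K S A \<alpha> A' \<alpha>' \<and>
             h \<in> dga_hom K (rep_dga K S V \<rho> A' \<alpha>') C \<longrightarrow>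
           \<Psi> A \<alpha> C (dga_comp (rep_dga K S V \<rho> A \<alpha>) h (rep_map K S V \<rho> A \<alpha> A' \<alpha>' f)) =
             dga_comp A (\<Psi> A' \<alpha>' C h) f) \<and>
        (\<forall>A \<alpha> C C' g h. dga_under K S A \<alpha> \<and> cdga K C \<and> cdga K C' \<and>
             g \<in> dga_hom K C C' \<and>
             h \<in> dga_hom K (rep_dga K S V \<rho> A \<alpha>) C \<longrightarrow>
           \<Psi> A \<alpha> C' (dga_comp (rep_dga K S V \<rho> A \<alpha>) g h) =
             dga_comp A (tensor_map K E C E C' (dga_id E) g) (\<Psi> A \<alpha> C h)))"
proof -
  obtain I :: "(int \<times> 'v) set" and d u w eps chi where frame: "frame K E I d u w eps chi"
    using End_has_frame[OF assms(4,5) nonzero] unfolding E_def by blast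
  have E: "dga K E" unfolding E_def by (rule End_is_dga[OF assms(4)])
  interpret rep_setting K E S I d u w eps chi \<rho>
    using frame E assms(3,7) by (intro rep_setting.intro rep_setting_axioms.intro) (auto simp: E_def)
  show ?thesis
    unfolding root_dga_def rep_dga_def root_map_def rep_map_def E_def[symmetric]
    by (rule conjI; rule exI[of _ Phi] exI[of _ Psi];
      intro conjI allI impI; (elim conjE)?;
      rule Phi_bij Phi_natural_left Phi_natural_right Psi_bij Psi_natural_left Psi_natural_right; assumption)
qed

end
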